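(* Let $n\geq 5$, $H=SL_n$ and $\Gamma=SL_n(\mathbb{Z})$. Let $\Sigma$ be a finite generating set of $\Gamma$ and let $X_k$ be the $k$-th step of the corresponding random walk. Then for any pair $\mathcal{G}=(G_1,G_2)$ of subgroups of the alternating group $\mathrm{Alt}(n)$ there exist an algebraic extension $F_{\mathcal G}$ of $\mathbb{Q}$ and sequences of natural numbers $\{n_i(\mathcal G)\}_{i\ge1}$, $\{k_i(\mathcal G)\}_{i\ge1}$ such that for all $i$ $$\mathbb{P}\big(\mathrm{Gal}(F_{\mathcal G}(X_{n_i(\mathcal G)})/F_{\mathcal G})\simeq G_1\big)\geq 1-\frac{1}{2^i},\qquad \mathbb{P}\big(\mathrm{Gal}(F_{\mathcal G}(X_{k_i(\mathcal G)})/F_{\mathcal G})\simeq G_2\big)\geq 1-\frac{1}{2^i}.$$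
   Context: For a field $F$ of characteristic zero and $\gamma\in GL_n(F)$, $F(\gamma)$ denotes the splitting field over $F$ of the characteristic polynomial of $\gamma$. The random walk is $X_k=s_1\cdots s_k$ with $s_1,s_2,\dots$ independent uniformly distributed elements of $\Sigma$; $\mathbb P$ is the probability with respect to it. *)

theory Defs
  imports "HOL-Analysis.Analysis" "HOL-Computational_Algebra.Polynomial" "HOL-Algebra.Sym_Groups"
begin

(* Subfields of the complex numbers. Every algebraic extension of Q embeds in C. *)
definition subfield_C :: "complex set \<Rightarrow> bool" where
  "subfield_C K \<longleftrightarrow> 0 \<in> K \<and> 1 \<in> K \<and>
     (\<forall>x\<in>K. \<forall>y\<in>K. x + y \<in> K \<and> x - y \<in> K \<and> x * y \<in> K) \<and>
     (\<forall>x\<in>K. x \<noteq> 0 \<longrightarrow> inverse x \<in> K)"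

(* F is an algebraic extension of Q (realised inside C) *)
definition algebraic_ext_Q :: "complex set \<Rightarrow> bool" where
  "algebraic_ext_Q F \<longleftrightarrow> subfield_C F \<and> (\<forall>x\<in>F. algebraic x)"

(* the subfield of C generated by F and S *)
definition field_adjoin :: "complex set \<Rightarrow> complex set \<Rightarrow> complex set" where
  "field_adjoin F S = \<Inter> {K. subfield_C K \<and> F \<union> S \<subseteq> K}"

(* characteristic polynomial det(X I - A) of an integer matrix, as a complex polynomial *)
definition char_poly_int :: "int ^'n^'n \<Rightarrow> complex poly" where
  "char_poly_int A = det (\<chi> i j. (if i = j then [:0, 1:] else 0) - [: of_int (A $ i $ j) :])"

(* F(gamma): splitting field over F of the characteristic polynomial of gamma *)
definition split_field :: "complex set \<Rightarrow> int ^'n^'n \<Rightarrow> complex set" where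
  "split_field F A = field_adjoin F {z. poly (char_poly_int A) z = 0}"

(* Gal(K/F): automorphisms of the field K fixing F pointwise, as a group under composition *)
definition gal_auts :: "complex set \<Rightarrow> complex set \<Rightarrow> (complex \<Rightarrow> complex) set" where
  "gal_auts K F = {\<sigma>. \<sigma> \<in> extensional K \<and> bij_betw \<sigma> K K \<and>
      (\<forall>x\<in>K. \<forall>y\<in>K. \<sigma> (x + y) = \<sigma> x + \<sigma> y \<and> \<sigma> (x * y) = \<sigma> x * \<sigma> y) \<and>
      (\<forall>x\<in>F. \<sigma> x = x)}"

definition gal :: "complex set \<Rightarrow> complex set \<Rightarrow> (complex \<Rightarrow> complex) monoid" where
  "gal K F = \<lparr> carrier = gal_auts K F,
               mult = (\<lambda>\<sigma> \<tau>. restrict (\<sigma> \<circ> \<tau>) K),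
               one = restrict id K \<rparr>"

(* SL_n(Z) *)
definition SLZ :: "(int ^'n^'n) set" where
  "SLZ = {A. det A = 1}"

(* subgroup of the (integer) matrix group generated by Sigma *)
inductive_set gen_by :: "(int ^'n^'n) set \<Rightarrow> (int ^'n^'n) set" for \<Sigma> where
  gen_one: "mat 1 \<in> gen_by \<Sigma>"
| gen_mult: "x \<in> gen_by \<Sigma> \<Longrightarrow> s \<in> \<Sigma> \<Longrightarrow> x ** s \<in> gen_by \<Sigma>"
| gen_inv: "x \<in> gen_by \<Sigma> \<Longrightarrow> s \<in> \<Sigma> \<Longrightarrow> s ** y = mat 1 \<Longrightarrow> y ** s = mat 1
             \<Longrightarrow> x ** y \<in> gen_by \<Sigma>"

(* P(P(X_k)) for the random walk X_k = s_1 ... s_k, s_i iid uniform on Sigma *)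
definition walk_prob :: "(int ^'n^'n) set \<Rightarrow> nat \<Rightarrow> (int ^'n^'n \<Rightarrow> bool) \<Rightarrow> real" where
  "walk_prob \<Sigma> k P =
     real (card {xs. set xs \<subseteq> \<Sigma> \<and> length xs = k \<and> P (foldl (**) (mat 1) xs)})
     / real (card \<Sigma>) ^ k"

end

theory Submission
  imports Defs "HOL-Computational_Algebra.Fundamental_Theorem_Algebra" "HOL-Computational_Algebra.Primes"
begin

text \<open>
  The Galois group of a characteristic polynomial over \<open>F\<close> depends only on the action of the automorphism group
  of the algebraic numbers on its roots, and for a typical element of \<open>SL(n, \<int>)\<close> this action is the full symmetric
  group. For most elements \<open>X\<close> of a long walk there are primes \<open>p\<close> at which the characteristic
  polynomial has an \<open>(n-1)\<close>-cycle, respectively a transposition, as Frobenius: modulo a prime \<open>p\<close> the walk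
  equidistributes on \<open>SL(n, \<int>/p)\<close>, the reductions modulo different primes are independent, and the proportion of
  matrices with the required factorisation type is bounded below independently of \<open>p\<close>. A Frobenius of type \<open>(n-1)\<close>
  whose fixed root is irrational makes the group 2-transitive, and with a transposition it is symmetric.

  The same argument separates splitting fields. Given a matrix \<open>A\<close> one can choose for every prime \<open>p\<close> the type of
  Frobenius of \<open>X\<close> (cycle length \<open>n-1\<close> or \<open>2\<close>) so that its square is trivial on the roots of exactly one of \<open>A\<close>, \<open>X\<close>.
  Hence long walks avoid any given finite set of splitting fields, and one can choose an increasing sequence of
  stages such that the splitting fields arising at different stages are different.

  Finally, since nontrivial normal subgroups of the symmetric group contain the alternating group, the
  alternating groups of different splitting fields are realised independently (a Ribet-type argument).
  The field \<open>F\<close> consists of the algebraic numbers fixed by all automorphisms which act, on finitely many of the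
  splitting fields, through \<open>G1\<close> at even stages and \<open>G2\<close> at odd stages.
\<close>

section \<open>Algebraic numbers and their automorphisms\<close>

text \<open>\<open>FF\<close> is fixed before any walk is run, although infinitely many splitting
  fields are prescribed. Two features make this possible. The type demanded of \<open>X\<close> at
  \<open>p\<close> depends on \<open>A\<close> and \<open>p\<close> alone, since triviality of the
  squared Frobenius on the roots of \<open>A\<close> is the congruence
  \<open>z ^ (p ^ 2) \<equiv>\<^sub>P z\<close>. And a stage avoids every value that earlier stages
  can take, a finite set, so stages are compared outcome by outcome and not in law. Congruences live
  in one subring of the complex numbers that contains every algebraic integer, with a prime ideal
  above \<open>p\<close>; finite fields enter through roots of unity of order prime to
  \<open>p\<close>. Frobenius elements are obtained from orbit polynomials, at ramified primes as
  well. Walk lengths may depend on the primes in use, so equidistribution is a contraction argument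
  without uniformity in the modulus. Its obstacle is periodicity of the walk; writing elementary
  matrices as commutators removes it.\<close>

lemma algebraic_if_powers_in_span:
  fixes x :: complex
  assumes "finite B" and "\<And>k. x ^ k \<in> module.span (\<lambda>(q::rat) (x::complex). of_rat q * x) B"
  shows "algebraic x"
proof -
  interpret Q: vector_space "\<lambda>(q::rat) (x::complex). of_rat q * x"
    by unfold_locales (auto simp: algebra_simps of_rat_add of_rat_mult)
  let ?S = "(\<lambda>k. x ^ k) ` {..card B}"
  show ?thesis
  proof (cases "inj_on (\<lambda>k. x ^ k) {..card B}")
    \<comment> \<open>Coinciding powers make \<open>?S\<close> too small for the dimension count,
      but then a difference of two monomials already vanishes at \<open>x\<close>.\<close>
    case False
    then obtain i j where ij: "i < j" "x ^ i = x ^ j"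
      unfolding inj_on_def by (metis nat_neq_iff)
    show ?thesis
    proof (rule algebraicI)
      show "poly (monom 1 j - monom 1 i) x = 0" using ij by (simp add: poly_monom)
      have "coeff (monom (1::complex) j - monom 1 i) j = 1" using ij by simp
      thus "monom (1::complex) j - monom 1 i \<noteq> 0" by (metis coeff_0 zero_neq_one)
    qed auto
  next
    case True
    have "Q.dependent ?S"
    proof (rule ccontr)
      assume "\<not> Q.dependent ?S"
      hence "card ?S \<le> card B" using Q.independent_span_bound[OF \<open>finite B\<close>] assms(2) by auto
      thus False using card_image[OF True] by simp
    qed
    then obtain u v where u: "v \<in> ?S" "u v \<noteq> 0" "(\<Sum>v\<in>?S. of_rat (u v) * v) = 0"
      using Q.dependent_finite[of ?S] by auto
    define q where "q = (\<Sum>k\<le>card B. monom (of_rat (u (x ^ k)) :: complex) k)"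
    obtain k where k: "k \<le> card B" "v = x ^ k" using u(1) by auto
    have "poly q x = (\<Sum>k\<le>card B. of_rat (u (x ^ k)) * x ^ k)"
      by (simp add: q_def poly_sum poly_monom)
    also have "\<dots> = 0" using u(3) by (simp add: sum.reindex[OF True])
    finally have "poly q x = 0" .
    moreover have cq: "coeff q i = (if i \<le> card B then of_rat (u (x ^ i)) else 0)" for i
      by (auto simp: q_def coeff_sum)
    hence "coeff q k \<noteq> 0" using k u(2) by simp
    hence "q \<noteq> 0" by auto
    moreover have "coeff q i \<in> \<rat>" for i by (simp add: cq)
    ultimately show ?thesis by (intro algebraicI'[of q]) auto
  qed
qed

text \<open>The monomials \<open>x ^ i * y ^ j\<close> of bounded degree span a finite-dimensional
  rational space that is stable under multiplication by \<open>x\<close> and by \<open>y\<close>,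
  hence contains all powers of the sum and of the product. Exponents run up to \<open>d\<close> and
  \<open>e\<close> inclusive, so that 1 is visibly among the monomials.\<close>

lemma algebraic_add_mult:
  fixes x y :: complex
  assumes "algebraic x" "algebraic y"
  shows "algebraic (x + y)" "algebraic (x * y)"
proof -
  interpret Q: vector_space "\<lambda>(q::rat) (x::complex). of_rat q * x"
    by unfold_locales (auto simp: algebra_simps of_rat_add of_rat_mult)
  have red: "\<exists>d. \<exists>c::nat \<Rightarrow> rat. z ^ d = (\<Sum>i<d. of_rat (c i) * z ^ i)" if "algebraic z" for z :: complex
  proof -
    obtain p where p: "p \<noteq> 0" "poly (map_poly of_int p) z = 0"
      using algebraicE'[OF \<open>algebraic z\<close>] by auto
    define d where "d = degree p"
    have "(\<Sum>i\<le>d. of_int (coeff p i) * z ^ i) = 0"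
      using p by (simp add: poly_altdef d_def degree_map_poly coeff_map_poly)
    hence "of_int (coeff p d) * z ^ d = (\<Sum>i<d. - of_int (coeff p i) * z ^ i)"
      by (simp add: lessThan_Suc_atMost[symmetric] sum_negf add_eq_0_iff)
    moreover have "coeff p d \<noteq> 0" using p by (simp add: d_def)
    ultimately have "z ^ d = (\<Sum>i<d. - of_int (coeff p i) * z ^ i) / of_int (coeff p d)"
      by (simp add: field_simps)
    also have "\<dots> = (\<Sum>i<d. of_rat (- of_int (coeff p i) / of_int (coeff p d)) * z ^ i)"
      by (simp add: sum_divide_distrib of_rat_divide of_rat_minus)
    finally show ?thesis by (intro exI)
  qed
  obtain d c where c: "x ^ d = (\<Sum>i<d. of_rat (c i :: rat) * x ^ i)" using red[OF assms(1)] by blast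
  obtain e b where b: "y ^ e = (\<Sum>i<e. of_rat (b i :: rat) * y ^ i)" using red[OF assms(2)] by blast
  define B where "B = (\<lambda>(i,j). x ^ i * y ^ j) ` ({..<Suc d} \<times> {..<Suc e})"
  have fin: "finite B" by (simp add: B_def)
  have B1: "x ^ i * y ^ j \<in> Q.span B" if "i \<le> d" "j \<le> e" for i j
    using that by (intro Q.span_base) (force simp: B_def)
  have mulx: "x * w \<in> Q.span B" if "w \<in> Q.span B" for w
    using that
  proof (induction rule: Q.span_induct)
    show "Q.subspace {a. x * a \<in> Q.span B}"
      by (auto intro!: Q.subspaceI intro: Q.span_zero simp: distrib_left Q.span_add
            mult.left_commute[of x] Q.span_scale)
  next
    fix w assume "w \<in> B"
    then obtain i j where ij: "w = x ^ i * y ^ j" "i \<le> d" "j \<le> e" by (auto simp: B_def)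
    show "x * w \<in> Q.span B"
    proof (cases "i < d")
      case True
      thus ?thesis using B1[of "Suc i" j] ij by (simp add: mult_ac)
    next
      case False
      hence "x * w = x * (x ^ d * y ^ j)" using ij by simp
      also have "\<dots> = (\<Sum>k<d. of_rat (c k) * (x ^ Suc k * y ^ j))"
        unfolding c by (simp add: sum_distrib_left sum_distrib_right mult_ac)
      also have "\<dots> \<in> Q.span B"
        using ij by (intro Q.span_sum Q.span_scale B1) auto
      finally show ?thesis .
    qed
  qed
  have muly: "y * w \<in> Q.span B" if "w \<in> Q.span B" for w
    using that
  proof (induction rule: Q.span_induct)
    show "Q.subspace {a. y * a \<in> Q.span B}"
      by (auto intro!: Q.subspaceI intro: Q.span_zero simp: distrib_left Q.span_add
            mult.left_commute[of y] Q.span_scale)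
  next
    fix w assume "w \<in> B"
    then obtain i j where ij: "w = x ^ i * y ^ j" "i \<le> d" "j \<le> e" by (auto simp: B_def)
    show "y * w \<in> Q.span B"
    proof (cases "j < e")
      case True
      thus ?thesis using B1[of i "Suc j"] ij by (simp add: mult_ac)
    next
      case False
      hence "y * w = y * (x ^ i * y ^ e)" using ij by simp
      also have "\<dots> = (\<Sum>k<e. of_rat (b k) * (x ^ i * y ^ Suc k))"
        unfolding b by (simp add: sum_distrib_left sum_distrib_right mult_ac)
      also have "\<dots> \<in> Q.span B"
        using ij by (intro Q.span_sum Q.span_scale B1) auto
      finally show ?thesis .
    qed
  qed
  have one: "1 \<in> Q.span B" using B1[of 0 0] by simp
  show "algebraic (x + y)"
  proof (rule algebraic_if_powers_in_span[OF fin])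
    fix k show "(x + y) ^ k \<in> Q.span B"
      by (induction k) (auto simp: one distrib_right mulx muly Q.span_add)
  qed
  show "algebraic (x * y)"
  proof (rule algebraic_if_powers_in_span[OF fin])
    fix k show "(x * y) ^ k \<in> Q.span B"
      by (induction k) (auto simp: one mult.assoc mulx muly)
  qed
qed

definition qbar :: "complex set" where "qbar = {x. algebraic x}"

lemma qbar_closed [intro]:
  "x \<in> qbar \<Longrightarrow> y \<in> qbar \<Longrightarrow> x + y \<in> qbar"
  "x \<in> qbar \<Longrightarrow> y \<in> qbar \<Longrightarrow> x * y \<in> qbar"
  "x \<in> qbar \<Longrightarrow> - x \<in> qbar"
  "x \<in> qbar \<Longrightarrow> y \<in> qbar \<Longrightarrow> x - y \<in> qbar"
  "x \<in> qbar \<Longrightarrow> inverse x \<in> qbar"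
  "x \<in> qbar \<Longrightarrow> x ^ k \<in> qbar"
  using algebraic_add_mult algebraic_add_mult(1)[of x "-y"]
  by (auto simp: qbar_def induct_nat_012) (induction k; auto)

lemma qbar_rat [intro, simp]: "of_rat q \<in> qbar" "0 \<in> qbar" "1 \<in> qbar" "of_int z \<in> qbar"
  by (auto simp: qbar_def intro: rat_imp_algebraic)

lemma qbar_sum [intro]: "(\<And>i. i \<in> I \<Longrightarrow> f i \<in> qbar) \<Longrightarrow> sum f I \<in> qbar"
  by (induction I rule: infinite_finite_induct) auto

text \<open>Partial embeddings of the algebraic numbers into themselves, represented by their graphs.
  Subrings that contain the rationals are automatically fields here, so that it is enough to extend
  graphs by single elements.\<close>

definition sv_ring :: "(complex \<times> complex) set \<Rightarrow> bool" where
  "sv_ring B \<longleftrightarrow> B \<subseteq> qbar \<times> qbar \<and> (\<forall>q. (of_rat q, of_rat q) \<in> B) \<and>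
     (\<forall>x y x' y'. (x,y) \<in> B \<longrightarrow> (x',y') \<in> B \<longrightarrow> (x + x', y + y') \<in> B \<and> (x * x', y * y') \<in> B) \<and>
     (\<forall>y. (0,y) \<in> B \<longrightarrow> y = 0)"

text \<open>With \<open>B\<close> the graph of an embedding, \<open>v\<close> arises from
  \<open>u\<close> by applying the embedding to every coefficient.\<close>

definition ppair :: "(complex \<times> complex) set \<Rightarrow> complex poly \<Rightarrow> complex poly \<Rightarrow> bool" where
  "ppair B u v \<longleftrightarrow> (\<forall>i. (coeff u i, coeff v i) \<in> B)"

context
  fixes B assumes B: "sv_ring B"
begin

lemma sv_add: "(x,y) \<in> B \<Longrightarrow> (x',y') \<in> B \<Longrightarrow> (x + x', y + y') \<in> B"
  and sv_mult: "(x,y) \<in> B \<Longrightarrow> (x',y') \<in> B \<Longrightarrow> (x * x', y * y') \<in> B"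
  and sv_rat: "(of_rat q, of_rat q) \<in> B"
  and sv_zero: "(0,y) \<in> B \<Longrightarrow> y = 0"
  and sv_qbar: "(x,y) \<in> B \<Longrightarrow> x \<in> qbar" "(x,y) \<in> B \<Longrightarrow> y \<in> qbar"
  using B unfolding sv_ring_def by auto

lemma sv_0_1: "(0,0) \<in> B" "(1,1) \<in> B" "(of_int z, of_int z) \<in> B"
  using sv_rat[of 0] sv_rat[of 1] sv_rat[of "of_int z"] by simp_all

lemma sv_minus: "(x,y) \<in> B \<Longrightarrow> (-x,-y) \<in> B"
  using sv_mult[of x y "-1" "-1"] sv_rat[of "-1"] by (simp add: of_rat_minus)

lemma sv_diff: "(x,y) \<in> B \<Longrightarrow> (x',y') \<in> B \<Longrightarrow> (x - x', y - y') \<in> B"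
  using sv_add[of x y "-x'" "-y'"] sv_minus by simp

lemma sv_unique: "(x,y) \<in> B \<Longrightarrow> (x,y') \<in> B \<Longrightarrow> y = y'"
  using sv_diff[of x y x y'] sv_zero by fastforce

lemma sv_power: "(x,y) \<in> B \<Longrightarrow> (x ^ k, y ^ k) \<in> B"
  by (induction k) (auto simp: sv_0_1 sv_mult)

lemma sv_sum: "(\<And>i. i \<in> I \<Longrightarrow> (f i, g i) \<in> B) \<Longrightarrow> (sum f I, sum g I) \<in> B"
  by (induction I rule: infinite_finite_induct) (auto simp: sv_0_1 sv_add)

lemma sv_poly:
  assumes "ppair B u v" "(a,b) \<in> B"
  shows "(poly u a, poly v b) \<in> B"
proof -
  let ?N = "max (degree u) (degree v)"
  have "poly u a = (\<Sum>i\<le>?N. coeff u i * a ^ i)" "poly v b = (\<Sum>i\<le>?N. coeff v i * b ^ i)"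
    unfolding poly_altdef by (rule sum.mono_neutral_left; auto simp: coeff_eq_0)+
  thus ?thesis using assms by (auto intro!: sv_sum sv_mult sv_power simp: ppair_def)
qed

lemma ppair_int: "ppair B (map_poly of_int p) (map_poly of_int p)"
  by (auto simp: ppair_def coeff_map_poly sv_0_1)

text \<open>An integer equation of \<open>x\<close> with nonzero constant term \<open>a\<close>
  reads a + x q(x) = 0, so -q(x)/a inverts \<open>x\<close>. This is an expression in
  \<open>x\<close> with rational coefficients: it stays in the ring, and the same expression in
  \<open>y\<close> inverts \<open>y\<close>. Hence the rings of \<open>sv_ring\<close> are
  fields.\<close>

lemma sv_inverse:
  assumes "(x,y) \<in> B" "x \<noteq> 0"
  shows "(inverse x, inverse y) \<in> B" "y \<noteq> 0"
proof -
  have "algebraic x" using sv_qbar assms by (auto simp: qbar_def)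
  then obtain p where p: "coeff p 0 \<noteq> 0" "poly (map_poly of_int p) x = 0"
    using algebraicE'_nonzero[of x] assms(2) by metis
  obtain a q where q: "p = pCons a q" by (cases p)
  have a: "a \<noteq> 0" "of_int a + x * poly (map_poly of_int q) x = 0"
    using p by (auto simp: q map_poly_pCons)
  define w where "w = - poly (map_poly of_int q) x / of_int a"
  define w' where "w' = - poly (map_poly of_int q) y / of_int a"
  have "(of_rat (-1 / of_int a), of_rat (-1 / of_int a)) \<in> B" by (rule sv_rat)
  hence "(w, w') \<in> B"
    using sv_mult[OF sv_poly[OF ppair_int assms(1), of q]] unfolding w_def w'_def
    by (fastforce simp: of_rat_divide of_rat_minus)
  moreover have xw: "x * w = 1" using a by (simp add: w_def field_simps add_eq_0_iff)
  ultimately have "(1, y * w') \<in> B" using sv_mult[OF assms(1), of w w'] by simp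
  hence yw: "y * w' = 1" using sv_unique sv_0_1 by blast
  have "w = inverse x" "w' = inverse y" using xw yw by (simp_all add: inverse_unique)
  with \<open>(w, w') \<in> B\<close> show "(inverse x, inverse y) \<in> B" by simp
  show "y \<noteq> 0" using yw by auto
qed

lemma ppair_add: "ppair B u v \<Longrightarrow> ppair B u' v' \<Longrightarrow> ppair B (u + u') (v + v')"
  and ppair_diff: "ppair B u v \<Longrightarrow> ppair B u' v' \<Longrightarrow> ppair B (u - u') (v - v')"
  and ppair_mult: "ppair B u v \<Longrightarrow> ppair B u' v' \<Longrightarrow> ppair B (u * u') (v * v')"
  and ppair_const: "(x,y) \<in> B \<Longrightarrow> ppair B [:x:] [:y:]"
  and ppair_monom: "(x,y) \<in> B \<Longrightarrow> ppair B (monom x k) (monom y k)"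
  by (auto simp: ppair_def coeff_mult coeff_pCons sv_0_1 sv_add sv_diff intro!: sv_sum sv_mult split: nat.splits)

lemma ppair_degree:
  assumes "ppair B u v" shows "degree v = degree u"
proof (rule antisym)
  show "degree v \<le> degree u"
    by (rule degree_le) (metis assms coeff_eq_0 ppair_def sv_zero)
  show "degree u \<le> degree v"
    by (rule degree_le) (metis assms coeff_eq_0 ppair_def sv_inverse(2))
qed

text \<open>\<open>f\<close> is the minimal polynomial of \<alpha> over the field of first
  components of \<open>B\<close>, and \<open>g\<close> is its image under the embedding.\<close>

definition minpair :: "complex \<Rightarrow> complex poly \<Rightarrow> complex poly \<Rightarrow> bool" where
  "minpair \<alpha> f g \<longleftrightarrow> ppair B f g \<and> lead_coeff f = 1 \<and> poly f \<alpha> = 0 \<and>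
     (\<forall>u v. ppair B u v \<longrightarrow> u \<noteq> 0 \<longrightarrow> degree u < degree f \<longrightarrow> poly u \<alpha> \<noteq> 0)"

lemma minpair_exists:
  assumes "\<alpha> \<in> qbar"
  obtains f g where "minpair \<alpha> f g"
proof -
  obtain h where h: "h \<noteq> 0" "poly (map_poly of_int h) \<alpha> = 0"
    using assms algebraicE'[of \<alpha>] by (auto simp: qbar_def)
  let ?P = "\<lambda>d. \<exists>u v. ppair B u v \<and> u \<noteq> 0 \<and> degree u = d \<and> poly u \<alpha> = 0"
  have "(map_poly of_int h :: complex poly) \<noteq> 0"
    using h(1) by (metis coeff_0 coeff_map_poly leading_coeff_0_iff of_int_0 of_int_eq_0_iff)
  hence "?P (degree (map_poly of_int h :: complex poly))" using h ppair_int by blast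
  hence "?P (LEAST d. ?P d)" by (rule LeastI)
  then obtain u v where uv: "ppair B u v" "u \<noteq> 0" "degree u = (LEAST d. ?P d)" "poly u \<alpha> = 0" by blast
  have "(lead_coeff u, coeff v (degree u)) \<in> B" using uv by (auto simp: ppair_def)
  hence inv: "(inverse (lead_coeff u), inverse (coeff v (degree u))) \<in> B"
    using uv(2) sv_inverse(1) leading_coeff_0_iff by blast
  let ?f = "[:inverse (lead_coeff u):] * u" and ?g = "[:inverse (coeff v (degree u)):] * v"
  have "minpair \<alpha> ?f ?g"
    unfolding minpair_def
  proof (intro conjI allI impI)
    show "ppair B ?f ?g" using uv inv by (intro ppair_mult ppair_const)
    show "lead_coeff ?f = 1" "poly ?f \<alpha> = 0" using uv(2,4) by (auto simp del: mult_pCons_left simp: lead_coeff_mult)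
    fix u' v' assume "ppair B u' v'" "u' \<noteq> 0" "degree u' < degree ?f"
    moreover have "degree ?f = degree u" using uv(2) by (simp)
    ultimately have lt: "degree u' < (LEAST d. ?P d)" and "ppair B u' v'" "u' \<noteq> 0" using uv(3) by simp_all
    show "poly u' \<alpha> \<noteq> 0"
    proof
      assume "poly u' \<alpha> = 0"
      hence "?P (degree u')" using \<open>ppair B u' v'\<close> \<open>u' \<noteq> 0\<close> by blast
      thus False using not_less_Least[OF lt] by contradiction
    qed
  qed
  thus ?thesis by (rule that)
qed

text \<open>\<open>f\<close> divides every such \<open>u\<close>, so \<open>g\<close> divides its
  image \<open>v\<close>. The division removes one leading term at a time from both components,
  which keeps the pair inside \<open>ppair\<close>. As a consequence, sending the value of
  \<open>u\<close> at \<alpha> to the value of \<open>v\<close> at \<beta> is well defined.\<close>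

lemma minpair_root:
  assumes m: "minpair \<alpha> f g" and \<beta>: "poly g \<beta> = 0"
  shows "ppair B u v \<Longrightarrow> poly u \<alpha> = 0 \<Longrightarrow> poly v \<beta> = 0"
proof (induction "degree u" arbitrary: u v rule: less_induct)
  case less
  show ?case
  proof (cases "u = 0")
    case True
    hence "v = 0" using less.prems(1) sv_zero by (auto simp: ppair_def intro!: poly_eqI)
    thus ?thesis by simp
  next
    case False
    define d where "d = degree f"
    have fg: "ppair B f g" "coeff f d = 1" using m by (auto simp: minpair_def d_def)
    have gd: "coeff g d = 1" using fg sv_unique sv_0_1 by (metis ppair_def)
    have du: "d \<le> degree u" using m False less.prems by (force simp: minpair_def d_def)
    let ?N = "degree u"
    let ?u = "u - monom (coeff u ?N) (?N - d) * f" and ?v = "v - monom (coeff v ?N) (?N - d) * g"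
    have pp: "ppair B ?u ?v"
      using less.prems fg by (intro ppair_diff ppair_mult ppair_monom) (auto simp: ppair_def)
    have z: "poly ?u \<alpha> = 0" using less.prems m by (simp add: minpair_def)
    have "poly ?v \<beta> = 0"
    proof (cases "?u = 0")
      case True
      hence "coeff ?v i = 0" for i using pp sv_zero unfolding ppair_def by (metis coeff_0)
      hence "?v = 0" using leading_coeff_0_iff by blast
      thus ?thesis by simp
    next
      case nz: False
      have "degree (monom (coeff u ?N) (?N - d) * f) \<le> ?N"
        using degree_mult_le[of "monom (coeff u ?N) (?N - d)" f] degree_monom_le[of "coeff u ?N" "?N - d"] du
        by (simp add: d_def)
      hence "degree ?u \<le> ?N" by (intro degree_diff_le) auto
      moreover have "coeff ?u ?N = 0"
        using du fg by (simp add: coeff_monom_mult)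
      hence "degree ?u \<noteq> ?N" using nz leading_coeff_0_iff by metis
      ultimately have "degree ?u < ?N" by simp
      thus ?thesis using less.hyps[of ?u ?v] pp z by blast
    qed
    thus ?thesis using \<beta> by simp
  qed
qed

lemma sv_extend:
  assumes "\<alpha> \<in> qbar" and m: "minpair \<alpha> f g" and \<beta>: "poly g \<beta> = 0"
  shows "\<exists>B'. sv_ring B' \<and> B \<subseteq> B' \<and> (\<alpha>,\<beta>) \<in> B'"
proof -
  let ?B' = "{(poly u \<alpha>, poly v \<beta>) | u v. ppair B u v}"
  obtain h where h: "h \<noteq> 0" "poly (map_poly of_int h) \<alpha> = 0"
    using assms algebraicE'[of \<alpha>] by (auto simp: qbar_def)
  have "poly (map_poly of_int h) \<beta> = 0" using minpair_root[OF m \<beta> ppair_int h(2)] .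
  hence bq: "\<beta> \<in> qbar" unfolding qbar_def mem_Collect_eq using h(1)
    by (intro algebraicI[of "map_poly of_int h"]) (auto simp: coeff_map_poly poly_eq_iff)
  have pq: "poly u z \<in> qbar" if "\<And>i. coeff u i \<in> qbar" "z \<in> qbar" for u z
    unfolding poly_altdef using that by auto
  have sub: "?B' \<subseteq> qbar \<times> qbar"
    using bq assms(1) sv_qbar unfolding ppair_def by (auto intro!: pq) blast+
  have con: "(x, y) \<in> ?B'" if "(x,y) \<in> B" for x y
    using ppair_const[OF that] by force
  have "ppair B [:0,1:] [:0,1:]" by (auto simp: ppair_def coeff_pCons sv_0_1 split: nat.splits)
  hence ab: "(\<alpha>,\<beta>) \<in> ?B'" by force
  have add: "(x + x', y + y') \<in> ?B'" if xy: "(x,y) \<in> ?B'" "(x',y') \<in> ?B'" for x y x' y'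
  proof -
    obtain u v where uv: "ppair B u v" "x = poly u \<alpha>" "y = poly v \<beta>" using xy(1) by blast
    obtain u' v' where uv': "ppair B u' v'" "x' = poly u' \<alpha>" "y' = poly v' \<beta>" using xy(2) by blast
    have "ppair B (u + u') (v + v')" using uv uv' ppair_add by blast
    hence "(poly (u + u') \<alpha>, poly (v + v') \<beta>) \<in> ?B'" by blast
    thus ?thesis using uv uv' by simp
  qed
  have mul: "(x * x', y * y') \<in> ?B'" if xy: "(x,y) \<in> ?B'" "(x',y') \<in> ?B'" for x y x' y'
  proof -
    obtain u v where uv: "ppair B u v" "x = poly u \<alpha>" "y = poly v \<beta>" using xy(1) by blast
    obtain u' v' where uv': "ppair B u' v'" "x' = poly u' \<alpha>" "y' = poly v' \<beta>" using xy(2) by blast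
    have "ppair B (u * u') (v * v')" using uv uv' ppair_mult by blast
    hence "(poly (u * u') \<alpha>, poly (v * v') \<beta>) \<in> ?B'" by blast
    thus ?thesis using uv uv' by simp
  qed
  have zero: "y = 0" if "(0,y) \<in> ?B'" for y
    using that minpair_root[OF m \<beta>] by auto
  have "sv_ring ?B'"
    unfolding sv_ring_def using sub con[OF sv_rat] add mul zero by (intro conjI allI impI)
  moreover have "B \<subseteq> ?B'" using con by (intro subrelI)
  ultimately show ?thesis using ab by (intro exI[of _ ?B'] conjI)
qed

end

text \<open>Automorphisms of \<open>qbar\<close> are encoded as total functions that are the
  identity outside, so that function composition and \<open>inv'\<close> are the group
  operations.\<close>

definition autq :: "(complex \<Rightarrow> complex) set" where
  "autq = {\<sigma>. bij_betw \<sigma> qbar qbar \<and> (\<forall>x. x \<notin> qbar \<longrightarrow> \<sigma> x = x) \<and>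
     (\<forall>x\<in>qbar. \<forall>y\<in>qbar. \<sigma> (x + y) = \<sigma> x + \<sigma> y \<and> \<sigma> (x * y) = \<sigma> x * \<sigma> y)}"

text \<open>By Zorn there is a maximal graph. It is total, because otherwise
  \<open>sv_extend\<close> adds a point, a root of the transported minimal polynomial existing in
  the complex numbers. It is onto, because an injective map of the finite root set of an integer
  polynomial into itself is onto.\<close>

lemma sv_ring_extends_to_aut:
  assumes "sv_ring B0"
  shows "\<exists>\<sigma>\<in>autq. \<forall>(x,y)\<in>B0. \<sigma> x = y"
proof -
  let ?A = "{B. sv_ring B \<and> B0 \<subseteq> B}"
  have "\<exists>M\<in>?A. \<forall>X\<in>?A. M \<subseteq> X \<longrightarrow> X = M"
  proof (rule subset_Zorn_nonempty)
    show "?A \<noteq> {}" using assms by auto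
    fix C assume C: "C \<noteq> {}" "subset.chain ?A C"
    have sv: "sv_ring b" if "b \<in> C" for b using C that by (auto simp: subset.chain_def)
    have two: "\<exists>b\<in>C. p \<in> b \<and> q \<in> b" if pq: "p \<in> \<Union>C" "q \<in> \<Union>C" for p q
    proof -
      obtain b b' where b: "b \<in> C" "b' \<in> C" "p \<in> b" "q \<in> b'" using pq by blast
      have "b \<subseteq> b' \<or> b' \<subseteq> b" using C(2) b unfolding subset.chain_def by blast
      thus ?thesis using b by blast
    qed
    have "sv_ring (\<Union>C)"
      unfolding sv_ring_def
    proof (intro conjI allI impI)
      show "\<Union>C \<subseteq> qbar \<times> qbar" using sv sv_qbar by fast
      show "(of_rat q, of_rat q) \<in> \<Union>C" for q using sv C(1) by (force simp: sv_ring_def)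
      show "y = 0" if "(0,y) \<in> \<Union>C" for y using that sv by (auto simp: sv_ring_def)
      fix x y x' y' assume "(x,y) \<in> \<Union>C" "(x',y') \<in> \<Union>C"
      then obtain b where b: "b \<in> C" "(x,y) \<in> b" "(x',y') \<in> b" using two by blast
      show "(x + x', y + y') \<in> \<Union>C" "(x * x', y * y') \<in> \<Union>C"
        using sv_add[OF sv[OF b(1)] b(2,3)] sv_mult[OF sv[OF b(1)] b(2,3)] b(1) by blast+
    qed
    moreover have "B0 \<subseteq> \<Union>C" using C unfolding subset.chain_def by blast
    ultimately show "\<Union>C \<in> ?A" by blast
  qed
  then obtain M where M: "sv_ring M" "B0 \<subseteq> M" and max: "\<And>X. sv_ring X \<Longrightarrow> M \<subseteq> X \<Longrightarrow> X = M"
    by auto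
  have dom: "\<exists>y. (x,y) \<in> M" if "x \<in> qbar" for x
  proof -
    obtain f g where fg: "minpair M x f g" using minpair_exists[OF M(1) \<open>x \<in> qbar\<close>] by blast
    have "\<exists>\<beta>. poly g \<beta> = 0"
    proof -
      have "degree f > 0"
      proof (rule ccontr)
        assume "\<not> degree f > 0"
        then obtain c where "f = [:c:]" by (auto elim: degree_eq_zeroE)
        thus False using fg by (auto simp: minpair_def[OF M(1)])
      qed
      hence "degree g > 0" using ppair_degree[OF M(1), of f g] fg by (auto simp: minpair_def[OF M(1)])
      thus ?thesis using fundamental_theorem_of_algebra[of g] constant_degree[of g] by auto
    qed
    then obtain \<beta> where \<beta>: "poly g \<beta> = 0" by blast
    obtain B' where "sv_ring B'" "M \<subseteq> B'" "(x,\<beta>) \<in> B'" using sv_extend[OF M(1) \<open>x \<in> qbar\<close> fg \<beta>] by blast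
    thus ?thesis using max by blast
  qed
  define \<sigma> where "\<sigma> x = (if x \<in> qbar then THE y. (x,y) \<in> M else x)" for x
  have \<sigma>: "(x, \<sigma> x) \<in> M" if "x \<in> qbar" for x
  proof -
    have "\<exists>!y. (x,y) \<in> M" using dom[OF that] sv_unique[OF M(1)] by blast
    thus ?thesis unfolding \<sigma>_def using theI'[of "\<lambda>y. (x,y) \<in> M"] that by simp
  qed
  have eq: "\<sigma> x = y" if "(x,y) \<in> M" for x y
    using sv_unique[OF M(1) \<sigma>[OF sv_qbar(1)[OF M(1) that]] that] .
  have hom: "\<sigma> (x + y) = \<sigma> x + \<sigma> y" "\<sigma> (x * y) = \<sigma> x * \<sigma> y" if "x \<in> qbar" "y \<in> qbar" for x y
    using eq[OF sv_add[OF M(1) \<sigma> \<sigma>]] eq[OF sv_mult[OF M(1) \<sigma> \<sigma>]] that by auto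
  have inj: "inj_on \<sigma> qbar"
  proof (rule inj_onI)
    fix x y assume xy: "x \<in> qbar" "y \<in> qbar" "\<sigma> x = \<sigma> y"
    hence "(x - y, 0) \<in> M" using sv_diff[OF M(1) \<sigma> \<sigma>, of x y] by simp
    thus "x = y" using sv_inverse(2)[OF M(1)] by fastforce
  qed
  have surj: "\<sigma> ` qbar = qbar"
  proof
    show "\<sigma> ` qbar \<subseteq> qbar" using \<sigma> sv_qbar[OF M(1)] by blast
    show "qbar \<subseteq> \<sigma> ` qbar"
    proof (rule subsetI)
      fix x assume x: "x \<in> qbar"
      then obtain h where h: "h \<noteq> 0" "poly (map_poly of_int h) x = 0"
        using algebraicE'[of x] by (auto simp: qbar_def)
      let ?h = "map_poly of_int h :: complex poly"
      let ?Z = "{z. poly ?h z = 0}"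
      have h0: "?h \<noteq> 0" using h(1) by (auto simp: poly_eq_iff coeff_map_poly)
      have Zq: "?Z \<subseteq> qbar" using h0 unfolding qbar_def by (auto intro!: algebraicI[of ?h] simp: coeff_map_poly)
      have "\<sigma> ` ?Z \<subseteq> ?Z"
      proof
        fix w assume "w \<in> \<sigma> ` ?Z"
        then obtain z where z: "poly ?h z = 0" "w = \<sigma> z" "z \<in> qbar" using Zq by auto
        have "(poly ?h z, poly ?h w) \<in> M" using sv_poly[OF M(1) ppair_int[OF M(1)] \<sigma>[OF z(3)]] z(2) by simp
        thus "w \<in> ?Z" using z sv_zero[OF M(1)] by auto
      qed
      moreover have "inj_on \<sigma> ?Z" using inj Zq inj_on_subset by blast
      moreover have "finite ?Z" using h0 poly_roots_finite by blast
      ultimately have "\<sigma> ` ?Z = ?Z" by (simp add: endo_inj_surj)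
      hence "x \<in> \<sigma> ` ?Z" using h(2) by simp
      thus "x \<in> \<sigma> ` qbar" using Zq by blast
    qed
  qed
  have "\<sigma> \<in> autq"
    unfolding autq_def using hom inj surj by (auto simp: bij_betw_def) (auto simp: \<sigma>_def)
  moreover have "\<forall>(x,y)\<in>B0. \<sigma> x = y" using eq M(2) by auto
  ultimately show ?thesis by blast
qed

text \<open>Start from the diagonal of the rationals. If the minimal polynomial of \<open>x\<close>
  had degree above 1, it would have a root \<beta> different from \<open>x\<close>: its derivative
  has smaller degree and so does not vanish at \<open>x\<close>, which makes \<open>x\<close> a
  simple root. The embedding sending \<open>x\<close> to \<beta> extends to an automorphism that
  moves \<open>x\<close>.\<close>

lemma fixed_by_autq_imp_rat:
  assumes "x \<in> qbar" and fixed: "\<And>\<sigma>. \<sigma> \<in> autq \<Longrightarrow> \<sigma> x = x"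
  shows "x \<in> \<rat>"
proof -
  let ?B = "(\<lambda>q. (of_rat q, of_rat q)) ` UNIV :: (complex \<times> complex) set"
  have B: "sv_ring ?B"
    unfolding sv_ring_def by (auto simp: image_iff) (metis of_rat_add, metis of_rat_mult)
  obtain f g where fg: "minpair ?B x f g" using minpair_exists[OF B assms(1)] by blast
  have Beq: "(a,b) \<in> ?B \<longleftrightarrow> a = b \<and> a \<in> \<rat>" for a b by (auto simp: Rats_def)
  have pp: "ppair ?B u v \<longleftrightarrow> u = v \<and> (\<forall>i. coeff u i \<in> \<rat>)" for u v
    unfolding ppair_def Beq by (auto simp: poly_eq_iff)
  have f: "g = f" "\<forall>i. coeff f i \<in> \<rat>" "lead_coeff f = 1" "poly f x = 0"
    and min: "\<And>u. (\<forall>i. coeff u i \<in> \<rat>) \<Longrightarrow> u \<noteq> 0 \<Longrightarrow> degree u < degree f \<Longrightarrow> poly u x \<noteq> 0"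
    using fg unfolding minpair_def[OF B] pp by auto
  obtain q where q: "f = [:-x, 1:] * q" using f(4) by (metis dvdE poly_eq_0_iff_dvd)
  have q0: "q \<noteq> 0" using q f(3) by auto
  have deg: "degree f = Suc (degree q)" unfolding q using q0 by (subst degree_mult_eq) auto
  have "degree q = 0"
  proof (rule ccontr)
    assume dq: "degree q \<noteq> 0"
    then obtain \<beta> where \<beta>: "poly q \<beta> = 0"
      using fundamental_theorem_of_algebra[of q] constant_degree[of q] by auto
    have "poly (pderiv f) x \<noteq> 0"
    proof (rule min)
      show "\<forall>i. coeff (pderiv f) i \<in> \<rat>" using f(2) by (auto simp: coeff_pderiv)
      show "pderiv f \<noteq> 0" using deg by (simp add: pderiv_eq_0_iff)
      show "degree (pderiv f) < degree f" using deg by (simp add: degree_pderiv)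
    qed
    moreover have "poly (pderiv f) x = poly q x" unfolding q by (subst pderiv_mult) (simp add: pderiv_pCons)
    ultimately have "poly q x \<noteq> 0" by simp
    hence "\<beta> \<noteq> x" using \<beta> by auto
    have "poly g \<beta> = 0" using f(1) q \<beta> by simp
    then obtain B' where B': "sv_ring B'" "(x,\<beta>) \<in> B'" using sv_extend[OF B assms(1) fg] by blast
    obtain \<sigma> where "\<sigma> \<in> autq" "\<sigma> x = \<beta>" using sv_ring_extends_to_aut[OF B'(1)] B'(2) by fast
    thus False using fixed \<open>\<beta> \<noteq> x\<close> by auto
  qed
  then obtain c where c: "q = [:c:]" by (auto elim: degree_eq_zeroE)
  have "coeff f 1 = c" "coeff f 0 = - x * c" using q c by (simp_all add: coeff_pCons)
  moreover have "c = 1" using f(3) deg c q by (simp)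
  ultimately show ?thesis using f(2) by (metis Rats_minus_iff mult.right_neutral)
qed

subsection \<open>The group of automorphisms\<close>

context
  fixes \<sigma> assumes \<sigma>: "\<sigma> \<in> autq"
begin

lemma autq_in: "x \<in> qbar \<Longrightarrow> \<sigma> x \<in> qbar"
  and autq_add: "x \<in> qbar \<Longrightarrow> y \<in> qbar \<Longrightarrow> \<sigma> (x + y) = \<sigma> x + \<sigma> y"
  and autq_mult: "x \<in> qbar \<Longrightarrow> y \<in> qbar \<Longrightarrow> \<sigma> (x * y) = \<sigma> x * \<sigma> y"
  and autq_out: "x \<notin> qbar \<Longrightarrow> \<sigma> x = x"
  and autq_bij_betw: "bij_betw \<sigma> qbar qbar"
  using \<sigma> unfolding autq_def by (auto dest: bij_betwE)

lemma autq_inj: "\<sigma> x = \<sigma> y \<longleftrightarrow> x = y"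
  by (metis autq_bij_betw autq_in autq_out bij_betw_def inj_onD)

lemma autq_bij: "bij \<sigma>"
proof (rule bijI)
  show "inj \<sigma>" using autq_inj by (auto intro: injI)
  show "surj \<sigma>"
  proof -
    have "y \<in> range \<sigma>" for y
    proof (cases "y \<in> qbar")
      case True
      thus ?thesis using autq_bij_betw unfolding bij_betw_def by blast
    next
      case False
      thus ?thesis using autq_out[OF False] by (metis rangeI)
    qed
    thus ?thesis by blast
  qed
qed

lemma autq_0: "\<sigma> 0 = 0" using autq_add[of 0 0] by simp
lemma autq_1: "\<sigma> 1 = 1"
  using autq_mult[of 1 1] autq_inj[of 1 0] by (simp add: autq_0)
lemma autq_minus: "x \<in> qbar \<Longrightarrow> \<sigma> (- x) = - \<sigma> x"
  using autq_add[of x "-x"] by (auto simp: autq_0 add_eq_0_iff)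
lemma autq_diff: "x \<in> qbar \<Longrightarrow> y \<in> qbar \<Longrightarrow> \<sigma> (x - y) = \<sigma> x - \<sigma> y"
  using autq_add[of x "-y"] autq_minus[of y] by auto
lemma autq_of_nat: "\<sigma> (of_nat n) = of_nat n"
  by (induction n) (auto simp: autq_0 autq_1 autq_add qbar_def)
lemma autq_of_int: "\<sigma> (of_int n) = of_int n"
  by (cases n) (auto simp: autq_of_nat autq_1 autq_minus autq_add autq_diff qbar_def algebraic_minus simp del: of_nat_Suc)
lemma autq_inverse: "x \<in> qbar \<Longrightarrow> \<sigma> (inverse x) = inverse (\<sigma> x)"
  using autq_mult[of x "inverse x"] autq_1 by (cases "x = 0") (auto simp: autq_0 inverse_unique qbar_closed)
lemma autq_power: "x \<in> qbar \<Longrightarrow> \<sigma> (x ^ k) = \<sigma> x ^ k"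
  by (induction k) (auto simp: autq_1 autq_mult qbar_closed)
lemma autq_sum: "(\<And>i. i \<in> I \<Longrightarrow> f i \<in> qbar) \<Longrightarrow> \<sigma> (sum f I) = (\<Sum>i\<in>I. \<sigma> (f i))"
  by (induction I rule: infinite_finite_induct) (auto simp: autq_0 autq_add qbar_sum)

lemma autq_poly:
  assumes "\<And>i. coeff f i \<in> qbar" "\<And>i. \<sigma> (coeff f i) = coeff f i" "x \<in> qbar"
  shows "\<sigma> (poly f x) = poly f (\<sigma> x)"
  using assms by (simp add: poly_altdef autq_sum autq_mult autq_power qbar_closed)

lemma autq_inv: "inv' \<sigma> \<in> autq"
proof -
  have b: "bij_betw (inv' \<sigma>) qbar qbar"
  proof -
    have "\<sigma> ` qbar = qbar" using autq_bij_betw by (simp add: bij_betw_def)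
    hence "inv' \<sigma> ` qbar = qbar" using autq_bij by (metis bij_is_inj image_inv_f_f)
    thus ?thesis using autq_bij by (metis bij_betw_def bij_imp_bij_inv bij_is_inj inj_on_subset subset_UNIV)
  qed
  have s: "\<sigma> (inv' \<sigma> x) = x" for x using autq_bij by (simp add: bij_is_surj surj_f_inv_f)
  have i: "inv' \<sigma> x \<in> qbar" if "x \<in> qbar" for x using b that by (auto dest: bij_betwE)
  show ?thesis
    unfolding autq_def mem_Collect_eq
  proof (intro conjI allI impI ballI b)
    show "inv' \<sigma> x = x" if "x \<notin> qbar" for x using autq_out[OF that] s autq_inj by metis
    show "inv' \<sigma> (x + y) = inv' \<sigma> x + inv' \<sigma> y" "inv' \<sigma> (x * y) = inv' \<sigma> x * inv' \<sigma> y"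
      if "x \<in> qbar" "y \<in> qbar" for x y
      using autq_add[OF i i, of x y] autq_mult[OF i i, of x y] that s autq_inj by metis+
  qed
qed

lemma autq_inv_apply: "\<sigma> (inv' \<sigma> x) = x" "inv' \<sigma> (\<sigma> x) = x"
  using autq_bij by (simp_all add: bij_is_surj surj_f_inv_f bij_is_inj)

end

lemma autq_id: "id \<in> autq" by (auto simp: autq_def)

lemma autq_comp: "\<sigma> \<in> autq \<Longrightarrow> \<tau> \<in> autq \<Longrightarrow> \<sigma> \<circ> \<tau> \<in> autq"
  unfolding autq_def mem_Collect_eq
  by (intro conjI allI impI ballI bij_betw_trans) (auto dest: bij_betwE)

lemma autq_funpow: "\<sigma> \<in> autq \<Longrightarrow> \<sigma> ^^ k \<in> autq"
  by (induction k) (auto simp: autq_id[unfolded id_def] id_def autq_comp)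

section \<open>Orbit polynomials of tuples\<close>

lemma coeff_linear_mult:
  "coeff ([:- c, 1:] * q) k = (case k of 0 \<Rightarrow> 0 | Suc j \<Rightarrow> coeff q j) - c * coeff q k" for c :: complex
  by (simp add: coeff_pCons split: nat.splits)

lemma coeff_prod_linear_in:
  fixes f :: "'a \<Rightarrow> complex"
  assumes "finite V" "\<And>v. v \<in> V \<Longrightarrow> f v \<in> S"
    and S: "0 \<in> S" "1 \<in> S" "\<And>x y. x \<in> S \<Longrightarrow> y \<in> S \<Longrightarrow> x - y \<in> S" "\<And>x y. x \<in> S \<Longrightarrow> y \<in> S \<Longrightarrow> x * y \<in> S"
  shows "coeff (\<Prod>v\<in>V. [:- f v, 1:]) k \<in> S"
  using assms(1,2)
proof (induction V arbitrary: k rule: finite_induct)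
  case empty
  thus ?case using S by (auto simp: coeff_pCons one_pCons split: nat.splits)
next
  case (insert v V)
  have "coeff (\<Prod>v\<in>V. [:- f v, 1:]) j \<in> S" for j using insert by auto
  moreover have "f v \<in> S" using insert by auto
  ultimately show ?case unfolding prod.insert[OF insert(1,2)] coeff_linear_mult
    using S by (auto split: nat.split)
qed

lemma coeff_prod_linear_hom:
  fixes \<tau> :: "complex \<Rightarrow> complex" and f :: "'a \<Rightarrow> complex"
  assumes "finite V" "\<And>v. v \<in> V \<Longrightarrow> f v \<in> S"
    and S: "0 \<in> S" "1 \<in> S" "\<And>x y. x \<in> S \<Longrightarrow> y \<in> S \<Longrightarrow> x - y \<in> S" "\<And>x y. x \<in> S \<Longrightarrow> y \<in> S \<Longrightarrow> x * y \<in> S"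
    and \<tau>: "\<And>x y. x \<in> S \<Longrightarrow> y \<in> S \<Longrightarrow> \<tau> (x - y) = \<tau> x - \<tau> y" "\<And>x y. x \<in> S \<Longrightarrow> y \<in> S \<Longrightarrow> \<tau> (x * y) = \<tau> x * \<tau> y" "\<tau> 1 = 1"
  shows "\<tau> (coeff (\<Prod>v\<in>V. [:- f v, 1:]) k) = coeff (\<Prod>v\<in>V. [:- \<tau> (f v), 1:]) k"
  using assms(1,2)
proof (induction V arbitrary: k rule: finite_induct)
  case empty
  have "\<tau> 0 = 0" using \<tau>(1)[of 0 0] S by simp
  thus ?case using \<tau>(3) by (auto simp: coeff_pCons one_pCons split: nat.splits)
next
  case (insert v V)
  have \<tau>0: "\<tau> 0 = 0" using \<tau>(1)[of 0 0] S by simp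
  let ?Q = "\<Prod>v\<in>V. [:- f v, 1:]"
  have i: "coeff ?Q k \<in> S" for k
    by (rule coeff_prod_linear_in[OF insert(1)]) (use insert S in auto)
  have v: "f v \<in> S" using insert by simp
  have "\<tau> ((case k of 0 \<Rightarrow> 0 | Suc j \<Rightarrow> coeff ?Q j) - f v * coeff ?Q k)
    = \<tau> (case k of 0 \<Rightarrow> 0 | Suc j \<Rightarrow> coeff ?Q j) - \<tau> (f v * coeff ?Q k)"
    by (rule \<tau>(1)) (use i v S in \<open>auto split: nat.splits\<close>)
  also have "\<tau> (f v * coeff ?Q k) = \<tau> (f v) * \<tau> (coeff ?Q k)"
    by (rule \<tau>(2)) (use i v in auto)
  finally show ?case unfolding prod.insert[OF insert(1,2)] coeff_linear_mult
    using insert \<tau>0 by (auto split: nat.splits)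
qed

definition orbit_vecs :: "(complex \<Rightarrow> complex) set \<Rightarrow> nat \<Rightarrow> (nat \<Rightarrow> complex) \<Rightarrow> (nat \<Rightarrow> complex) set" where
  "orbit_vecs H N a = (\<lambda>\<tau>. restrict (\<lambda>i. \<tau> (a i)) {..<N}) ` H"

text \<open>The coefficients are powers of \<open>t\<close>, so as a function of \<open>t\<close>
  this is the polynomial with coefficient vector \<open>v\<close>. A bound on the number of its
  roots therefore recovers the vector from its values.\<close>

definition theta :: "nat \<Rightarrow> int \<Rightarrow> (nat \<Rightarrow> complex) \<Rightarrow> complex" where
  "theta N t v = (\<Sum>i<N. of_int t ^ i * v i)"

text \<open>An element of \<open>H\<close> maps the orbit into itself injectively, and the orbit is
  finite, so it permutes the linear factors of \<open>Q\<close>.\<close>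

lemma orbit_poly_fixed:
  fixes t :: int
  assumes H: "H \<subseteq> autq" "\<And>\<sigma> \<tau>. \<sigma> \<in> H \<Longrightarrow> \<tau> \<in> H \<Longrightarrow> \<sigma> \<circ> \<tau> \<in> H"
    and a: "\<And>i. i < N \<Longrightarrow> a i \<in> qbar" and fin: "finite (orbit_vecs H N a)" and \<sigma>: "\<sigma> \<in> H"
  defines "Q \<equiv> (\<Prod>v\<in>orbit_vecs H N a. [:- theta N t v, 1:])"
  shows "\<sigma> (coeff Q k) = coeff Q k" "coeff Q k \<in> qbar"
proof -
  let ?V = "orbit_vecs H N a"
  have \<sigma>a: "\<sigma> \<in> autq" using H \<sigma> by auto
  have vq: "v i \<in> qbar" if "v \<in> ?V" "i < N" for v i
    using that a H autq_in by (auto simp: orbit_vecs_def)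
  have thq: "theta N t v \<in> qbar" if "v \<in> ?V" for v
    unfolding theta_def using vq[OF that] by (intro qbar_sum qbar_closed) auto
  define s where "s v = restrict (\<lambda>i. \<sigma> (v i)) {..<N}" for v
  have sV: "s ` ?V \<subseteq> ?V"
  proof safe
    fix v assume "v \<in> ?V"
    then obtain \<tau> where "\<tau> \<in> H" "v = restrict (\<lambda>i. \<tau> (a i)) {..<N}" by (auto simp: orbit_vecs_def)
    hence "s v = restrict (\<lambda>i. (\<sigma> \<circ> \<tau>) (a i)) {..<N}" "\<sigma> \<circ> \<tau> \<in> H" using H \<sigma> by (auto simp: s_def)
    thus "s v \<in> ?V" unfolding orbit_vecs_def by blast
  qed
  have inj: "inj_on s ?V"
  proof (rule inj_onI)
    fix v w assume vw: "v \<in> ?V" "w \<in> ?V" "s v = s w"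
    have "v i = w i" if "i < N" for i
      using fun_cong[OF vw(3), of i] that autq_inj[OF \<sigma>a] by (simp add: s_def)
    moreover have "v \<in> extensional {..<N}" "w \<in> extensional {..<N}" using vw by (auto simp: orbit_vecs_def)
    ultimately show "v = w" by (auto intro!: extensionalityI)
  qed
  have bij: "bij_betw s ?V ?V" using sV inj fin by (simp add: bij_betw_def endo_inj_surj)
  have ths: "\<sigma> (theta N t v) = theta N t (s v)" if "v \<in> ?V" for v
  proof -
    have "\<sigma> (theta N t v) = (\<Sum>i<N. \<sigma> (of_int t ^ i * v i))"
      unfolding theta_def using vq[OF that] by (intro autq_sum[OF \<sigma>a] qbar_closed) auto
    also have "\<dots> = theta N t (s v)" unfolding theta_def s_def
      using vq[OF that] by (intro sum.cong) (auto simp: autq_mult[OF \<sigma>a] qbar_closed autq_power[OF \<sigma>a] autq_of_int[OF \<sigma>a])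
    finally show ?thesis .
  qed
  show "coeff Q k \<in> qbar" unfolding Q_def
    by (rule coeff_prod_linear_in[OF fin]) (use thq in auto)
  have "\<sigma> (coeff Q k) = coeff (\<Prod>v\<in>?V. [:- \<sigma> (theta N t v), 1:]) k" unfolding Q_def
    by (rule coeff_prod_linear_hom[OF fin, of _ qbar])
      (use thq in \<open>auto simp: autq_diff[OF \<sigma>a] autq_mult[OF \<sigma>a] autq_1[OF \<sigma>a]\<close>)
  also have "(\<Prod>v\<in>?V. [:- \<sigma> (theta N t v), 1:]) = (\<Prod>v\<in>?V. [:- theta N t (s v), 1:])"
    by (intro prod.cong) (auto simp: ths)
  also have "\<dots> = Q" unfolding Q_def
    by (rule prod.reindex_bij_betw[OF bij, of "\<lambda>v. [:- theta N t v, 1:]"])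
  finally show "\<sigma> (coeff Q k) = coeff Q k" .
qed

section \<open>Congruences modulo prime ideals\<close>

text \<open>A subring of the complex numbers with a prime ideal. It is used for places above a prime
  number and also for the whole field with the zero ideal, where congruence is equality; both uses
  share \<open>vector_of_theta\<close>.\<close>

locale prime_pair =
  fixes R P :: "complex set"
  assumes R1: "1 \<in> R" and R_add: "x \<in> R \<Longrightarrow> y \<in> R \<Longrightarrow> x + y \<in> R"
    and R_mult: "x \<in> R \<Longrightarrow> y \<in> R \<Longrightarrow> x * y \<in> R" and R_minus: "x \<in> R \<Longrightarrow> - x \<in> R"
    and PR: "P \<subseteq> R" and P0: "0 \<in> P" and P_add: "x \<in> P \<Longrightarrow> y \<in> P \<Longrightarrow> x + y \<in> P"
    and P_mult: "x \<in> R \<Longrightarrow> y \<in> P \<Longrightarrow> x * y \<in> P" and P1: "1 \<notin> P"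
    and P_prime: "x \<in> R \<Longrightarrow> y \<in> R \<Longrightarrow> x * y \<in> P \<Longrightarrow> x \<in> P \<or> y \<in> P"
begin

lemma R0: "0 \<in> R" using P0 PR by auto
lemma R_diff: "x \<in> R \<Longrightarrow> y \<in> R \<Longrightarrow> x - y \<in> R" using R_add[of x "-y"] R_minus by simp
lemma R_power: "x \<in> R \<Longrightarrow> x ^ k \<in> R" by (induction k) (auto simp: R1 R_mult)
lemma R_sum: "(\<And>i. i \<in> I \<Longrightarrow> f i \<in> R) \<Longrightarrow> sum f I \<in> R"
  by (induction I rule: infinite_finite_induct) (auto simp: R0 R_add)
lemma R_prod: "(\<And>i. i \<in> I \<Longrightarrow> f i \<in> R) \<Longrightarrow> prod f I \<in> R"
  by (induction I rule: infinite_finite_induct) (auto simp: R1 R_mult)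
lemma R_of_nat: "of_nat n \<in> R" by (induction n) (auto simp: R0 R1 R_add)
lemma R_of_int: "of_int n \<in> R"
  by (cases n) (auto simp: R_of_nat R_minus R_add R1 R_diff simp del: of_nat_Suc)
lemma P_mult': "x \<in> P \<Longrightarrow> y \<in> R \<Longrightarrow> x * y \<in> P" using P_mult[of y x] by (simp add: mult.commute)
lemma P_minus: "x \<in> P \<Longrightarrow> - x \<in> P" using P_mult[of "-1" x] R_minus[OF R1] by simp
lemma P_diff: "x \<in> P \<Longrightarrow> y \<in> P \<Longrightarrow> x - y \<in> P" using P_add[of x "-y"] P_minus by simp
lemma P_sum: "(\<And>i. i \<in> I \<Longrightarrow> f i \<in> P) \<Longrightarrow> sum f I \<in> P"
  by (induction I rule: infinite_finite_induct) (auto simp: P0 P_add)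
lemma P_prodE: "finite I \<Longrightarrow> (\<And>i. i \<in> I \<Longrightarrow> f i \<in> R) \<Longrightarrow> prod f I \<in> P \<Longrightarrow> \<exists>i\<in>I. f i \<in> P"
proof (induction I rule: finite_induct)
  case (insert x F)
  have "prod f F \<in> R" "f x \<in> R" using insert by (auto intro: R_prod)
  thus ?case using insert P_prime[of "f x" "prod f F"] by auto
qed (use P1 in auto)
lemma P_power: "x \<in> R \<Longrightarrow> x ^ k \<in> P \<Longrightarrow> x \<in> P"
  by (induction k) (use P1 P_prime R_power in auto)

abbreviation cg :: "complex \<Rightarrow> complex \<Rightarrow> bool" (infix "\<equiv>\<^sub>P" 50) where "x \<equiv>\<^sub>P y \<equiv> x - y \<in> P"

lemma cg_refl: "x \<equiv>\<^sub>P x" by (simp add: P0)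
lemma cg_sym: "x \<equiv>\<^sub>P y \<Longrightarrow> y \<equiv>\<^sub>P x" using P_minus[of "x - y"] by simp
lemma cg_trans: "x \<equiv>\<^sub>P y \<Longrightarrow> y \<equiv>\<^sub>P z \<Longrightarrow> x \<equiv>\<^sub>P z" using P_add[of "x - y" "y - z"] by simp
lemma cg_add: "x \<equiv>\<^sub>P y \<Longrightarrow> x' \<equiv>\<^sub>P y' \<Longrightarrow> x + x' \<equiv>\<^sub>P y + y'"
  using P_add[of "x - y" "x' - y'"] by (simp add: algebra_simps)
lemma cg_diff: "x \<equiv>\<^sub>P y \<Longrightarrow> x' \<equiv>\<^sub>P y' \<Longrightarrow> x - x' \<equiv>\<^sub>P y - y'"
  using P_diff[of "x - y" "x' - y'"] by (simp add: algebra_simps)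
lemma cg_mult: "x \<equiv>\<^sub>P y \<Longrightarrow> x' \<equiv>\<^sub>P y' \<Longrightarrow> x \<in> R \<Longrightarrow> y' \<in> R \<Longrightarrow> x * x' \<equiv>\<^sub>P y * y'"
  using P_add[OF P_mult[of x "x' - y'"] P_mult'[of "x - y" y']] by (simp add: algebra_simps)
lemma cg_power: "x \<equiv>\<^sub>P y \<Longrightarrow> x \<in> R \<Longrightarrow> y \<in> R \<Longrightarrow> x ^ k \<equiv>\<^sub>P y ^ k"
  by (induction k) (auto simp: P0 R_power intro!: cg_mult)
lemma cg_sum: "(\<And>i. i \<in> I \<Longrightarrow> f i \<equiv>\<^sub>P g i) \<Longrightarrow> sum f I \<equiv>\<^sub>P sum g I"
  using P_sum[of I "\<lambda>i. f i - g i"] by (simp add: sum_subtractf)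
lemma cg_prod: "(\<And>i. i \<in> I \<Longrightarrow> f i \<equiv>\<^sub>P g i) \<Longrightarrow> (\<And>i. i \<in> I \<Longrightarrow> f i \<in> R) \<Longrightarrow> (\<And>i. i \<in> I \<Longrightarrow> g i \<in> R) \<Longrightarrow>
    prod f I \<equiv>\<^sub>P prod g I"
  by (induction I rule: infinite_finite_induct) (auto simp: P0 R_prod intro!: cg_mult)
lemma cg_P: "x \<equiv>\<^sub>P y \<Longrightarrow> x \<in> P \<longleftrightarrow> y \<in> P"
  using P_add[of "x - y" y] P_diff[of x "x - y"] by auto
lemma cg_mult_cancel: "c * x \<equiv>\<^sub>P c * y \<Longrightarrow> c \<in> R \<Longrightarrow> c \<notin> P \<Longrightarrow> x \<in> R \<Longrightarrow> y \<in> R \<Longrightarrow> x \<equiv>\<^sub>P y"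
  using P_prime[of c "x - y"] by (simp add: right_diff_distrib R_diff)

lemma R_poly: "(\<And>i. coeff f i \<in> R) \<Longrightarrow> x \<in> R \<Longrightarrow> poly f x \<in> R"
  unfolding poly_altdef by (intro R_sum R_mult R_power) auto

text \<open>The usual bound on the number of roots, in the domain R/P. It is carried out in
  \<open>R\<close> itself: synthetic division splits off \<open>t0\<close>, and the quotient
  vanishes modulo \<open>P\<close> at the remaining points because \<open>P\<close> is
  prime.\<close>

lemma root_bound:
  assumes "\<And>i. coeff f i \<in> R" "finite T" "degree f < card T" "T \<subseteq> R"
    and "\<And>s t. s \<in> T \<Longrightarrow> t \<in> T \<Longrightarrow> s \<equiv>\<^sub>P t \<Longrightarrow> s = t" and "\<And>t. t \<in> T \<Longrightarrow> poly f t \<in> P"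
  shows "coeff f i \<in> P"
  using assms
proof (induction "card T" arbitrary: f T i)
  case 0 thus ?case by simp
next
  case (Suc n)
  then obtain t0 where t0: "t0 \<in> T" by (metis card.empty ex_in_conv nat.simps(3))
  define q where "q = synthetic_div f t0"
  have f: "f = pCons (poly f t0) q - smult t0 q"
    using synthetic_div_correct[of f t0] by (simp add: q_def algebra_simps)
  \<comment> \<open>Induction downwards from the degree: each coefficient of the quotient is one of
    \<open>f\<close> plus \<open>t0\<close> times the next one.\<close>
  have qR: "coeff q i \<in> R" for i
  proof (induction "degree f - i" arbitrary: i rule: less_induct)
    case less
    show ?case
    proof (cases "i \<ge> degree f")
      case True
      have "degree q \<le> degree f - 1" by (simp add: q_def degree_synthetic_div)
      hence "coeff q i = 0 \<or> i = 0 \<and> degree f = 0" using True by (cases "i > degree q") (auto simp: coeff_eq_0)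
      moreover have "degree f = 0 \<Longrightarrow> q = 0" using synthetic_div_eq_0_iff[of f t0] by (simp add: q_def)
      ultimately have "coeff q i = 0" by auto
      thus ?thesis by (simp add: R0)
    next
      case False
      have "coeff f (Suc i) = coeff q i - t0 * coeff q (Suc i)" by (subst f) simp
      hence "coeff q i = coeff f (Suc i) + t0 * coeff q (Suc i)" by simp
      moreover have "coeff q (Suc i) \<in> R" using less[of "Suc i"] False by simp
      ultimately show ?thesis using Suc.prems t0 by (auto intro!: R_add R_mult)
    qed
  qed
  have qP: "coeff q i \<in> P" for i
  proof (cases "degree f = 0")
    case True
    hence "q = 0" using synthetic_div_eq_0_iff[of f t0] by (simp add: q_def)
    thus ?thesis by (simp add: P0)
  next
    case False
    show ?thesis
    proof (rule Suc.hyps(1)[of "T - {t0}"])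
      show "n = card (T - {t0})" using Suc t0 by simp
      show "degree q < card (T - {t0})" using Suc.prems t0 False by (simp add: q_def degree_synthetic_div)
      fix t assume t: "t \<in> T - {t0}"
      have "poly f t = poly f t0 + t * poly q t - t0 * poly q t" by (subst f) simp
      hence "poly f t - poly f t0 = (t - t0) * poly q t" by (simp add: algebra_simps)
      moreover have "poly f t - poly f t0 \<in> P" using Suc.prems t t0 by (intro P_diff) auto
      ultimately have "(t - t0) * poly q t \<in> P" by simp
      moreover have "t - t0 \<in> R" "poly q t \<in> R" using t t0 Suc.prems qR by (auto intro!: R_diff R_poly)
      moreover have "t - t0 \<notin> P" using t t0 Suc.prems(5)[of t t0] by auto
      ultimately show "poly q t \<in> P" using P_prime by blast
    qed (use Suc.prems qR in auto)
  qed
  have "coeff f i = (case i of 0 \<Rightarrow> poly f t0 | Suc j \<Rightarrow> coeff q j) - t0 * coeff q i"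
    by (subst f) (simp add: coeff_pCons)
  thus ?case using qP Suc.prems t0 by (auto intro!: P_diff P_mult split: nat.splits)
qed

text \<open>Replacing vectors by the values of generic linear forms reduces a simultaneous conjugacy
  statement to one for single elements.\<close>

lemma vector_of_theta:
  assumes "finite V" and T: "finite T" "card T > card V * N"
    and Tinj: "\<And>s t. s \<in> T \<Longrightarrow> t \<in> T \<Longrightarrow> of_int s \<equiv>\<^sub>P of_int t \<Longrightarrow> s = t"
    and VR: "\<And>v i. v \<in> V \<Longrightarrow> i < N \<Longrightarrow> v i \<in> R" and wR: "\<And>i. i < N \<Longrightarrow> w i \<in> R"
    and prod: "\<And>t. t \<in> T \<Longrightarrow> (\<Prod>v\<in>V. theta N t w - theta N t v) \<in> P"
  shows "\<exists>v\<in>V. \<forall>i<N. w i \<equiv>\<^sub>P v i"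
proof -
  let ?S = "\<lambda>v. {t\<in>T. theta N t w \<equiv>\<^sub>P theta N t v}"
  have thR: "theta N t u \<in> R" if "\<And>i. i < N \<Longrightarrow> u i \<in> R" for t u
    unfolding theta_def using that by (intro R_sum R_mult R_power R_of_int) auto
  have "\<exists>v\<in>V. theta N t w \<equiv>\<^sub>P theta N t v" if "t \<in> T" for t
    using P_prodE[OF \<open>finite V\<close> _ prod[OF that]] thR VR wR R_diff by blast
  hence Tsub: "T \<subseteq> (\<Union>v\<in>V. ?S v)" by blast
  \<comment> \<open>Pigeonhole: some single \<open>v\<close> serves for more than \<open>N\<close>
    values of \<open>t\<close>, and then the polynomial with coefficients \<open>w i - v i\<close>
    has too many roots modulo \<open>P\<close>.\<close>
  have "\<exists>v\<in>V. card (?S v) > N"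
  proof (rule ccontr)
    assume "\<not> ?thesis"
    hence le: "card (?S v) \<le> N" if "v \<in> V" for v using that by (meson not_le)
    have "card T \<le> card (\<Union>v\<in>V. ?S v)" using Tsub T assms(1) by (intro card_mono) auto
    also have "\<dots> \<le> (\<Sum>v\<in>V. card (?S v))" by (rule card_UN_le[OF assms(1)])
    also have "\<dots> \<le> (\<Sum>v\<in>V. N)" by (rule sum_mono[OF le])
    finally show False using T by simp
  qed
  then obtain v where v: "v \<in> V" "card (?S v) > N" by blast
  define f where "f = (\<Sum>i<N. monom (w i - v i) i)"
  have cf: "coeff f i = (if i < N then w i - v i else 0)" for i by (auto simp: f_def coeff_sum)
  have pf: "poly f (of_int t) = theta N t w - theta N t v" for t
    by (simp add: f_def poly_sum poly_monom theta_def sum_subtractf[symmetric] algebra_simps)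
  have inj: "inj_on (of_int :: int \<Rightarrow> complex) (?S v)" by (simp add: inj_on_def)
  have "coeff f i \<in> P" for i
  proof (rule root_bound)
    show "coeff f i \<in> R" for i using cf VR v wR by (auto simp: R0 R_diff)
    show "degree f < card ((of_int :: int \<Rightarrow> complex) ` ?S v)"
    proof -
      have "degree f \<le> N" by (intro degree_le) (auto simp: cf)
      thus ?thesis using v card_image[OF inj] by simp
    qed
    show "finite (of_int ` ?S v :: complex set)" using T by simp
  qed (use Tinj pf R_of_int in auto)
  thus ?thesis using v cf by (intro bexI[of _ v]) (auto split: if_splits, metis)
qed

end

section \<open>Places of the complex numbers above a prime number\<close>

locale place = prime_pair +
  fixes p :: nat
  assumes p: "prime p" and pP: "of_nat p \<in> P" and alg_int_R: "algebraic_int x \<Longrightarrow> x \<in> R"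

text \<open>A maximal subring in which \<open>p\<close> is not invertible is a valuation ring, and therefore contains
  all algebraic integers.\<close>

lemma place_exists:
  assumes p: "prime p"
  obtains R P where "place R P p"
proof -
  define pc where "pc = (of_nat p :: complex)"
  have pc0: "pc \<noteq> 0" using p by (auto simp: pc_def)
  define sub where "sub R \<longleftrightarrow> (1::complex) \<in> R \<and> (\<forall>x\<in>R. \<forall>y\<in>R. x + y \<in> R \<and> x * y \<in> R \<and> - x \<in> R)" for R
  let ?A = "{R. sub R \<and> inverse pc \<notin> R}"
  have "\<exists>M\<in>?A. \<forall>X\<in>?A. M \<subseteq> X \<longrightarrow> X = M"
  proof (rule subset_Zorn_nonempty)
    have "inverse pc \<notin> \<int>"
    proof
      assume "inverse pc \<in> \<int>"
      then obtain z where "inverse pc = of_int z" by (auto elim: Ints_cases)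
      hence "of_int (int p * z) = (1::complex)" using pc0 by (simp add: pc_def field_simps)
      hence "int p * z = 1" by (metis of_int_eq_1_iff)
      hence "int p dvd 1" by (metis dvd_triv_left)
      thus False using p by (simp add: prime_nat_iff)
    qed
    hence "\<int> \<in> ?A" by (auto simp: sub_def)
    thus "?A \<noteq> {}" by blast
    fix C assume C: "C \<noteq> {}" "subset.chain ?A C"
    have sv: "sub b" "inverse pc \<notin> b" if "b \<in> C" for b using C that by (auto simp: subset.chain_def)
    have two: "\<exists>b\<in>C. u \<in> b \<and> v \<in> b" if pq: "u \<in> \<Union>C" "v \<in> \<Union>C" for u v
    proof -
      obtain b b' where b: "b \<in> C" "b' \<in> C" "u \<in> b" "v \<in> b'" using pq by blast
      have "b \<subseteq> b' \<or> b' \<subseteq> b" using C(2) b unfolding subset.chain_def by blast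
      thus ?thesis using b by blast
    qed
    have "sub (\<Union>C)" unfolding sub_def
    proof (intro conjI ballI)
      show "1 \<in> \<Union>C" using C(1) sv unfolding sub_def by blast
      fix x y assume "x \<in> \<Union>C" "y \<in> \<Union>C"
      then obtain b where b: "b \<in> C" "x \<in> b" "y \<in> b" using two by blast
      show "x + y \<in> \<Union>C" "x * y \<in> \<Union>C" "- x \<in> \<Union>C"
        using sv(1)[OF b(1)] b unfolding sub_def by blast+
    qed
    moreover have "inverse pc \<notin> \<Union>C" using sv(2) by blast
    ultimately show "\<Union>C \<in> ?A" by blast
  qed
  then obtain R where R: "sub R" "inverse pc \<notin> R" and max: "\<And>X. sub X \<Longrightarrow> inverse pc \<notin> X \<Longrightarrow> R \<subseteq> X \<Longrightarrow> X = R"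
    by auto
  have R1: "1 \<in> R" and Radd: "x + y \<in> R" and Rmult: "x * y \<in> R" and Rminus: "- x \<in> R"
    if "x \<in> R" "y \<in> R" for x y using R(1) that by (auto simp: sub_def)
  have R1: "1 \<in> R" using R(1) by (simp add: sub_def)
  have Rminus: "- x \<in> R" if "x \<in> R" for x using Rminus[OF that that] .
  have R0: "0 \<in> R" using Radd[OF R1 Rminus[OF R1]] by simp
  have Rdiff: "x - y \<in> R" if "x \<in> R" "y \<in> R" for x y
    using Radd[OF that(1) Rminus[OF that(2)]] by simp
  have Rpow: "x ^ k \<in> R" if "x \<in> R" for x k by (induction k) (use that R1 Rmult in auto)
  have Rsum: "sum f I \<in> R" if "\<And>i. i \<in> I \<Longrightarrow> f i \<in> R" for f and I :: "nat set"
    using that by (induction I rule: infinite_finite_induct) (auto simp: R0 Radd)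
  have Rnat: "of_nat k \<in> R" for k by (induction k) (auto simp: R0 R1 Radd)
  have Rint: "of_int k \<in> R" for k by (cases k) (auto simp: Rnat R1 Rdiff Rminus simp del: of_nat_Suc)
  have pR: "pc \<in> R" using Rnat by (simp add: pc_def)
  have adj: "\<exists>a m. (\<forall>i. a i \<in> R) \<and> inverse pc = (\<Sum>i\<le>m. a i * x ^ i)" if "x \<notin> R" for x
  proof -
    let ?X = "{poly q x | q. \<forall>i. coeff q i \<in> R}"
    have "sub ?X" unfolding sub_def
    proof (intro conjI ballI)
      show "1 \<in> ?X" by (rule CollectI, rule exI[of _ 1]) (auto simp: one_pCons coeff_pCons R0 R1 split: nat.splits)
      fix u v assume "u \<in> ?X" "v \<in> ?X"
      then obtain q r where qr: "u = poly q x" "v = poly r x" "\<forall>i. coeff q i \<in> R" "\<forall>i. coeff r i \<in> R" by blast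
      show "u + v \<in> ?X" using qr by (intro CollectI exI[of _ "q + r"]) (auto simp: Radd)
      show "u * v \<in> ?X" using qr by (intro CollectI exI[of _ "q * r"]) (auto simp: coeff_mult intro!: Rsum Rmult)
      show "- u \<in> ?X" using qr by (intro CollectI exI[of _ "- q"]) (auto simp: Rminus)
    qed
    moreover have "R \<subseteq> ?X"
    proof
      fix r assume "r \<in> R"
      thus "r \<in> ?X" by (intro CollectI exI[of _ "[:r:]"]) (auto simp: coeff_pCons R0 split: nat.splits)
    qed
    moreover have "x \<in> ?X" by (intro CollectI exI[of _ "[:0,1:]"]) (auto simp: coeff_pCons R0 R1 split: nat.splits)
    ultimately have "inverse pc \<in> ?X" using max[of ?X] \<open>x \<notin> R\<close> by blast
    then obtain q where "inverse pc = poly q x" "\<forall>i. coeff q i \<in> R" by blast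
    thus ?thesis unfolding poly_altdef by blast
  qed
  \<comment> \<open>If the inverse of u = 1 - p a were missing, adjoining it would make 1/p a
    polynomial in 1/u. Clearing denominators puts u^m/p into \<open>R\<close>, and u^m is 1 minus a
    multiple of p, so 1/p would lie in \<open>R\<close>.\<close>
  have unit: "inverse (1 - pc * a) \<in> R" "1 - pc * a \<noteq> 0" if a: "a \<in> R" for a
  proof -
    let ?u = "1 - pc * a"
    show u0: "?u \<noteq> 0"
    proof
      assume "?u = 0"
      hence "inverse pc = a" using pc0 by (simp add: field_simps)
      thus False using a R by simp
    qed
    show "inverse ?u \<in> R"
    proof (rule ccontr)
      assume "inverse ?u \<notin> R"
      then obtain c m where c: "\<forall>i. c i \<in> R" "inverse pc = (\<Sum>i\<le>m. c i * inverse ?u ^ i)" using adj by blast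
      have uR: "?u \<in> R" using a pR by (intro Rdiff R1 Rmult)
      have "?u ^ m * inverse pc = (\<Sum>i\<le>m. c i * ?u ^ (m - i))"
        unfolding c(2) sum_distrib_left using u0
        by (intro sum.cong) (auto simp: power_diff field_simps)
      also have "\<dots> \<in> R" using c uR by (intro Rsum Rmult Rpow) auto
      finally have 1: "?u ^ m * inverse pc \<in> R" .
      have "\<exists>b\<in>R. ?u ^ m = 1 - pc * b"
      proof (induction m)
        case 0 show ?case using R0 by (intro bexI[of _ 0]) auto
      next
        case (Suc m)
        then obtain b where b: "b \<in> R" "?u ^ m = 1 - pc * b" by blast
        have "?u ^ Suc m = ?u * (1 - pc * b)" using b(2) by simp
        also have "\<dots> = 1 - pc * (a + b * ?u)" by (simp add: algebra_simps)
        finally have "?u ^ Suc m = 1 - pc * (a + b * ?u)" .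
        moreover have "a + b * ?u \<in> R" using a b uR by (intro Radd Rmult)
        ultimately show ?case by blast
      qed
      then obtain b where b: "b \<in> R" "?u ^ m = 1 - pc * b" by blast
      have "inverse pc = ?u ^ m * inverse pc + b" using b(2) pc0 by (simp add: field_simps)
      thus False using 1 b(1) Radd R(2) by metis
    qed
  qed
  \<comment> \<open>A relation expressing 1 as a polynomial of degree at most \<open>m\<close> in
    \<open>x\<close> with coefficients in p R. By maximality every \<open>x\<close> outside
    \<open>R\<close> satisfies one.\<close>
  define Pm where "Pm x m \<longleftrightarrow> (\<exists>a. (\<forall>i. a i \<in> R) \<and> 1 = (\<Sum>i\<le>m. pc * a i * x ^ i))" for x m
  have PmE: "\<exists>m. Pm x m" if "x \<notin> R" for x
  proof -
    obtain a m where a: "\<forall>i. a i \<in> R" "inverse pc = (\<Sum>i\<le>m. a i * x ^ i)" using adj[OF \<open>x \<notin> R\<close>] by blast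
    have "1 = pc * inverse pc" using pc0 by simp
    also have "\<dots> = (\<Sum>i\<le>m. pc * a i * x ^ i)" unfolding a(2) by (simp add: sum_distrib_left mult.assoc)
    finally show ?thesis using a(1) unfolding Pm_def by blast
  qed
  have Pm0: "\<not> Pm x 0" for x
  proof
    assume "Pm x 0"
    then obtain a where "a \<in> R" "1 = pc * a" unfolding Pm_def by auto
    thus False using unit(2)[of a] by simp
  qed
  \<comment> \<open>In the relation for 1/x the constant term is absorbed by the unit 1 - p b0, so 1
    becomes a combination of strictly negative powers of \<open>x\<close>. Multiplying the top term
    of the relation for \<open>x\<close> by it lowers the degree.\<close>
  have red: "Pm x (m - 1)" if x0: "x \<noteq> 0" and a: "Pm x m" and b: "Pm (inverse x) k" and km: "k \<le> m" for x m k
  proof -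
    have k0: "k \<noteq> 0" using b Pm0 by metis
    obtain a where a: "\<forall>i. a i \<in> R" "1 = (\<Sum>i\<le>m. pc * a i * x ^ i)" using a unfolding Pm_def by blast
    obtain b where b: "\<forall>i. b i \<in> R" "1 = (\<Sum>i\<le>k. pc * b i * inverse x ^ i)" using b unfolding Pm_def by blast
    let ?w = "inverse (1 - pc * b 0)"
    have w: "?w \<in> R" "1 - pc * b 0 \<noteq> 0" using unit[of "b 0"] b(1) by auto
    have "1 - pc * b 0 = (\<Sum>i=1..k. pc * b i * inverse x ^ i)"
    proof -
      have "{..k} = insert 0 {1..k}" using k0 by auto
      hence "1 = pc * b 0 + (\<Sum>i=1..k. pc * b i * inverse x ^ i)" using b(2) by simp
      thus ?thesis by (metis add_diff_cancel_left')
    qed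
    note b0 = this
    have "1 = ?w * (1 - pc * b 0)" using w(2) by simp
    also have "\<dots> = ?w * (\<Sum>i=1..k. pc * b i * inverse x ^ i)" by (simp only: b0)
    also have "\<dots> = (\<Sum>i=1..k. pc * (?w * b i) * inverse x ^ i)" unfolding sum_distrib_left by (rule sum.cong) (auto simp: mult_ac)
    finally have one: "1 = (\<Sum>i=1..k. pc * (?w * b i) * inverse x ^ i)" .
    have top: "pc * a m * x ^ m = (\<Sum>i=1..k. pc * (pc * a m * (?w * b i)) * x ^ (m - i))"
    proof -
      have "pc * a m * x ^ m = pc * a m * x ^ m * (\<Sum>i=1..k. pc * (?w * b i) * inverse x ^ i)"
        by (subst one[symmetric]) simp
      also have "\<dots> = (\<Sum>i=1..k. pc * (pc * a m * (?w * b i)) * x ^ (m - i))"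
        unfolding sum_distrib_left
      proof (rule sum.cong)
        fix i assume "i \<in> {1..k}"
        hence "x ^ (m - i) = x ^ m * inverse x ^ i" using km x0 by (simp add: power_diff field_simps)
        thus "pc * a m * x ^ m * (pc * (?w * b i) * inverse x ^ i) = pc * (pc * a m * (?w * b i)) * x ^ (m - i)"
          by simp
      qed simp
      finally show ?thesis .
    qed
    also have "\<dots> = (\<Sum>j\<in>{m-k..m-1}. pc * (pc * a m * (?w * b (m - j))) * x ^ j)"
      by (rule sum.reindex_bij_witness[of _ "\<lambda>j. m - j" "\<lambda>i. m - i"]) (use km k0 in auto)
    also have "\<dots> = (\<Sum>j\<le>m-1. pc * (if m - k \<le> j then pc * a m * (?w * b (m - j)) else 0) * x ^ j)"
      by (rule sum.mono_neutral_cong_left) auto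
    finally have top': "pc * a m * x ^ m = (\<Sum>j\<le>m-1. pc * (if m - k \<le> j then pc * a m * (?w * b (m - j)) else 0) * x ^ j)" .
    have "m \<noteq> 0" using km k0 by simp
    hence "{..m} = insert m {..m-1}" by auto
    hence "1 = pc * a m * x ^ m + (\<Sum>i\<le>m-1. pc * a i * x ^ i)" using a(2) \<open>m \<noteq> 0\<close> by simp
    also have "\<dots> = (\<Sum>j\<le>m-1. pc * ((if m - k \<le> j then pc * a m * (?w * b (m - j)) else 0) + a j) * x ^ j)"
      unfolding top' sum.distrib[symmetric] by (rule sum.cong) (auto simp: algebra_simps)
    finally have "1 = (\<Sum>j\<le>m-1. pc * ((if m - k \<le> j then pc * a m * (?w * b (m - j)) else 0) + a j) * x ^ j)" .
    moreover have "(if m - k \<le> j then pc * a m * (?w * b (m - j)) else 0) + a j \<in> R" for j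
      using a b w pR R0 by (auto intro!: Radd Rmult)
    ultimately show ?thesis unfolding Pm_def
      by (intro exI[of _ "\<lambda>j. (if m - k \<le> j then pc * a m * (?w * b (m - j)) else 0) + a j"] conjI allI)
  qed
  \<comment> \<open>Were \<open>x\<close> and its inverse both outside \<open>R\<close>, take
    relations of least degree for each; \<open>red\<close> shortens the longer one.\<close>
  have val: "x \<in> R \<or> inverse x \<in> R" for x
  proof (rule ccontr)
    assume n: "\<not> (x \<in> R \<or> inverse x \<in> R)"
    hence x0: "x \<noteq> 0" using R0 by auto
    define m where "m = (LEAST m. Pm x m)"
    define k where "k = (LEAST k. Pm (inverse x) k)"
    have m: "Pm x m" "Pm (inverse x) k" unfolding m_def k_def using PmE n by (metis LeastI_ex)+
    have "m \<noteq> 0" "k \<noteq> 0" using m Pm0 by metis+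
    show False
    proof (cases "k \<le> m")
      case True
      hence "Pm x (m - 1)" using red[OF x0] m by blast
      hence "m \<le> m - 1" unfolding m_def by (rule Least_le)
      thus False using \<open>m \<noteq> 0\<close> by simp
    next
      case False
      hence "Pm (inverse x) (k - 1)" using red[of "inverse x" k m] x0 m by simp
      hence "k \<le> k - 1" unfolding k_def by (rule Least_le)
      thus False using \<open>k \<noteq> 0\<close> by simp
    qed
  qed
  \<comment> \<open>The nonunits. Zero is listed separately because \<open>inverse 0 = 0\<close>
    lies in \<open>R\<close>. Closure under addition uses \<open>val\<close>: one of x/y and y/x
    lies in \<open>R\<close>.\<close>
  define P where "P = {x\<in>R. x = 0 \<or> inverse x \<notin> R}"
  have Pmult: "x * y \<in> P" if "x \<in> R" "y \<in> P" for x y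
  proof -
    have "y = 0 \<or> x = 0 \<or> inverse (x * y) \<notin> R"
      using Rmult[OF that(1), of "inverse (x * y)"] that(2) by (auto simp: P_def field_simps)
    thus ?thesis using that Rmult by (auto simp: P_def)
  qed
  have Padd1: "x + y \<in> P" if xy: "x \<in> P" "y \<in> P" "y \<noteq> 0" "x / y \<in> R" for x y
  proof -
    have "inverse (x + y) \<notin> R" if "x + y \<noteq> 0"
    proof
      assume "inverse (x + y) \<in> R"
      hence "(1 + x / y) * inverse (x + y) \<in> R" using xy R1 by (intro Rmult Radd)
      moreover have "(1 + x / y) * inverse (x + y) = inverse y" using that xy(3) by (simp add: field_simps)
      ultimately show False using xy by (auto simp: P_def)
    qed
    thus ?thesis using xy Radd by (auto simp: P_def)
  qed
  have Padd: "x + y \<in> P" if xy: "x \<in> P" "y \<in> P" for x y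
  proof (cases "x = 0 \<or> y = 0")
    case True thus ?thesis using xy by auto
  next
    case False
    have "x / y \<in> R \<or> y / x \<in> R" using val[of "x / y"] by (simp add: field_simps)
    thus ?thesis using Padd1[of x y] Padd1[of y x] xy False by (auto simp: add.commute)
  qed
  have pp: "prime_pair R P"
  proof
    show "x \<in> P \<or> y \<in> P" if "x \<in> R" "y \<in> R" "x * y \<in> P" for x y
    proof (rule ccontr)
      assume "\<not> ?thesis"
      hence "x \<noteq> 0" "y \<noteq> 0" "inverse x \<in> R" "inverse y \<in> R" using that by (auto simp: P_def)
      moreover from this have "inverse (x * y) \<in> R" using Rmult[of "inverse x" "inverse y"] by simp
      ultimately show False using that(3) by (simp add: P_def)
    qed
  qed (use R1 Radd Rmult Rminus Pmult Padd R0 in \<open>auto simp: P_def\<close>)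
  interpret prime_pair R P by (rule pp)
  \<comment> \<open>For \<open>x\<close> outside \<open>R\<close> the inverse lies in
    \<open>P\<close>; dividing the monic equation by its top power of \<open>x\<close> then writes 1
    as an element of \<open>P\<close>.\<close>
  have ai: "x \<in> R" if x: "algebraic_int x" for x
  proof (rule ccontr)
    assume xR: "x \<notin> R"
    hence x0: "x \<noteq> 0" and yP: "inverse x \<in> P" using val[of x] R0 by (auto simp: P_def)
    obtain q where q: "poly (map_poly of_int q) x = 0" "lead_coeff q = 1"
      using x by (auto simp: algebraic_int_altdef_ipoly)
    define d where "d = degree q"
    have "(\<Sum>i\<le>d. of_int (coeff q i) * x ^ i) = 0"
      using q(1) by (simp add: poly_altdef d_def degree_map_poly coeff_map_poly)
    hence "x ^ d = - (\<Sum>i<d. of_int (coeff q i) * x ^ i)"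
      using q(2) by (simp add: lessThan_Suc_atMost[symmetric] d_def add_eq_0_iff)
    hence "x ^ d * inverse x ^ d = - (\<Sum>i<d. of_int (coeff q i) * x ^ i) * inverse x ^ d" by simp
    also have "x ^ d * inverse x ^ d = 1" using x0 by (simp flip: power_mult_distrib)
    also have "- (\<Sum>i<d. of_int (coeff q i) * x ^ i) * inverse x ^ d = - (\<Sum>i<d. of_int (coeff q i) * inverse x ^ (d - i))"
      unfolding sum_distrib_right minus_mult_left[symmetric] using x0
      by (intro arg_cong[of _ _ uminus] sum.cong) (auto simp: power_diff field_simps)
    finally have one: "1 = - (\<Sum>i<d. of_int (coeff q i) * inverse x ^ (d - i))" .
    have "inverse x ^ (d - i) \<in> P" if "i < d" for i
    proof -
      have "inverse x ^ (d - i) = inverse x ^ (d - i - 1) * inverse x" using that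
        by (metis Suc_diff_Suc diff_Suc_eq_diff_pred diff_commute power_Suc2 Suc_pred' zero_less_diff)
      thus ?thesis using yP PR by (auto intro!: P_mult R_power)
    qed
    hence "1 \<in> P" by (subst one) (intro P_minus P_sum P_mult R_of_int, auto)
    thus False using P1 by simp
  qed
  have "place R P p"
    by unfold_locales (use p ai pR R(2) in \<open>auto simp: P_def pc_def\<close>)
  thus ?thesis by (rule that)
qed

section \<open>The Frobenius map at a place\<close>

context place
begin

lemma of_int_P: "of_int z \<in> P \<longleftrightarrow> int p dvd z"
proof
  assume "int p dvd z"
  thus "of_int z \<in> P" using P_mult'[OF pP R_of_int] by (auto elim!: dvdE)
next
  assume z: "of_int z \<in> P"
  show "int p dvd z"
  proof (rule ccontr)
    assume "\<not> int p dvd z"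
    hence "coprime (int p) z" using p by (simp add: prime_imp_coprime)
    then obtain u v where "u * int p + v * z = 1" by (metis bezout_int coprime_imp_gcd_eq_1)
    hence "(1::complex) = of_int u * of_nat p + of_int v * of_int z"
      by (metis of_int_1 of_int_add of_int_mult of_int_of_nat_eq)
    also have "\<dots> \<in> P" using z pP by (intro P_add P_mult R_of_int)
    finally show False using P1 by simp
  qed
qed

lemma of_int_cg: "of_int a \<equiv>\<^sub>P of_int b \<longleftrightarrow> int p dvd (a - b)"
  using of_int_P[of "a - b"] by simp

lemma frob_add:
  assumes "x \<in> R" "y \<in> R" shows "(x + y) ^ p \<equiv>\<^sub>P x ^ p + y ^ p"
proof -
  have p1: "p > 1" using p by (simp add: prime_nat_iff)
  have "(x + y) ^ p = (\<Sum>k\<le>p. of_nat (p choose k) * x ^ k * y ^ (p - k))" by (rule binomial_ring)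
  also have "{..p} = insert 0 (insert p {1..<p})" using p1 by auto
  finally have "(x + y) ^ p - (x ^ p + y ^ p) = (\<Sum>k=1..<p. of_nat (p choose k) * x ^ k * y ^ (p - k))"
    using p1 by simp
  also have "\<dots> \<in> P"
  proof (rule P_sum)
    fix k assume k: "k \<in> {1..<p}"
    hence "p dvd (p choose k)" using p by (intro dvd_choose_prime) auto
    hence "of_int (int (p choose k)) \<in> P" by (simp only: of_int_P int_dvd_int_iff)
    thus "of_nat (p choose k) * x ^ k * y ^ (p - k) \<in> P" using assms by (auto intro!: P_mult' R_power)
  qed
  finally show ?thesis .
qed

lemma frob_sum:
  assumes "finite I" "\<And>i. i \<in> I \<Longrightarrow> f i \<in> R" shows "(\<Sum>i\<in>I. f i) ^ p \<equiv>\<^sub>P (\<Sum>i\<in>I. f i ^ p)"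
  using assms
proof (induction I rule: finite_induct)
  case empty
  have "p > 0" using p prime_gt_0_nat by auto
  thus ?case by (simp add: P0 power_0_left)
next
  case (insert a I)
  have "(f a + sum f I) ^ p \<equiv>\<^sub>P f a ^ p + sum f I ^ p" using insert by (intro frob_add R_sum) auto
  moreover have "f a ^ p + sum f I ^ p \<equiv>\<^sub>P f a ^ p + (\<Sum>i\<in>I. f i ^ p)" using insert by (intro cg_add cg_refl) auto
  ultimately show ?case using insert cg_trans by auto
qed

lemma fermat: "of_int z ^ p \<equiv>\<^sub>P of_int z"
proof -
  have n: "of_nat k ^ p \<equiv>\<^sub>P of_nat k" for k
  proof (induction k)
    case 0
    have "p > 0" using p prime_gt_0_nat by auto
    thus ?case by (simp add: P0 power_0_left)
  next
    case (Suc k)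
    have "(of_nat k + 1) ^ p \<equiv>\<^sub>P of_nat k ^ p + 1 ^ p" by (intro frob_add R_of_nat R1)
    moreover have "of_nat k ^ p + 1 ^ p \<equiv>\<^sub>P of_nat k + 1" using Suc by (simp)
    ultimately show ?case using cg_trans by (simp add: add.commute)
  qed
  define k where "k = nat (z mod int p)"
  have p0: "int p > 0" using p prime_gt_0_nat by simp
  have k: "int k = z mod int p" using p0 by (simp add: k_def)
  have "int p dvd z - int k" unfolding k by (metis minus_mod_eq_mult_div dvd_triv_left)
  hence zk: "of_int z \<equiv>\<^sub>P of_nat k" using of_int_cg[of z "int k"] by simp
  have "of_int z ^ p \<equiv>\<^sub>P of_nat k ^ p" by (intro cg_power zk R_of_int R_of_nat)
  thus ?thesis using n[of k] cg_trans cg_sym[OF zk] by blast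
qed

text \<open>A rational number in \<open>R\<close> has denominator \<open>b\<close> prime to
  \<open>p\<close>: otherwise Bezout puts 1/b into \<open>R\<close>, and 1 = p (b/p)(1/b) into
  \<open>P\<close>. Fermat for numerator and denominator gives the rest after cancelling
  \<open>b\<close>.\<close>

lemma frob_rat:
  assumes "x \<in> \<rat>" "x \<in> R" shows "x ^ p \<equiv>\<^sub>P x"
proof -
  obtain a b where ab: "b > 0" "coprime a b" "x = of_int a / of_int b" using assms(1) by (elim Rats_cases')
  have nb: "\<not> int p dvd b"
  proof
    assume "int p dvd b"
    then obtain c where c: "b = int p * c" by (elim dvdE)
    obtain u v where "u * a + v * b = 1" using ab(2) by (metis bezout_int coprime_imp_gcd_eq_1)
    hence "of_int u * of_int a + of_int v * of_int b = (1::complex)" by (metis of_int_1 of_int_add of_int_mult)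
    moreover have "of_int a = x * of_int b" using ab by simp
    ultimately have "(of_int u * x + of_int v) * of_int b = 1" by (simp add: algebra_simps)
    hence "of_int u * x + of_int v = 1 / of_int b" using ab(1) by (simp add: eq_divide_eq)
    hence "1 / of_int b \<in> R" using assms(2) by (metis R_add R_mult R_of_int)
    hence "of_nat p * (of_int c * (1 / of_int b)) \<in> P" using pP by (intro P_mult' R_mult R_of_int)
    moreover have "of_nat p * of_int c = (of_int b :: complex)" by (simp add: c)
    hence "of_nat p * (of_int c * (1 / of_int b)) = (1::complex)" using ab(1) by (metis divide_self_if mult.assoc mult.right_neutral of_int_eq_0_iff order_less_irrefl times_divide_eq_right)
    ultimately show False using P1 by simp
  qed
  have bx: "of_int b * x = of_int a" using ab by simp
  have "of_int b * x ^ p \<equiv>\<^sub>P of_int b ^ p * x ^ p"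
    by (intro cg_mult cg_refl R_of_int R_power assms cg_sym[OF fermat])
  moreover have "of_int b ^ p * x ^ p = of_int a ^ p" by (simp flip: bx add: power_mult_distrib)
  moreover have "of_int a ^ p \<equiv>\<^sub>P of_int b * x" unfolding bx by (rule fermat)
  ultimately have "of_int b * x ^ p \<equiv>\<^sub>P of_int b * x" using cg_trans by auto
  thus ?thesis by (rule cg_mult_cancel) (use nb of_int_P assms in \<open>auto intro: R_of_int R_power\<close>)
qed

text \<open>Otherwise \<open>x\<close> and the \<open>p\<close> residues of the integers would be p
  + 1 incongruent roots of X^p - X.\<close>

lemma frob_cg_int:
  assumes "x \<in> R" "x ^ p \<equiv>\<^sub>P x" shows "\<exists>a. 0 \<le> a \<and> a < int p \<and> x \<equiv>\<^sub>P of_int a"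
proof (rule ccontr)
  assume n: "\<not> ?thesis"
  let ?I = "(of_int :: int \<Rightarrow> complex) ` {0..<int p}"
  have inc: "of_int a \<equiv>\<^sub>P of_int b \<Longrightarrow> a \<in> {0..<int p} \<Longrightarrow> b \<in> {0..<int p} \<Longrightarrow> a = b" for a b
    unfolding of_int_cg using zdvd_imp_le[of "int p" "a - b"] zdvd_imp_le[of "int p" "b - a"]
    by (auto simp: dvd_diff_commute) (metis atLeastLessThan_iff mod_eq_dvd_iff mod_pos_pos_trivial)
  define f where "f = monom (1::complex) p - [:0, 1:]"
  have p1: "p > 1" using p by (simp add: prime_nat_iff)
  have cf: "coeff f i = (if i = p then 1 else if i = 1 then -1 else 0)" for i
    using p1 by (auto simp: f_def coeff_pCons split: nat.splits)
  have xI: "x \<notin> ?I" using n by (force simp: P0)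
  have c: "card ?I = p" by (simp add: card_image inj_on_def)
  have "coeff f p \<in> P"
  proof (rule root_bound[of _ "insert x ?I"])
    show "coeff f i \<in> R" for i using cf by (auto simp: R0 R1 R_minus)
    have "degree f \<le> p" by (intro degree_le) (use p1 in \<open>auto simp: cf\<close>)
    thus "degree f < card (insert x ?I)" using c xI by simp
    show "poly f t \<in> P" if "t \<in> insert x ?I" for t
      using that assms fermat by (auto simp: f_def poly_monom)
    show "s = t" if "s \<in> insert x ?I" "t \<in> insert x ?I" "s \<equiv>\<^sub>P t" for s t
      using that inc n cg_sym by auto
  qed (use assms R_of_int in auto)
  thus False using P1 by (simp add: cf)
qed

text \<open>For an integer \<open>t\<close> the orbit polynomial of \<open>theta N t a\<close> has
  rational coefficients in \<open>R\<close>, which Frobenius fixes modulo \<open>P\<close>. Hence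
  the \<open>p\<close>-th power of \<open>theta N t a\<close> is again a root modulo
  \<open>P\<close>, that is, congruent to a conjugate. Having this for more values of
  \<open>t\<close> than \<open>vector_of_theta\<close> asks for yields one automorphism for all
  coordinates. The bound \<open>big\<close> only ensures that the residues modulo \<open>p\<close>
  supply enough \<open>t\<close>.\<close>

lemma frobenius_exists:
  assumes a: "\<And>i. i < N \<Longrightarrow> algebraic_int (a i)" and fin: "finite Z"
    and Z: "\<And>\<sigma> i. \<sigma> \<in> autq \<Longrightarrow> i < N \<Longrightarrow> \<sigma> (a i) \<in> Z" and Zint: "\<And>z. z \<in> Z \<Longrightarrow> algebraic_int z"
    and big: "p > card Z ^ N * N"
  shows "\<exists>\<sigma>\<in>autq. \<forall>i<N. \<sigma> (a i) \<equiv>\<^sub>P a i ^ p"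
proof -
  let ?V = "orbit_vecs autq N a"
  have Vsub: "?V \<subseteq> {..<N} \<rightarrow>\<^sub>E Z" using Z by (auto simp: orbit_vecs_def PiE_def extensional_def)
  have finP: "finite ({..<N} \<rightarrow>\<^sub>E Z)" by (intro finite_PiE) (use fin in auto)
  have finV: "finite ?V" using Vsub finP finite_subset by blast
  have "card ?V \<le> card ({..<N} \<rightarrow>\<^sub>E Z)" by (rule card_mono[OF finP Vsub])
  hence cV: "card ?V \<le> card Z ^ N" by (simp add: card_PiE)
  have aq: "a i \<in> qbar" if "i < N" for i using a[OF that] by (auto simp: qbar_def)
  have aR: "a i \<in> R" if "i < N" for i using a[OF that] alg_int_R by auto
  have vR: "v i \<in> R" if "v \<in> ?V" "i < N" for v i using Vsub that Zint alg_int_R by (auto simp: PiE_iff)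
  have thR: "theta N t u \<in> R" if "\<And>i. i < N \<Longrightarrow> u i \<in> R" for t u
    unfolding theta_def using that by (intro R_sum R_mult R_power R_of_int) auto
  let ?w = "\<lambda>i. a i ^ p"
  have "\<exists>v\<in>?V. \<forall>i<N. ?w i \<equiv>\<^sub>P v i"
  proof (rule vector_of_theta[OF finV, of "{0..<int p}"])
    have "card ?V * N \<le> card Z ^ N * N" using mult_le_mono1[OF cV] .
    also have "\<dots> < card {0..<int p}" using big by simp
    finally show "card ?V * N < card {0..<int p}" .
    show "s = t" if "s \<in> {0..<int p}" "t \<in> {0..<int p}" "of_int s \<equiv>\<^sub>P of_int t" for s t
      using that unfolding of_int_cg by (metis atLeastLessThan_iff mod_eq_dvd_iff mod_pos_pos_trivial)
    fix t assume "t \<in> {0..<int p}"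
    define Q where "Q = (\<Prod>v\<in>?V. [:- theta N t v, 1:])"
    have rat: "coeff Q k \<in> \<rat>" for k
    proof (rule fixed_by_autq_imp_rat)
      show "coeff Q k \<in> qbar" unfolding Q_def
        by (rule orbit_poly_fixed(2)[OF _ _ aq finV]) (use autq_comp autq_id in auto)
      show "\<sigma> (coeff Q k) = coeff Q k" if "\<sigma> \<in> autq" for \<sigma> unfolding Q_def
        by (rule orbit_poly_fixed(1)[OF _ _ aq finV that]) (use autq_comp in auto)
    qed
    have QR: "coeff Q k \<in> R" for k unfolding Q_def
      by (rule coeff_prod_linear_in[OF finV]) (use thR vR R0 R1 R_diff R_mult in auto)
    have pQ: "poly Q x = (\<Prod>v\<in>?V. x - theta N t v)" for x by (simp add: Q_def poly_prod)
    let ?x = "theta N t a"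
    have xR: "?x \<in> R" using thR aR by simp
    have "restrict a {..<N} \<in> ?V" using autq_id unfolding orbit_vecs_def by (intro image_eqI[of _ _ id]) auto
    moreover have "theta N t (restrict a {..<N}) = ?x" by (simp add: theta_def)
    ultimately have "poly Q ?x = 0" unfolding pQ using finV by (intro prod_zero bexI[of _ "restrict a {..<N}"]) auto
    have "poly Q ?x ^ p \<equiv>\<^sub>P (\<Sum>i\<le>degree Q. (coeff Q i * ?x ^ i) ^ p)"
      unfolding poly_altdef using QR xR by (intro frob_sum R_mult R_power) auto
    moreover have "(\<Sum>i\<le>degree Q. (coeff Q i * ?x ^ i) ^ p) \<equiv>\<^sub>P poly Q (?x ^ p)"
      unfolding poly_altdef
    proof (rule cg_sum)
      fix i
      have "(?x ^ i) ^ p = (?x ^ p) ^ i" by (simp add: power_mult[symmetric] mult.commute)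
      thus "(coeff Q i * ?x ^ i) ^ p \<equiv>\<^sub>P coeff Q i * (?x ^ p) ^ i"
        unfolding power_mult_distrib
        using frob_rat[OF rat QR] QR xR by (auto intro!: cg_mult cg_refl R_power)
    qed
    ultimately have "poly Q ?x ^ p \<equiv>\<^sub>P poly Q (?x ^ p)" by (rule cg_trans)
    moreover have "p > 0" using p prime_gt_0_nat by auto
    hence "poly Q ?x ^ p \<in> P" using \<open>poly Q ?x = 0\<close> by (simp add: P0 power_0_left)
    ultimately have Qp: "poly Q (?x ^ p) \<in> P" using cg_P by blast
    have "?x ^ p \<equiv>\<^sub>P (\<Sum>i<N. (of_int t ^ i * a i) ^ p)" unfolding theta_def
      using aR by (intro frob_sum R_mult R_power R_of_int) auto
    moreover have "(\<Sum>i<N. (of_int t ^ i * a i) ^ p) \<equiv>\<^sub>P theta N t ?w" unfolding theta_def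
    proof (rule cg_sum)
      fix i assume "i \<in> {..<N}"
      have "(of_int t ^ i) ^ p \<equiv>\<^sub>P of_int t ^ i" using fermat[of "t ^ i"] by simp
      thus "(of_int t ^ i * a i) ^ p \<equiv>\<^sub>P of_int t ^ i * a i ^ p"
        unfolding power_mult_distrib using aR \<open>i \<in> {..<N}\<close> by (intro cg_mult cg_refl R_power R_of_int) auto
    qed
    ultimately have xw: "?x ^ p \<equiv>\<^sub>P theta N t ?w" by (rule cg_trans)
    have wR: "theta N t ?w \<in> R" using thR aR R_power by simp
    have "poly Q (?x ^ p) \<equiv>\<^sub>P (\<Prod>v\<in>?V. theta N t ?w - theta N t v)"
      unfolding pQ using xR wR thR vR by (intro cg_prod cg_diff xw cg_refl R_diff R_power) auto
    thus "(\<Prod>v\<in>?V. theta N t ?w - theta N t v) \<in> P" using Qp cg_P by blast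
  qed (use vR aR R_power in auto)
  then obtain \<sigma> where \<sigma>: "\<sigma> \<in> autq" "\<forall>i<N. ?w i \<equiv>\<^sub>P restrict (\<lambda>i. \<sigma> (a i)) {..<N} i"
    unfolding orbit_vecs_def by blast
  hence "\<forall>i<N. \<sigma> (a i) \<equiv>\<^sub>P a i ^ p" using cg_sym by auto
  thus ?thesis using \<sigma>(1) by blast
qed

end

section \<open>Permutation groups\<close>

abbreviation tr :: "'a \<Rightarrow> 'a \<Rightarrow> 'a \<Rightarrow> 'a" where "tr \<equiv> Transposition.transpose"

lemma conj_tr:
  assumes "bij g" shows "g \<circ> tr a b \<circ> inv' g = tr (g a) (g b)"
proof
  fix x
  obtain y where y: "x = g y" using assms by (meson bij_pointE)
  have "inv' g x = y" using assms y by (simp add: bij_is_inj)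
  thus "(g \<circ> tr a b \<circ> inv' g) x = tr (g a) (g b) x"
    using assms y by (auto simp: Transposition.transpose_def bij_is_inj inj_eq)
qed

lemma symmetric_if_2transitive:
  assumes S: "finite S" and comp: "\<And>g h. g \<in> G \<Longrightarrow> h \<in> G \<Longrightarrow> g \<circ> h \<in> G"
    and perm: "\<And>g. g \<in> G \<Longrightarrow> g permutes S" and inv: "\<And>g. g \<in> G \<Longrightarrow> inv' g \<in> G"
    and id: "id \<in> G" and t: "tr a b \<in> G"
    and two: "\<And>x y. x \<in> S \<Longrightarrow> y \<in> S \<Longrightarrow> x \<noteq> y \<Longrightarrow> \<exists>g\<in>G. g a = x \<and> g b = y"
    and p: "p permutes S"
  shows "p \<in> G"
proof -
  have tr: "tr x y \<in> G" if xy: "x \<in> S" "y \<in> S" for x y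
  proof (cases "x = y")
    case True thus ?thesis using id by (simp add: id_def)
  next
    case False
    obtain g where g: "g \<in> G" "g a = x" "g b = y" using two[OF xy False] by blast
    have "g \<circ> tr a b \<circ> inv' g \<in> G" using g t by (intro comp inv)
    thus ?thesis using conj_tr[of g a b] perm[OF g(1)] g by (simp add: permutes_bij)
  qed
  show ?thesis using p S
    by (induction rule: permutes_induct) (use id comp tr in blast)+
qed

lemma permutes_triple:
  assumes "x \<in> S" "y \<in> S" "z \<in> S" "a \<in> S" "b \<in> S" "c \<in> S"
    and "x \<noteq> y" "x \<noteq> z" "y \<noteq> z" "a \<noteq> b" "a \<noteq> c" "b \<noteq> c"
  obtains g where "g permutes S" "g x = a" "g y = b" "g z = c"
proof -
  let ?g1 = "tr x a"
  let ?y = "?g1 y"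
  let ?g2 = "tr ?y b"
  let ?z = "?g2 (?g1 z)"
  let ?g3 = "tr ?z c"
  have p1: "?g1 permutes S" using assms by (intro permutes_swap_id)
  have yS: "?y \<in> S" using permutes_in_image[OF p1] assms by simp
  have p2: "?g2 permutes S" using yS assms by (intro permutes_swap_id)
  have "?z \<in> S" using permutes_in_image[OF p1] permutes_in_image[OF p2] assms by simp
  hence p3: "?g3 permutes S" using assms by (intro permutes_swap_id)
  have ya: "?y \<noteq> a" using assms by (auto simp: Transposition.transpose_def)
  have za: "?g1 z \<noteq> a" "?g1 z \<noteq> ?y" using assms by (auto simp: Transposition.transpose_def)
  have zab: "?z \<noteq> a" "?z \<noteq> b" using ya za assms by (auto simp: Transposition.transpose_def split: if_splits)
  show ?thesis
  proof (rule that[of "?g3 \<circ> ?g2 \<circ> ?g1"])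
    show "?g3 \<circ> ?g2 \<circ> ?g1 permutes S" using p1 p2 p3 by (intro permutes_compose)
    have "?g2 a = a" using ya assms by (simp add: Transposition.transpose_def)
    thus "(?g3 \<circ> ?g2 \<circ> ?g1) x = a" using zab assms by (simp add: Transposition.transpose_def)
    show "(?g3 \<circ> ?g2 \<circ> ?g1) y = b" using zab assms by (simp add: Transposition.transpose_def)
    show "(?g3 \<circ> ?g2 \<circ> ?g1) z = c" by simp
  qed
qed

text \<open>Let \<open>p\<close> move \<open>x\<close> and choose \<open>z\<close> different from
  \<open>x\<close> and \<open>p x\<close>. The commutator of \<open>p\<close> with the transposition
  of \<open>x\<close> and \<open>z\<close> lies in \<open>N\<close> and is a product of two
  transpositions. If these meet, it is a 3-cycle. If they are disjoint, a fifth point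
  \<open>e\<close> gives a conjugate that shares one of them, and combining both leaves a 3-cycle.
  Conjugation in the symmetric group then reaches every 3-cycle.\<close>

lemma normal_contains_3cycles:
  fixes N :: "('a \<Rightarrow> 'a) set"
  assumes S: "finite S" "card S \<ge> 5" and perm: "\<And>g. g \<in> N \<Longrightarrow> g permutes S"
    and comp: "\<And>g h. g \<in> N \<Longrightarrow> h \<in> N \<Longrightarrow> g \<circ> h \<in> N" and inv: "\<And>g. g \<in> N \<Longrightarrow> inv' g \<in> N"
    and conj: "\<And>g h. g \<in> N \<Longrightarrow> h permutes S \<Longrightarrow> h \<circ> g \<circ> inv' h \<in> N"
    and p: "p \<in> N" "p \<noteq> id"
    and abc: "a \<in> S" "b \<in> S" "c \<in> S" "a \<noteq> b" "a \<noteq> c" "b \<noteq> c"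
  shows "tr a b \<circ> tr b c \<in> N"
proof -
  have dt: "\<exists>w\<in>S. w \<notin> A" if "finite A" "card A \<le> 4" for A :: "'a set"
  proof (rule ccontr)
    assume "\<not> ?thesis"
    hence "S \<subseteq> A" by blast
    hence "card S \<le> card A" using that(1) by (intro card_mono)
    thus False using S that by simp
  qed
  have "\<exists>x y z. x \<in> S \<and> y \<in> S \<and> z \<in> S \<and> x \<noteq> y \<and> x \<noteq> z \<and> y \<noteq> z \<and> tr x y \<circ> tr y z \<in> N"
  proof -
    obtain x where x: "p x \<noteq> x" using p(2) by (auto simp: fun_eq_iff)
    let ?y = "p x"
    have pp: "p permutes S" using perm p by simp
    have xS: "x \<in> S" using x pp by (meson permutes_not_in)
    have yS: "?y \<in> S" using xS pp by (simp add: permutes_in_image)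
    have "card {x, ?y} \<le> 4" by (simp add: card_insert_if)
    then obtain z where z: "z \<in> S" "z \<notin> {x, ?y}" using dt[of "{x, ?y}"] by auto
    let ?d = "p z"
    have dS: "?d \<in> S" using z pp by (simp add: permutes_in_image)
    have dy: "?d \<noteq> ?y" using z permutes_inj[OF pp] by (auto dest: injD)
    have tN: "tr ?y ?d \<circ> tr x z \<in> N"
    proof -
      let ?t = "tr x z"
      have tp: "?t permutes S" using xS z by (intro permutes_swap_id)
      have it: "inv' ?t = ?t" by simp
      have "p \<circ> (?t \<circ> inv' p \<circ> inv' ?t) \<in> N" using p tp by (intro comp conj inv)
      also have "p \<circ> (?t \<circ> inv' p \<circ> inv' ?t) = (p \<circ> ?t \<circ> inv' p) \<circ> ?t" unfolding it by (simp add: o_assoc)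
      also have "p \<circ> ?t \<circ> inv' p = tr ?y ?d" using conj_tr[OF permutes_bij[OF pp]] .
      finally show ?thesis .
    qed
    consider "?d = x" | "?d = z" | "?d \<noteq> x" "?d \<noteq> z" by blast
    thus ?thesis
    proof cases
      case 1
      have "tr ?y x \<circ> tr x z \<in> N" using tN 1 by simp
      thus ?thesis using x z xS yS by (intro exI[of _ ?y] exI[of _ x] exI[of _ z]) auto
    next
      case 2
      have "tr ?y z \<circ> tr z x \<in> N" using tN 2 by (simp add: transpose_commute)
      thus ?thesis using x z xS yS by (intro exI[of _ ?y] exI[of _ z] exI[of _ x]) auto
    next
      case 3
      have "card {x, ?y, z, ?d} \<le> 4" by (simp add: card_insert_if)
      then obtain e where e: "e \<in> S" "e \<notin> {x, ?y, z, ?d}" using dt[of "{x, ?y, z, ?d}"] by auto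
      let ?h = "tr z e"
      have hp: "?h permutes S" using z e by (intro permutes_swap_id)
      have "?h \<circ> (tr ?y ?d \<circ> tr x z) \<circ> inv' ?h = (?h \<circ> tr ?y ?d \<circ> inv' ?h) \<circ> (?h \<circ> tr x z \<circ> inv' ?h)"
        by (simp add: fun_eq_iff)
      also have "\<dots> = tr (?h ?y) (?h ?d) \<circ> tr (?h x) (?h z)" unfolding conj_tr[OF permutes_bij[OF hp]] ..
      also have "?h ?y = ?y" using z e by (intro transpose_apply_other) auto
      also have "?h ?d = ?d" using 3 e by (intro transpose_apply_other) auto
      also have "?h x = x" using z e by (intro transpose_apply_other) auto
      also have "?h z = e" by simp
      finally have "tr ?y ?d \<circ> tr x e \<in> N" using conj[OF tN hp] by argo
      moreover have "inv' (tr ?y ?d \<circ> tr x z) \<in> N" by (rule inv[OF tN])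
      moreover have "inv' (tr ?y ?d \<circ> tr x z) = tr x z \<circ> tr ?y ?d" by (simp add: o_inv_distrib)
      ultimately have "tr x z \<circ> tr ?y ?d \<in> N" "tr ?y ?d \<circ> tr x e \<in> N" by argo+
      hence "(tr x z \<circ> tr ?y ?d) \<circ> (tr ?y ?d \<circ> tr x e) \<in> N" by (rule comp)
      moreover have "(tr x z \<circ> tr ?y ?d) \<circ> (tr ?y ?d \<circ> tr x e) = tr z x \<circ> tr x e"
        by (simp add: fun_eq_iff transpose_commute)
      ultimately have "tr z x \<circ> tr x e \<in> N" by argo
      thus ?thesis using z e xS by (intro exI[of _ z] exI[of _ x] exI[of _ e]) auto
    qed
  qed
  then obtain x y z where xyz: "x \<in> S" "y \<in> S" "z \<in> S" "x \<noteq> y" "x \<noteq> z" "y \<noteq> z" "tr x y \<circ> tr y z \<in> N" by blast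
  obtain g where g: "g permutes S" "g x = a" "g y = b" "g z = c"
    using permutes_triple[OF xyz(1-3) abc(1-3) xyz(4-6) abc(4-6)] by blast
  have "g \<circ> (tr x y \<circ> tr y z) \<circ> inv' g = (g \<circ> tr x y \<circ> inv' g) \<circ> (g \<circ> tr y z \<circ> inv' g)"
    using permutes_inverses[OF g(1)] by (simp add: fun_eq_iff)
  also have "\<dots> = tr a b \<circ> tr b c" using conj_tr[OF permutes_bij[OF g(1)]] g by simp
  finally show ?thesis using conj[OF xyz(7) g(1)] by argo
qed

text \<open>The commutator of two 3-cycles with exactly one common point is a 3-cycle. It serves to
  combine two triviality conditions: a commutator is trivial wherever one of its factors is.\<close>

lemma tr3_commutator:
  assumes "distinct [a, b, c, d, e]"
  shows "(tr a b \<circ> tr b d) \<circ> (tr a c \<circ> tr c e) \<circ> (tr b d \<circ> tr a b) \<circ> (tr c e \<circ> tr a c) = tr a b \<circ> tr b c"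
proof
  fix x
  have d: "a \<noteq> b" "a \<noteq> c" "a \<noteq> d" "a \<noteq> e" "b \<noteq> c" "b \<noteq> d" "b \<noteq> e" "c \<noteq> d" "c \<noteq> e" "d \<noteq> e"
    using assms by auto
  consider "x = a" | "x = b" | "x = c" | "x = d" | "x = e" | "x \<noteq> a" "x \<noteq> b" "x \<noteq> c" "x \<noteq> d" "x \<noteq> e" by blast
  thus "((tr a b \<circ> tr b d) \<circ> (tr a c \<circ> tr c e) \<circ> (tr b d \<circ> tr a b) \<circ> (tr c e \<circ> tr a c)) x = (tr a b \<circ> tr b c) x"
    by cases (simp_all add: Transposition.transpose_def d d[symmetric])
qed

section \<open>Galois action on finite sets of algebraic numbers\<close>

text \<open>For a \<open>gstable\<close> set this is the absolute Galois group of the field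
  generated by it, so equality of kernels is equality of splitting fields.\<close>

definition ker_of :: "complex set \<Rightarrow> (complex \<Rightarrow> complex) set" where
  "ker_of Z = {\<sigma>\<in>autq. \<forall>z\<in>Z. \<sigma> z = z}"

definition gstable :: "complex set \<Rightarrow> bool" where
  "gstable Z \<longleftrightarrow> finite Z \<and> Z \<subseteq> qbar \<and> (\<forall>\<sigma>\<in>autq. \<forall>z\<in>Z. \<sigma> z \<in> Z)"

lemma ker_ofD: "\<sigma> \<in> ker_of Z \<Longrightarrow> \<sigma> \<in> autq" "\<sigma> \<in> ker_of Z \<Longrightarrow> z \<in> Z \<Longrightarrow> \<sigma> z = z"
  by (auto simp: ker_of_def)

lemma ker_of_agree:
  assumes "ker_of Z \<subseteq> ker_of Z'" "\<sigma> \<in> autq" "\<tau> \<in> autq" "\<And>z. z \<in> Z \<Longrightarrow> \<sigma> z = \<tau> z" "z \<in> Z'"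
  shows "\<sigma> z = \<tau> z"
proof -
  have "inv' \<sigma> \<circ> \<tau> \<in> ker_of Z"
    using assms autq_comp autq_inv by (auto simp: ker_of_def autq_inv_apply[OF assms(2)] simp flip: assms(4))
  hence "inv' \<sigma> (\<tau> z) = z" using assms by (auto simp: ker_of_def)
  thus ?thesis by (metis assms(2) autq_inv_apply(1))
qed

lemma ker_of_normal:
  assumes "gstable Z" "\<sigma> \<in> ker_of Z" "\<tau> \<in> autq" shows "\<tau> \<circ> \<sigma> \<circ> inv' \<tau> \<in> ker_of Z"
proof -
  have "inv' \<tau> z \<in> Z" if "z \<in> Z" for z using assms that autq_inv by (auto simp: gstable_def)
  thus ?thesis using assms autq_comp autq_inv by (auto simp: ker_of_def autq_inv_apply)
qed

lemma ker_of_comp: "\<sigma> \<in> ker_of Z \<Longrightarrow> \<tau> \<in> ker_of Z \<Longrightarrow> \<sigma> \<circ> \<tau> \<in> ker_of Z"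
  using autq_comp by (auto simp: ker_of_def)

lemma ker_of_inv: "\<sigma> \<in> ker_of Z \<Longrightarrow> inv' \<sigma> \<in> ker_of Z"
  using autq_inv autq_inv_apply by (auto simp: ker_of_def) metis

definition acts :: "nat \<Rightarrow> (nat \<Rightarrow> complex) \<Rightarrow> (complex \<Rightarrow> complex) \<Rightarrow> (nat \<Rightarrow> nat) \<Rightarrow> bool" where
  "acts n e \<sigma> g \<longleftrightarrow> \<sigma> \<in> autq \<and> g permutes {1..n} \<and> (\<forall>k\<in>{1..n}. \<sigma> (e k) = e (g k))"

text \<open>The numbers enumerate a Galois-stable set on which the Galois group is the full
  symmetric group.\<close>

definition full_enum :: "nat \<Rightarrow> (nat \<Rightarrow> complex) \<Rightarrow> bool" where
  "full_enum n e \<longleftrightarrow> inj_on e {1..n} \<and> gstable (e ` {1..n}) \<and> (\<forall>g. g permutes {1..n} \<longrightarrow> (\<exists>\<sigma>. acts n e \<sigma> g))"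

lemma acts_id: "acts n e id id" by (simp add: acts_def autq_id permutes_id)

lemma acts_comp: "acts n e \<sigma> g \<Longrightarrow> acts n e \<tau> h \<Longrightarrow> acts n e (\<sigma> \<circ> \<tau>) (g \<circ> h)"
  using permutes_in_image[of h "{1..n}"] by (auto simp: acts_def autq_comp permutes_compose)

lemma acts_inv: assumes "acts n e \<sigma> g" shows "acts n e (inv' \<sigma>) (inv' g)"
proof -
  have g: "g permutes {1..n}" and \<sigma>: "\<sigma> \<in> autq" using assms by (auto simp: acts_def)
  have "inv' \<sigma> (e k) = e (inv' g k)" if "k \<in> {1..n}" for k
  proof -
    have "inv' g k \<in> {1..n}" using that permutes_in_image[OF permutes_inv[OF g]] by simp
    hence "\<sigma> (e (inv' g k)) = e k" using assms permutes_inverses[OF g] by (auto simp: acts_def)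
    thus ?thesis by (metis autq_inv_apply(2)[OF \<sigma>])
  qed
  thus ?thesis using autq_inv[OF \<sigma>] permutes_inv[OF g] by (simp add: acts_def)
qed

lemma acts_unique:
  assumes "inj_on e {1..n}" "acts n e \<sigma> g" "acts n e \<sigma> h" shows "g = h"
proof
  fix k show "g k = h k"
  proof (cases "k \<in> {1..n}")
    case True
    hence "e (g k) = e (h k)" using assms by (auto simp: acts_def)
    moreover have "g k \<in> {1..n}" "h k \<in> {1..n}"
      using True assms permutes_in_image[of g "{1..n}" k] permutes_in_image[of h "{1..n}" k] unfolding acts_def by blast+
    ultimately show ?thesis using assms(1) by (auto dest: inj_onD)
  next
    case False
    thus ?thesis using assms permutes_not_in[of _ "{1..n}" k] unfolding acts_def by metis
  qed
qed

lemma acts_exists: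
  assumes "inj_on e {1..n}" "gstable (e ` {1..n})" "\<sigma> \<in> autq" obtains g where "acts n e \<sigma> g"
proof -
  define g where "g k = (if k \<in> {1..n} then inv_into {1..n} e (\<sigma> (e k)) else k)" for k
  have im: "\<sigma> (e k) \<in> e ` {1..n}" if "k \<in> {1..n}" for k using assms that by (auto simp: gstable_def)
  have eg: "e (g k) = \<sigma> (e k)" "g k \<in> {1..n}" if "k \<in> {1..n}" for k
    using im[OF that] that by (auto simp: g_def f_inv_into_f inv_into_into simp del: atLeastAtMost_iff)
  have "g permutes {1..n}"
  proof (rule inj_imp_permutes)
    show "inj_on g {1..n}"
    proof (rule inj_onI)
      fix k l assume kl: "k \<in> {1..n}" "l \<in> {1..n}" "g k = g l"
      hence "\<sigma> (e k) = \<sigma> (e l)" using eg by metis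
      thus "k = l" using kl assms autq_inj[OF assms(3)] by (auto dest: inj_onD)
    qed
  qed (use eg in \<open>auto simp: g_def\<close>)
  thus ?thesis using that[of g] eg assms(3) unfolding acts_def by simp
qed

lemma acts_id_iff:
  assumes "inj_on e {1..n}" shows "acts n e \<sigma> id \<longleftrightarrow> \<sigma> \<in> ker_of (e ` {1..n})"
  by (auto simp: acts_def ker_of_def permutes_id)

lemma acts_ker_eq:
  assumes "acts n e \<sigma> g" "acts n e \<tau> g" "ker_of (e ` {1..n}) \<subseteq> ker_of W" "w \<in> W"
  shows "\<sigma> w = \<tau> w"
  by (rule ker_of_agree[OF assms(3)]) (use assms in \<open>auto simp: acts_def\<close>)

text \<open>The inclusion of kernels makes the action on \<open>f\<close> a function \<phi> of the
  action on \<open>e\<close>. It maps the permutations of {1..n} onto themselves, so it is injective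
  by finiteness, which is the reverse inclusion.\<close>

lemma ker_of_subset_imp_eq:
  assumes e: "full_enum n e" and f: "full_enum n f"
    and sub: "ker_of (e ` {1..n}) \<subseteq> ker_of (f ` {1..n})"
  shows "ker_of (e ` {1..n}) = ker_of (f ` {1..n})"
proof -
  let ?P = "{g. g permutes {1..n}}"
  have ie: "inj_on e {1..n}" and jf: "inj_on f {1..n}" using e f by (auto simp: full_enum_def)
  define s where "s g = (SOME \<sigma>. acts n e \<sigma> g)" for g
  have s: "acts n e (s g) g" if "g \<in> ?P" for g
  proof -
    have "\<exists>\<sigma>. acts n e \<sigma> g" using e that unfolding full_enum_def by blast
    thus ?thesis unfolding s_def by (rule someI_ex)
  qed
  define \<phi> where "\<phi> g = (SOME h. acts n f (s g) h)" for g
  have \<phi>: "acts n f (s g) (\<phi> g)" if "g \<in> ?P" for g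
  proof -
    have "s g \<in> autq" using s[OF that] by (simp add: acts_def)
    then obtain h where "acts n f (s g) h" using acts_exists[OF jf, of "s g"] f unfolding full_enum_def by blast
    thus ?thesis unfolding \<phi>_def using someI[of "acts n f (s g)" h] by simp
  qed
  have key: "\<phi> g = h" if "acts n e \<sigma> g" "acts n f \<sigma> h" for \<sigma> g h
  proof -
    have g: "g \<in> ?P" using that by (simp add: acts_def)
    have "s g w = \<sigma> w" if "w \<in> f ` {1..n}" for w
      by (rule acts_ker_eq[OF s[OF g] \<open>acts n e \<sigma> g\<close> sub that])
    hence "acts n f (s g) h" using that s[OF g] by (auto simp: acts_def)
    thus ?thesis using acts_unique[OF jf \<phi>[OF g]] by blast
  qed
  have surj: "\<phi> ` ?P = ?P"
  proof
    show "\<phi> ` ?P \<subseteq> ?P" using \<phi> by (auto simp: acts_def)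
    show "?P \<subseteq> \<phi> ` ?P"
    proof
      fix h assume "h \<in> ?P"
      then obtain \<sigma> where \<sigma>: "acts n f \<sigma> h" using f by (auto simp: full_enum_def)
      obtain g where g: "acts n e \<sigma> g" using acts_exists[OF ie, of \<sigma>] e \<sigma> unfolding acts_def full_enum_def by blast
      have "g \<in> ?P" using g by (simp add: acts_def)
      thus "h \<in> \<phi> ` ?P" using key[OF g \<sigma>] by blast
    qed
  qed
  have fin: "finite ?P" by (simp add: finite_permutations)
  have inj: "inj_on \<phi> ?P" using surj fin by (intro eq_card_imp_inj_on) auto
  have "ker_of (f ` {1..n}) \<subseteq> ker_of (e ` {1..n})"
  proof
    fix \<sigma> assume \<sigma>: "\<sigma> \<in> ker_of (f ` {1..n})"
    obtain g where g: "acts n e \<sigma> g" using acts_exists[OF ie, of \<sigma>] e ker_ofD(1)[OF \<sigma>] unfolding full_enum_def by blast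
    have "\<phi> g = id" using key[OF g] \<sigma> acts_id_iff[OF jf] by blast
    moreover have "\<phi> id = id" using key[OF acts_id acts_id] .
    ultimately have "g = id" using inj g by (auto simp: inj_on_def acts_def permutes_id)
    thus "\<sigma> \<in> ker_of (e ` {1..n})" using g acts_id_iff[OF ie] by simp
  qed
  thus ?thesis using sub by blast
qed

text \<open>Induction over the other fields. The actions on \<open>e\<close> of elements that are
  trivial on the new field \<open>f\<close> form a normal subgroup, nontrivial because the kernels
  differ, so it contains all 3-cycles. A commutator of an element that is trivial on the old fields
  with one that is trivial on \<open>f\<close> is trivial on all of them, and
  \<open>tr3_commutator\<close> makes it the wanted 3-cycle.\<close>

lemma tr3_realised:
  assumes n: "n \<ge> 5" and e: "full_enum n e" and "finite \<F>"
    and \<F>: "\<And>f. f \<in> \<F> \<Longrightarrow> full_enum n f \<and> ker_of (f ` {1..n}) \<noteq> ker_of (e ` {1..n})"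
    and abc: "a \<in> {1..n}" "b \<in> {1..n}" "c \<in> {1..n}" "a \<noteq> b" "a \<noteq> c" "b \<noteq> c"
  shows "\<exists>\<sigma>. acts n e \<sigma> (tr a b \<circ> tr b c) \<and> (\<forall>f\<in>\<F>. \<sigma> \<in> ker_of (f ` {1..n}))"
  using assms(3) \<F> abc
proof (induction \<F> arbitrary: a b c rule: finite_induct)
  case empty
  have "tr a b \<circ> tr b c permutes {1..n}" using empty by (intro permutes_compose permutes_swap_id)
  thus ?case using e unfolding full_enum_def by blast
next
  case (insert f \<F>)
  have ie: "inj_on e {1..n}" using e by (auto simp: full_enum_def)
  have f: "full_enum n f" "ker_of (f ` {1..n}) \<noteq> ker_of (e ` {1..n})" using insert by auto
  have stf: "gstable (f ` {1..n})" using f by (simp add: full_enum_def)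
  define N where "N = {g. \<exists>\<sigma>\<in>ker_of (f ` {1..n}). acts n e \<sigma> g}"
  have "\<not> ker_of (f ` {1..n}) \<subseteq> ker_of (e ` {1..n})" using ker_of_subset_imp_eq[OF f(1) e] f(2) by blast
  then obtain \<sigma>0 where \<sigma>0: "\<sigma>0 \<in> ker_of (f ` {1..n})" "\<sigma>0 \<notin> ker_of (e ` {1..n})" by blast
  obtain g0 where g0: "acts n e \<sigma>0 g0" using acts_exists[OF ie, of \<sigma>0] e ker_ofD(1)[OF \<sigma>0(1)] unfolding full_enum_def by blast
  have g0id: "g0 \<noteq> id" using g0 \<sigma>0 acts_id_iff[OF ie] by auto
  have Nt: "tr x y \<circ> tr y z \<in> N" if "x \<in> {1..n}" "y \<in> {1..n}" "z \<in> {1..n}" "x \<noteq> y" "x \<noteq> z" "y \<noteq> z" for x y z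
  proof (rule normal_contains_3cycles[of "{1..n}" N g0])
    show "g permutes {1..n}" if "g \<in> N" for g using that by (auto simp: N_def acts_def)
    show "g \<circ> h \<in> N" if gh: "g \<in> N" "h \<in> N" for g h
    proof -
      obtain \<sigma> \<tau> where "\<sigma> \<in> ker_of (f ` {1..n})" "\<tau> \<in> ker_of (f ` {1..n})" "acts n e \<sigma> g" "acts n e \<tau> h"
        using gh unfolding N_def by blast
      thus ?thesis unfolding N_def using acts_comp ker_of_comp by blast
    qed
    show "inv' g \<in> N" if "g \<in> N" for g
      using that acts_inv ker_of_inv unfolding N_def by blast
    show "h \<circ> g \<circ> inv' h \<in> N" if gh: "g \<in> N" "h permutes {1..n}" for g h
    proof -
      obtain \<sigma> where \<sigma>: "\<sigma> \<in> ker_of (f ` {1..n})" "acts n e \<sigma> g" using gh unfolding N_def by blast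
      obtain \<tau> where \<tau>: "acts n e \<tau> h" using e gh by (auto simp: full_enum_def)
      have "acts n e (\<tau> \<circ> \<sigma> \<circ> inv' \<tau>) (h \<circ> g \<circ> inv' h)" using \<sigma> \<tau> by (intro acts_comp acts_inv)
      moreover have "\<tau> \<circ> \<sigma> \<circ> inv' \<tau> \<in> ker_of (f ` {1..n})" using ker_of_normal[OF stf \<sigma>(1)] \<tau> by (simp add: acts_def)
      ultimately show ?thesis unfolding N_def by blast
    qed
    show "g0 \<in> N" using g0 \<sigma>0 unfolding N_def by blast
  qed (use n g0id that in auto)
  have "card ({1..n} - {a,b,c}) \<ge> 2"
    using n card_Diff_subset[of "{a,b,c}" "{1..n}"] insert.prems by (simp add: card_insert_if)
  then obtain d d' where d: "d \<in> {1..n} - {a,b,c}" "d' \<in> {1..n} - {a,b,c}" "d \<noteq> d'"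
  proof -
    have "\<not> card ({1..n} - {a,b,c}) \<le> Suc 0" using \<open>card ({1..n} - {a,b,c}) \<ge> 2\<close> by linarith
    hence "\<not> (\<forall>x\<in>{1..n} - {a,b,c}. \<forall>y\<in>{1..n} - {a,b,c}. x = y)"
      using card_le_Suc0_iff_eq[of "{1..n} - {a,b,c}"] by blast
    thus ?thesis using that by blast
  qed
  \<comment> \<open>Two different points outside \<open>a\<close>, \<open>b\<close>,
    \<open>c\<close> make the 3-cycles of \<sigma> and \<tau> meet in \<open>a\<close> only; this
    uses \<open>n \<ge> 5\<close>.\<close>
  obtain \<sigma> where \<sigma>: "acts n e \<sigma> (tr a b \<circ> tr b d)" "\<forall>f\<in>\<F>. \<sigma> \<in> ker_of (f ` {1..n})"
  proof -
    have "\<exists>\<sigma>. acts n e \<sigma> (tr a b \<circ> tr b d) \<and> (\<forall>f\<in>\<F>. \<sigma> \<in> ker_of (f ` {1..n}))"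
      by (rule insert.IH) (use insert.prems d in auto)
    thus ?thesis using that by blast
  qed
  obtain \<tau> where \<tau>: "acts n e \<tau> (tr a c \<circ> tr c d')" "\<tau> \<in> ker_of (f ` {1..n})"
  proof -
    have "tr a c \<circ> tr c d' \<in> N" by (rule Nt) (use insert.prems d in auto)
    thus ?thesis using that unfolding N_def by blast
  qed
  let ?\<rho> = "\<sigma> \<circ> \<tau> \<circ> inv' \<sigma> \<circ> inv' \<tau>"
  have sa: "\<sigma> \<in> autq" "\<tau> \<in> autq" using \<sigma> \<tau> by (auto simp: acts_def)
  have "acts n e ?\<rho> ((tr a b \<circ> tr b d) \<circ> (tr a c \<circ> tr c d') \<circ> inv' (tr a b \<circ> tr b d) \<circ> inv' (tr a c \<circ> tr c d'))"
    using \<sigma> \<tau> by (intro acts_comp acts_inv)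
  also have "inv' (tr a b \<circ> tr b d) = tr b d \<circ> tr a b" by (simp add: o_inv_distrib)
  also have "inv' (tr a c \<circ> tr c d') = tr c d' \<circ> tr a c" by (simp add: o_inv_distrib)
  also have "(tr a b \<circ> tr b d) \<circ> (tr a c \<circ> tr c d') \<circ> (tr b d \<circ> tr a b) \<circ> (tr c d' \<circ> tr a c) = tr a b \<circ> tr b c"
    by (rule tr3_commutator) (use d insert.prems in auto)
  finally have "acts n e ?\<rho> (tr a b \<circ> tr b c)" .
  moreover have "?\<rho> \<in> ker_of (f ` {1..n})"
    using ker_of_comp[OF ker_of_normal[OF stf \<tau>(2) sa(1)] ker_of_inv[OF \<tau>(2)]] by simp
  moreover have "?\<rho> \<in> ker_of (f' ` {1..n})" if "f' \<in> \<F>" for f'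
  proof -
    have st: "gstable (f' ` {1..n})" using insert.prems that by (simp add: full_enum_def)
    have "\<tau> \<circ> inv' \<sigma> \<circ> inv' \<tau> \<in> ker_of (f' ` {1..n})"
      using ker_of_normal[OF st ker_of_inv sa(2)] \<sigma>(2) that by blast
    thus ?thesis using ker_of_comp[of \<sigma> "f' ` {1..n}" "\<tau> \<circ> inv' \<sigma> \<circ> inv' \<tau>"] \<sigma>(2) that by (simp add: o_assoc)
  qed
  ultimately show ?case by blast
qed

lemma even_realised:
  assumes n: "n \<ge> 5" and e: "full_enum n e" and fin: "finite \<F>"
    and \<F>: "\<And>f. f \<in> \<F> \<Longrightarrow> full_enum n f \<and> ker_of (f ` {1..n}) \<noteq> ker_of (e ` {1..n})"
    and g: "g \<in> carrier (alt_group n)"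
  shows "\<exists>\<sigma>. acts n e \<sigma> g \<and> (\<forall>f\<in>\<F>. \<sigma> \<in> ker_of (f ` {1..n}))"
proof -
  have 3: "\<exists>\<sigma>. acts n e \<sigma> g \<and> (\<forall>f\<in>\<F>. \<sigma> \<in> ker_of (f ` {1..n}))" if "g \<in> three_cycles n" for g
  proof -
    obtain cs where cs: "g = cycle_of_list cs" "distinct cs" "length cs = 3" "set cs \<subseteq> {1..n}" using \<open>g \<in> three_cycles n\<close> by blast
    then obtain a b c where abc: "cs = [a,b,c]" using stupid_lemma by blast
    have "g = tr a b \<circ> tr b c" using cs abc by simp
    thus ?thesis using tr3_realised[OF n e fin \<F>, of a b c] cs abc by auto
  qed
  have "g \<in> generate (alt_group n) (three_cycles n)" using g alt_group_carrier_as_three_cycles by blast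
  thus ?thesis
  proof (induction rule: generate.induct)
    case one
    have "id \<in> ker_of Z" for Z by (simp add: ker_of_def autq_id)
    thus ?case unfolding alt_group_one using acts_id by blast
  next
    case (incl h) thus ?case by (rule 3)
  next
    case (inv h)
    have "h \<in> carrier (alt_group n)" using inv three_cycles_incl by blast
    hence "inv\<^bsub>alt_group n\<^esub> h = inv' h" by (rule alt_group_inv_equality)
    moreover obtain \<sigma> where "acts n e \<sigma> h" "\<forall>f\<in>\<F>. \<sigma> \<in> ker_of (f ` {1..n})" using 3[OF inv] by blast
    hence "acts n e (inv' \<sigma>) (inv' h)" "\<forall>f\<in>\<F>. inv' \<sigma> \<in> ker_of (f ` {1..n})" using acts_inv ker_of_inv by blast+
    ultimately show ?case by auto
  next
    case (eng h1 h2)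
    then obtain \<sigma> \<tau> where "acts n e \<sigma> h1" "\<forall>f\<in>\<F>. \<sigma> \<in> ker_of (f ` {1..n})"
      "acts n e \<tau> h2" "\<forall>f\<in>\<F>. \<tau> \<in> ker_of (f ` {1..n})" by blast
    thus ?case unfolding alt_group_mult using acts_comp ker_of_comp by blast
  qed
qed

section \<open>Prescribing Galois groups\<close>

lemma subfield_CD:
  assumes "subfield_C K"
  shows "0 \<in> K" "1 \<in> K" "x \<in> K \<Longrightarrow> y \<in> K \<Longrightarrow> x + y \<in> K" "x \<in> K \<Longrightarrow> y \<in> K \<Longrightarrow> x - y \<in> K"
    "x \<in> K \<Longrightarrow> y \<in> K \<Longrightarrow> x * y \<in> K" "x \<in> K \<Longrightarrow> inverse x \<in> K"
  using assms by (cases "x = 0"; auto simp: subfield_C_def)+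

lemma subfield_C_adjoin: "subfield_C (field_adjoin F S)"
  unfolding field_adjoin_def subfield_C_def by auto

lemma adjoin_superset: "F \<subseteq> field_adjoin F S" "S \<subseteq> field_adjoin F S"
  unfolding field_adjoin_def by auto

lemma adjoin_least: "subfield_C K \<Longrightarrow> F \<subseteq> K \<Longrightarrow> S \<subseteq> K \<Longrightarrow> field_adjoin F S \<subseteq> K"
  unfolding field_adjoin_def by auto

lemma subfield_C_qbar: "subfield_C qbar"
  unfolding subfield_C_def by auto

section \<open>The fixed field of prescribed actions and its Galois groups\<close>

locale galois_family =
  fixes n :: nat and I :: "'i set" and e :: "'i \<Rightarrow> nat \<Rightarrow> complex" and G :: "'i \<Rightarrow> (nat \<Rightarrow> nat) set"
  assumes n5: "n \<ge> 5" and full: "i \<in> I \<Longrightarrow> full_enum n (e i)"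
    and ker_inj: "i \<in> I \<Longrightarrow> j \<in> I \<Longrightarrow> ker_of (e i ` {1..n}) = ker_of (e j ` {1..n}) \<Longrightarrow> i = j"
    and subG: "i \<in> I \<Longrightarrow> subgroup (G i) (alt_group n)"
begin

definition Hs :: "'i \<Rightarrow> (complex \<Rightarrow> complex) set" where
  "Hs i = {\<sigma>. \<exists>g\<in>G i. acts n (e i) \<sigma> g}"

definition Dl :: "'i set \<Rightarrow> (complex \<Rightarrow> complex) set" where
  "Dl J = {\<sigma>\<in>autq. \<forall>j\<in>J. \<sigma> \<in> Hs j}"

text \<open>The union of the fixed fields of the groups \<open>Dl J\<close>, for finite \<open>J\<close>. The kernels being different, simplicity of
  the alternating group makes the conditions for different indices independent of each other.\<close>

definition FF :: "complex set" where
  "FF = {x\<in>qbar. \<exists>J. finite J \<and> J \<subseteq> I \<and> (\<forall>\<sigma>\<in>Dl J. \<sigma> x = x)}"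

lemma G_id: "i \<in> I \<Longrightarrow> id \<in> G i"
  using subgroup.one_closed[OF subG] by (simp add: alt_group_one)

lemma G_comp: "i \<in> I \<Longrightarrow> g \<in> G i \<Longrightarrow> h \<in> G i \<Longrightarrow> g \<circ> h \<in> G i"
  using subgroup.m_closed[OF subG, of i g h] unfolding alt_group_mult by blast

lemma G_alt: "i \<in> I \<Longrightarrow> g \<in> G i \<Longrightarrow> g \<in> carrier (alt_group n)"
  using subgroup.subset[OF subG] by auto

lemma G_inv: "i \<in> I \<Longrightarrow> g \<in> G i \<Longrightarrow> inv' g \<in> G i"
  using subgroup.m_inv_closed[OF subG, of i g] alt_group_inv_equality[OF G_alt] by simp

lemma Dl_mono: "J \<subseteq> J' \<Longrightarrow> Dl J' \<subseteq> Dl J" by (auto simp: Dl_def)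

lemma Dl_comp: assumes "J \<subseteq> I" "\<sigma> \<in> Dl J" "\<tau> \<in> Dl J" shows "\<sigma> \<circ> \<tau> \<in> Dl J"
proof -
  have "\<sigma> \<circ> \<tau> \<in> Hs j" if "j \<in> J" for j
  proof -
    obtain g where g: "g \<in> G j" "acts n (e j) \<sigma> g" using assms \<open>j \<in> J\<close> unfolding Dl_def Hs_def by blast
    obtain h where h: "h \<in> G j" "acts n (e j) \<tau> h" using assms \<open>j \<in> J\<close> unfolding Dl_def Hs_def by blast
    have "acts n (e j) (\<sigma> \<circ> \<tau>) (g \<circ> h)" by (rule acts_comp[OF g(2) h(2)])
    moreover have "j \<in> I" using assms \<open>j \<in> J\<close> by blast
    hence "g \<circ> h \<in> G j" using g(1) h(1) by (rule G_comp)
    ultimately show ?thesis unfolding Hs_def by blast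
  qed
  thus ?thesis using assms autq_comp unfolding Dl_def by blast
qed

text \<open>Membership in \<open>FF\<close> involves finite index sets only, so finitely many
  conditions have to be met at a time: act by \<open>g\<close> at \<open>i\<close> and trivially at
  the other members of \<open>J\<close>, the identity lying in every \<open>G j\<close>.\<close>

lemma realise:
  assumes J: "finite J" "J \<subseteq> I" and i: "i \<in> I" and g: "g \<in> G i"
  obtains \<sigma> where "\<sigma> \<in> Dl J" "acts n (e i) \<sigma> g"
proof -
  have "\<exists>\<sigma>. acts n (e i) \<sigma> g \<and> (\<forall>f\<in>e ` (J - {i}). \<sigma> \<in> ker_of (f ` {1..n}))"
  proof (rule even_realised[OF n5 full[OF i] _ _ G_alt[OF i g]])
    show "full_enum n f \<and> ker_of (f ` {1..n}) \<noteq> ker_of (e i ` {1..n})" if "f \<in> e ` (J - {i})" for f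
      using that J i full ker_inj by blast
  qed (use J in auto)
  then obtain \<sigma> where \<sigma>: "acts n (e i) \<sigma> g" "\<And>j. j \<in> J - {i} \<Longrightarrow> \<sigma> \<in> ker_of (e j ` {1..n})" by blast
  have "\<sigma> \<in> Hs j" if "j \<in> J" for j
  proof (cases "j = i")
    case True thus ?thesis using \<sigma> g unfolding Hs_def by blast
  next
    case False
    hence "acts n (e j) \<sigma> id" using \<sigma>(2)[of j] that acts_id_iff[of "e j" n \<sigma>] full[of j] J(2)
      unfolding full_enum_def by blast
    thus ?thesis unfolding Hs_def using G_id J that by blast
  qed
  hence "\<sigma> \<in> Dl J" using \<sigma>(1) by (auto simp: Dl_def acts_def)
  thus ?thesis using that \<sigma> by blast
qed

lemma FF_pair:
  assumes "x \<in> FF" "y \<in> FF"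
  shows "\<exists>J. finite J \<and> J \<subseteq> I \<and> (\<forall>\<sigma>\<in>Dl J. \<sigma> x = x) \<and> (\<forall>\<sigma>\<in>Dl J. \<sigma> y = y)"
proof -
  obtain J J' where J: "finite J" "J \<subseteq> I" "\<forall>\<sigma>\<in>Dl J. \<sigma> x = x" "finite J'" "J' \<subseteq> I" "\<forall>\<sigma>\<in>Dl J'. \<sigma> y = y"
    using assms unfolding FF_def by blast
  show ?thesis
    by (rule exI[of _ "J \<union> J'"]) (use J Dl_mono[of J "J \<union> J'"] Dl_mono[of J' "J \<union> J'"] in auto)
qed

lemma subfield_FF: "subfield_C FF"
  unfolding subfield_C_def
proof (intro conjI ballI impI)
  have "0 \<in> qbar \<and> (\<forall>\<sigma>\<in>Dl {}. \<sigma> 0 = 0)" "1 \<in> qbar \<and> (\<forall>\<sigma>\<in>Dl {}. \<sigma> 1 = 1)"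
    using autq_0 autq_1 by (auto simp: Dl_def)
  thus "0 \<in> FF" "1 \<in> FF" unfolding FF_def by blast+
next
  fix x y assume xy: "x \<in> FF" "y \<in> FF"
  obtain J where J: "finite J" "J \<subseteq> I" "\<And>\<sigma>. \<sigma> \<in> Dl J \<Longrightarrow> \<sigma> x = x" "\<And>\<sigma>. \<sigma> \<in> Dl J \<Longrightarrow> \<sigma> y = y"
    using FF_pair[OF xy] by blast
  have q: "x \<in> qbar" "y \<in> qbar" using xy by (auto simp: FF_def)
  have "\<sigma> (x + y) = x + y" "\<sigma> (x - y) = x - y" "\<sigma> (x * y) = x * y" if "\<sigma> \<in> Dl J" for \<sigma>
  proof -
    have \<sigma>a: "\<sigma> \<in> autq" using that by (simp add: Dl_def)
    show "\<sigma> (x + y) = x + y" "\<sigma> (x - y) = x - y" "\<sigma> (x * y) = x * y"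
      by (simp_all add: autq_add[OF \<sigma>a q] autq_diff[OF \<sigma>a q] autq_mult[OF \<sigma>a q] J(3,4)[OF that])
  qed
  thus "x + y \<in> FF" "x - y \<in> FF" "x * y \<in> FF" using q J(1,2) unfolding FF_def by blast+
next
  fix x assume x: "x \<in> FF"
  then obtain J where J: "finite J" "J \<subseteq> I" "\<And>\<sigma>. \<sigma> \<in> Dl J \<Longrightarrow> \<sigma> x = x" unfolding FF_def by blast
  have q: "x \<in> qbar" using x by (auto simp: FF_def)
  have "\<sigma> (inverse x) = inverse x" if "\<sigma> \<in> Dl J" for \<sigma>
  proof -
    have \<sigma>a: "\<sigma> \<in> autq" using that by (simp add: Dl_def)
    show ?thesis by (simp add: autq_inverse[OF \<sigma>a q] J(3)[OF that])
  qed
  thus "inverse x \<in> FF" using q J(1,2) unfolding FF_def by blast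
qed

lemma algebraic_FF: "algebraic_ext_Q FF"
  using subfield_FF by (auto simp: algebraic_ext_Q_def FF_def qbar_def)

text \<open>\<open>W\<close> stands for the roots of any polynomial whose splitting field is the
  \<open>i\<close>-th one. Different matrices may share an index, and then only their kernels agree
  with that of the chosen enumeration.\<close>

context
  fixes i W
  assumes i: "i \<in> I" and W: "gstable W" and kW: "ker_of W = ker_of (e i ` {1..n})"
begin

abbreviation "LL \<equiv> field_adjoin FF W"

lemma LL_qbar: "LL \<subseteq> qbar"
  by (rule adjoin_least[OF subfield_C_qbar]) (use W in \<open>auto simp: FF_def gstable_def\<close>)

lemmas LL_field = subfield_CD[OF subfield_C_adjoin[of FF W]]

lemma acts_W: "acts n (e i) \<sigma> g \<Longrightarrow> acts n (e i) \<tau> g \<Longrightarrow> w \<in> W \<Longrightarrow> \<sigma> w = \<tau> w"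
  by (rule acts_ker_eq[of n "e i" \<sigma> g \<tau> W]) (use kW in auto)

text \<open>An element of \<open>G i\<close> should become an automorphism over \<open>FF\<close>,
  but \<open>realise\<close> handles only finitely many conditions. Its value at a single
  \<open>y\<close> is already forced by a finite \<open>J\<close>: all members of
  \<open>Dl J\<close> acting by \<open>g\<close> agree at \<open>y\<close>. \<open>Phi\<close> is
  put together from these forced values.\<close>

definition spec :: "(nat \<Rightarrow> nat) \<Rightarrow> complex \<Rightarrow> complex \<Rightarrow> 'i set \<Rightarrow> bool" where
  "spec g y z J \<longleftrightarrow> finite J \<and> J \<subseteq> I \<and> (\<forall>\<sigma>\<in>Dl J. acts n (e i) \<sigma> g \<longrightarrow> \<sigma> y = z)"

lemma spec_mono: "spec g y z J \<Longrightarrow> J \<subseteq> J' \<Longrightarrow> finite J' \<Longrightarrow> J' \<subseteq> I \<Longrightarrow> spec g y z J'"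
  using Dl_mono unfolding spec_def by blast

lemma spec_unique:
  assumes "spec g y z J" "spec g y z' J'" "g \<in> G i" shows "z = z'"
proof -
  have J: "finite (J \<union> J')" "J \<union> J' \<subseteq> I" using assms by (auto simp: spec_def)
  obtain \<sigma> where "\<sigma> \<in> Dl (J \<union> J')" "acts n (e i) \<sigma> g" using realise[OF J i assms(3)] .
  thus ?thesis using assms Dl_mono[of J "J \<union> J'"] Dl_mono[of J' "J \<union> J'"] unfolding spec_def by blast
qed

lemma spec_exists:
  assumes "y \<in> LL" "g \<in> G i" shows "\<exists>z J. spec g y z J"
proof -
  let ?K = "{y\<in>qbar. \<exists>z J. spec g y z J}"
  have "LL \<subseteq> ?K"
  proof (rule adjoin_least)
    show "FF \<subseteq> ?K" unfolding FF_def spec_def by blast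
    show "W \<subseteq> ?K"
    proof
      fix w assume w: "w \<in> W"
      obtain \<tau> where \<tau>: "acts n (e i) \<tau> g" using realise[of "{}" i g] i assms by auto
      have "spec g w (\<tau> w) {}" unfolding spec_def using acts_W \<tau> w by blast
      thus "w \<in> ?K" using w W unfolding gstable_def by blast
    qed
    show "subfield_C ?K"
      unfolding subfield_C_def
    proof (intro conjI ballI impI)
      have "spec g 0 0 {}" "spec g 1 1 {}" using autq_0 autq_1 by (auto simp: spec_def Dl_def)
      thus "0 \<in> ?K" "1 \<in> ?K" by (auto intro!: exI)
    next
      fix x y assume xy: "x \<in> ?K" "y \<in> ?K"
      then obtain z J z' J' where s: "spec g x z J" "spec g y z' J'" by blast
      have q: "x \<in> qbar" "y \<in> qbar" using xy by auto
      have J: "finite (J \<union> J')" "J \<union> J' \<subseteq> I" using s by (auto simp: spec_def)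
      have s': "spec g x z (J \<union> J')" "spec g y z' (J \<union> J')" using s spec_mono J by blast+
      have "spec g (x + y) (z + z') (J \<union> J')" "spec g (x - y) (z - z') (J \<union> J')" "spec g (x * y) (z * z') (J \<union> J')"
        using s' q autq_add autq_diff autq_mult unfolding spec_def Dl_def by auto
      thus "x + y \<in> ?K" "x - y \<in> ?K" "x * y \<in> ?K" using q by blast+
    next
      fix x assume x: "x \<in> ?K"
      then obtain z J where "spec g x z J" "x \<in> qbar" by blast
      hence "spec g (inverse x) (inverse z) J" using autq_inverse unfolding spec_def Dl_def by auto
      thus "inverse x \<in> ?K" using x by blast
    qed
  qed
  thus ?thesis using assms by blast
qed

definition Phi :: "(nat \<Rightarrow> nat) \<Rightarrow> complex \<Rightarrow> complex" where
  "Phi g y = (SOME z. \<exists>J. spec g y z J)"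

lemma Phi_spec: "y \<in> LL \<Longrightarrow> g \<in> G i \<Longrightarrow> \<exists>J. spec g y (Phi g y) J"
  unfolding Phi_def using spec_exists someI_ex[of "\<lambda>z. \<exists>J. spec g y z J"] by simp

lemma Phi_spec_common:
  assumes "finite Y" "Y \<subseteq> LL" "g \<in> G i"
  shows "\<exists>J. finite J \<and> J \<subseteq> I \<and> (\<forall>y\<in>Y. spec g y (Phi g y) J)"
  using assms(1,2)
proof (induction Y rule: finite_induct)
  case (insert y Y)
  then obtain J where J: "finite J" "J \<subseteq> I" "\<forall>y\<in>Y. spec g y (Phi g y) J" by auto
  obtain J' where J': "spec g y (Phi g y) J'" using Phi_spec[of y g] insert assms by blast
  hence "finite (J \<union> J')" "J \<union> J' \<subseteq> I" using J by (auto simp: spec_def)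
  moreover have "spec g z (Phi g z) (J \<union> J')" if "z \<in> insert y Y" for z
    using that J J' calculation spec_mono[of g z "Phi g z" J "J \<union> J'"] spec_mono[of g z "Phi g z" J' "J \<union> J'"] by blast
  ultimately show ?case by blast
qed auto

text \<open>On finitely many points \<open>Phi g\<close> coincides with a genuine automorphism, so
  each algebraic identity is inherited from \<open>autq\<close>.\<close>

lemma PhiE:
  assumes "finite Y" "Y \<subseteq> LL" "g \<in> G i"
  shows "\<exists>\<sigma>\<in>autq. acts n (e i) \<sigma> g \<and> (\<forall>y\<in>Y. Phi g y = \<sigma> y)"
proof -
  obtain J where J: "finite J" "J \<subseteq> I" "\<forall>y\<in>Y. spec g y (Phi g y) J"
    using Phi_spec_common[OF assms] by blast
  obtain \<sigma> where \<sigma>: "\<sigma> \<in> Dl J" "acts n (e i) \<sigma> g" using realise[OF J(1,2) i assms(3)] .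
  show ?thesis
  proof (intro bexI[of _ \<sigma>] conjI ballI)
    show "\<sigma> \<in> autq" using \<sigma> by (simp add: Dl_def)
    show "Phi g y = \<sigma> y" if "y \<in> Y" for y using J(3) \<sigma> that unfolding spec_def by auto
  qed (rule \<sigma>)
qed

lemma Phi_hom:
  assumes "x \<in> LL" "y \<in> LL" "g \<in> G i"
  shows "Phi g (x + y) = Phi g x + Phi g y" "Phi g (x - y) = Phi g x - Phi g y"
    "Phi g (x * y) = Phi g x * Phi g y" "Phi g (inverse x) = inverse (Phi g x)" "Phi g 0 = 0" "Phi g 1 = 1"
proof -
  have sub: "{x, y, x + y, x - y, x * y, inverse x, 0, 1} \<subseteq> LL" using assms LL_field by auto
  obtain \<sigma> where \<sigma>: "\<sigma> \<in> autq" "\<And>z. z \<in> {x, y, x + y, x - y, x * y, inverse x, 0, 1} \<Longrightarrow> Phi g z = \<sigma> z"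
    using PhiE[OF _ sub assms(3)] by auto
  have q: "x \<in> qbar" "y \<in> qbar" using assms LL_qbar by auto
  show "Phi g (x + y) = Phi g x + Phi g y" "Phi g (x - y) = Phi g x - Phi g y"
    "Phi g (x * y) = Phi g x * Phi g y" "Phi g (inverse x) = inverse (Phi g x)" "Phi g 0 = 0" "Phi g 1 = 1"
    using \<sigma> q by (simp_all add: autq_add autq_diff autq_mult autq_inverse autq_0 autq_1)
qed

lemma Phi_FF: assumes "x \<in> FF" "g \<in> G i" shows "Phi g x = x"
proof -
  obtain J where J: "finite J" "J \<subseteq> I" "\<forall>\<sigma>\<in>Dl J. \<sigma> x = x" using assms unfolding FF_def by blast
  hence "spec g x x J" unfolding spec_def by blast
  moreover have "x \<in> LL" using assms adjoin_superset by blast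
  ultimately show ?thesis using Phi_spec[of x g] assms spec_unique by blast
qed

lemma Phi_W: assumes "w \<in> W" "g \<in> G i" "acts n (e i) \<sigma> g" shows "Phi g w = \<sigma> w"
proof -
  have "spec g w (\<sigma> w) {}" unfolding spec_def using acts_W assms by blast
  moreover have "w \<in> LL" using assms adjoin_superset by blast
  ultimately show ?thesis using Phi_spec[of w g] assms spec_unique by blast
qed

lemma Phi_LL: assumes "y \<in> LL" "g \<in> G i" shows "Phi g y \<in> LL"
proof -
  have "LL \<subseteq> {y\<in>LL. Phi g y \<in> LL}"
  proof (rule adjoin_least)
    show "FF \<subseteq> {y\<in>LL. Phi g y \<in> LL}" using Phi_FF assms adjoin_superset[of FF W] by auto
    show "W \<subseteq> {y\<in>LL. Phi g y \<in> LL}"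
    proof
      fix w assume w: "w \<in> W"
      obtain \<sigma> where \<sigma>: "\<sigma> \<in> autq" "acts n (e i) \<sigma> g" using PhiE[of "{}" g] assms by blast
      have "Phi g w \<in> W" using Phi_W[OF w assms(2) \<sigma>(2)] w W \<sigma> by (auto simp: gstable_def)
      thus "w \<in> {y\<in>LL. Phi g y \<in> LL}" using w adjoin_superset[of W FF] adjoin_superset(2)[of W FF] by auto
    qed
    show "subfield_C {y\<in>LL. Phi g y \<in> LL}"
      unfolding subfield_C_def using Phi_hom[OF _ _ assms(2)] LL_field by auto
  qed
  thus ?thesis using assms by blast
qed

lemma Phi_comp:
  assumes y: "y \<in> LL" and g: "g \<in> G i" and h: "h \<in> G i" shows "Phi (g \<circ> h) y = Phi g (Phi h y)"
proof -
  have gh: "g \<circ> h \<in> G i" using G_comp i g h by blast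
  obtain J1 where J1: "spec h y (Phi h y) J1" using Phi_spec[OF y h] by blast
  obtain J2 where J2: "spec g (Phi h y) (Phi g (Phi h y)) J2" using Phi_spec[OF Phi_LL[OF y h] g] by blast
  obtain J3 where J3: "spec (g \<circ> h) y (Phi (g \<circ> h) y) J3" using Phi_spec[OF y gh] by blast
  let ?J = "J1 \<union> J2 \<union> J3"
  have J: "finite ?J" "?J \<subseteq> I" using J1 J2 J3 by (auto simp: spec_def)
  obtain \<sigma> where \<sigma>: "\<sigma> \<in> Dl ?J" "acts n (e i) \<sigma> g" using realise[OF J i g] .
  obtain \<tau> where \<tau>: "\<tau> \<in> Dl ?J" "acts n (e i) \<tau> h" using realise[OF J i h] .
  have "spec h y (Phi h y) ?J" by (rule spec_mono[OF J1 _ J]) auto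
  hence 1: "\<tau> y = Phi h y" using \<tau> unfolding spec_def by blast
  have "spec g (Phi h y) (Phi g (Phi h y)) ?J" by (rule spec_mono[OF J2 _ J]) auto
  hence 2: "\<sigma> (Phi h y) = Phi g (Phi h y)" using \<sigma> unfolding spec_def by blast
  have "spec (g \<circ> h) y (Phi (g \<circ> h) y) ?J" by (rule spec_mono[OF J3 _ J]) auto
  moreover have "\<sigma> \<circ> \<tau> \<in> Dl ?J" using Dl_comp[OF J(2)] \<sigma> \<tau> by blast
  moreover have "acts n (e i) (\<sigma> \<circ> \<tau>) (g \<circ> h)" using acts_comp \<sigma> \<tau> by blast
  ultimately have "(\<sigma> \<circ> \<tau>) y = Phi (g \<circ> h) y" unfolding spec_def by blast
  thus ?thesis using 1 2 by simp
qed

lemma Phi_id: "y \<in> LL \<Longrightarrow> Phi id y = y"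
proof -
  assume y: "y \<in> LL"
  \<comment> \<open>\<open>Phi id\<close> is idempotent and agrees on \<open>y\<close> and its image
    with an injective map, so it fixes \<open>y\<close>.\<close>
  have p: "Phi (id \<circ> id) y = Phi id (Phi id y)" by (rule Phi_comp[OF y]) (use G_id i in auto)
  obtain \<sigma> where "\<sigma> \<in> autq" "\<And>z. z \<in> {y, Phi id y} \<Longrightarrow> Phi id z = \<sigma> z"
    using PhiE[of "{y, Phi id y}" id] y Phi_LL[OF y G_id[OF i]] G_id[OF i] by blast
  hence "\<sigma> (Phi id y) = \<sigma> y" using p by simp
  thus ?thesis using autq_inj[OF \<open>\<sigma> \<in> autq\<close>] by blast
qed

lemma Phi_gal: assumes g: "g \<in> G i" shows "restrict (Phi g) LL \<in> gal_auts LL FF"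
  unfolding gal_auts_def
proof (intro CollectI conjI ballI)
  have g': "inv' g \<in> G i" using G_inv i g by blast
  have gp: "g permutes {1..n}" using G_alt[OF i g] by (simp add: alt_group_carrier)
  have "bij_betw (Phi g) LL LL"
  proof (rule bij_betw_byWitness[where f' = "Phi (inv' g)"])
    have a: "Phi (inv' g) (Phi g y) = y" "Phi g (Phi (inv' g) y) = y" if "y \<in> LL" for y
      using Phi_comp[OF that g' g] Phi_comp[OF that g g'] Phi_id[OF that] permutes_inv_o[OF gp] by simp_all
    show "\<forall>y\<in>LL. Phi (inv' g) (Phi g y) = y" "\<forall>y\<in>LL. Phi g (Phi (inv' g) y) = y" using a by auto
    show "Phi g ` LL \<subseteq> LL" "Phi (inv' g) ` LL \<subseteq> LL" using Phi_LL g g' by auto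
  qed
  thus "bij_betw (restrict (Phi g) LL) LL LL" by (simp cong: bij_betw_cong)
  show "restrict (Phi g) LL (x + y) = restrict (Phi g) LL x + restrict (Phi g) LL y"
    "restrict (Phi g) LL (x * y) = restrict (Phi g) LL x * restrict (Phi g) LL y" if "x \<in> LL" "y \<in> LL" for x y
    using that Phi_hom[OF that g] LL_field by auto
  show "restrict (Phi g) LL x = x" if "x \<in> FF" for x
    using that Phi_FF[OF that g] adjoin_superset[of FF W] by auto
qed simp

text \<open>The orbit polynomials of the tuple \<open>a\<close> of all elements of \<open>W\<close>
  under \<open>Hs i\<close> have coefficients in \<open>FF\<close>, so \<tau> sends each root of
  them to a root. Doing this for enough linear forms yields one \<sigma> in \<open>Hs i\<close> that
  agrees with \<tau> on all of \<open>W\<close>, and the elements of \<open>FF\<close> and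
  \<open>W\<close> generate the field.\<close>

lemma gal_is_Phi:
  assumes \<tau>: "\<tau> \<in> gal_auts LL FF"
  shows "\<exists>g\<in>G i. \<tau> = restrict (Phi g) LL"
proof -
  have \<tau>h: "\<tau> (x + y) = \<tau> x + \<tau> y" "\<tau> (x * y) = \<tau> x * \<tau> y" if "x \<in> LL" "y \<in> LL" for x y
    using \<tau> that by (auto simp: gal_auts_def)
  have \<tau>F: "\<tau> x = x" if "x \<in> FF" for x using \<tau> that by (auto simp: gal_auts_def)
  have FL: "x \<in> LL" if "x \<in> FF" for x using that adjoin_superset by blast
  have WL: "x \<in> LL" if "x \<in> W" for x using that adjoin_superset by blast
  have \<tau>01: "\<tau> 0 = 0" "\<tau> 1 = 1" using \<tau>F subfield_CD(1,2)[OF subfield_FF] by auto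
  have \<tau>d: "\<tau> (x - y) = \<tau> x - \<tau> y" if "x \<in> LL" "y \<in> LL" for x y
    using \<tau>h(1)[of "x - y" y] LL_field that by simp
  have \<tau>p: "\<tau> (x ^ k) = \<tau> x ^ k \<and> x ^ k \<in> LL" if "x \<in> LL" for x k
    by (induction k) (use that \<tau>01 \<tau>h LL_field in auto)
  have \<tau>s: "\<tau> (sum f A) = (\<Sum>a\<in>A. \<tau> (f a)) \<and> sum f A \<in> LL" if "\<And>a. a \<in> A \<Longrightarrow> f a \<in> LL" for f and A :: "nat set"
    using that by (induction A rule: infinite_finite_induct) (auto simp: \<tau>01 \<tau>h LL_field)
  have intF: "of_int t \<in> FF" for t
  proof -
    have nat: "of_nat k \<in> FF" for k by (induction k) (use subfield_CD[OF subfield_FF] in auto)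
    have "of_int t = of_nat (nat t) - (of_nat (nat (- t)) :: complex)" by (cases "t \<ge> 0") auto
    thus ?thesis using subfield_CD(4)[OF subfield_FF nat nat] by metis
  qed
  have finW: "finite W" using W by (simp add: gstable_def)
  obtain a where a: "bij_betw a {..<card W} W"
    using ex_bij_betw_nat_finite[OF finW] by (auto simp: atLeast0LessThan)
  let ?N = "card W"
  have aW: "a k \<in> W" if "k < ?N" for k using a that by (auto dest: bij_betwE)
  have Hi: "Hs i = Dl {i}" by (auto simp: Dl_def Hs_def acts_def)
  have idH: "id \<in> Hs i" unfolding Hs_def using acts_id G_id[OF i] by blast
  have HC: "\<sigma> \<circ> \<tau> \<in> Hs i" if "\<sigma> \<in> Hs i" "\<tau> \<in> Hs i" for \<sigma> \<tau>
    using Dl_comp[of "{i}"] that i unfolding Hi by blast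
  let ?V = "orbit_vecs (Hs i) ?N a"
  have HA: "Hs i \<subseteq> autq" by (auto simp: Hs_def acts_def)
  have "?V \<subseteq> {..<?N} \<rightarrow>\<^sub>E W" using aW HA W by (auto simp: orbit_vecs_def PiE_def extensional_def gstable_def)
  hence finV: "finite ?V" using finite_PiE[of "{..<?N}" "\<lambda>_. W"] finW finite_subset by auto
  \<comment> \<open>With the zero ideal, \<open>vector_of_theta\<close> turns congruences into
    equalities.\<close>
  interpret prime_pair UNIV "{0}" by unfold_locales auto
  have "\<exists>v\<in>?V. \<forall>k<?N. \<tau> (a k) - v k \<in> {0}"
  proof (rule vector_of_theta[OF finV, of "{0..<int (card ?V * ?N + 1)}"])
    show "card ?V * ?N < card {0..<int (card ?V * ?N + 1)}"
      by (simp only: card_atLeastLessThan_int diff_zero nat_int)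
    fix t :: int
    define Q where "Q = (\<Prod>v\<in>?V. [:- theta ?N t v, 1:])"
    have QF: "coeff Q k \<in> FF" for k
    proof -
      have "\<forall>\<sigma>\<in>Dl {i}. \<sigma> (coeff Q k) = coeff Q k"
        unfolding Hi[symmetric] Q_def
        by (intro ballI orbit_poly_fixed(1)[OF HA HC]) (use aW W finV in \<open>auto simp: gstable_def\<close>)
      moreover have "coeff Q k \<in> qbar" unfolding Q_def
        by (rule orbit_poly_fixed(2)[OF HA _ _ finV, of id])
          (use HC idH aW W in \<open>auto simp: gstable_def\<close>)
      ultimately show ?thesis unfolding FF_def using i by blast
    qed
    have pQ: "poly Q x = (\<Prod>v\<in>?V. x - theta ?N t v)" for x by (simp add: Q_def poly_prod)
    have "restrict a {..<?N} \<in> ?V" unfolding orbit_vecs_def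
      by (intro image_eqI[of _ _ id]) (use acts_id G_id[OF i] in \<open>auto simp: Hs_def\<close>)
    moreover have "theta ?N t (restrict a {..<?N}) = theta ?N t a" by (simp add: theta_def)
    ultimately have 0: "poly Q (theta ?N t a) = 0"
      unfolding pQ using finV by (intro prod_zero bexI[of _ "restrict a {..<?N}"]) auto
    have thL: "theta ?N t a \<in> LL" and th\<tau>: "\<tau> (theta ?N t a) = theta ?N t (\<lambda>k. \<tau> (a k))"
    proof -
      have m: "of_int t ^ k * a k \<in> LL" "\<tau> (of_int t ^ k * a k) = of_int t ^ k * \<tau> (a k)" if "k < ?N" for k
        using \<tau>p[OF FL[OF intF[of t]], of k] LL_field WL[OF aW[OF that]] \<tau>h \<tau>F[OF intF] by auto
      thus "theta ?N t a \<in> LL" "\<tau> (theta ?N t a) = theta ?N t (\<lambda>k. \<tau> (a k))"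
        unfolding theta_def using \<tau>s[of "{..<?N}" "\<lambda>k. of_int t ^ k * a k"] by auto
    qed
    have "0 = \<tau> (poly Q (theta ?N t a))" using 0 \<tau>01 by simp
    also have "\<dots> = (\<Sum>k\<le>degree Q. \<tau> (coeff Q k * theta ?N t a ^ k))"
      unfolding poly_altdef using \<tau>s[of "{..degree Q}" "\<lambda>k. coeff Q k * theta ?N t a ^ k"] FL[OF QF] \<tau>p[OF thL] LL_field by blast
    also have "\<dots> = poly Q (theta ?N t (\<lambda>k. \<tau> (a k)))"
      unfolding poly_altdef using FL[OF QF] \<tau>p[OF thL] \<tau>h(2) \<tau>F[OF QF] th\<tau> by simp
    finally show "(\<Prod>v\<in>?V. theta ?N t (\<lambda>k. \<tau> (a k)) - theta ?N t v) \<in> {0}" unfolding pQ by simp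
  qed auto
  then obtain \<sigma> where \<sigma>: "\<sigma> \<in> Hs i" "\<forall>k<?N. \<tau> (a k) = \<sigma> (a k)" unfolding orbit_vecs_def by auto
  obtain g where g: "g \<in> G i" "acts n (e i) \<sigma> g" using \<sigma>(1) by (auto simp: Hs_def)
  have tW: "\<tau> w = Phi g w" if "w \<in> W" for w
  proof -
    obtain k where "k < ?N" "w = a k" using a \<open>w \<in> W\<close> by (auto simp: bij_betw_def)
    thus ?thesis using \<sigma>(2) Phi_W[OF that g] by simp
  qed
  have "LL \<subseteq> {y\<in>LL. \<tau> y = Phi g y}"
  proof (rule adjoin_least)
    show "FF \<subseteq> {y\<in>LL. \<tau> y = Phi g y}" using FL \<tau>F Phi_FF g by auto
    show "W \<subseteq> {y\<in>LL. \<tau> y = Phi g y}" using tW WL by auto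
    have inv: "\<tau> (inverse x) = inverse (\<tau> x)" if "x \<in> LL" "x \<noteq> 0" for x
    proof -
      have "\<tau> x * \<tau> (inverse x) = 1" using \<tau>h(2)[of x "inverse x"] that LL_field \<tau>01 by simp
      thus ?thesis by (simp add: inverse_unique)
    qed
    show "subfield_C {y\<in>LL. \<tau> y = Phi g y}"
      unfolding subfield_C_def using Phi_hom[OF _ _ g(1)] LL_field \<tau>h \<tau>d \<tau>01 inv by auto
  qed
  moreover have "\<tau> \<in> extensional LL" using \<tau> by (auto simp: gal_auts_def)
  ultimately have "\<tau> = restrict (Phi g) LL" by (intro extensionalityI[of _ LL]) auto
  thus ?thesis using g by blast
qed

theorem gal_iso: "gal LL FF \<cong> (alt_group n)\<lparr>carrier := G i\<rparr>"
proof -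
  let ?A = "(alt_group n)\<lparr>carrier := G i\<rparr>"
  let ?h = "\<lambda>g. restrict (Phi g) LL"
  have gA: "group ?A" by (rule group.subgroup_imp_group[OF alt_group_is_group subG[OF i]])
  have ie: "inj_on (e i) {1..n}" using full[OF i] by (simp add: full_enum_def)
  have "?h \<in> iso ?A (gal LL FF)"
  proof (rule isoI)
    show "?h \<in> hom ?A (gal LL FF)"
    proof (rule homI)
      fix g assume "g \<in> carrier ?A"
      thus "?h g \<in> carrier (gal LL FF)" using Phi_gal by (simp add: gal_def)
    next
      fix g h assume "g \<in> carrier ?A" "h \<in> carrier ?A"
      hence gh: "g \<in> G i" "h \<in> G i" by auto
      have "?h (g \<circ> h) y = restrict (?h g \<circ> ?h h) LL y" for y
        using Phi_comp[OF _ gh] Phi_LL[OF _ gh(2)] by (cases "y \<in> LL") auto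
      thus "?h (g \<otimes>\<^bsub>?A\<^esub> h) = ?h g \<otimes>\<^bsub>gal LL FF\<^esub> ?h h"
        by (auto simp: gal_def alt_group_mult)
    qed
    show "bij_betw ?h (carrier ?A) (carrier (gal LL FF))"
    proof (rule bij_betw_imageI)
      show "inj_on ?h (carrier ?A)"
      proof (rule inj_onI)
        fix g h assume "g \<in> carrier ?A" "h \<in> carrier ?A" and eq: "?h g = ?h h"
        hence gh: "g \<in> G i" "h \<in> G i" by auto
        have WL: "W \<subseteq> LL" by (rule adjoin_superset)
        obtain \<sigma> where \<sigma>: "\<sigma> \<in> autq" "acts n (e i) \<sigma> g" using PhiE[of "{}" g] gh by blast
        obtain \<tau> where \<tau>: "\<tau> \<in> autq" "acts n (e i) \<tau> h" using PhiE[of "{}" h] gh by blast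
        have "\<sigma> w = \<tau> w" if "w \<in> W" for w
          using Phi_W[OF that gh(1) \<sigma>(2)] Phi_W[OF that gh(2) \<tau>(2)] fun_cong[OF eq, of w] WL that by auto
        \<comment> \<open>The kernels of \<open>W\<close> and of the enumerated roots are equal, so
          an action known on \<open>W\<close> is known on those roots and determines the
          permutation.\<close>
        hence "\<sigma> z = \<tau> z" if "z \<in> e i ` {1..n}" for z
          using ker_of_agree[of W "e i ` {1..n}" \<sigma> \<tau> z] \<sigma> \<tau> kW that by blast
        hence "acts n (e i) \<tau> g" using \<sigma> \<tau> by (auto simp: acts_def)
        thus "g = h" using acts_unique[OF ie _ \<tau>(2)] by blast
      qed
      show "?h ` carrier ?A = carrier (gal LL FF)"
        using Phi_gal gal_is_Phi by (auto simp: gal_def)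
    qed
  qed
  hence "?A \<cong> gal LL FF" by (auto simp: is_iso_def)
  thus ?thesis using group.iso_sym[OF gA] by blast
qed

end

end

section \<open>Integer matrices modulo primes\<close>

lemma prod_diff_dvd:
  fixes f g :: "'i \<Rightarrow> 'a::comm_ring_1"
  assumes "\<And>i. i \<in> I \<Longrightarrow> c dvd f i - g i" shows "c dvd prod f I - prod g I"
  using assms
proof (induction I rule: infinite_finite_induct)
  case (insert i I)
  have "prod f (insert i I) - prod g (insert i I) = f i * (prod f I - prod g I) + (f i - g i) * prod g I"
    using insert by (simp add: algebra_simps)
  thus ?case using insert by simp
qed auto

lemma det_diff_dvd:
  fixes A B :: "'a::comm_ring_1^'n^'n"
  assumes "\<And>i j. c dvd A$i$j - B$i$j" shows "c dvd det A - det B"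
  unfolding det_def sum_subtractf[symmetric] right_diff_distrib[symmetric]
  by (intro dvd_sum dvd_mult prod_diff_dvd assms)

section \<open>Congruence of integer matrices, elementary matrices and strong approximation\<close>

definition mcong :: "nat \<Rightarrow> int^'n^'n \<Rightarrow> int^'n^'n \<Rightarrow> bool" where
  "mcong m A B \<longleftrightarrow> (\<forall>i j. int m dvd A$i$j - B$i$j)"

lemma mcong_refl: "mcong m A A" by (simp add: mcong_def)
lemma mcong_sym: "mcong m A B \<Longrightarrow> mcong m B A" by (simp add: mcong_def dvd_diff_commute)
lemma mcong_trans: "mcong m A B \<Longrightarrow> mcong m B C \<Longrightarrow> mcong m A C"
  unfolding mcong_def using dvd_add by (metis (no_types, opaque_lifting) diff_add_cancel add_diff_eq)
lemma mcong_mult: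
  assumes "mcong m A B" "mcong m C D" shows "mcong m (A ** C) (B ** D)"
proof -
  have "int m dvd A$i$k * C$k$j - B$i$k * D$k$j" for i j k
  proof -
    have "A$i$k * C$k$j - B$i$k * D$k$j = A$i$k * (C$k$j - D$k$j) + (A$i$k - B$i$k) * D$k$j" by (simp add: algebra_simps)
    thus ?thesis using assms by (simp add: mcong_def)
  qed
  thus ?thesis by (simp add: mcong_def matrix_matrix_mult_def sum_subtractf[symmetric] dvd_sum)
qed
lemma mcong_det: "mcong m A B \<Longrightarrow> int m dvd det A - det B"
  unfolding mcong_def by (intro det_diff_dvd) auto

definition elmat :: "'n \<Rightarrow> 'n \<Rightarrow> int \<Rightarrow> int^'n^'n" where
  "elmat i j t = (\<chi> a b. (if a = b then 1 else 0) + (if a = i \<and> b = j then t else 0))"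

lemma elem_mult_left: "(elmat i j t ** A)$a$b = A$a$b + (if a = i then t * A$j$b else 0)"
proof -
  have "(elmat i j t ** A)$a$b = (\<Sum>k\<in>UNIV. (if a = k then A$k$b else 0) + (if k = j then (if a = i then t * A$k$b else 0) else 0))"
    unfolding elmat_def matrix_matrix_mult_def by (simp, intro sum.cong) (auto simp: distrib_right)
  also have "\<dots> = A$a$b + (if a = i then t * A$j$b else 0)" by (simp add: sum.distrib)
  finally show ?thesis .
qed

lemma elem_mult_elem: "elmat i j t ** elmat i j s = (if i = j then elmat i j (t + s + t * s) else elmat i j (t + s))"
  by (auto simp: vec_eq_iff elem_mult_left) (auto simp: elmat_def algebra_simps)

lemma elem_0: "elmat i j 0 = mat 1" by (simp add: elmat_def mat_def vec_eq_iff)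

lemma det_elem: assumes "i \<noteq> j" shows "det (elmat i j t) = 1"
proof -
  have "elmat i j t = (\<chi> k. if k = i then row i (mat 1) + t *s row j (mat 1) else row k (mat 1))"
    by (simp add: vec_eq_iff elmat_def row_def mat_def)
  thus ?thesis using det_row_operation[OF assms, of "mat 1" t] by simp
qed

text \<open>Products of elementary matrices, kept as words: rescaling the parameters letter by
  letter and reaching each letter by the walk are both inductions over the word.\<close>

inductive_set elemgrp :: "(int^'n^'n) set" where
  elemgrp_one: "mat 1 \<in> elemgrp"
| elemgrp_step: "A \<in> elemgrp \<Longrightarrow> i \<noteq> j \<Longrightarrow> elmat i j t ** A \<in> elemgrp"

lemma elemgrp_elem: "i \<noteq> j \<Longrightarrow> elmat i j t \<in> elemgrp"
  using elemgrp_step[OF elemgrp_one, of i j t] by simp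

lemma elemgrp_mult: "A \<in> elemgrp \<Longrightarrow> B \<in> elemgrp \<Longrightarrow> A ** B \<in> elemgrp"
  by (induction rule: elemgrp.induct) (auto simp: matrix_mul_assoc[symmetric] intro: elemgrp_step)

lemma elemgrp_inverse: "A \<in> elemgrp \<Longrightarrow> \<exists>B\<in>elemgrp. A ** B = mat 1 \<and> B ** A = mat 1"
proof (induction rule: elemgrp.induct)
  case elemgrp_one thus ?case using elemgrp.elemgrp_one by (intro bexI[of _ "mat 1"]) auto
next
  case (elemgrp_step A i j t)
  then obtain B where B: "B \<in> elemgrp" "A ** B = mat 1" "B ** A = mat 1" by blast
  have e: "elmat i j t ** elmat i j (-t) = mat 1" "elmat i j (-t) ** elmat i j t = mat 1"
    using elemgrp_step by (simp_all add: elem_mult_elem elem_0)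
  have "elmat i j t ** A ** (B ** elmat i j (-t)) = mat 1"
    by (metis B(2) e(1) matrix_mul_assoc matrix_mul_rid)
  moreover have "B ** elmat i j (-t) ** (elmat i j t ** A) = mat 1"
    by (metis B(3) e(2) matrix_mul_assoc matrix_mul_rid)
  moreover have "B ** elmat i j (-t) \<in> elemgrp" using B elemgrp_step by (intro elemgrp_mult elemgrp_elem)
  ultimately show ?case by blast
qed

lemma elemgrp_det: "A \<in> elemgrp \<Longrightarrow> det A = 1"
  by (induction rule: elemgrp.induct) (auto simp: det_mul det_elem)

lemma elemgrp_SLZ: "elemgrp \<subseteq> SLZ" using elemgrp_det by (auto simp: SLZ_def)

definition unit_col :: "nat \<Rightarrow> int^'n^'n \<Rightarrow> 'n \<Rightarrow> bool" where
  "unit_col p A s \<longleftrightarrow> (\<forall>i. int p dvd A$i$s - (if i = s then 1 else 0))"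

text \<open>In the Leibniz expansion modulo \<open>p\<close>, a column that reduces to a unit vector
  allows only its diagonal entry.\<close>

lemma unit_col_perm:
  assumes p: "prime p" and S: "\<And>s. s \<in> S \<Longrightarrow> unit_col p A s" and \<pi>: "\<pi> permutes (UNIV :: 'n set)"
    and nz: "\<not> int p dvd (\<Prod>i\<in>UNIV. (A :: int^'n^'n)$i$(\<pi> i))" and "s \<in> S"
  shows "\<pi> s = s"
proof -
  obtain i where i: "\<pi> i = s" using permutes_surj[OF \<pi>] by (metis surjD)
  have "\<not> int p dvd A$i$(\<pi> i)" using nz dvd_prodI[where f="\<lambda>i. A$i$(\<pi> i)" and a=i and A=UNIV, OF finite UNIV_I] dvd_trans by blast
  hence "i = s" using S[OF \<open>s \<in> S\<close>] i unfolding unit_col_def by (metis diff_zero)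
  thus ?thesis using i by simp
qed

lemma unit_col_nonzero:
  assumes p: "prime p" and S: "\<And>s. s \<in> S \<Longrightarrow> unit_col p (A :: int^'n^'n) s" and k: "k \<notin> S"
    and det: "\<not> int p dvd det A"
  shows "\<exists>i. i \<notin> S \<and> \<not> int p dvd A$i$k"
proof (rule ccontr)
  assume n: "\<not> ?thesis"
  have "int p dvd of_int (sign \<pi>) * (\<Prod>i\<in>UNIV. A$i$\<pi> i)" if \<pi>: "\<pi> permutes UNIV" for \<pi>
  proof -
    have "int p dvd (\<Prod>i\<in>UNIV. A$i$\<pi> i)"
    proof (rule ccontr)
      assume nz: "\<not> ?thesis"
      obtain i where i: "\<pi> i = k" using permutes_surj[OF \<pi>] by (metis surjD)
      have "i \<notin> S" using unit_col_perm[OF p S \<pi> nz, where s=i] i k by auto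
      hence "int p dvd A$i$(\<pi> i)" using n i by blast
      thus False using nz dvd_prodI[where f="\<lambda>i. A$i$(\<pi> i)" and a=i and A=UNIV, OF finite UNIV_I] dvd_trans by blast
    qed
    thus ?thesis by simp
  qed
  hence "int p dvd det A" unfolding det_def by (intro dvd_sum) auto
  thus False using det by blast
qed

lemma unit_col_last:
  assumes p: "prime p" and S: "\<And>s. s \<noteq> k \<Longrightarrow> unit_col p (A :: int^'n^'n) s"
  shows "int p dvd det A - A$k$k"
proof -
  have "int p dvd (\<Sum>\<pi>\<in>{\<pi>. \<pi> permutes UNIV} - {id}. of_int (sign \<pi>) * (\<Prod>i\<in>UNIV. A$i$\<pi> i))"
  proof (intro dvd_sum)
    fix \<pi> assume a: "\<pi> \<in> {\<pi>. \<pi> permutes (UNIV :: 'n set)} - {id}"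
    hence \<pi>: "\<pi> permutes UNIV" by auto
    have "int p dvd (\<Prod>i\<in>UNIV. A$i$\<pi> i)"
    proof (rule ccontr)
      assume nz: "\<not> ?thesis"
      have f: "\<pi> s = s" if "s \<noteq> k" for s using unit_col_perm[OF p _ \<pi> nz, of "UNIV - {k}"] S that by auto
      have "\<pi> k = k" using f permutes_inj[OF \<pi>] by (metis injD)
      hence "\<pi> = id" using f by (auto simp: fun_eq_iff) metis
      thus False using a by auto
    qed
    thus "int p dvd of_int (sign \<pi>) * (\<Prod>i\<in>UNIV. A$i$\<pi> i)" by simp
  qed
  moreover have "det A = (\<Prod>i\<in>UNIV. A$i$i) + (\<Sum>\<pi>\<in>{\<pi>. \<pi> permutes UNIV} - {id}. of_int (sign \<pi>) * (\<Prod>i\<in>UNIV. A$i$\<pi> i))"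
    unfolding det_def by (subst sum.remove[of _ id]) (auto simp: finite_permutations permutes_id)
  moreover have "int p dvd (\<Prod>i\<in>UNIV. A$i$i) - A$k$k"
  proof -
    have "int p dvd (\<Prod>i\<in>UNIV. A$i$i) - (\<Prod>i\<in>UNIV. if i = k then A$k$k else 1)"
      by (intro prod_diff_dvd) (use S in \<open>auto simp: unit_col_def\<close>, metis)
    thus ?thesis by simp
  qed
  ultimately show ?thesis by (metis (no_types, lifting) add_diff_eq add.commute dvd_add)
qed

lemma clear_column:
  assumes "k \<notin> T" "finite T"
  shows "\<exists>B\<in>elemgrp. \<forall>a b. (B ** A)$a$b = (A :: int^'n^'n)$a$b - (if a \<in> T then A$a$k * A$k$b else 0)"
  using assms(2,1)
proof (induction T rule: finite_induct)
  case empty thus ?case using elemgrp_one by (intro bexI[of _ "mat 1"]) auto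
next
  case (insert i T)
  then obtain B where B: "B \<in> elemgrp" "\<And>a b. (B ** A)$a$b = A$a$b - (if a \<in> T then A$a$k * A$k$b else 0)" by auto
  have "elmat i k (- A$i$k) ** B \<in> elemgrp" using B insert by (intro elemgrp_step) auto
  moreover have "(elmat i k (- A$i$k) ** B ** A)$a$b = A$a$b - (if a \<in> insert i T then A$a$k * A$k$b else 0)" for a b
    unfolding matrix_mul_assoc[symmetric] elem_mult_left B(2) using insert by auto
  ultimately show ?case by blast
qed

text \<open>Gaussian elimination modulo \<open>p\<close>, where \<open>S\<close> holds the columns
  already finished. Rows can only be combined, not scaled, so the pivot 1 is produced with the help
  of another row; for the last column the determinant supplies it.\<close>

lemma elemgrp_reduce:
  assumes p: "prime p"
  shows "int p dvd det A - 1 \<Longrightarrow> (\<And>s. s \<in> S \<Longrightarrow> unit_col p A s) \<Longrightarrow> \<exists>B\<in>elemgrp. mcong p (B ** A) (mat 1 :: int^'n^'n)"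
proof (induction "card (UNIV - S)" arbitrary: A S rule: less_induct)
  case less
  show ?case
  proof (cases "S = UNIV")
    case True
    hence "mcong p A (mat 1)" using less.prems(2) by (auto simp: mcong_def unit_col_def mat_def)
    thus ?thesis using elemgrp_one by (intro bexI[of _ "mat 1"]) auto
  next
    case False
    then obtain k where k: "k \<notin> S" by blast
    have p1: "\<not> int p dvd 1" using p by (auto simp: prime_nat_iff)
    have nd: "\<not> int p dvd det A" using less.prems(1) p1 by (metis dvd_diff_right_iff dvd_diff_commute)
    have keep: "unit_col p (elmat i j t ** M) s" if "unit_col p M s" "j \<noteq> s" for i j t and M :: "int^'n^'n" and s
    proof -
      have j: "int p dvd M$j$s" using that unfolding unit_col_def by (metis diff_zero)
      have "(elmat i j t ** M)$a$s - (if a = s then 1 else 0) = (M$a$s - (if a = s then 1 else 0)) + (if a = i then t * M$j$s else 0)" for a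
        by (simp add: elem_mult_left)
      moreover have "int p dvd (if a = i then t * M$j$s else 0)" for a using j by simp
      ultimately show ?thesis using that(1) unfolding unit_col_def by (metis dvd_add)
    qed
    have kk: "\<exists>B\<in>elemgrp. (\<forall>s\<in>S. unit_col p (B ** A) s) \<and> int p dvd (B ** A)$k$k - 1"
    proof (cases "\<exists>k'. k' \<notin> S \<and> k' \<noteq> k")
      case False
      have "int p dvd det A - A$k$k" by (rule unit_col_last[OF p]) (use False less.prems(2) in blast)
      hence "int p dvd A$k$k - 1" using less.prems(1) by (metis (no_types, opaque_lifting) diff_add_cancel add_diff_eq dvd_add dvd_diff_commute)
      thus ?thesis using elemgrp_one less.prems(2) by (intro bexI[of _ "mat 1"]) auto
    next
      case True
      then obtain k' where k': "k' \<notin> S" "k' \<noteq> k" by blast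
      \<comment> \<open>A unit is needed in column \<open>k\<close> in some row \<open>r\<close>
        other than \<open>k\<close> and outside \<open>S\<close>. If the only unit is on the
        diagonal, adding row \<open>k\<close> to row \<open>k'\<close> creates one.\<close>
      have "\<exists>B\<in>elemgrp. \<exists>r. r \<notin> S \<and> r \<noteq> k \<and> (\<forall>s\<in>S. unit_col p (B ** A) s) \<and> \<not> int p dvd (B ** A)$r$k"
      proof (cases "\<exists>r. r \<notin> S \<and> r \<noteq> k \<and> \<not> int p dvd A$r$k")
        case True
        thus ?thesis using elemgrp_one less.prems(2) by (intro bexI[of _ "mat 1"]) auto
      next
        case False
        have "\<not> int p dvd A$k$k" using unit_col_nonzero[OF p less.prems(2) k nd] False by blast
        moreover have "int p dvd A$k'$k" using False k' by blast
        ultimately have "\<not> int p dvd (elmat k' k 1 ** A)$k'$k" by (simp add: elem_mult_left dvd_add_right_iff)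
        moreover have "\<forall>s\<in>S. unit_col p (elmat k' k 1 ** A) s"
        proof
          fix s assume s: "s \<in> S"
          hence "k \<noteq> s" using k by blast
          thus "unit_col p (elmat k' k 1 ** A) s" by (rule keep[OF less.prems(2)[OF s]])
        qed
        ultimately show ?thesis using k' elemgrp_elem[OF k'(2)] by blast
      qed
      then obtain B r where B: "B \<in> elemgrp" "r \<notin> S" "r \<noteq> k" "\<forall>s\<in>S. unit_col p (B ** A) s" "\<not> int p dvd (B ** A)$r$k" by blast
      let ?M = "B ** A"
      have "coprime (int p) (?M$r$k)" using B(5) p by (simp add: prime_imp_coprime)
      then obtain u v where uv: "u * int p + v * ?M$r$k = 1" by (metis bezout_int coprime_imp_gcd_eq_1)
      \<comment> \<open>\<open>v\<close> inverts the entry of row \<open>r\<close> in column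
        \<open>k\<close> modulo \<open>p\<close>, so adding \<open>?t\<close> times row
        \<open>r\<close> turns the diagonal entry into 1.\<close>
      let ?t = "(1 - ?M$k$k) * v"
      have "(elmat k r ?t ** ?M)$k$k - 1 = (1 - ?M$k$k) * (v * ?M$r$k - 1)" by (simp add: elem_mult_left algebra_simps)
      also have "v * ?M$r$k - 1 = - (u * int p)" using uv by linarith
      finally have "int p dvd (elmat k r ?t ** ?M)$k$k - 1" by simp
      moreover have "\<forall>s\<in>S. unit_col p (elmat k r ?t ** ?M) s"
      proof
        fix s assume s: "s \<in> S"
        hence "r \<noteq> s" using B(2) by blast
        thus "unit_col p (elmat k r ?t ** ?M) s" using B(4) s by (intro keep) auto
      qed
      moreover have "elmat k r ?t ** B \<in> elemgrp" using B by (intro elemgrp_step) auto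
      ultimately show ?thesis by (intro bexI[of _ "elmat k r ?t ** B"]) (auto simp: matrix_mul_assoc[symmetric])
    qed
    then obtain B where B: "B \<in> elemgrp" "\<forall>s\<in>S. unit_col p (B ** A) s" "int p dvd (B ** A)$k$k - 1" by blast
    let ?M = "B ** A"
    obtain C where C: "C \<in> elemgrp" "\<And>a b. (C ** ?M)$a$b = ?M$a$b - (if a \<in> UNIV - {k} then ?M$a$k * ?M$k$b else 0)"
      using clear_column[of k "UNIV - {k}" ?M] by auto
    have "int p dvd det (C ** ?M) - 1" using less.prems(1) by (simp add: det_mul elemgrp_det C(1) B(1))
    moreover have "unit_col p (C ** ?M) s" if "s \<in> insert k S" for s
    proof (cases "s = k")
      case True
      show ?thesis unfolding unit_col_def
      proof
        fix a
        have "?M$a$k - ?M$a$k * ?M$k$k = - (?M$a$k * (?M$k$k - 1))" by (simp add: algebra_simps)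
        thus "int p dvd (C ** ?M)$a$s - (if a = s then 1 else 0)" unfolding C(2) True using B(3) by auto
      qed
    next
      case False
      hence s: "s \<in> S" using that by simp
      have "int p dvd ?M$k$s" using B(2) s k unfolding unit_col_def by (metis diff_zero)
      moreover have "(C ** ?M)$a$s - (if a = s then 1 else 0) = (?M$a$s - (if a = s then 1 else 0)) - (if a \<in> UNIV - {k} then ?M$a$k * ?M$k$s else 0)" for a
        by (simp add: C(2))
      moreover have "int p dvd ?M$a$s - (if a = s then 1 else 0)" for a using B(2) s unfolding unit_col_def by blast
      moreover have "int p dvd (if a \<in> UNIV - {k} then ?M$a$k * ?M$k$s else 0)" for a using calculation(1) by simp
      ultimately show ?thesis unfolding unit_col_def by (metis dvd_diff)
    qed
    moreover have "card (UNIV - insert k S) < card (UNIV - S)"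
      using k by (intro psubset_card_mono) auto
    ultimately obtain D where D: "D \<in> elemgrp" "mcong p (D ** (C ** ?M)) (mat 1)" using less.hyps[of "insert k S" "C ** ?M"] by blast
    have "D ** C ** B \<in> elemgrp" using D C B by (intro elemgrp_mult)
    moreover have "mcong p (D ** C ** B ** A) (mat 1)" using D(2) by (simp add: matrix_mul_assoc)
    ultimately show ?thesis by blast
  qed
qed

lemma elemgrp_mod_prime:
  assumes "prime p" "int p dvd det (A :: int^'n^'n) - 1" shows "\<exists>B\<in>elemgrp. mcong p B A"
proof -
  obtain B where B: "B \<in> elemgrp" "mcong p (B ** A) (mat 1)" using elemgrp_reduce[OF assms(1,2), of "{}"] by auto
  obtain C where C: "C \<in> elemgrp" "C ** B = mat 1" using elemgrp_inverse[OF B(1)] by blast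
  have "mcong p (C ** (B ** A)) (C ** mat 1)" by (intro mcong_mult mcong_refl B)
  hence "mcong p A C" using C by (simp add: matrix_mul_assoc)
  thus ?thesis using C mcong_sym by blast
qed

text \<open>Multiply every parameter of the word for \<open>A\<close> by \<open>c\<close>. The
  result cannot be told from \<open>A\<close> where \<open>c\<close> is 1, nor from the identity
  where \<open>c\<close> is 0. With \<open>c\<close> a Bezout idempotent this separates coprime
  moduli.\<close>

lemma elemgrp_scale:
  assumes "A \<in> elemgrp"
  shows "\<exists>B\<in>elemgrp. (\<forall>m. int m dvd c - 1 \<longrightarrow> mcong m B A) \<and> (\<forall>m. int m dvd c \<longrightarrow> mcong m B (mat 1))"
  using assms
proof (induction rule: elemgrp.induct)
  case elemgrp_one thus ?case using elemgrp.elemgrp_one mcong_refl by blast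
next
  case (elemgrp_step A i j t)
  then obtain B where B: "B \<in> elemgrp" "\<And>m. int m dvd c - 1 \<Longrightarrow> mcong m B A" "\<And>m. int m dvd c \<Longrightarrow> mcong m B (mat 1)" by blast
  have 1: "mcong m (elmat i j (t * c)) (elmat i j t)" if "int m dvd c - 1" for m
  proof -
    have "t * c - t = t * (c - 1)" by (simp add: algebra_simps)
    thus ?thesis using that by (auto simp: mcong_def elmat_def)
  qed
  have 2: "mcong m (elmat i j (t * c)) (mat 1)" if "int m dvd c" for m
    using that by (auto simp: mcong_def elmat_def mat_def)
  have "mcong m (elmat i j (t * c) ** B) (mat 1)" if "int m dvd c" for m
    using mcong_mult[OF 2[OF that] B(3)[OF that]] by simp
  moreover have "mcong m (elmat i j (t * c) ** B) (elmat i j t ** A)" if "int m dvd c - 1" for m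
    using mcong_mult[OF 1[OF that] B(2)[OF that]] .
  moreover have "elmat i j (t * c) ** B \<in> elemgrp" using B elemgrp_step by (intro elemgrp.elemgrp_step)
  ultimately show ?case by blast
qed

text \<open>With \<open>u * int q + v * int (\<Prod>J) = 1\<close>, the first summand is 1 modulo
  the primes of \<open>J\<close> and 0 modulo \<open>q\<close>, the second the other way round.
  Scaling the two given lifts by them and multiplying solves both conditions.\<close>

lemma elemgrp_crt:
  fixes A :: "nat \<Rightarrow> int^'n^'n"
  assumes "finite J" "\<And>p. p \<in> J \<Longrightarrow> prime p" "\<And>p. p \<in> J \<Longrightarrow> int p dvd det (A p) - 1"
  shows "\<exists>B\<in>elemgrp. \<forall>p\<in>J. mcong p B (A p)"
  using assms
proof (induction J rule: finite_induct)
  case empty thus ?case using elemgrp_one by blast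
next
  case (insert q J)
  then obtain B0 where B0: "B0 \<in> elemgrp" "\<And>p. p \<in> J \<Longrightarrow> mcong p B0 (A p)" by auto
  obtain B1 where B1: "B1 \<in> elemgrp" "mcong q B1 (A q)" using elemgrp_mod_prime[of q "A q"] insert by auto
  have "coprime q (\<Prod>J)" using insert by (intro prod_coprime_right primes_coprime) auto
  hence "coprime (int q) (int (\<Prod>J))" by (simp only: coprime_int_iff)
  then obtain u v where uv: "u * int q + v * int (\<Prod>J) = 1" by (metis bezout_int coprime_imp_gcd_eq_1)
  obtain C0 where C0: "C0 \<in> elemgrp" "\<And>m. int m dvd u * int q - 1 \<Longrightarrow> mcong m C0 B0" "\<And>m. int m dvd u * int q \<Longrightarrow> mcong m C0 (mat 1)"
    using elemgrp_scale[OF B0(1), of "u * int q"] by blast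
  obtain C1 where C1: "C1 \<in> elemgrp" "\<And>m. int m dvd v * int (\<Prod>J) - 1 \<Longrightarrow> mcong m C1 B1" "\<And>m. int m dvd v * int (\<Prod>J) \<Longrightarrow> mcong m C1 (mat 1)"
    using elemgrp_scale[OF B1(1), of "v * int (\<Prod>J)"] by blast
  have e: "u * int q - 1 = - (v * int (\<Prod>J))" "v * int (\<Prod>J) - 1 = - (u * int q)" using uv by linarith+
  have "mcong p (C0 ** C1) (A p)" if "p \<in> insert q J" for p
  proof (cases "p = q")
    case True
    have "mcong q (C0 ** C1) (mat 1 ** B1)" by (intro mcong_mult C0(3) C1(2)) (simp_all add: e(2) del: of_nat_prod)
    thus ?thesis using B1(2) True mcong_trans by auto
  next
    case False
    hence pJ: "p \<in> J" using that by simp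
    have "p dvd \<Prod>J" using pJ insert(1) by (intro dvd_prod_eqI[of _ p]) auto
    hence d: "int p dvd int (\<Prod>J)" by (simp only: int_dvd_int_iff)
    have "int p dvd u * int q - 1" "int p dvd v * int (\<Prod>J)" unfolding e using d by simp_all
    hence "mcong p (C0 ** C1) (B0 ** mat 1)" using C0(2)[of p] C1(3)[of p] by (intro mcong_mult)
    thus ?thesis using B0(2)[OF pJ] mcong_trans by auto
  qed
  thus ?case using elemgrp_mult[OF C0(1) C1(1)] by blast
qed

text \<open>The two outer factors are the inverses of the first two, so elementary matrices are
  commutators as soon as a third index exists. This is the source of aperiodicity in
  \<open>reach_all\<close>.\<close>

lemma elem_commutator:
  assumes "i \<noteq> j" "i \<noteq> k" "j \<noteq> k"
  shows "elmat i k t ** elmat k j 1 ** elmat i k (-t) ** elmat k j (-1) = elmat i j t"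
  unfolding matrix_mul_assoc[symmetric] vec_eq_iff elem_mult_left using assms
  by (auto simp: elmat_def)

section \<open>Equidistribution of the random walk modulo primes\<close>

text \<open>The expectation of \<open>f\<close> after \<open>k\<close> uniformly random steps from
  \<open>x\<close>, that is, the \<open>k\<close>-th power of the averaging operator.\<close>

primrec walk_avg :: "'s set \<Rightarrow> ('x \<Rightarrow> 's \<Rightarrow> 'x) \<Rightarrow> nat \<Rightarrow> ('x \<Rightarrow> real) \<Rightarrow> 'x \<Rightarrow> real" where
  "walk_avg \<Sigma> \<rho> 0 f x = f x"
| "walk_avg \<Sigma> \<rho> (Suc k) f x = (\<Sum>s\<in>\<Sigma>. walk_avg \<Sigma> \<rho> k f (\<rho> x s)) / real (card \<Sigma>)"

lemma card_words_eq_walk_avg: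
  assumes "finite \<Sigma>"
  shows "real (card {xs. set xs \<subseteq> \<Sigma> \<and> length xs = k \<and> P (foldl \<rho> x xs)}) / real (card \<Sigma>) ^ k
     = walk_avg \<Sigma> \<rho> k (\<lambda>y. if P y then 1 else 0) x"
proof (induction k arbitrary: x)
  case 0
  have "{xs. set xs \<subseteq> \<Sigma> \<and> length xs = 0 \<and> P (foldl \<rho> x xs)} = (if P x then {[]} else {})" by auto
  thus ?case by simp
next
  case (Suc k)
  let ?W = "\<lambda>k x. {xs. set xs \<subseteq> \<Sigma> \<and> length xs = k \<and> P (foldl \<rho> x xs)}"
  have fin: "finite (?W k x)" for x
    by (rule finite_subset[OF _ finite_lists_length_eq[OF assms, of k]]) auto
  have "?W (Suc k) x = (\<Union>s\<in>\<Sigma>. Cons s ` ?W k (\<rho> x s))"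
    by (auto simp: length_Suc_conv image_iff)
  also have "card \<dots> = (\<Sum>s\<in>\<Sigma>. card (Cons s ` ?W k (\<rho> x s)))"
    by (rule card_UN_disjoint) (use assms fin in auto)
  also have "\<dots> = (\<Sum>s\<in>\<Sigma>. card (?W k (\<rho> x s)))" by (simp add: card_image)
  finally have "real (card (?W (Suc k) x)) / real (card \<Sigma>) ^ Suc k
      = (\<Sum>s\<in>\<Sigma>. real (card (?W k (\<rho> x s))) / real (card \<Sigma>) ^ k) / real (card \<Sigma>)"
    by (simp add: sum_divide_distrib mult.commute)
  thus ?case using Suc.IH by simp
qed

context
  fixes \<Sigma> :: "'s set" and \<rho> :: "'x \<Rightarrow> 's \<Rightarrow> 'x" and S :: "'x set"
  assumes fin: "finite \<Sigma>" and ne: "\<Sigma> \<noteq> {}" and finS: "finite S"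
    and cl: "\<And>x s. x \<in> S \<Longrightarrow> s \<in> \<Sigma> \<Longrightarrow> \<rho> x s \<in> S"
    and inj: "\<And>s. s \<in> \<Sigma> \<Longrightarrow> inj_on (\<lambda>x. \<rho> x s) S"
begin

lemma card_pos: "real (card \<Sigma>) > 0" using fin ne by (simp add: card_gt_0_iff)

lemma walk_avg_add: "walk_avg \<Sigma> \<rho> (a + b) f x = walk_avg \<Sigma> \<rho> a (walk_avg \<Sigma> \<rho> b f) x"
  by (induction a arbitrary: x) auto

lemma walk_avg_le: "(\<And>y. y \<in> S \<Longrightarrow> f y \<le> M) \<Longrightarrow> x \<in> S \<Longrightarrow> walk_avg \<Sigma> \<rho> k f x \<le> M"
proof (induction k arbitrary: x)
  case (Suc k)
  have "(\<Sum>s\<in>\<Sigma>. walk_avg \<Sigma> \<rho> k f (\<rho> x s)) \<le> (\<Sum>s\<in>\<Sigma>. M)" using Suc cl by (intro sum_mono) auto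
  thus ?case using card_pos by (simp add: divide_le_eq mult.commute)
qed auto

lemma walk_avg_ge: "(\<And>y. y \<in> S \<Longrightarrow> M \<le> f y) \<Longrightarrow> x \<in> S \<Longrightarrow> M \<le> walk_avg \<Sigma> \<rho> k f x"
proof (induction k arbitrary: x)
  case (Suc k)
  have "(\<Sum>s\<in>\<Sigma>. M) \<le> (\<Sum>s\<in>\<Sigma>. walk_avg \<Sigma> \<rho> k f (\<rho> x s))" using Suc cl by (intro sum_mono) auto
  thus ?case using card_pos by (simp add: le_divide_eq mult.commute)
qed auto

text \<open>The word \<open>xs\<close> alone has probability 1 over a power of
  \<open>card \<Sigma>\<close>, and its endpoint falls short of the bound \<open>M\<close> by the
  stated amount.\<close>

lemma walk_avg_word:
  "set xs \<subseteq> \<Sigma> \<Longrightarrow> x \<in> S \<Longrightarrow> (\<And>y. y \<in> S \<Longrightarrow> f y \<le> M) \<Longrightarrow>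
   walk_avg \<Sigma> \<rho> (length xs) f x \<le> M - (M - f (foldl \<rho> x xs)) / real (card \<Sigma>) ^ length xs"
proof (induction xs arbitrary: x)
  case (Cons s xs)
  let ?c = "real (card \<Sigma>)" and ?w = "walk_avg \<Sigma> \<rho> (length xs) f"
  let ?d = "(M - f (foldl \<rho> (\<rho> x s) xs)) / ?c ^ length xs"
  have s: "s \<in> \<Sigma>" "\<rho> x s \<in> S" using Cons.prems cl by auto
  have "(\<Sum>t\<in>\<Sigma>. ?w (\<rho> x t)) = ?w (\<rho> x s) + (\<Sum>t\<in>\<Sigma> - {s}. ?w (\<rho> x t))"
    using s fin by (simp add: sum.remove)
  also have "\<dots> \<le> (M - ?d) + (\<Sum>t\<in>\<Sigma> - {s}. M)"
    using Cons s cl walk_avg_le by (intro add_mono sum_mono) auto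
  also have "\<dots> = ?c * M - ?d"
    using s fin card_pos by (simp add: of_nat_diff algebra_simps Suc_leI card_gt_0_iff)
  finally have "(\<Sum>t\<in>\<Sigma>. ?w (\<rho> x t)) / ?c \<le> (?c * M - ?d) / ?c" using card_pos by (intro divide_right_mono) auto
  also have "\<dots> = M - (M - f (foldl \<rho> x (s # xs))) / ?c ^ length (s # xs)"
    using card_pos by (simp add: field_simps)
  finally show ?case by simp
qed auto

lemma walk_avg_sum: "(\<Sum>x\<in>S. walk_avg \<Sigma> \<rho> k f x) = (\<Sum>x\<in>S. f x)"
proof (induction k)
  case (Suc k)
  have b: "bij_betw (\<lambda>x. \<rho> x s) S S" if "s \<in> \<Sigma>" for s
    unfolding bij_betw_def using inj[OF that] endo_inj_surj[OF finS _ inj[OF that]] cl that by blast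
  have "(\<Sum>x\<in>S. walk_avg \<Sigma> \<rho> (Suc k) f x) = (\<Sum>x\<in>S. \<Sum>s\<in>\<Sigma>. walk_avg \<Sigma> \<rho> k f (\<rho> x s)) / real (card \<Sigma>)"
    by (simp add: sum_divide_distrib)
  also have "(\<Sum>x\<in>S. \<Sum>s\<in>\<Sigma>. walk_avg \<Sigma> \<rho> k f (\<rho> x s)) = (\<Sum>s\<in>\<Sigma>. \<Sum>x\<in>S. walk_avg \<Sigma> \<rho> k f (\<rho> x s))"
    by (rule sum.swap)
  also have "\<dots> = (\<Sum>s\<in>\<Sigma>. \<Sum>x\<in>S. walk_avg \<Sigma> \<rho> k f x)"
    by (intro sum.cong refl sum.reindex_bij_betw b)
  finally show ?case using Suc card_pos by simp
qed simp

text \<open>Every point reaches a minimum of the current function in exactly \<open>m\<close> steps,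
  so the oscillation shrinks by the factor 1 - \<delta> every \<open>m\<close> steps, with \<delta>
  the probability of a single word. The same \<open>m\<close> for all pairs rules out periodicity.
  Since each step permutes \<open>S\<close>, the sum over \<open>S\<close> is preserved, which
  identifies the limit as the uniform average.\<close>

lemma walk_equidistributed:
  assumes m: "m > 0" "\<And>x y. x \<in> S \<Longrightarrow> y \<in> S \<Longrightarrow> \<exists>xs. length xs = m \<and> set xs \<subseteq> \<Sigma> \<and> foldl \<rho> x xs = y"
    and f: "\<And>x. x \<in> S \<Longrightarrow> 0 \<le> f x" "\<And>x. x \<in> S \<Longrightarrow> f x \<le> 1" and "\<epsilon> > 0"
  shows "\<exists>K. \<forall>k\<ge>K. \<forall>x\<in>S. walk_avg \<Sigma> \<rho> k f x \<le> (\<Sum>y\<in>S. f y) / real (card S) + \<epsilon>"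
proof -
  define \<delta> where "\<delta> = 1 / real (card \<Sigma>) ^ m"
  have "real (card \<Sigma>) \<ge> 1" using card_pos by simp
  hence \<delta>: "0 < \<delta>" "\<delta> \<le> 1" using card_pos by (auto simp: \<delta>_def)
  have osc: "walk_avg \<Sigma> \<rho> (j * m + r) f x - walk_avg \<Sigma> \<rho> (j * m + r) f y \<le> (1 - \<delta>) ^ j"
    if "x \<in> S" "y \<in> S" for x y j r
    using that
  proof (induction j arbitrary: x y)
    case 0
    have "walk_avg \<Sigma> \<rho> r f x \<le> 1" "0 \<le> walk_avg \<Sigma> \<rho> r f y" using 0 f walk_avg_le walk_avg_ge by auto
    thus ?case by simp
  next
    case (Suc j)
    let ?g = "walk_avg \<Sigma> \<rho> (j * m + r) f"
    have S0: "S \<noteq> {}" using Suc.prems by auto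
    obtain x1 where x1: "x1 \<in> S" "\<And>z. z \<in> S \<Longrightarrow> ?g z \<le> ?g x1"
      using Max_in[of "?g ` S"] Max_ge[of "?g ` S"] finS S0 by (smt (verit) empty_is_image finite_imageI imageE imageI)
    obtain y1 where y1: "y1 \<in> S" "\<And>z. z \<in> S \<Longrightarrow> ?g y1 \<le> ?g z"
      using Min_in[of "?g ` S"] Min_le[of "?g ` S"] finS S0 by (smt (verit) empty_is_image finite_imageI imageE imageI)
    obtain xs where xs: "length xs = m" "set xs \<subseteq> \<Sigma>" "foldl \<rho> x xs = y1" using m(2) Suc.prems y1 by blast
    have "walk_avg \<Sigma> \<rho> m ?g x \<le> ?g x1 - (?g x1 - ?g y1) * \<delta>"
      using walk_avg_word[OF xs(2) Suc.prems(1) x1(2)] xs by (simp add: \<delta>_def)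
    moreover have "?g y1 \<le> walk_avg \<Sigma> \<rho> m ?g y" using walk_avg_ge[of "?g y1" ?g y m] y1 Suc.prems by blast
    ultimately have "walk_avg \<Sigma> \<rho> m ?g x - walk_avg \<Sigma> \<rho> m ?g y \<le> (?g x1 - ?g y1) * (1 - \<delta>)"
      by (simp add: algebra_simps)
    also have "\<dots> \<le> (1 - \<delta>) ^ j * (1 - \<delta>)"
      using Suc.IH[OF x1(1) y1(1)] \<delta> by (intro mult_right_mono) auto
    finally show ?case using walk_avg_add[of m "j * m + r" f] by (simp add: add.assoc mult.commute)
  qed
  obtain j0 where j0: "(1 - \<delta>) ^ j0 < \<epsilon>" using real_arch_pow_inv[of \<epsilon> "1 - \<delta>"] \<delta> \<open>\<epsilon> > 0\<close> by auto
  show ?thesis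
  proof (intro exI[of _ "j0 * m"] allI impI ballI)
    fix k x assume k: "k \<ge> j0 * m" and x: "x \<in> S"
    define j where "j = k div m"
    have kj: "k = j * m + k mod m" by (simp add: j_def)
    have "j \<ge> j0" using k m(1) unfolding j_def by (metis div_le_mono nonzero_mult_div_cancel_right not_gr_zero)
    hence "(1 - \<delta>) ^ j \<le> (1 - \<delta>) ^ j0" using \<delta> by (intro power_decreasing) auto
    hence d: "walk_avg \<Sigma> \<rho> k f x - walk_avg \<Sigma> \<rho> k f y \<le> \<epsilon>" if "y \<in> S" for y
      using osc[OF x that, of j "k mod m"] j0 kj by simp
    have cS: "real (card S) > 0" using x finS by (auto simp: card_gt_0_iff)
    have "real (card S) * walk_avg \<Sigma> \<rho> k f x = (\<Sum>y\<in>S. (walk_avg \<Sigma> \<rho> k f x - walk_avg \<Sigma> \<rho> k f y)) + (\<Sum>y\<in>S. f y)"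
      using walk_avg_sum[of k f] by (simp add: sum_subtractf)
    also have "(\<Sum>y\<in>S. (walk_avg \<Sigma> \<rho> k f x - walk_avg \<Sigma> \<rho> k f y)) \<le> (\<Sum>y\<in>S. \<epsilon>)" using d by (intro sum_mono)
    finally show "walk_avg \<Sigma> \<rho> k f x \<le> (\<Sum>y\<in>S. f y) / real (card S) + \<epsilon>"
      using cS by (simp add: field_simps)
  qed
qed

end

section \<open>Matrices over the prime field, represented by integers\<close>

lemma card_vec:
  fixes T :: "'n::finite \<Rightarrow> 'a set"
  shows "card {v :: 'a^'n. \<forall>i. v$i \<in> T i} = (\<Prod>i\<in>UNIV. card (T i))"
    and "(\<And>i. finite (T i)) \<Longrightarrow> finite {v :: 'a^'n. \<forall>i. v$i \<in> T i}"
proof -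
  have b: "bij_betw vec_lambda (PiE UNIV T) {v :: 'a^'n. \<forall>i. v$i \<in> T i}"
    by (rule bij_betw_byWitness[where f' = vec_nth]) (auto simp: PiE_iff)
  show "card {v :: 'a^'n. \<forall>i. v$i \<in> T i} = (\<Prod>i\<in>UNIV. card (T i))"
    using bij_betw_same_card[OF b] by (simp add: card_PiE)
  show "finite {v :: 'a^'n. \<forall>i. v$i \<in> T i}" if "\<And>i. finite (T i)"
    using bij_betw_finite[OF b] that by (simp add: finite_PiE)
qed

text \<open>Matrices over the field with \<open>p\<close> elements are represented by their least
  nonnegative entries, so that \<open>p\<close> can vary without any change of type.\<close>

definition Mp :: "nat \<Rightarrow> (int^'n^'n) set" where
  "Mp p = {A. \<forall>i j. A$i$j \<in> {0..<int p}}"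

definition SLp :: "nat \<Rightarrow> (int^'n^'n) set" where
  "SLp p = {A\<in>Mp p. int p dvd det A - 1}"

definition red :: "nat \<Rightarrow> int^'n^'n \<Rightarrow> int^'n^'n" where
  "red p A = (\<chi> i j. A$i$j mod int p)"

lemma finite_Mp: "finite (Mp p :: (int^'n^'n) set)"
proof -
  have "Mp p = {A :: int^'n^'n. \<forall>i. A$i \<in> {v. \<forall>j. v$j \<in> {0..<int p}}}" by (auto simp: Mp_def)
  thus ?thesis using card_vec(2)[of "\<lambda>i. {v :: int^'n. \<forall>j. v$j \<in> {0..<int p}}"] card_vec(2)[of "\<lambda>j. {0..<int p}"] by simp
qed

lemma card_Mp: "card (Mp p :: (int^'n^'n) set) = p ^ (CARD('n) * CARD('n))"
proof -
  have "Mp p = {A :: int^'n^'n. \<forall>i. A$i \<in> {v. \<forall>j. v$j \<in> {0..<int p}}}" by (auto simp: Mp_def)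
  thus ?thesis by (simp only: card_vec) (simp add: power_mult)
qed

lemma finite_SLp: "finite (SLp p)" by (rule finite_subset[OF _ finite_Mp]) (auto simp: SLp_def)

lemma red_mcong: "mcong p (red p A) A"
  by (simp add: mcong_def red_def mod_eq_dvd_iff[symmetric])

lemma red_Mp: "p > 0 \<Longrightarrow> red p A \<in> Mp p" by (simp add: Mp_def red_def)

lemma red_eq_iff: "red p A = red p B \<longleftrightarrow> mcong p A B"
  by (simp add: mcong_def red_def vec_eq_iff mod_eq_dvd_iff)

lemma red_id: "A \<in> Mp p \<Longrightarrow> red p A = A"
  by (simp add: Mp_def red_def vec_eq_iff)

lemma red_SLp: assumes "p > 0" "int p dvd det A - 1" shows "red p A \<in> SLp p"
proof -
  have "int p dvd det (red p A) - det A" by (rule mcong_det[OF red_mcong])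
  hence "int p dvd det (red p A) - 1" using assms(2) dvd_add by fastforce
  thus ?thesis using red_Mp assms by (auto simp: SLp_def)
qed

lemma foldl_mat_mult: "foldl (**) A xs = A ** foldl (**) (mat 1) xs" for A :: "int^'n^'n"
proof (induction xs arbitrary: A)
  case (Cons x xs)
  show ?case using Cons[of "A ** x"] Cons[of x] by (simp add: matrix_mul_assoc)
qed simp

definition wp :: "(int^'n^'n) list \<Rightarrow> int^'n^'n" where "wp xs = foldl (**) (mat 1) xs"

lemma wp_append: "wp (xs @ ys) = wp xs ** wp ys" by (simp add: wp_def foldl_mat_mult[of "foldl _ _ _"])
lemma wp_Cons: "wp (x # xs) = x ** wp xs" by (simp add: wp_def foldl_mat_mult[of x])
lemma wp_Nil [simp]: "wp [] = mat 1" by (simp add: wp_def)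

section \<open>The walk modulo a finite set of primes\<close>

context
  fixes \<Sigma> :: "(int^'n^'n) set" and J :: "nat set"
  assumes n3: "CARD('n) \<ge> 3" and fin: "finite \<Sigma>" and sub: "\<Sigma> \<subseteq> SLZ" and gen: "gen_by \<Sigma> = SLZ"
    and J: "finite J" "\<And>p. p \<in> J \<Longrightarrow> prime p"
begin

definition cgJ :: "int^'n^'n \<Rightarrow> int^'n^'n \<Rightarrow> bool" (infix "\<sim>" 50) where
  "A \<sim> B \<longleftrightarrow> (\<forall>p\<in>J. mcong p A B)"

lemma cgJ_refl: "A \<sim> A" unfolding cgJ_def using mcong_refl by blast
lemma cgJ_sym: "A \<sim> B \<Longrightarrow> B \<sim> A" unfolding cgJ_def using mcong_sym by blast
lemma cgJ_trans [trans]: "A \<sim> B \<Longrightarrow> B \<sim> C \<Longrightarrow> A \<sim> C"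
  unfolding cgJ_def by (auto intro: mcong_trans[of _ A B C])
lemma cgJ_mult: "A \<sim> B \<Longrightarrow> C \<sim> D \<Longrightarrow> A ** C \<sim> B ** D"
  unfolding cgJ_def by (auto intro: mcong_mult)

definition st :: "int^'n^'n \<Rightarrow> nat \<Rightarrow> int^'n^'n" where "st A = (\<lambda>p\<in>J. red p A)"

abbreviation "SS \<equiv> PiE J SLp :: (nat \<Rightarrow> int^'n^'n) set"

lemma st_eq_iff: "st A = st B \<longleftrightarrow> A \<sim> B"
proof
  assume "st A = st B"
  hence "st A p = st B p" for p by simp
  thus "A \<sim> B" unfolding cgJ_def red_eq_iff[symmetric] st_def by (metis restrict_apply')
next
  assume "A \<sim> B"
  thus "st A = st B" unfolding cgJ_def red_eq_iff[symmetric] st_def by (intro restrict_ext) blast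
qed

lemma p_pos: "p \<in> J \<Longrightarrow> p > 0" using J prime_gt_0_nat by blast

lemma st_in: "det A = 1 \<Longrightarrow> st A \<in> SS"
  unfolding st_def by (intro restrict_PiE_iff[THEN iffD2] ballI red_SLp p_pos) auto

lemma st_surj: assumes "x \<in> SS" shows "\<exists>B\<in>elemgrp. st B = x"
proof -
  have "int p dvd det (x p) - 1" if "p \<in> J" for p using assms that by (auto simp: SLp_def PiE_iff)
  then obtain B where B: "B \<in> elemgrp" "\<And>p. p \<in> J \<Longrightarrow> mcong p B (x p)"
    using elemgrp_crt[OF J, of x] by blast
  have "st B p = x p" for p
  proof (cases "p \<in> J")
    case True
    hence "red p B = red p (x p)" using B red_eq_iff by blast
    also have "\<dots> = x p" using assms True by (intro red_id) (auto simp: SLp_def PiE_iff)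
    finally show ?thesis using True by (simp add: st_def)
  next
    case False
    thus ?thesis using PiE_arb[OF assms False] by (simp add: st_def)
  qed
  thus ?thesis using B by blast
qed

lemma finSS: "finite SS" using J finite_SLp by (intro finite_PiE) auto

lemma inverse_mod: assumes "det A = 1" shows "\<exists>B\<in>elemgrp. A ** B \<sim> mat 1 \<and> B ** A \<sim> mat 1"
proof -
  obtain C where C: "C \<in> elemgrp" "C \<sim> A" using st_surj[OF st_in[OF assms]] st_eq_iff by blast
  obtain B where B: "B \<in> elemgrp" "C ** B = mat 1" "B ** C = mat 1" using elemgrp_inverse[OF C(1)] by blast
  have "A ** B \<sim> C ** B" "B ** A \<sim> B ** C" using C cgJ_sym by (intro cgJ_mult cgJ_refl; blast)+
  thus ?thesis using B by auto
qed

lemma det_wp: "set xs \<subseteq> \<Sigma> \<Longrightarrow> det (wp xs) = 1"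
proof (induction xs)
  case (Cons x xs)
  have "det x = 1" using Cons.prems sub by (auto simp: SLZ_def)
  thus ?case using Cons unfolding wp_Cons by (simp add: det_mul)
qed simp

lemma Sigma_ne: "\<Sigma> \<noteq> {}"
proof
  assume e: "\<Sigma> = {}"
  have "x = mat 1" if "x \<in> gen_by \<Sigma>" for x using that e by (induction rule: gen_by.induct) auto
  moreover have "\<not> CARD('n) \<le> Suc 0" using n3 by simp
  then obtain i j :: 'n where ij: "i \<noteq> j" using card_le_Suc0_iff_eq[of "UNIV :: 'n set"] by auto
  have "elmat i j 1 \<in> gen_by \<Sigma>" using elemgrp_elem[OF ij] elemgrp_SLZ gen by blast
  ultimately have "elmat i j 1 = mat 1" by blast
  hence "elmat i j 1 $ i $ j = mat 1 $ i $ j" by simp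
  thus False using ij by (simp add: elmat_def mat_def)
qed

text \<open>Modulo \<open>J\<close> only finitely many states exist, so each generator has a finite
  order; the product over \<Sigma> is a common exponent. It allows positive words to imitate
  inverses.\<close>

lemma sigma_order: "\<exists>e>0. \<forall>s\<in>\<Sigma>. wp (replicate e s) \<sim> mat 1"
proof -
  have "\<exists>e>0. wp (replicate e s) \<sim> mat 1" if s: "s \<in> \<Sigma>" for s
  proof -
    have d: "det (wp (replicate k s)) = 1" for k using s by (intro det_wp) auto
    have "\<not> inj (\<lambda>k. st (wp (replicate k s)))"
    proof
      assume "inj (\<lambda>k. st (wp (replicate k s)))"
      hence "infinite (range (\<lambda>k. st (wp (replicate k s))))" using range_inj_infinite by blast
      moreover have "range (\<lambda>k. st (wp (replicate k s))) \<subseteq> SS" using d st_in by blast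
      ultimately show False using finSS finite_subset by blast
    qed
    then obtain a b where ab: "a < b" "wp (replicate a s) \<sim> wp (replicate b s)"
      unfolding inj_def st_eq_iff by (metis cgJ_sym nat_neq_iff)
    obtain B where B: "B ** wp (replicate a s) \<sim> mat 1" using inverse_mod[OF d[of a]] by blast
    have "replicate b s = replicate a s @ replicate (b - a) s" using ab(1) by (simp add: replicate_add[symmetric])
    hence "wp (replicate b s) = wp (replicate a s) ** wp (replicate (b - a) s)" by (simp only: wp_append)
    hence eq: "B ** wp (replicate b s) = (B ** wp (replicate a s)) ** wp (replicate (b - a) s)" by (simp add: matrix_mul_assoc)
    have "mat 1 ** wp (replicate (b - a) s) \<sim> (B ** wp (replicate a s)) ** wp (replicate (b - a) s)"
      by (intro cgJ_mult cgJ_refl cgJ_sym[OF B])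
    also have "\<dots> \<sim> B ** wp (replicate a s)" unfolding eq[symmetric] by (intro cgJ_mult cgJ_refl cgJ_sym[OF ab(2)])
    also note B
    finally show ?thesis using ab(1) by (intro exI[of _ "b - a"]) auto
  qed
  then obtain f where f: "\<And>s. s \<in> \<Sigma> \<Longrightarrow> f s > 0 \<and> wp (replicate (f s) s) \<sim> mat 1" by metis
  have mul: "wp (replicate (a * c) s) \<sim> mat 1" if "wp (replicate a s) \<sim> mat 1" for a c s
  proof (induction c)
    case (Suc c)
    have "replicate (a * Suc c) s = replicate a s @ replicate (a * c) s" by (simp add: replicate_add[symmetric])
    hence "wp (replicate (a * Suc c) s) = wp (replicate a s) ** wp (replicate (a * c) s)" by (simp only: wp_append)
    also have "\<dots> \<sim> mat 1 ** mat 1" by (intro cgJ_mult that Suc)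
    finally show ?case by simp
  qed (simp add: cgJ_refl)
  show ?thesis
  proof (intro exI[of _ "prod f \<Sigma>"] conjI ballI)
    show "prod f \<Sigma> > 0" using f by (simp add: prod_pos)
    fix s assume s: "s \<in> \<Sigma>"
    have "prod f \<Sigma> = f s * prod f (\<Sigma> - {s})" using s fin by (simp add: prod.remove)
    thus "wp (replicate (prod f \<Sigma>) s) \<sim> mat 1" using mul f[OF s] by simp
  qed
qed

definition reach :: "nat \<Rightarrow> int^'n^'n \<Rightarrow> bool" where
  "reach k g \<longleftrightarrow> (\<exists>xs. length xs = k \<and> set xs \<subseteq> \<Sigma> \<and> wp xs \<sim> g)"

lemma reach_mult: assumes "reach k g" "reach l h" shows "reach (k + l) (g ** h)"
proof -
  obtain xs ys where "length xs = k" "set xs \<subseteq> \<Sigma>" "wp xs \<sim> g" "length ys = l" "set ys \<subseteq> \<Sigma>" "wp ys \<sim> h"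
    using assms unfolding reach_def by blast
  thus ?thesis unfolding reach_def by (intro exI[of _ "xs @ ys"]) (simp add: wp_append cgJ_mult)
qed

lemma reach_cong: "reach k g \<Longrightarrow> g \<sim> h \<Longrightarrow> reach k h"
  unfolding reach_def using cgJ_trans by blast

text \<open>The difficulty is a common length. As each generator is inverted by its power e - 1, a
  matrix reached in \<open>k\<close> steps has its inverse reached in (e - 1) k steps, and a
  commutator is reached in a multiple of \<open>e\<close> steps. Elementary matrices are
  commutators, so every member of \<open>elemgrp\<close> is reached in a multiple of
  \<open>e\<close> steps, and appending the power \<open>e\<close> of a generator brings all lengths
  to the same multiple.\<close>

lemma reach_all: "\<exists>m>0. \<forall>B\<in>elemgrp. reach m B"
proof -
  obtain e where e: "e > 0" "\<And>s. s \<in> \<Sigma> \<Longrightarrow> wp (replicate e s) \<sim> mat 1" using sigma_order by blast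
  obtain s0 where s0: "s0 \<in> \<Sigma>" using Sigma_ne by blast
  have re: "reach e (mat 1)" unfolding reach_def using e s0 by (intro exI[of _ "replicate e s0"]) auto
  have sr: "s ** wp (replicate (e - 1) s) \<sim> mat 1" if "s \<in> \<Sigma>" for s
    using e(2)[OF that] e(1) by (cases e) (auto simp: wp_Cons)
  have gw: "\<exists>k. reach k g" if "g \<in> gen_by \<Sigma>" for g
    using that
  proof (induction rule: gen_by.induct)
    case gen_one thus ?case using re by blast
  next
    case (gen_mult x s)
    have "reach 1 s" unfolding reach_def using gen_mult by (intro exI[of _ "[s]"]) (auto simp: cgJ_refl wp_Cons)
    thus ?case using gen_mult reach_mult by blast
  next
    case (gen_inv x s y)
    have "y ** (s ** wp (replicate (e - 1) s)) \<sim> y ** mat 1" using gen_inv sr by (intro cgJ_mult cgJ_refl) auto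
    hence "wp (replicate (e - 1) s) \<sim> y" using gen_inv by (simp add: matrix_mul_assoc)
    hence "reach (e - 1) y" unfolding reach_def using gen_inv by (intro exI[of _ "replicate (e - 1) s"]) auto
    thus ?case using gen_inv reach_mult by blast
  qed
  have winv: "\<exists>ys. length ys = (e - 1) * length xs \<and> set ys \<subseteq> \<Sigma> \<and> wp xs ** wp ys \<sim> mat 1" if "set xs \<subseteq> \<Sigma>" for xs
    using that
  proof (induction xs)
    case Nil thus ?case by (simp add: cgJ_refl)
  next
    case (Cons s xs)
    then obtain ys where ys: "length ys = (e - 1) * length xs" "set ys \<subseteq> \<Sigma>" "wp xs ** wp ys \<sim> mat 1" by auto
    let ?r = "replicate (e - 1) s"
    have "wp (s # xs) ** wp (ys @ ?r) = s ** (wp xs ** wp ys) ** wp ?r"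
      unfolding wp_append wp_Cons by (simp add: matrix_mul_assoc)
    also have "\<dots> \<sim> s ** mat 1 ** wp ?r" by (intro cgJ_mult cgJ_refl ys)
    also have "s ** mat 1 ** wp ?r = s ** wp ?r" by simp
    also have "\<dots> \<sim> mat 1" using sr Cons.prems by auto
    finally show ?case using ys Cons.prems by (intro exI[of _ "ys @ ?r"]) auto
  qed
  have inv: "reach ((e - 1) * k) h" if gk: "reach k g" and gh: "h ** g = mat 1" for g h k
  proof -
    obtain xs where xs: "length xs = k" "set xs \<subseteq> \<Sigma>" "wp xs \<sim> g" using gk unfolding reach_def by blast
    obtain ys where ys: "length ys = (e - 1) * k" "set ys \<subseteq> \<Sigma>" "wp xs ** wp ys \<sim> mat 1" using winv[OF xs(2)] xs(1) by auto
    have "wp ys = h ** (g ** wp ys)" using gh by (simp add: matrix_mul_assoc)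
    also have "\<dots> \<sim> h ** (wp xs ** wp ys)" by (intro cgJ_mult cgJ_refl cgJ_sym[OF xs(3)])
    also have "\<dots> \<sim> h ** mat 1" by (intro cgJ_mult cgJ_refl ys)
    finally show ?thesis unfolding reach_def using ys by auto
  qed
  have comm: "\<exists>c. reach (e * c) (g ** h ** g' ** h')" if gh: "g \<in> SLZ" "h \<in> SLZ" "g' ** g = mat 1" "h' ** h = mat 1" for g h g' h'
  proof -
    obtain k l where kl: "reach k g" "reach l h" using gw[of g] gw[of h] gh(1,2) gen by blast
    have "reach (k + l + (e - 1) * k + (e - 1) * l) (g ** h ** g' ** h')"
      by (intro reach_mult kl inv[OF kl(1) gh(3)] inv[OF kl(2) gh(4)])
    moreover have "k + l + (e - 1) * k + (e - 1) * l = e * (k + l)" using e(1) by (cases e) (auto simp: algebra_simps)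
    ultimately show ?thesis by auto
  qed
  have el: "\<exists>c. reach (e * c) (elmat i j t)" if ij: "i \<noteq> j" for i j :: 'n and t
  proof -
    have "card {i, j} < CARD('n)" using n3 by (simp add: card_insert_if)
    then obtain k where k: "k \<noteq> i" "k \<noteq> j" by (metis (full_types) UNIV_eq_I insertCI less_irrefl)
    have "\<exists>c. reach (e * c) (elmat i k t ** elmat k j 1 ** elmat i k (-t) ** elmat k j (-1))"
    proof (rule comm)
      show "elmat i k t \<in> SLZ" "elmat k j 1 \<in> SLZ"
        using k by (auto intro!: subsetD[OF elemgrp_SLZ] elemgrp_elem)
    qed (use k in \<open>auto simp: elem_mult_elem elem_0\<close>)
    thus ?thesis using elem_commutator[of i j k t] ij k by auto
  qed
  have all: "\<exists>c. reach (e * c) B" if "B \<in> elemgrp" for B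
    using that
  proof (induction rule: elemgrp.induct)
    case elemgrp_one thus ?case using re by (intro exI[of _ 1]) simp
  next
    case (elemgrp_step A i j t)
    then obtain c d where "reach (e * c) (elmat i j t)" "reach (e * d) A" using el by blast
    hence "reach (e * (c + d)) (elmat i j t ** A)" using reach_mult by (simp add: distrib_left)
    thus ?case by blast
  qed
  have mono: "reach (e * (c + d)) g" if "reach (e * c) g" for c d g
  proof (induction d)
    case (Suc d)
    have "reach (e * (c + d) + e) (g ** mat 1)" by (intro reach_mult Suc re)
    thus ?case by (simp add: algebra_simps)
  qed (use that in simp)
  have "\<exists>c. \<forall>B\<in>elemgrp. st B = x \<longrightarrow> reach (e * c) B" if x: "x \<in> SS" for x
  proof -
    obtain B where B: "B \<in> elemgrp" "st B = x" using st_surj[OF x] by blast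
    obtain c where c: "reach (e * c) B" using all[OF B(1)] by blast
    have "reach (e * c) B'" if "st B' = x" for B' using reach_cong[OF c] that B(2) st_eq_iff by metis
    thus ?thesis by blast
  qed
  then obtain c where c: "\<And>x B. x \<in> SS \<Longrightarrow> B \<in> elemgrp \<Longrightarrow> st B = x \<Longrightarrow> reach (e * c x) B" by metis
  \<comment> \<open>Lengths are chosen once per residue class, of which there are finitely many.
    \<open>Suc C\<close> keeps the common length positive even if all of them are 0.\<close>
  define C where "C = (\<Sum>x\<in>SS. c x)"
  have "reach (e * Suc C) B" if B: "B \<in> elemgrp" for B
  proof -
    have x: "st B \<in> SS" using st_in elemgrp_det B by blast
    have "c (st B) \<le> C" unfolding C_def using finSS x by (intro member_le_sum) auto
    hence "Suc C = c (st B) + (Suc C - c (st B))" by simp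
    thus ?thesis using mono[OF c[OF x B refl]] by metis
  qed
  thus ?thesis using e(1) by (intro exI[of _ "e * Suc C"]) auto
qed

definition step :: "(nat \<Rightarrow> int^'n^'n) \<Rightarrow> int^'n^'n \<Rightarrow> nat \<Rightarrow> int^'n^'n" where
  "step x s = (\<lambda>p\<in>J. red p (x p ** s))"

lemma step_st: "step (st A) s = st (A ** s)"
proof -
  have "red p (red p A ** s) = red p (A ** s)" for p
    unfolding red_eq_iff by (intro mcong_mult mcong_refl red_mcong)
  thus ?thesis by (auto simp: step_def st_def fun_eq_iff)
qed

lemma foldl_step: "foldl step (st A) xs = st (A ** wp xs)"
proof (induction xs arbitrary: A)
  case (Cons x xs)
  thus ?case by (simp only: foldl_Cons step_st wp_Cons matrix_mul_assoc)
qed simp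

lemma walk_mod:
  assumes T: "T \<subseteq> SS" and "\<epsilon> > 0"
  shows "\<exists>K. \<forall>k\<ge>K. walk_prob \<Sigma> k (\<lambda>X. st X \<in> T) \<le> real (card T) / real (card SS) + \<epsilon>"
proof -
  obtain m where m: "m > 0" "\<And>B. B \<in> elemgrp \<Longrightarrow> reach m B" using reach_all by blast
  let ?f = "\<lambda>y. if y \<in> T then 1 else 0 :: real"
  have "\<exists>K. \<forall>k\<ge>K. \<forall>x\<in>SS. walk_avg \<Sigma> step k ?f x \<le> (\<Sum>y\<in>SS. ?f y) / real (card SS) + \<epsilon>"
  proof (rule walk_equidistributed[OF fin Sigma_ne finSS _ _ m(1)])
    fix x s assume "x \<in> SS" "s \<in> \<Sigma>"
    then obtain A where "A \<in> elemgrp" "st A = x" using st_surj by blast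
    moreover have "det s = 1" using sub \<open>s \<in> \<Sigma>\<close> by (auto simp: SLZ_def)
    hence "det (A ** s) = 1" using elemgrp_det[OF \<open>A \<in> elemgrp\<close>] by (simp add: det_mul)
    ultimately show "step x s \<in> SS" using st_in step_st by metis
  next
    fix s assume s: "s \<in> \<Sigma>"
    have "det s = 1" using s sub by (auto simp: SLZ_def)
    then obtain V where V: "s ** V \<sim> mat 1" using inverse_mod by blast
    show "inj_on (\<lambda>x. step x s) SS"
    proof (rule inj_onI)
      fix x y assume "x \<in> SS" "y \<in> SS" and eq: "step x s = step y s"
      then obtain A B where AB: "st A = x" "st B = y" using st_surj by meson
      have "A ** s \<sim> B ** s" using eq unfolding AB[symmetric] step_st st_eq_iff .
      hence 1: "A ** s ** V \<sim> B ** s ** V" by (rule cgJ_mult[OF _ cgJ_refl])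
      have "A ** mat 1 \<sim> A ** (s ** V)" by (intro cgJ_mult cgJ_refl cgJ_sym[OF V])
      also have "A ** (s ** V) \<sim> B ** (s ** V)" using 1 by (simp add: matrix_mul_assoc)
      also have "B ** (s ** V) \<sim> B ** mat 1" by (intro cgJ_mult cgJ_refl V)
      finally show "x = y" using AB st_eq_iff by auto
    qed
  next
    fix x y assume "x \<in> SS" "y \<in> SS"
    then obtain A B where A: "A \<in> elemgrp" "st A = x" and B: "B \<in> elemgrp" "st B = y" using st_surj by meson
    obtain A' where A': "A' \<in> elemgrp" "A ** A' = mat 1" using elemgrp_inverse[OF A(1)] by blast
    obtain xs where xs: "length xs = m" "set xs \<subseteq> \<Sigma>" "wp xs \<sim> A' ** B"
      using m(2)[OF elemgrp_mult[OF A'(1) B(1)]] unfolding reach_def by blast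
    have "A ** wp xs \<sim> A ** (A' ** B)" by (intro cgJ_mult cgJ_refl xs)
    also have "A ** (A' ** B) = B" using A' by (simp add: matrix_mul_assoc)
    finally have "foldl step x xs = y" unfolding A(2)[symmetric] B(2)[symmetric] foldl_step st_eq_iff .
    thus "\<exists>xs. length xs = m \<and> set xs \<subseteq> \<Sigma> \<and> foldl step x xs = y" using xs by blast
  qed (use assms in auto)
  then obtain K where K: "\<And>k x. k \<ge> K \<Longrightarrow> x \<in> SS \<Longrightarrow> walk_avg \<Sigma> step k ?f x \<le> (\<Sum>y\<in>SS. ?f y) / real (card SS) + \<epsilon>" by blast
  have "(\<Sum>y\<in>SS. ?f y) = real (card T)"
    using T finSS by (simp add: sum.If_cases Int_absorb1)
  moreover have "walk_prob \<Sigma> k (\<lambda>X. st X \<in> T) = walk_avg \<Sigma> step k ?f (st (mat 1))" for k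
    unfolding walk_prob_def card_words_eq_walk_avg[OF fin, symmetric] foldl_step wp_def by simp
  moreover have "st (mat 1) \<in> SS" by (rule st_in) simp
  ultimately show ?thesis using K by metis
qed

text \<open>Independence of the primes: the states form the full product of the groups
  \<open>SLp p\<close>, so the proportion of states avoiding every \<open>G p\<close> is a product
  of proportions.\<close>

lemma walk_avoids_product:
  assumes G: "\<And>p. p \<in> J \<Longrightarrow> G p \<subseteq> SLp p" and c: "\<And>p. p \<in> J \<Longrightarrow> real (card (G p)) \<ge> c * real (card (SLp p :: (int^'n^'n) set))"
    and "\<epsilon> > 0"
  shows "\<exists>K. \<forall>k\<ge>K. walk_prob \<Sigma> k (\<lambda>X. \<forall>p\<in>J. red p X \<notin> G p) \<le> (1 - c) ^ card J + \<epsilon>"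
proof -
  let ?T = "PiE J (\<lambda>p. SLp p - G p) :: (nat \<Rightarrow> int^'n^'n) set"
  have T: "?T \<subseteq> SS" by (intro PiE_mono) auto
  obtain K where K: "\<And>k. k \<ge> K \<Longrightarrow> walk_prob \<Sigma> k (\<lambda>X. st X \<in> ?T) \<le> real (card ?T) / real (card SS) + \<epsilon>"
    using walk_mod[OF T \<open>\<epsilon> > 0\<close>] by blast
  have pos: "card (SLp p :: (int^'n^'n) set) > 0" if "p \<in> J" for p
    using red_SLp[OF p_pos[OF that], of "mat 1 :: int^'n^'n"] finite_SLp card_gt_0_iff by fastforce
  have "real (card ?T) / real (card SS) = (\<Prod>p\<in>J. real (card (SLp p - G p :: (int^'n^'n) set)) / real (card (SLp p :: (int^'n^'n) set)))"
    using J by (simp add: card_PiE prod_dividef)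
  also have "\<dots> \<le> (\<Prod>p\<in>J. 1 - c)"
  proof (rule prod_mono)
    fix p assume p: "p \<in> J"
    have "real (card (SLp p - G p :: (int^'n^'n) set)) = real (card (SLp p :: (int^'n^'n) set)) - real (card (G p))"
      using card_Diff_subset[OF finite_subset[OF G[OF p] finite_SLp] G[OF p]] card_mono[OF finite_SLp G[OF p]] by simp
    hence "real (card (SLp p - G p :: (int^'n^'n) set)) \<le> (1 - c) * real (card (SLp p :: (int^'n^'n) set))"
      using c[OF p] by (simp add: algebra_simps)
    thus "0 \<le> real (card (SLp p - G p :: (int^'n^'n) set)) / real (card (SLp p :: (int^'n^'n) set)) \<and>
        real (card (SLp p - G p :: (int^'n^'n) set)) / real (card (SLp p :: (int^'n^'n) set)) \<le> 1 - c"
      using pos[OF p] by (simp add: divide_le_eq)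
  qed
  finally have le: "real (card ?T) / real (card SS) \<le> (1 - c) ^ card J" by simp
  have "walk_prob \<Sigma> k (\<lambda>X. \<forall>p\<in>J. red p X \<notin> G p) = walk_prob \<Sigma> k (\<lambda>X. st X \<in> ?T)" for k
  proof -
    have "(\<forall>p\<in>J. red p (wp xs) \<notin> G p) = (st (wp xs) \<in> ?T)" if "set xs \<subseteq> \<Sigma>" for xs
      using st_in[OF det_wp[OF that]] by (auto simp: st_def PiE_iff)
    hence "{xs. set xs \<subseteq> \<Sigma> \<and> length xs = k \<and> (\<forall>p\<in>J. red p (wp xs) \<notin> G p)} = {xs. set xs \<subseteq> \<Sigma> \<and> length xs = k \<and> st (wp xs) \<in> ?T}"
      by blast
    thus ?thesis unfolding walk_prob_def wp_def by simp
  qed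
  note eq = this
  show ?thesis
  proof (intro exI[of _ K] allI impI)
    fix k assume "k \<ge> K"
    thus "walk_prob \<Sigma> k (\<lambda>X. \<forall>p\<in>J. red p X \<notin> G p) \<le> (1 - c) ^ card J + \<epsilon>"
      using K[of k] le eq[of k] by linarith
  qed
qed

end

section \<open>Counting polynomials of given factorisation type\<close>

abbreviation cpoly :: "int poly \<Rightarrow> complex poly" where "cpoly \<equiv> map_poly of_int"

definition fpoly :: "nat \<Rightarrow> (nat \<Rightarrow> int) \<Rightarrow> int poly" where
  "fpoly n c = monom 1 n + (\<Sum>i<n. monom (c i) i)"

lemma coeff_fpoly: "coeff (fpoly n c) i = (if i < n then c i else if i = n then 1 else 0)"
  by (auto simp: fpoly_def coeff_sum)

lemma coeff_prod_linear_top: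
  fixes f :: "nat \<Rightarrow> complex"
  shows "coeff (\<Prod>k<n. [:- f k, 1:]) n = 1" "i > n \<Longrightarrow> coeff (\<Prod>k<n. [:- f k, 1:]) i = 0"
proof -
  have d: "degree (\<Prod>k<n. [:- f k, 1:]) = n" by (subst degree_prod_eq_sum_degree) auto
  have "lead_coeff (\<Prod>k<n. [:- f k, 1:]) = 1" by (simp add: lead_coeff_prod)
  thus "coeff (\<Prod>k<n. [:- f k, 1:]) n = 1" by (simp add: d)
  show "i > n \<Longrightarrow> coeff (\<Prod>k<n. [:- f k, 1:]) i = 0" using d by (simp add: coeff_eq_0)
qed

context prime_pair
begin

lemma coeff_prod_R: "finite I \<Longrightarrow> (\<And>i. i \<in> I \<Longrightarrow> f i \<in> R) \<Longrightarrow> coeff (\<Prod>i\<in>I. [:- f i, 1:]) k \<in> R"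
  by (rule coeff_prod_linear_in) (use R0 R1 R_diff R_mult in auto)

lemma coeff_prod_cong:
  assumes "finite I" "\<And>i. i \<in> I \<Longrightarrow> f i \<in> R" "\<And>i. i \<in> I \<Longrightarrow> g i \<in> R" "\<And>i. i \<in> I \<Longrightarrow> f i \<equiv>\<^sub>P g i"
  shows "coeff (\<Prod>i\<in>I. [:- f i, 1:]) k \<equiv>\<^sub>P coeff (\<Prod>i\<in>I. [:- g i, 1:]) k"
  using assms
proof (induction I arbitrary: k rule: finite_induct)
  case empty thus ?case by (simp add: P0)
next
  case (insert v I)
  have IH: "coeff (\<Prod>i\<in>I. [:- f i, 1:]) k \<equiv>\<^sub>P coeff (\<Prod>i\<in>I. [:- g i, 1:]) k" for k
    by (rule insert.IH) (use insert.prems in auto)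
  have gR: "coeff (\<Prod>i\<in>I. [:- g i, 1:]) k \<in> R" for k by (rule coeff_prod_R) (use insert in auto)
  have m: "f v * coeff (\<Prod>i\<in>I. [:- f i, 1:]) k \<equiv>\<^sub>P g v * coeff (\<Prod>i\<in>I. [:- g i, 1:]) k"
    by (rule cg_mult) (use insert.prems IH gR in auto)
  show ?case unfolding prod.insert[OF insert(1,2)] coeff_linear_mult
    by (rule cg_diff[OF _ m]) (use IH P0 in \<open>auto split: nat.split\<close>)
qed

end

context place
begin

lemma frob_diff: assumes "x \<in> R" "y \<in> R" shows "(x - y) ^ p \<equiv>\<^sub>P x ^ p - y ^ p"
proof -
  have "(x - y + y) ^ p \<equiv>\<^sub>P (x - y) ^ p + y ^ p" using assms by (intro frob_add R_diff)
  hence "x ^ p - y ^ p \<equiv>\<^sub>P (x - y) ^ p" by (simp add: algebra_simps)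
  thus ?thesis by (rule cg_sym)
qed

lemma coeff_prod_frob:
  assumes "finite I" "\<And>i. i \<in> I \<Longrightarrow> f i \<in> R"
  shows "coeff (\<Prod>i\<in>I. [:- f i, 1:]) k ^ p \<equiv>\<^sub>P coeff (\<Prod>i\<in>I. [:- (f i ^ p), 1:]) k"
  using assms
proof (induction I arbitrary: k rule: finite_induct)
  case empty
  have "p > 0" using p prime_gt_0_nat by auto
  thus ?case by (cases k) (auto simp: P0 coeff_pCons one_pCons power_0_left)
next
  case (insert v I)
  let ?A = "\<Prod>i\<in>I. [:- f i, 1:]" and ?B = "\<Prod>i\<in>I. [:- (f i ^ p), 1:]"
  have p0: "p > 0" using p prime_gt_0_nat by auto
  have IH: "coeff ?A k ^ p \<equiv>\<^sub>P coeff ?B k" for k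
    by (rule insert.IH) (use insert.prems in auto)
  have AR: "coeff ?A k \<in> R" for k by (rule coeff_prod_R) (use insert in auto)
  have BR: "coeff ?B k \<in> R" for k by (rule coeff_prod_R) (use insert in \<open>auto intro: R_power\<close>)
  have vR: "f v \<in> R" using insert by simp
  have "((case k of 0 \<Rightarrow> 0 | Suc j \<Rightarrow> coeff ?A j) - f v * coeff ?A k) ^ p
     \<equiv>\<^sub>P (case k of 0 \<Rightarrow> 0 | Suc j \<Rightarrow> coeff ?A j) ^ p - (f v * coeff ?A k) ^ p"
    using AR vR R0 by (intro frob_diff R_mult) (auto split: nat.split)
  moreover have "(case k of 0 \<Rightarrow> 0 | Suc j \<Rightarrow> coeff ?A j) ^ p - (f v * coeff ?A k) ^ p
     \<equiv>\<^sub>P (case k of 0 \<Rightarrow> 0 | Suc j \<Rightarrow> coeff ?B j) - f v ^ p * coeff ?B k"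
  proof (rule cg_diff)
    show "(case k of 0 \<Rightarrow> 0 | Suc j \<Rightarrow> coeff ?A j) ^ p \<equiv>\<^sub>P (case k of 0 \<Rightarrow> 0 | Suc j \<Rightarrow> coeff ?B j)"
      using IH P0 p0 by (auto split: nat.split simp: power_0_left)
    show "(f v * coeff ?A k) ^ p \<equiv>\<^sub>P f v ^ p * coeff ?B k"
      unfolding power_mult_distrib using IH vR BR by (intro cg_mult cg_refl R_power) auto
  qed
  ultimately show ?case unfolding prod.insert[OF insert(1,2)] coeff_linear_mult by (rule cg_trans)
qed

text \<open>Frobenius permutes the residues \<beta>, hence fixes the coefficients of the product
  modulo \<open>P\<close>, and \<open>frob_cg_int\<close> places them in the prime field.\<close>

lemma coeff_prod_cg_int:
  fixes n :: nat
  assumes \<beta>: "\<And>k. k < n \<Longrightarrow> \<beta> k \<in> R" and \<pi>: "bij_betw \<pi> {..<n} {..<n}"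
    and fr: "\<And>k. k < n \<Longrightarrow> \<beta> k ^ p \<equiv>\<^sub>P \<beta> (\<pi> k)"
  shows "\<exists>a. 0 \<le> a \<and> a < int p \<and> coeff (\<Prod>k<n. [:- \<beta> k, 1:]) i \<equiv>\<^sub>P of_int a"
proof (rule frob_cg_int)
  show "coeff (\<Prod>k<n. [:- \<beta> k, 1:]) i \<in> R" using \<beta> by (intro coeff_prod_R finite_lessThan) simp
  have "coeff (\<Prod>k<n. [:- \<beta> k, 1:]) i ^ p \<equiv>\<^sub>P coeff (\<Prod>k<n. [:- (\<beta> k ^ p), 1:]) i"
    by (rule coeff_prod_frob) (use \<beta> in auto)
  moreover have "coeff (\<Prod>k<n. [:- (\<beta> k ^ p), 1:]) i \<equiv>\<^sub>P coeff (\<Prod>k<n. [:- \<beta> (\<pi> k), 1:]) i"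
    by (rule coeff_prod_cong) (use \<beta> fr \<pi> bij_betwE in \<open>auto intro!: R_power\<close>, fastforce)
  moreover have "(\<Prod>k<n. [:- \<beta> (\<pi> k), 1:]) = (\<Prod>k<n. [:- \<beta> k, 1:])"
    by (rule prod.reindex_bij_betw[OF \<pi>, of "\<lambda>k. [:- \<beta> k, 1:]"])
  ultimately show "coeff (\<Prod>k<n. [:- \<beta> k, 1:]) i ^ p \<equiv>\<^sub>P coeff (\<Prod>k<n. [:- \<beta> k, 1:]) i"
    using cg_trans[of "coeff (\<Prod>k<n. [:- \<beta> k, 1:]) i ^ p"] by auto
qed

lemma unity_R: assumes "z ^ N = 1" "N > 0" shows "z \<in> R"
proof (rule alg_int_R, rule algebraic_int_root)
  show "poly (monom 1 N) z = 1" using assms by (simp add: poly_monom)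
qed (use assms in \<open>auto simp: degree_monom_eq\<close>)

lemma unity_notP: assumes "z ^ N = 1" "N > 0" shows "z \<notin> P"
proof
  assume "z \<in> P"
  moreover have "z ^ (N - 1) \<in> R" using unity_R[OF assms] by (rule R_power)
  ultimately have "z * z ^ (N - 1) \<in> P" by (rule P_mult')
  thus False using assms P1 by (simp add: power_eq_if)
qed

text \<open>For u = z/w different from 1 the geometric sum of \<open>N\<close> powers vanishes. If
  \<open>u\<close> is congruent to 1, this sum is congruent to \<open>N\<close>, and
  \<open>p\<close> would divide \<open>N\<close>. So the roots of unity of order prime to
  \<open>p\<close> stay different modulo \<open>P\<close>.\<close>

lemma unity_cg:
  assumes z: "z ^ N = 1" "w ^ N = 1" "N > 0" "\<not> p dvd N" and "z \<equiv>\<^sub>P w"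
  shows "z = w"
proof -
  define u where "u = z * w ^ (N - 1)"
  have w1: "w * w ^ (N - 1) = 1" using z by (simp add: power_eq_if)
  have "u ^ N = z ^ N * (w ^ N) ^ (N - 1)" by (simp add: u_def power_mult_distrib power_mult[symmetric] mult.commute)
  hence uN: "u ^ N = 1" using z by simp
  have uR: "u \<in> R" using unity_R[OF uN z(3)] .
  have "u - 1 = (z - w) * w ^ (N - 1)" using w1 by (simp add: u_def algebra_simps)
  hence u1: "u \<equiv>\<^sub>P 1" using assms(5) unity_R[OF z(2,3)] by (auto intro!: P_mult' R_power)
  have "u = 1"
  proof (rule ccontr)
    assume ne: "u \<noteq> 1"
    have "(\<Sum>j<N. u ^ j) = 0" using geometric_sum[OF ne, of N] uN by simp
    moreover have "(\<Sum>j<N. u ^ j) \<equiv>\<^sub>P (\<Sum>j<N. 1 ^ j)" using cg_power[OF u1 uR R1] by (intro cg_sum) auto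
    ultimately have "of_int (int N) \<in> P" using cg_P[of 0 "of_nat N"] P0 by simp
    thus False using of_int_P[of "int N"] z(4) by simp
  qed
  hence "z * w ^ (N - 1) * w = w" by (simp add: u_def)
  hence "z * (w * w ^ (N - 1)) = w" by (simp only: mult_ac)
  thus ?thesis unfolding w1 by simp
qed

text \<open>The polynomial has, modulo \<open>P\<close>, one Frobenius orbit of \<open>m\<close> roots and \<open>n - m\<close> further roots in the
  prime field, all different and the latter different from \<open>\<plusminus>1\<close>.\<close>

definition ptype :: "nat \<Rightarrow> nat \<Rightarrow> int poly \<Rightarrow> bool" where
  "ptype n m f \<longleftrightarrow> (\<exists>\<beta>. (\<forall>k<n. \<beta> k \<in> R) \<and> (\<forall>k<n. \<forall>l<n. \<beta> k \<equiv>\<^sub>P \<beta> l \<longrightarrow> k = l) \<and>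
     (\<forall>k<m. \<beta> k ^ p \<equiv>\<^sub>P \<beta> (if Suc k < m then Suc k else 0)) \<and>
     (\<forall>k. m \<le> k \<longrightarrow> k < n \<longrightarrow> (\<exists>a::int. \<beta> k = of_int a \<and> \<not> int p dvd a - 1 \<and> \<not> int p dvd a + 1)) \<and>
     (\<forall>i. coeff (cpoly f) i \<equiv>\<^sub>P coeff (\<Prod>k<n. [:- \<beta> k, 1:]) i))"

text \<open>Take \<open>\<zeta>\<close> among the roots of unity of order dividing \<open>p ^ m - 1\<close> and integers \<open>a\<^sub>j\<close> in disjoint intervals; the
  constant coefficient fixes one more integer root, and each polynomial arises at most \<open>n ^ n\<close> times.\<close>

lemma many_ptypes:
  assumes m: "2 \<le> m" "m < n" and big: "p \<ge> 8 * n"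
  shows "\<exists>F. F \<subseteq> ({..<n} \<rightarrow>\<^sub>E {0..<int p}) \<and> (\<forall>c\<in>F. ptype n m (fpoly n c) \<and> int p dvd c 0 - (-1) ^ n) \<and>
    p ^ (n - 1) \<le> card F * (2 * (4 * n) ^ n * n ^ n)"
proof -
  define L where "L = n - m - 1"
  have nL: "n = m + L + 1" using m by (simp add: L_def)
  \<comment> \<open>Block length. At most \<open>n\<close> blocks starting at 2 end no later than p
    - 2, so integers from different blocks are incongruent modulo \<open>p\<close> and differ from
    0, 1 and -1.\<close>
  define q where "q = p div (2 * n)"
  \<comment> \<open>\<open>\<mu>\<close> lifts the nonzero elements of the field with p^m elements,
    and \<open>N\<close> is the norm to the prime field, raising to the power M = 1 + p + ... +
    p^(m-1).\<close>
  define e where "e = p ^ m - 1"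
  define M where "M = (\<Sum>i<m. p ^ i)"
  define \<mu> where "\<mu> = {z::complex. z ^ e = 1}"
  define N where "N z = z ^ M" for z :: complex
  have p2: "p \<ge> 2" using p by (simp add: prime_ge_2_nat)
  have pm2: "p ^ m \<ge> 2" using p2 self_le_power[of p m] m(1) by linarith
  have e0: "e > 0" using pm2 by (simp add: e_def)
  have pe: "\<not> p dvd e"
  proof
    assume "p dvd e"
    moreover have "p dvd p ^ m" using m by (simp add: dvd_power)
    ultimately have "p dvd p ^ m - e" by (rule dvd_diff_nat[rotated])
    thus False using pm2 p2 by (simp add: e_def)
  qed
  have fin\<mu>: "finite \<mu>" and card\<mu>: "card \<mu> = e"
    using e0 by (auto simp: \<mu>_def finite_roots_unity card_roots_unity_eq)
  have \<mu>R: "z \<in> R" "z \<notin> P" if "z \<in> \<mu>" for z using that e0 unity_R unity_notP by (auto simp: \<mu>_def)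
  have \<mu>pow: "z ^ k \<in> \<mu>" if "z \<in> \<mu>" for z k
    using that by (simp add: \<mu>_def power_mult[symmetric] mult.commute[of k]) (simp add: power_mult)
  have \<mu>cg: "z = w" if "z \<in> \<mu>" "w \<in> \<mu>" "z \<equiv>\<^sub>P w" for z w
    using unity_cg[of z e w] that e0 pe by (auto simp: \<mu>_def)
  have \<mu>m: "z ^ (p ^ m) = z" if "z \<in> \<mu>" for z
  proof -
    have "p ^ m = Suc e" using pm2 by (simp add: e_def)
    hence "z ^ (p ^ m) = z ^ e * z" by (simp only: power_Suc2)
    thus ?thesis using that by (simp add: \<mu>_def)
  qed
  have frinj: "z = w" if "z \<in> \<mu>" "w \<in> \<mu>" "z ^ (p ^ k) = w ^ (p ^ k)" "k \<le> m" for z w k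
  proof -
    have "z ^ (p ^ m) = (z ^ (p ^ k)) ^ (p ^ (m - k))" "w ^ (p ^ m) = (w ^ (p ^ k)) ^ (p ^ (m - k))"
      using that(4) by (simp_all add: power_mult[symmetric] power_add[symmetric])
    thus ?thesis using that \<mu>m by metis
  qed
  have geo: "M * (p - 1) = e"
  proof -
    have "(\<Sum>i<k. p ^ i) * (p - 1) + 1 = p ^ k" for k
    proof (induction k)
      case (Suc k)
      have "(\<Sum>i<Suc k. p ^ i) * (p - 1) + 1 = p ^ k + p ^ k * (p - 1)" using Suc by (simp add: algebra_simps)
      also have "\<dots> = p ^ k * (1 + (p - 1))" by (simp only: distrib_left mult_1_right)
      also have "1 + (p - 1) = p" using p2 by simp
      finally show ?case by simp
    qed simp
    from this[of m] show ?thesis by (simp add: M_def e_def)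
  qed
  have NR: "N z \<in> R" if "z \<in> \<mu>" for z using \<mu>R[OF that] by (auto simp: N_def intro: R_power)
  have NP: "N z \<notin> P" if "z \<in> \<mu>" for z using \<mu>R(2)[OF \<mu>pow[OF that]] by (simp add: N_def)
  have Nfr: "N z ^ p = N z" if "z \<in> \<mu>" for z
  proof -
    have "M * p = M * (p - 1) + M" using p2 by (metis One_nat_def Suc_pred add.commute mult_Suc_right less_le_trans pos2)
    hence "M * p = e + M" using geo by simp
    hence "N z ^ p = z ^ e * z ^ M" by (simp add: N_def power_mult[symmetric] power_add)
    thus ?thesis using that by (simp add: \<mu>_def N_def)
  qed
  have Nprod: "N z = (\<Prod>i<m. z ^ (p ^ i))" for z by (simp add: N_def M_def power_sum)
  have "p ^ 0 \<le> M" unfolding M_def using m by (intro member_le_sum) auto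
  hence M0: "M > 0" by simp
  have Mle: "M \<le> 2 * p ^ (m - 1)"
  proof -
    have "(\<Sum>i<Suc k. p ^ i) \<le> 2 * p ^ k" for k
    proof (induction k)
      case (Suc k)
      have "2 * p ^ k \<le> p ^ Suc k" using p2 by simp
      moreover have "(\<Sum>i<Suc (Suc k). p ^ i) = (\<Sum>i<Suc k. p ^ i) + p ^ Suc k" by (simp only: sum.lessThan_Suc)
      ultimately show ?case using Suc by linarith
    qed simp
    from this[of "m - 1"] show ?thesis using m by (simp add: M_def)
  qed
  have q0: "q > 0" and q4: "p \<le> 4 * n * q" and qn: "2 * n * q \<le> p"
  proof -
    have n2: "2 * n > 0" using m by simp
    show "q > 0" using big n2 by (auto simp: q_def div_greater_zero_iff)
    have "p < 2 * n * Suc q" using n2 by (simp add: q_def dividend_less_times_div)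
    also have "\<dots> \<le> 2 * n * (2 * q)" using \<open>q > 0\<close> by (intro mult_le_mono) auto
    finally show "p \<le> 4 * n * q" by simp
    show "2 * n * q \<le> p" by (simp add: q_def)
  qed
  define blk where "blk j = {2 + int j * int q..<2 + int (Suc j) * int q}" for j :: nat
  define AA where "AA = PiE {..<L} blk"
  have finA: "finite AA" unfolding AA_def by (intro finite_PiE) (auto simp: blk_def)
  have cardA: "card AA = q ^ L"
  proof -
    have "card (blk j) = q" for j by (simp add: blk_def algebra_simps)
    thus ?thesis by (simp add: AA_def card_PiE)
  qed
  have n3: "n \<ge> 3" using m by simp
  have blkr: "2 \<le> x \<and> x \<le> int p - 2" if "x \<in> blk j" "j < L" for x j
  proof -
    have "int (Suc j) * int q \<le> int n * int q" using that nL by (intro mult_right_mono) auto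
    moreover have "2 * (int n * int q) \<le> int p" using qn by (metis mult.assoc of_nat_le_iff of_nat_mult of_nat_numeral)
    moreover have "int p \<ge> 24" using big n3 by linarith
    moreover have "0 \<le> int j * int q" by simp
    ultimately show ?thesis using that(1) unfolding blk_def atLeastLessThan_iff by linarith
  qed
  have blkd: "j = k" if "x \<in> blk j" "x \<in> blk k" for x j k
  proof (rule ccontr)
    assume "j \<noteq> k"
    have "\<And>j k. j < k \<Longrightarrow> x \<in> blk j \<Longrightarrow> x \<in> blk k \<Longrightarrow> False"
    proof -
      fix j k assume jk: "j < k" "x \<in> blk j" "x \<in> blk k"
      have "int (Suc j) * int q \<le> int k * int q" using jk by (intro mult_right_mono) auto
      thus False using jk unfolding blk_def by auto
    qed
    thus False using that \<open>j \<noteq> k\<close> by (metis nat_neq_iff)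
  qed
  define pa where "pa a = (\<Prod>j<L. of_int (a j) :: complex)" for a :: "nat \<Rightarrow> int"
  define W where "W a = {1, -1} \<union> (\<lambda>j. of_int (a j) :: complex) ` {..<L}" for a :: "nat \<Rightarrow> int"
  have ain: "a j \<in> blk j" if "a \<in> AA" "j < L" for a j using that by (auto simp: AA_def)
  have aP: "of_int (a j) \<notin> P" if "a \<in> AA" "j < L" for a j
  proof
    assume "of_int (a j) \<in> P"
    hence "int p dvd a j" using of_int_P by blast
    thus False using blkr[OF ain[OF that] that(2)] zdvd_imp_le[of "int p" "a j"] by auto
  qed
  have paR: "pa a \<in> R" for a by (auto simp: pa_def intro!: R_prod R_of_int)
  have paP: "pa a \<notin> P" if "a \<in> AA" for a
    using P_prodE[of "{..<L}" "\<lambda>j. of_int (a j)"] aP[OF that] R_of_int by (auto simp: pa_def)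
  have WR: "w \<in> R" if "w \<in> W a" for w a using that by (auto simp: W_def R1 R_minus R_of_int)
  have WP: "w \<notin> P" if "w \<in> W a" "a \<in> AA" for w a
    using that P1 P_minus[of "-1"] aP[OF that(2)] by (auto simp: W_def)
  \<comment> \<open>\<open>bad1\<close> contains the lifts that are fixed by a smaller power of
    Frobenius, whose orbit is too short. \<open>bad2\<close> contains those for which the last root,
    forced to be the inverse of \<open>N z * pa a\<close>, collides with 1, -1 or one of the chosen
    integers.\<close>
  define bad1 where "bad1 = (\<Union>d\<in>{1..<m}. {z::complex. z ^ (p ^ d - 1) = 1})"
  define bad2 where "bad2 a = (\<Union>w\<in>W a. {z\<in>\<mu>. N z * pa a * w \<equiv>\<^sub>P 1})" for a
  define good where "good a = \<mu> - bad1 - bad2 a" for a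
  have cb1: "card bad1 \<le> n * p ^ (m - 1)"
  proof -
    have "card bad1 \<le> (\<Sum>d\<in>{1..<m}. card {z::complex. z ^ (p ^ d - 1) = 1})" unfolding bad1_def by (rule card_UN_le) simp
    also have "\<dots> \<le> (\<Sum>d\<in>{1..<m}. p ^ (m - 1))"
    proof (rule sum_mono)
      fix d assume d: "d \<in> {1..<m}"
      have "p ^ d > 1" using d p2 by (intro one_less_power) auto
      hence "card {z::complex. z ^ (p ^ d - 1) = 1} = p ^ d - 1" by (intro card_roots_unity_eq) auto
      also have "\<dots> \<le> p ^ d" by simp
      also have "\<dots> \<le> p ^ (m - 1)" by (rule power_increasing) (use d p2 in auto)
      finally show "card {z::complex. z ^ (p ^ d - 1) = 1} \<le> p ^ (m - 1)" .
    qed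
    also have "\<dots> = (m - 1) * p ^ (m - 1)" by simp
    also have "\<dots> \<le> n * p ^ (m - 1)" using m by (intro mult_right_mono) auto
    finally show ?thesis .
  qed
  have cb2: "card (bad2 a) \<le> n * (2 * p ^ (m - 1))" if a: "a \<in> AA" for a
  proof -
    have finW: "finite (W a)" by (simp add: W_def)
    have "card (W a) \<le> card {1, -1::complex} + card ((\<lambda>j. of_int (a j) :: complex) ` {..<L})" unfolding W_def by (rule card_Un_le)
    also have "\<dots> \<le> 2 + L" using card_image_le[of "{..<L}" "\<lambda>j. of_int (a j) :: complex"] card_length[of "[1, -1::complex]"] by simp
    also have "\<dots> \<le> n" using nL m by simp
    finally have cW: "card (W a) \<le> n" .
    have one: "card {z\<in>\<mu>. N z * pa a * w \<equiv>\<^sub>P 1} \<le> M" if w: "w \<in> W a" for w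
    proof (rule ccontr)
      assume n: "\<not> ?thesis"
      define f where "f = monom (pa a * w) M - [:1:]"
      have cf: "coeff f i = (if i = M then pa a * w else 0) - (if i = 0 then 1 else 0)" for i
        by (auto simp: f_def coeff_pCons split: nat.split)
      have "coeff f M \<in> P"
      proof (rule root_bound)
        show "coeff f i \<in> R" for i using paR WR[OF w] by (auto simp: cf R0 R1 intro!: R_mult R_diff R_minus)
        show "finite {z\<in>\<mu>. N z * pa a * w \<equiv>\<^sub>P 1}" using fin\<mu> by simp
        have "degree f \<le> M" by (intro degree_le) (use M0 in \<open>auto simp: cf\<close>)
        thus "degree f < card {z\<in>\<mu>. N z * pa a * w \<equiv>\<^sub>P 1}" using n by simp
        show "poly f t \<in> P" if "t \<in> {z\<in>\<mu>. N z * pa a * w \<equiv>\<^sub>P 1}" for t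
          using that by (simp add: f_def poly_monom N_def mult_ac)
      qed (use \<mu>R \<mu>cg in auto)
      hence "pa a * w \<in> P" using M0 by (simp add: cf)
      thus False using P_prime[OF paR WR[OF w]] paP[OF a] WP[OF w a] by blast
    qed
    have "card (bad2 a) \<le> (\<Sum>w\<in>W a. card {z\<in>\<mu>. N z * pa a * w \<equiv>\<^sub>P 1})" unfolding bad2_def by (rule card_UN_le[OF finW])
    also have "\<dots> \<le> (\<Sum>w\<in>W a. M)" using one by (rule sum_mono)
    also have "\<dots> = card (W a) * M" by simp
    also have "\<dots> \<le> n * (2 * p ^ (m - 1))" using cW Mle by (rule mult_le_mono)
    finally show ?thesis .
  qed
  \<comment> \<open>At most 3 n p^(m-1) lifts are bad, which is at most 3/8 of p^m because
    \<open>p \<ge> 8 * n\<close>; more than half remain even after the missing zero is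
    deducted.\<close>
  have cgood: "p ^ m \<le> 2 * card (good a)" if a: "a \<in> AA" for a
  proof -
    have "\<mu> \<subseteq> good a \<union> (\<mu> \<inter> bad1) \<union> bad2 a" by (auto simp: good_def)
    hence "card \<mu> \<le> card (good a \<union> (\<mu> \<inter> bad1) \<union> bad2 a)"
      by (intro card_mono finite_subset[OF _ fin\<mu>, of "good a \<union> \<mu> \<inter> bad1 \<union> bad2 a"]) (auto simp: good_def bad2_def)
    also have "\<dots> \<le> card (good a) + card (\<mu> \<inter> bad1) + card (bad2 a)"
      by (metis (no_types, lifting) add_mono_thms_linordered_semiring(3) card_Un_le order_trans)
    also have "card (\<mu> \<inter> bad1) \<le> card bad1"
    proof (rule card_mono)
      show "finite bad1" unfolding bad1_def
      proof (intro finite_UN_I)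
        fix d assume d: "d \<in> {1..<m}"
        have "p ^ d > 1" using d p2 by (intro one_less_power) auto
        thus "finite {z::complex. z ^ (p ^ d - 1) = 1}" by (intro finite_roots_unity) auto
      qed simp
    qed simp
    finally have "e \<le> card (good a) + 3 * (n * p ^ (m - 1))" using cb1 cb2[OF a] card\<mu> by simp
    moreover have "8 * (n * p ^ (m - 1)) \<le> p ^ m"
    proof -
      have "8 * n * p ^ (m - 1) \<le> p * p ^ (m - 1)" using big by (rule mult_right_mono) simp
      also have "\<dots> = p ^ m" using m by (simp add: power_eq_if)
      finally show ?thesis by (simp add: mult.assoc)
    qed
    moreover have "n * p ^ (m - 1) \<ge> 1" using n3 p2 by (simp add: Suc_le_eq)
    ultimately show ?thesis using pm2 unfolding e_def by linarith
  qed
  define V where "V = (SIGMA a:AA. good a)"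
  have cV: "q ^ L * p ^ m \<le> 2 * card V"
  proof -
    have fg: "finite (good a)" for a using fin\<mu> by (simp add: good_def)
    have "card V = (\<Sum>a\<in>AA. card (good a))" unfolding V_def using finA fg by (intro card_SigmaI) auto
    hence "2 * card V = (\<Sum>a\<in>AA. 2 * card (good a))" by (simp add: sum_distrib_left)
    moreover have "(\<Sum>a\<in>AA. p ^ m) \<le> (\<Sum>a\<in>AA. 2 * card (good a))" by (rule sum_mono[OF cgood])
    ultimately show ?thesis by (simp add: cardA)
  qed
  \<comment> \<open>The residues in order: the Frobenius orbit of \<open>z\<close>, then the chosen
    integers, then at position n - 1 the root forced by the constant coefficient.\<close>
  define bet where "bet z a l k = (if k < m then z ^ (p ^ k) else if k < n - 1 then of_int (a (k - m)) else of_int l :: complex)"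
    for z :: complex and a :: "nat \<Rightarrow> int" and l :: int and k :: nat
  define \<pi> where "\<pi> k = (if k < m then (if Suc k < m then Suc k else 0) else k)" for k :: nat
  have \<pi>: "bij_betw \<pi> {..<n} {..<n}"
  proof -
    have "inj_on \<pi> {..<n}" by (rule inj_onI) (auto simp: \<pi>_def split: if_splits)
    moreover have "\<pi> ` {..<n} \<subseteq> {..<n}" using m by (auto simp: \<pi>_def)
    ultimately show ?thesis by (simp add: bij_betw_def endo_inj_surj)
  qed
  \<comment> \<open>All properties sit in one existence statement, so that \<open>l\<close> and
    \<open>c\<close> can be chosen together as functions of the pair.\<close>
  have ex: "\<exists>l c. c \<in> {..<n} \<rightarrow>\<^sub>E {0..<int p} \<and> int p dvd c 0 - (-1) ^ n \<and>
     (\<forall>k<n. bet z a l k \<in> R) \<and> (\<forall>k<n. \<forall>k'<n. bet z a l k \<equiv>\<^sub>P bet z a l k' \<longrightarrow> k = k') \<and>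
     (\<forall>k<m. bet z a l k ^ p \<equiv>\<^sub>P bet z a l (if Suc k < m then Suc k else 0)) \<and>
     (\<forall>k. m \<le> k \<longrightarrow> k < n \<longrightarrow> (\<exists>x::int. bet z a l k = of_int x \<and> \<not> int p dvd x - 1 \<and> \<not> int p dvd x + 1)) \<and>
     (\<forall>i. coeff (cpoly (fpoly n c)) i \<equiv>\<^sub>P coeff (\<Prod>k<n. [:- bet z a l k, 1:]) i)"
    if av: "(a, z) \<in> V" for a z
  proof -
    have a: "a \<in> AA" and z: "z \<in> \<mu>" "z \<notin> bad1" "z \<notin> bad2 a" using av by (auto simp: V_def good_def)
    define u where "u = N z * pa a"
    have uR: "u \<in> R" using NR[OF z(1)] paR by (auto simp: u_def intro: R_mult)
    have uP: "u \<notin> P" unfolding u_def using P_prime[OF NR[OF z(1)] paR] NP[OF z(1)] paP[OF a] by blast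
    have pafr: "pa a ^ p \<equiv>\<^sub>P pa a"
    proof -
      have "pa a = of_int (\<Prod>j<L. a j)" by (simp add: pa_def)
      thus ?thesis using fermat by metis
    qed
    have "u ^ p \<equiv>\<^sub>P u" unfolding u_def power_mult_distrib Nfr[OF z(1)]
      by (rule cg_mult[OF cg_refl pafr NR[OF z(1)] paR])
    then obtain b where b: "u \<equiv>\<^sub>P of_int b" using frob_cg_int[OF uR] by blast
    have nb: "\<not> int p dvd b" using b uP of_int_P cg_P by blast
    hence "coprime (int p) b" using p by (simp add: prime_imp_coprime)
    hence "coprime b (int p)" by (simp add: coprime_commute)
    then obtain s t where st: "s * b + t * int p = 1" by (metis bezout_int coprime_imp_gcd_eq_1)
    \<comment> \<open>The inverse modulo \<open>p\<close> of \<open>u\<close>, the product of the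
      other residues; this makes the product of all residues 1.\<close>
    define l where "l = s mod int p"
    have "int p dvd b * l - 1"
    proof -
      have "b * l - 1 = b * (l - s) + (s * b - 1)" by (simp add: algebra_simps)
      moreover have "s * b - 1 = - t * int p" using st by (simp add: algebra_simps)
      moreover have "int p dvd l - s" by (simp add: l_def mod_eq_dvd_iff[symmetric])
      ultimately show ?thesis by simp
    qed
    hence "of_int b * of_int l \<equiv>\<^sub>P 1" using of_int_cg[of "b * l" 1] by simp
    moreover have "u * of_int l \<equiv>\<^sub>P of_int b * of_int l" by (rule cg_mult[OF b cg_refl uR R_of_int])
    ultimately have ul: "u * of_int l \<equiv>\<^sub>P 1" using cg_trans by blast
    have lW: "\<not> of_int l \<equiv>\<^sub>P w" if w: "w \<in> W a" for w
    proof
      assume "of_int l \<equiv>\<^sub>P w"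
      hence "u * of_int l \<equiv>\<^sub>P u * w" by (intro cg_mult cg_refl uR WR[OF w])
      hence "u * w \<equiv>\<^sub>P 1" using ul cg_trans cg_sym by blast
      hence "z \<in> bad2 a" using w z by (auto simp: bad2_def u_def)
      thus False using z by simp
    qed
    have l1: "\<not> int p dvd l - 1" using lW[of 1] of_int_cg[of l 1] by (simp add: W_def)
    have l2: "\<not> int p dvd l + 1" using lW[of "-1"] of_int_cg[of l "-1"] by (simp add: W_def)
    let ?b = "bet z a l"
    have zd: "z ^ (p ^ (k + d)) \<noteq> z ^ (p ^ k)" if "0 < d" "d < m" "k \<le> m" for k d
    proof
      assume "z ^ (p ^ (k + d)) = z ^ (p ^ k)"
      hence "(z ^ (p ^ d)) ^ (p ^ k) = z ^ (p ^ k)" by (simp add: power_mult[symmetric] power_add mult.commute)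
      hence zz: "z ^ (p ^ d) = z" using frinj[OF \<mu>pow[OF z(1)] z(1)] that by blast
      have "p ^ d \<ge> 1" using p2 by simp
      hence "p ^ d = Suc (p ^ d - 1)" by simp
      hence "z ^ (p ^ d) = z ^ (p ^ d - 1) * z" by (metis power_Suc2)
      hence "z ^ (p ^ d - 1) * z = z" using zz by simp
      moreover have "z \<noteq> 0" using \<mu>R(2)[OF z(1)] P0 by auto
      ultimately have "z ^ (p ^ d - 1) = 1" by simp
      thus False using z(2) that by (auto simp: bad1_def)
    qed
    have bR: "?b k \<in> R" for k using \<mu>R(1)[OF \<mu>pow[OF z(1)]] by (auto simp: bet_def R_of_int)
    have fr: "?b k ^ p \<equiv>\<^sub>P ?b (\<pi> k)" for k
    proof (cases "k < m")
      case True
      have e: "(z ^ p ^ k) ^ p = z ^ p ^ Suc k" by (simp add: power_mult[symmetric] mult.commute)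
      show ?thesis
      proof (cases "Suc k < m")
        case True thus ?thesis using e by (simp add: bet_def \<pi>_def P0)
      next
        case False
        hence "Suc k = m" using \<open>k < m\<close> by simp
        thus ?thesis using e \<mu>m[OF z(1)] \<open>k < m\<close> m by (simp add: bet_def \<pi>_def P0)
      qed
    next
      case False thus ?thesis using fermat by (auto simp: bet_def \<pi>_def)
    qed
    have ints: "\<exists>x::int. ?b k = of_int x \<and> \<not> int p dvd x - 1 \<and> \<not> int p dvd x + 1" if k: "m \<le> k" "k < n" for k
    proof (cases "k < n - 1")
      case True
      hence kL: "k - m < L" using k nL by simp
      have r: "2 \<le> a (k - m)" "a (k - m) \<le> int p - 2" using blkr[OF ain[OF a kL] kL] by auto
      have "\<not> int p dvd a (k - m) - 1" "\<not> int p dvd a (k - m) + 1"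
        using r zdvd_imp_le[of "int p" "a (k - m) - 1"] zdvd_imp_le[of "int p" "a (k - m) + 1"] by auto
      thus ?thesis using True k by (auto simp: bet_def)
    next
      case False thus ?thesis using l1 l2 k by (auto simp: bet_def)
    qed
    have inc1: "k = k'" if kk: "k < k' \<or> k = k'" "k' < n" "?b k \<equiv>\<^sub>P ?b k'" for k k'
    proof (rule ccontr)
      assume "k \<noteq> k'"
      hence lt: "k < k'" using kk(1) by simp
      consider "k' < m" | "k < m" "m \<le> k'" | "m \<le> k" "k' < n - 1" | "m \<le> k" "k' = n - 1" using kk(2) lt by linarith
      thus False
      proof cases
        case 1
        hence "z ^ (p ^ k) = z ^ (p ^ k')" using kk(3) lt \<mu>cg[OF \<mu>pow[OF z(1)] \<mu>pow[OF z(1)]] by (simp add: bet_def)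
        moreover have "z ^ (p ^ (k + (k' - k))) \<noteq> z ^ (p ^ k)" by (rule zd) (use 1 lt in auto)
        moreover have "k + (k' - k) = k'" using lt by simp
        ultimately show False by simp
      next
        case 2
        \<comment> \<open>A member of the orbit congruent to an integer would be fixed by Frobenius,
          against \<open>zd\<close> with shift 1, which is allowed because
          \<open>2 \<le> m\<close>.\<close>
        obtain x where x: "?b k' = of_int x" using ints[of k'] 2 kk(2) by blast
        have kx: "?b k \<equiv>\<^sub>P of_int x" using kk(3) x by simp
        have "?b k ^ p \<equiv>\<^sub>P of_int x ^ p" by (rule cg_power[OF kx bR R_of_int])
        hence "?b k ^ p \<equiv>\<^sub>P of_int x" using fermat cg_trans by blast
        hence kp: "?b k ^ p \<equiv>\<^sub>P ?b k" using kx cg_trans cg_sym by blast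
        have "?b k ^ p = z ^ (p ^ (k + 1))" using 2 by (simp add: bet_def power_mult[symmetric] mult.commute)
        hence "z ^ (p ^ (k + 1)) = z ^ (p ^ k)" using kp 2 \<mu>cg[OF \<mu>pow[OF z(1)] \<mu>pow[OF z(1)]] by (simp add: bet_def)
        thus False using zd[of 1 k] 2 m by simp
      next
        case 3
        have L: "k - m < L" "k' - m < L" using 3 lt nL by auto
        have "of_int (a (k - m)) \<equiv>\<^sub>P of_int (a (k' - m))" using kk(3) 3 lt by (simp add: bet_def)
        hence "int p dvd a (k - m) - a (k' - m)" using of_int_cg by blast
        moreover have "2 \<le> a (k - m)" "a (k - m) \<le> int p - 2" "2 \<le> a (k' - m)" "a (k' - m) \<le> int p - 2"
          using blkr[OF ain[OF a L(1)] L(1)] blkr[OF ain[OF a L(2)] L(2)] by auto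
        ultimately have "a (k - m) = a (k' - m)"
          using zdvd_imp_le[of "int p" "a (k - m) - a (k' - m)"] zdvd_imp_le[of "int p" "a (k' - m) - a (k - m)"]
          by (cases "a (k - m)" "a (k' - m)" rule: linorder_cases) (auto simp: dvd_diff_commute)
        hence "k - m = k' - m" using blkd ain[OF a L(1)] ain[OF a L(2)] by metis
        thus False using 3 lt by simp
      next
        case 4
        have "of_int (a (k - m)) \<in> W a" using 4 lt nL by (auto simp: W_def)
        moreover have "of_int l \<equiv>\<^sub>P of_int (a (k - m))" using cg_sym[OF kk(3)] 4 lt m by (simp add: bet_def)
        ultimately show False using lW by blast
      qed
    qed
    have inc: "k = k'" if "k < n" "k' < n" "?b k \<equiv>\<^sub>P ?b k'" for k k'
      using inc1[of k k'] inc1[of k' k] that cg_sym[OF that(3)] by (cases k k' rule: linorder_cases) auto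
    have "\<forall>i. \<exists>x. 0 \<le> x \<and> x < int p \<and> coeff (\<Prod>k<n. [:- ?b k, 1:]) i \<equiv>\<^sub>P of_int x"
      using coeff_prod_cg_int[of n ?b \<pi>] bR \<pi> fr by blast
    then obtain c0 where c0: "\<And>i. 0 \<le> c0 i \<and> c0 i < int p \<and> coeff (\<Prod>k<n. [:- ?b k, 1:]) i \<equiv>\<^sub>P of_int (c0 i)" by metis
    define c where "c = restrict c0 {..<n}"
    have cc: "coeff (cpoly (fpoly n c)) i \<equiv>\<^sub>P coeff (\<Prod>k<n. [:- ?b k, 1:]) i" for i
    proof -
      consider "i < n" | "i = n" | "i > n" by linarith
      thus ?thesis
      proof cases
        case 1 thus ?thesis using cg_sym c0[of i] by (auto simp: coeff_map_poly coeff_fpoly c_def)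
      next
        case 2 thus ?thesis using coeff_prod_linear_top(1)[of ?b n] by (simp add: coeff_map_poly coeff_fpoly P0)
      next
        case 3 thus ?thesis using coeff_prod_linear_top(2)[of n i ?b] by (simp add: coeff_map_poly coeff_fpoly P0)
      qed
    qed
    \<comment> \<open>The constant coefficient is (-1)^n times the product of the residues, as
      required for a characteristic polynomial of determinant 1.\<close>
    have const: "int p dvd c 0 - (-1) ^ n"
    proof -
      have sp: "{..<n} = {..<m} \<union> {m..<m + L} \<union> {m + L}" using nL by auto
      have "(\<Prod>k<n. ?b k) = (\<Prod>k<m. ?b k) * (\<Prod>k\<in>{m..<m + L}. ?b k) * ?b (m + L)"
        unfolding sp by (subst prod.union_disjoint; (subst prod.union_disjoint)?) auto
      also have "(\<Prod>k<m. ?b k) = N z" by (simp add: Nprod bet_def)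
      also have "(\<Prod>k\<in>{m..<m + L}. ?b k) = pa a" unfolding pa_def
        by (rule prod.reindex_bij_witness[of _ "\<lambda>j. j + m" "\<lambda>k. k - m"]) (auto simp: bet_def nL)
      also have "?b (m + L) = of_int l" by (simp add: bet_def nL)
      finally have pb: "(\<Prod>k<n. ?b k) = u * of_int l" by (simp add: u_def)
      have "coeff (\<Prod>k<n. [:- ?b k, 1:]) 0 = (\<Prod>k<n. - ?b k)" unfolding poly_0_coeff_0[symmetric] by (simp add: poly_prod)
      also have "\<dots> = (-1) ^ n * (u * of_int l)" by (simp add: prod_uminus pb)
      finally have 0: "coeff (\<Prod>k<n. [:- ?b k, 1:]) 0 = (-1) ^ n * (u * of_int l)" .
      have "of_int (c 0) \<equiv>\<^sub>P (-1) ^ n * (u * of_int l)" using cc[of 0] nL unfolding 0 by (simp add: coeff_map_poly coeff_fpoly)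
      moreover have "(-1) ^ n * (u * of_int l) \<equiv>\<^sub>P (-1) ^ n * 1" by (intro cg_mult cg_refl ul R_power R_minus R1)
      ultimately have "of_int (c 0) \<equiv>\<^sub>P (-1) ^ n * 1" by (rule cg_trans)
      hence "of_int (c 0) \<equiv>\<^sub>P of_int ((-1) ^ n)" by simp
      thus ?thesis using of_int_cg by blast
    qed
    have cE: "c \<in> {..<n} \<rightarrow>\<^sub>E {0..<int p}" using c0 by (auto simp: c_def)
    have fr': "?b k ^ p \<equiv>\<^sub>P ?b (if Suc k < m then Suc k else 0)" if "k < m" for k using fr[of k] that by (simp add: \<pi>_def)
    show ?thesis
      by (rule exI[of _ l], rule exI[of _ c]) (use cE const bR inc fr' ints cc in blast)
  qed
  define Q where "Q v l c \<longleftrightarrow> (case v of (a, z) \<Rightarrow> c \<in> {..<n} \<rightarrow>\<^sub>E {0..<int p} \<and> int p dvd c 0 - (-1) ^ n \<and>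
     (\<forall>k<n. bet z a l k \<in> R) \<and> (\<forall>k<n. \<forall>k'<n. bet z a l k \<equiv>\<^sub>P bet z a l k' \<longrightarrow> k = k') \<and>
     (\<forall>k<m. bet z a l k ^ p \<equiv>\<^sub>P bet z a l (if Suc k < m then Suc k else 0)) \<and>
     (\<forall>k. m \<le> k \<longrightarrow> k < n \<longrightarrow> (\<exists>x::int. bet z a l k = of_int x \<and> \<not> int p dvd x - 1 \<and> \<not> int p dvd x + 1)) \<and>
     (\<forall>i. coeff (cpoly (fpoly n c)) i \<equiv>\<^sub>P coeff (\<Prod>k<n. [:- bet z a l k, 1:]) i))" for v l c
  have "\<exists>l c. Q v l c" if v: "v \<in> V" for v
  proof -
    obtain a z where av: "v = (a, z)" by (cases v)
    show ?thesis unfolding av Q_def prod.case by (rule ex) (use v av in simp)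
  qed
  hence "\<forall>v\<in>V. \<exists>l c. Q v l c" by blast
  then obtain ll \<Psi> where QQ: "\<forall>v\<in>V. Q v (ll v) (\<Psi> v)" by metis
  have q: "Q (a, z) (ll (a, z)) (\<Psi> (a, z))" if "(a, z) \<in> V" for a z using that QQ by blast
  note q' = q[unfolded Q_def prod.case]
  have cE: "\<Psi> (a, z) \<in> {..<n} \<rightarrow>\<^sub>E {0..<int p}" if "(a, z) \<in> V" for a z using q'[OF that] by (rule conjunct1)
  have const: "int p dvd \<Psi> (a, z) 0 - (-1) ^ n" if "(a, z) \<in> V" for a z using q'[OF that] by blast
  have bR: "bet z a (ll (a, z)) k \<in> R" if "(a, z) \<in> V" "k < n" for a z k using q'[OF that(1)] that(2) by blast
  have cc: "coeff (cpoly (fpoly n (\<Psi> (a, z)))) i \<equiv>\<^sub>P coeff (\<Prod>k<n. [:- bet z a (ll (a, z)) k, 1:]) i"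
    if "(a, z) \<in> V" for a z i using q'[OF that] by blast
  define F where "F = \<Psi> ` V"
  have finV: "finite V" unfolding V_def using finA fin\<mu> by (intro finite_SigmaI) (auto simp: good_def)
  have "ptype n m (fpoly n (\<Psi> (a, z)))" if v: "(a, z) \<in> V" for a z
    unfolding ptype_def
    by (rule exI[of _ "bet z a (ll (a, z))"]) (use q'[OF v] in blast)
  hence 1: "\<forall>c\<in>F. ptype n m (fpoly n c) \<and> int p dvd c 0 - (-1) ^ n" using const by (auto simp: F_def)
  have 2: "F \<subseteq> ({..<n} \<rightarrow>\<^sub>E {0..<int p})" using cE by (auto simp: F_def)
  \<comment> \<open>A polynomial determines its residues up to order. Each \<open>v\<close> is
    compared with one base point of its fibre: \<open>\<kappa> v\<close> records which residue of
    the base point each residue of \<open>v\<close> meets, so a fibre has at most n^n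
    elements.\<close>
  have fib: "card V \<le> card F * n ^ n"
  proof -
    define base where "base c = inv_into V \<Psi> c" for c
    have base: "base (\<Psi> v) \<in> V" "\<Psi> (base (\<Psi> v)) = \<Psi> v" if "v \<in> V" for v
      using that by (auto simp: base_def inv_into_into f_inv_into_f)
    define bb where "bb v = bet (snd v) (fst v) (ll v)" for v
    have bbR: "bb v k \<in> R" if "v \<in> V" "k < n" for v k using bR[of "fst v" "snd v" k] that by (simp add: bb_def)
    have bbc: "coeff (cpoly (fpoly n (\<Psi> v))) i \<equiv>\<^sub>P coeff (\<Prod>k<n. [:- bb v k, 1:]) i" if "v \<in> V" for v i
      using cc[of "fst v" "snd v" i] that by (simp add: bb_def)
    have match: "\<exists>l. l < n \<and> bb v k \<equiv>\<^sub>P bb v' l" if v: "v \<in> V" "v' \<in> V" "\<Psi> v = \<Psi> v'" "k < n" for v v' k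
    proof -
      let ?f = "\<Prod>k<n. [:- bb v k, 1:]" and ?g = "\<Prod>k<n. [:- bb v' k, 1:]"
      have fg: "coeff ?f i \<equiv>\<^sub>P coeff ?g i" for i by (rule cg_trans[OF cg_sym[OF bbc[OF v(1)]] bbc[OF v(2), folded v(3)]])
      have pol: "poly h x = (\<Sum>i\<le>n. coeff h i * x ^ i)" if "\<And>i. i > n \<Longrightarrow> coeff h i = 0" for h and x :: complex
      proof -
        have "degree h \<le> n" by (intro degree_le) (use that in auto)
        thus ?thesis unfolding poly_altdef by (intro sum.mono_neutral_left) (auto simp: coeff_eq_0)
      qed
      have gR: "coeff ?g i \<in> R" for i by (rule coeff_prod_R) (use bbR v in auto)
      have fR: "coeff ?f i \<in> R" for i by (rule coeff_prod_R) (use bbR v in auto)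
      have pf: "poly ?f x = (\<Sum>i\<le>n. coeff ?f i * x ^ i)" for x by (rule pol) (rule coeff_prod_linear_top(2))
      have pg: "poly ?g x = (\<Sum>i\<le>n. coeff ?g i * x ^ i)" for x by (rule pol) (rule coeff_prod_linear_top(2))
      have "poly ?f (bb v k) \<equiv>\<^sub>P poly ?g (bb v k)"
        unfolding pf pg by (intro cg_sum cg_mult cg_refl R_power fg fR bbR[OF v(1,4)])
      moreover have "poly ?f (bb v k) = 0" using v(4) by (auto simp: poly_prod intro!: prod_zero)
      ultimately have "poly ?g (bb v k) \<in> P" using cg_P P0 by metis
      hence "(\<Prod>l<n. bb v k - bb v' l) \<in> P" by (simp add: poly_prod)
      thus ?thesis using P_prodE[of "{..<n}" "\<lambda>l. bb v k - bb v' l"] bbR v R_diff by auto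
    qed
    define \<kappa> where "\<kappa> v = restrict (\<lambda>k. SOME l. l < n \<and> bb v k \<equiv>\<^sub>P bb (base (\<Psi> v)) l) {..<n}" for v
    have \<kappa>: "\<kappa> v k < n" "bb v k \<equiv>\<^sub>P bb (base (\<Psi> v)) (\<kappa> v k)" if "v \<in> V" "k < n" for v k
      using someI_ex[OF match[OF that(1) base(1)[OF that(1)] base(2)[OF that(1), symmetric] that(2)]] that by (auto simp: \<kappa>_def)
    have "inj_on (\<lambda>v. (\<Psi> v, \<kappa> v)) V"
    proof (rule inj_onI)
      fix v v' assume v: "v \<in> V" "v' \<in> V" and "(\<Psi> v, \<kappa> v) = (\<Psi> v', \<kappa> v')"
      hence eq: "\<Psi> v = \<Psi> v'" "\<kappa> v = \<kappa> v'" by auto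
      have bb: "bb v k \<equiv>\<^sub>P bb v' k" if "k < n" for k
        using \<kappa>(2)[OF v(1) that] \<kappa>(2)[OF v(2) that] eq cg_trans cg_sym by metis
      obtain a z a' z' where vv: "v = (a, z)" "v' = (a', z')" by (metis surj_pair)
      have az: "a \<in> AA" "a' \<in> AA" "z \<in> \<mu>" "z' \<in> \<mu>" using v vv by (auto simp: V_def good_def)
      have "z = z'" using bb[of 0] m az \<mu>cg by (auto simp: bb_def bet_def vv)
      moreover have "a j = a' j" if "j < L" for j
      proof -
        have "of_int (a j) \<equiv>\<^sub>P of_int (a' j)" using bb[of "j + m"] that nL by (simp add: bb_def bet_def vv)
        hence "int p dvd a j - a' j" using of_int_cg by blast
        moreover have "2 \<le> a j" "a j \<le> int p - 2" "2 \<le> a' j" "a' j \<le> int p - 2"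
          using blkr[OF ain[OF az(1) that] that] blkr[OF ain[OF az(2) that] that] by auto
        ultimately show ?thesis
          using zdvd_imp_le[of "int p" "a j - a' j"] zdvd_imp_le[of "int p" "a' j - a j"]
          by (cases "a j" "a' j" rule: linorder_cases) (auto simp: dvd_diff_commute)
      qed
      hence "a = a'" using az(1,2) unfolding AA_def by (intro PiE_ext) auto
      ultimately show "v = v'" using vv by simp
    qed
    moreover have "(\<lambda>v. (\<Psi> v, \<kappa> v)) ` V \<subseteq> F \<times> ({..<n} \<rightarrow>\<^sub>E {..<n})"
    proof (intro image_subsetI SigmaI)
      fix v assume v: "v \<in> V"
      show "\<Psi> v \<in> F" using v by (simp add: F_def)
      show "\<kappa> v \<in> {..<n} \<rightarrow>\<^sub>E {..<n}" by (rule PiE_I) (use \<kappa>(1)[OF v] in \<open>auto simp: \<kappa>_def\<close>)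
    qed
    moreover have "finite (F \<times> ({..<n} \<rightarrow>\<^sub>E {..<n}))" using finV by (auto simp: F_def intro!: finite_PiE)
    ultimately have "card V \<le> card (F \<times> ({..<n} \<rightarrow>\<^sub>E {..<n}))" by (rule card_inj_on_le)
    thus ?thesis by (simp add: card_cartesian_product card_PiE)
  qed
  \<comment> \<open>\<open>V\<close> has at least q^L p^m / 2 elements. Replacing \<open>q\<close>
    by \<open>p\<close> costs a factor 4 n for each of the \<open>L\<close> chosen integers, and the
    fibres cost n^n.\<close>
  have "p ^ (n - 1) = p ^ L * p ^ m" using nL by (simp add: power_add)
  also have "\<dots> \<le> (4 * n * q) ^ L * p ^ m" using q4 by (intro mult_right_mono power_mono) auto
  also have "\<dots> = (4 * n) ^ L * (q ^ L * p ^ m)" by (simp add: power_mult_distrib)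
  also have "\<dots> \<le> (4 * n) ^ n * (2 * card V)" by (rule mult_le_mono[OF power_increasing cV]) (use nL n3 in auto)
  also have "\<dots> \<le> (4 * n) ^ n * (2 * (card F * n ^ n))" using fib by simp
  finally have "p ^ (n - 1) \<le> card F * (2 * (4 * n) ^ n * n ^ n)" by (simp add: mult_ac)
  thus ?thesis using 1 2 by blast
qed

end

section \<open>Counting matrices with given characteristic polynomial\<close>

lemma det_hom:
  fixes h :: "'a::comm_ring_1 \<Rightarrow> 'b::comm_ring_1" and A :: "'a^'n^'n"
  assumes add: "\<And>x y. h (x + y) = h x + h y" and mult: "\<And>x y. h (x * y) = h x * h y" and one: "h 1 = 1"
  shows "h (det A) = det (\<chi> i j. h (A$i$j))"
proof -
  have z: "h 0 = 0" using add[of 0 0] by simp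
  have m: "h (- x) = - h x" for x using add[of x "-x"] z by (simp add: add_eq_0_iff)
  have s: "h (sum f I) = (\<Sum>i\<in>I. h (f i))" for f and I :: "('n \<Rightarrow> 'n) set"
    by (induction I rule: infinite_finite_induct) (auto simp: z add)
  have p: "h (prod f I) = (\<Prod>i\<in>I. h (f i))" for f and I :: "'n set"
    by (induction I rule: infinite_finite_induct) (auto simp: one mult)
  have sg: "h (of_int (sign \<pi>)) = of_int (sign \<pi>)" for \<pi> :: "'n \<Rightarrow> 'n"
    by (cases \<pi> rule: sign_cases) (auto simp: one m)
  show ?thesis unfolding det_def s mult sg p by simp
qed

text \<open>The index type carries no order, so triangularity is measured by an injective rank. A
  permutation that never raises the rank preserves the sum of the ranks, hence every rank, and is
  the identity.\<close>

lemma det_rank_triangular: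
  fixes A :: "'a::comm_ring_1^'n^'n" and r :: "'n \<Rightarrow> nat"
  assumes inj: "inj r" and z: "\<And>i j. r i < r j \<Longrightarrow> A$i$j = 0"
  shows "det A = (\<Prod>i\<in>UNIV. A$i$i)"
proof -
  have "(\<Prod>i\<in>UNIV. A$i$\<pi> i) = 0" if \<pi>: "\<pi> permutes UNIV" "\<pi> \<noteq> id" for \<pi>
  proof -
    have "\<exists>i. r i < r (\<pi> i)"
    proof (rule ccontr)
      assume "\<not> ?thesis"
      hence le: "r (\<pi> i) \<le> r i" for i by (meson not_le)
      have "(\<Sum>i\<in>UNIV. r (\<pi> i)) = (\<Sum>i\<in>UNIV. r i)"
        using sum.permute[OF \<pi>(1), of r] by (simp add: o_def)
      hence "r (\<pi> i) = r i" for i using sum_strict_mono_ex1[of UNIV "\<lambda>i. r (\<pi> i)" r] le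
        by (metis finite UNIV_I le_neq_implies_less nat_neq_iff)
      hence "\<pi> = id" using inj by (auto simp: inj_def fun_eq_iff)
      thus False using \<pi> by simp
    qed
    then obtain i where "A$i$\<pi> i = 0" using z by blast
    thus ?thesis by (intro prod_zero) auto
  qed
  hence "det A = (\<Sum>\<pi>\<in>{id}. of_int (sign \<pi>) * (\<Prod>i\<in>UNIV. A$i$\<pi> i))"
    unfolding det_def by (intro sum.mono_neutral_right) (auto simp: permutes_id finite_permutations)
  thus ?thesis by simp
qed

section \<open>Characteristic polynomials over the integers\<close>

definition xmat :: "int^'n^'n \<Rightarrow> int poly^'n^'n" where
  "xmat A = (\<chi> i j. (if i = j then [:0, 1:] else 0) - [:A$i$j:])"

definition cpi :: "int^'n^'n \<Rightarrow> int poly" where "cpi A = det (xmat A)"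

lemma cpoly_hom: "cpoly (f + g) = cpoly f + cpoly g" "cpoly (f * g) = cpoly f * cpoly g" "cpoly 1 = 1"
  "cpoly (f - g) = cpoly f - cpoly g"
  by (auto simp: poly_eq_iff coeff_map_poly coeff_mult)

lemma char_poly_int_eq: "char_poly_int A = cpoly (cpi A)"
proof -
  have "cpoly (cpi A) = det (\<chi> i j. cpoly (xmat A$i$j))" unfolding cpi_def
    by (rule det_hom) (auto simp: cpoly_hom)
  also have "(\<chi> i j. cpoly (xmat A$i$j)) = (\<chi> i j. (if i = j then [:0, 1:] else 0) - [: of_int (A $ i $ j) :])"
    by (simp add: vec_eq_iff xmat_def poly_eq_iff coeff_map_poly coeff_pCons split: nat.splits)
  finally show ?thesis by (simp add: char_poly_int_def)
qed

lemma poly_cpi: "poly (cpi A) t = det (\<chi> i j. (if i = j then t else 0) - A$i$j)"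
proof -
  have "poly (cpi A) t = det (\<chi> i j. poly (xmat A$i$j) t)" unfolding cpi_def by (rule det_hom) auto
  also have "(\<chi> i j. poly (xmat A$i$j) t) = (\<chi> i j. (if i = j then t else 0) - A$i$j)"
    by (simp add: vec_eq_iff xmat_def)
  finally show ?thesis .
qed

lemma det_neg: "det (- A) = (- 1) ^ CARD('n) * det A" for A :: "int^'n^'n"
proof -
  have "det (- A) = (\<Sum>\<pi>\<in>{\<pi>. \<pi> permutes UNIV}. (- 1) ^ CARD('n) * (of_int (sign \<pi>) * (\<Prod>i\<in>UNIV. A$i$\<pi> i)))"
    unfolding det_def by (intro sum.cong) (auto simp: prod_uminus)
  thus ?thesis unfolding det_def by (simp add: sum_distrib_left)
qed

lemma cpi_coeff_0: "coeff (cpi A) 0 = (- 1) ^ CARD('n) * det A" for A :: "int^'n^'n"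
proof -
  have "coeff (cpi A) 0 = det (- A)" unfolding poly_0_coeff_0[symmetric] poly_cpi
    by (intro arg_cong[of _ _ det]) (simp add: vec_eq_iff)
  thus ?thesis by (simp add: det_neg)
qed

lemma cpi_monic: "degree (cpi A) = CARD('n)" "lead_coeff (cpi A) = 1" for A :: "int^'n^'n"
proof -
  let ?q = "\<lambda>\<pi>. of_int (sign \<pi>) * (\<Prod>i\<in>UNIV. xmat A$i$\<pi> i)"
  let ?d = "\<Prod>i\<in>UNIV. [:- A$i$i, 1:]"
  let ?rest = "\<Sum>\<pi>\<in>{\<pi>. \<pi> permutes UNIV} - {id}. ?q \<pi>"
  have n0: "CARD('n) > 0" by simp
  have split: "cpi A = ?d + ?rest" unfolding cpi_def det_def
    by (subst sum.remove[of _ id]) (auto simp: finite_permutations permutes_id xmat_def)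
  have dd: "degree ?d = CARD('n)" by (subst degree_prod_eq_sum_degree) auto
  have ld: "lead_coeff ?d = 1" by (simp add: lead_coeff_prod)
  have "degree ?rest \<le> CARD('n) - 1"
  proof (rule degree_sum_le)
    fix \<pi> :: "'n \<Rightarrow> 'n" assume "\<pi> \<in> {\<pi>. \<pi> permutes UNIV} - {id}"
    then obtain k where k: "\<pi> k \<noteq> k" by (auto simp: fun_eq_iff)
    have le1: "degree (xmat A$i$\<pi> i) \<le> (if i = k then 0 else 1)" for i using k by (auto simp: xmat_def)
    have "degree (?q \<pi>) \<le> degree (\<Prod>i\<in>UNIV. xmat A$i$\<pi> i)"
      using degree_mult_le[of "of_int (sign \<pi>)" "\<Prod>i\<in>UNIV. xmat A$i$\<pi> i"] by (simp add: degree_of_int)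
    also have "\<dots> \<le> (\<Sum>i\<in>UNIV. degree (xmat A$i$\<pi> i))" using degree_prod_sum_le[of UNIV "\<lambda>i. xmat A$i$\<pi> i"] by (simp add: o_def)
    also have "\<dots> \<le> (\<Sum>i\<in>UNIV. if i = k then 0 else 1)" by (intro sum_mono le1)
    also have "\<dots> = CARD('n) - 1" by (simp add: sum.If_cases Compl_eq_Diff_UNIV)
    finally show "degree (?q \<pi>) \<le> CARD('n) - 1" .
  qed (simp add: finite_permutations)
  hence lt: "degree ?rest < degree ?d" using n0 dd by linarith
  show "degree (cpi A) = CARD('n)" unfolding split using degree_add_eq_left[OF lt] dd by simp
  show "lead_coeff (cpi A) = 1" unfolding split using degree_add_eq_left[OF lt] ld lt by (simp add: coeff_eq_0)
qed

lemma const_dvd_iff_coeff: "[:c:] dvd (f :: int poly) \<longleftrightarrow> (\<forall>i. c dvd coeff f i)"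
  by (rule const_poly_dvd_iff)

lemma cpi_mcong: assumes "mcong p A B" shows "int p dvd coeff (cpi A) i - coeff (cpi B) i"
proof -
  have "[:int p:] dvd cpi A - cpi B" unfolding cpi_def
  proof (rule det_diff_dvd)
    fix i j
    have "xmat A$i$j - xmat B$i$j = [:- (A$i$j - B$i$j):]" by (simp add: xmat_def)
    moreover have "int p dvd - (A$i$j - B$i$j)" using assms unfolding mcong_def by (metis dvd_minus_iff)
    ultimately show "[:int p:] dvd xmat A$i$j - xmat B$i$j" by (simp only: const_poly_dvd_const_poly_iff)
  qed
  thus ?thesis unfolding const_dvd_iff_coeff by simp
qed

text \<open>\<open>h'\<close> inverts \<open>h\<close> only modulo \<open>p\<close>. Compare X - h C
  h' with h (X - C) h': they differ by X (1 - h h'), which is divisible by \<open>p\<close>. The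
  determinant of the latter is that of X - C times det h det h', and this factor is 1 modulo
  \<open>p\<close>.\<close>

lemma cpi_conj:
  fixes h h' C :: "int^'n^'n"
  assumes "mcong p (h ** h') (mat 1)"
  shows "int p dvd coeff (cpi (h ** C ** h')) i - coeff (cpi C) i"
proof -
  let ?c = "\<lambda>M :: int^'n^'n. (\<chi> i j. [:M$i$j:]) :: int poly^'n^'n"
  let ?X = "(\<chi> i j. if i = j then [:0,1:] else 0) :: int poly^'n^'n"
  have cm: "?c (M ** N) = ?c M ** ?c N" for M N :: "int^'n^'n"
  proof -
    have "[:sum f I:] = (\<Sum>i\<in>I. [:f i:])" for f :: "'n \<Rightarrow> int" and I
      by (simp add: poly_eq_iff coeff_sum coeff_pCons split: nat.splits)
    thus ?thesis by (simp add: vec_eq_iff matrix_matrix_mult_def mult.commute)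
  qed
  have xm: "xmat M = ?X - ?c M" for M by (simp add: vec_eq_iff xmat_def)
  have Xc: "(?c h ** ?X)$i$j = [:0,1:] * [:h$i$j:]" for i j
  proof -
    have "(?c h ** ?X)$i$j = (\<Sum>k\<in>UNIV. if k = j then [:h$i$k:] * [:0,1:] else 0)"
      unfolding matrix_matrix_mult_def vec_lambda_beta by (intro sum.cong) auto
    thus ?thesis by (simp add: mult.commute)
  qed
  have Xhh: "(?c h ** ?X ** ?c h')$i$j = [:0,1:] * ?c (h ** h')$i$j" for i j
  proof -
    have "(?c h ** ?X ** ?c h')$i$j = (\<Sum>k\<in>UNIV. [:0,1:] * ([:h$i$k:] * [:h'$k$j:]))"
      unfolding matrix_matrix_mult_def[of "?c h ** ?X"] by (simp only: vec_lambda_beta Xc mult.assoc)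
    also have "\<dots> = [:0,1:] * (?c h ** ?c h')$i$j"
      unfolding matrix_matrix_mult_def by (simp only: vec_lambda_beta sum_distrib_left)
    finally show ?thesis by (simp only: cm)
  qed
  have "?c h ** xmat C ** ?c h' = ?c h ** ?X ** ?c h' - ?c (h ** C ** h')"
    unfolding xm cm by (simp add: vec_eq_iff matrix_matrix_mult_def algebra_simps sum_subtractf sum_distrib_left)
  hence e: "(?c h ** xmat C ** ?c h')$i$j = [:0,1:] * [:(h ** h')$i$j:] - [:(h ** C ** h')$i$j:]" for i j
    using Xhh[of i j] by simp
  have "[:int p:] dvd det (xmat (h ** C ** h')) - det (?c h ** xmat C ** ?c h')"
  proof (rule det_diff_dvd)
    fix i j
    have "xmat (h ** C ** h')$i$j - (?c h ** xmat C ** ?c h')$i$j = [:0,1:] * [:mat 1$i$j - (h ** h')$i$j:]"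
      unfolding e by (simp add: xmat_def mat_def)
    moreover have "[:int p:] dvd [:mat 1$i$j - (h ** h')$i$j:]"
      using mcong_sym[OF assms] by (simp only: const_poly_dvd_const_poly_iff mcong_def)
    ultimately show "[:int p:] dvd xmat (h ** C ** h')$i$j - (?c h ** xmat C ** ?c h')$i$j" by (metis dvd_mult)
  qed
  from dvd_add[OF this] have "[:int p:] dvd cpi (h ** C ** h') - cpi C"
    if "[:int p:] dvd det (?c h ** xmat C ** ?c h') - det (xmat C)" using that unfolding cpi_def by fastforce
  moreover have "[:int p:] dvd det (?c h ** xmat C ** ?c h') - det (xmat C)"
  proof -
    have dc: "det (?c M) = [:det M:]" for M :: "int^'n^'n"
      using det_hom[of "\<lambda>x. [:x:]" M] by (simp add: one_pCons)
    have "int p dvd det (h ** h') - det (mat 1 :: int^'n^'n)" by (rule mcong_det[OF assms])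
    hence "[:int p:] dvd [:det h * det h' - 1:]" by (simp add: det_mul)
    hence "[:int p:] dvd [:det h * det h' - 1:] * det (xmat C)" by (rule dvd_mult2)
    also have "[:det h * det h' - 1:] * det (xmat C) = det (?c h ** xmat C ** ?c h') - det (xmat C)"
      unfolding det_mul dc by (simp add: smult_diff_left mult.commute)
    finally show ?thesis .
  qed
  ultimately have "[:int p:] dvd cpi (h ** C ** h') - cpi C" by blast
  thus ?thesis unfolding const_dvd_iff_coeff by simp
qed

lemma fpoly_monic: "degree (fpoly n c) = n" "lead_coeff (fpoly n c) = 1"
proof -
  show d: "degree (fpoly n c) = n"
    by (intro antisym degree_le le_degree) (auto simp: coeff_fpoly)
  show "lead_coeff (fpoly n c) = 1" by (simp add: d coeff_fpoly)
qed

section \<open>Companion matrices\<close>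

context
  fixes r :: "'n::finite \<Rightarrow> nat"
  assumes r: "bij_betw r UNIV {..<CARD('n)}"
begin

lemma r_lt: "r i < CARD('n)" using r by (auto dest: bij_betwE)
lemma r_inj: "r i = r j \<longleftrightarrow> i = j" using r by (auto simp: bij_betw_def inj_on_def)
lemma r_surj: "k < CARD('n) \<Longrightarrow> \<exists>i. r i = k" using bij_betw_imp_surj_on[OF r] by (metis imageE lessThan_iff)

definition comp_mat :: "(nat \<Rightarrow> int) \<Rightarrow> int^'n^'n" where
  "comp_mat c = (\<chi> i j. if Suc (r j) < CARD('n) then (if r i = Suc (r j) then 1 else 0) else - c (r i))"

lemma sum_rank: "(\<Sum>i\<in>UNIV. f (r i)) = (\<Sum>k<CARD('n). f k)" for f :: "nat \<Rightarrow> 'b::comm_monoid_add"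
  using sum.reindex_bij_betw[OF r, of f] by simp

lemma cpi_comp_mat: "cpi (comp_mat c) = fpoly CARD('n) c"
proof -
  let ?n = "CARD('n)" and ?C = "comp_mat c" and ?f = "fpoly CARD('n) c"
  let ?x = "[:0,1:] :: int poly"
  have n0: "?n > 0" by simp
  obtain i0 where i0: "r i0 = 0" using r_surj[OF n0] by blast
  \<comment> \<open>Multiplying by \<open>?U\<close> replaces the row of rank 0 by the sum of all
    rows weighted with the powers of x; the sum telescopes to zeros followed by the polynomial
    itself.\<close>
  let ?U = "(\<chi> i j. if i = i0 then ?x ^ r j else if i = j then 1 else 0) :: int poly^'n^'n"
  have dU: "det ?U = 1"
  proof -
    have "det (transpose ?U) = (\<Prod>i\<in>UNIV. transpose ?U$i$i)"
      by (rule det_rank_triangular[of r]) (use r_inj i0 in \<open>auto simp: transpose_def inj_def\<close>)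
    also have "\<dots> = 1" by (intro prod.neutral) (auto simp: transpose_def i0)
    finally show ?thesis by simp
  qed
  let ?M = "?U ** xmat ?C"
  have entry: "xmat ?C$i$j = (if i = j then ?x else 0) - (if Suc (r j) < ?n then (if r i = Suc (r j) then 1 else 0) else [:- c (r i):])" for i j
    by (simp add: xmat_def comp_mat_def one_pCons)
  have M0: "?M$i0$j = (if Suc (r j) < ?n then 0 else ?f)" for j
  proof -
    have "?M$i0$j = (\<Sum>k\<in>UNIV. ?x ^ r k * xmat ?C$k$j)" by (simp add: matrix_matrix_mult_def)
    also have "\<dots> = (\<Sum>k\<in>UNIV. (if k = j then ?x ^ r k * ?x else 0) - ?x ^ r k * (if Suc (r j) < ?n then (if r k = Suc (r j) then 1 else 0) else [:- c (r k):]))"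
      unfolding entry by (intro sum.cong) (auto simp: algebra_simps)
    also have "\<dots> = ?x ^ Suc (r j) - (\<Sum>k\<in>UNIV. ?x ^ r k * (if Suc (r j) < ?n then (if r k = Suc (r j) then 1 else 0) else [:- c (r k):]))"
      by (simp add: sum_subtractf mult.commute)
    also have "(\<Sum>k\<in>UNIV. ?x ^ r k * (if Suc (r j) < ?n then (if r k = Suc (r j) then 1 else 0) else [:- c (r k):]))
        = (\<Sum>k<?n. ?x ^ k * (if Suc (r j) < ?n then (if k = Suc (r j) then 1 else 0) else [:- c k:]))"
      by (rule sum_rank[of "\<lambda>k. ?x ^ k * (if Suc (r j) < ?n then (if k = Suc (r j) then 1 else 0) else [:- c k:])"])
    also have "?x ^ Suc (r j) - \<dots> = (if Suc (r j) < ?n then 0 else ?f)"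
    proof (cases "Suc (r j) < ?n")
      case True
      have "(\<Sum>k<?n. ?x ^ k * (if k = Suc (r j) then 1 else 0)) = (\<Sum>k<?n. if k = Suc (r j) then ?x ^ k else 0)"
        by (intro sum.cong) auto
      thus ?thesis using True by simp
    next
      case False
      hence e: "Suc (r j) = ?n" using r_lt[of j] by simp
      have xk: "?x ^ k = monom 1 k" for k by (simp add: monom_altdef)
      have "(\<Sum>k<?n. ?x ^ k * [:- c k:]) = - (\<Sum>k<?n. monom (c k) k)"
        unfolding xk sum_negf[symmetric] by (intro sum.cong) (auto simp: smult_monom minus_monom)
      thus ?thesis using False e by (simp add: fpoly_def xk)
    qed
    finally show ?thesis .
  qed
  have Mi: "?M$i$j = xmat ?C$i$j" if "i \<noteq> i0" for i j
  proof -
    have "?M$i$j = (\<Sum>k\<in>UNIV. if i = k then xmat ?C$k$j else 0)"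
      using that unfolding matrix_matrix_mult_def vec_lambda_beta by (intro sum.cong) auto
    thus ?thesis by simp
  qed
  \<comment> \<open>A cyclic shift of the columns, which moves the subdiagonal entries -1 and the
    polynomial onto the diagonal.\<close>
  define \<kappa> where "\<kappa> j = (SOME i. r i = (if r j = 0 then ?n - 1 else r j - 1))" for j
  have rk: "r (\<kappa> j) = (if r j = 0 then ?n - 1 else r j - 1)" for j
  proof -
    have "(if r j = 0 then ?n - 1 else r j - 1) < ?n" using r_lt[of j] n0 by auto
    then obtain i where "r i = (if r j = 0 then ?n - 1 else r j - 1)" using r_surj by blast
    thus ?thesis unfolding \<kappa>_def by (rule someI)
  qed
  have "inj \<kappa>"
  proof (rule injI)
    fix i j assume "\<kappa> i = \<kappa> j"
    hence "(if r i = 0 then ?n - 1 else r i - 1) = (if r j = 0 then ?n - 1 else r j - 1)" using rk by metis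
    hence "r i = r j" using r_lt[of i] r_lt[of j] by (auto split: if_splits)
    thus "i = j" using r_inj by simp
  qed
  hence \<kappa>p: "\<kappa> permutes UNIV" by (intro bij_imp_permutes) (auto simp: bij_def finite_UNIV_inj_surj)
  let ?M' = "(\<chi> i j. ?M$i$\<kappa> j) :: int poly^'n^'n"
  \<comment> \<open>The shifted column of rank k > 0 has its entries x and -1 in the rows of rank k
    - 1 and k. In the order 0, n - 1, ..., 1 these lie on one side of the diagonal, the row of rank
    0 having been cleared.\<close>
  let ?\<rho> = "\<lambda>i. if r i = 0 then 0 else ?n - r i"
  have "det ?M' = (\<Prod>i\<in>UNIV. ?M'$i$i)"
  proof (rule det_rank_triangular[of ?\<rho>])
    show "inj ?\<rho>"
    proof (rule injI)
      fix i j assume "?\<rho> i = ?\<rho> j"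
      hence "r i = r j" using r_lt[of i] r_lt[of j] by (auto split: if_splits)
      thus "i = j" using r_inj by simp
    qed
    fix i j assume lt: "?\<rho> i < ?\<rho> j"
    have rj: "r j \<noteq> 0" using lt by (auto split: if_splits)
    have kj: "Suc (r (\<kappa> j)) = r j" "r (\<kappa> j) \<noteq> r j" using rk[of j] rj by auto
    show "?M'$i$j = 0"
    proof (cases "i = i0")
      case True
      thus ?thesis using M0[of "\<kappa> j"] kj r_lt[of j] by simp
    next
      case False
      hence ri: "r i \<noteq> 0" using i0 r_inj by metis
      hence "r j < r i" using lt rj r_lt[of i] r_lt[of j] by auto
      hence "i \<noteq> \<kappa> j" "r i \<noteq> Suc (r (\<kappa> j))" "Suc (r (\<kappa> j)) < ?n" using kj r_lt[of j] by auto
      thus ?thesis using Mi[OF False] entry by simp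
    qed
  qed
  also have "(\<Prod>i\<in>UNIV. ?M'$i$i) = ?M'$i0$i0 * (\<Prod>i\<in>UNIV - {i0}. ?M'$i$i)" by (simp add: prod.remove)
  also have "?M'$i0$i0 = ?f" using M0[of "\<kappa> i0"] rk[of i0] i0 n0 by simp
  also have "(\<Prod>i\<in>UNIV - {i0}. ?M'$i$i) = (\<Prod>i\<in>UNIV - {i0}. - 1)"
  proof (rule prod.cong)
    fix i assume i: "i \<in> UNIV - {i0}"
    hence ri: "r i \<noteq> 0" using i0 r_inj by (metis DiffD2 singletonI)
    have "Suc (r (\<kappa> i)) = r i" using rk[of i] ri by auto
    moreover from this have "i \<noteq> \<kappa> i" by auto
    ultimately show "?M'$i$i = - 1" using Mi[of i "\<kappa> i"] i entry[of i "\<kappa> i"] r_lt[of i] by simp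
  qed simp
  finally have "det ?M' = ?f * (- 1) ^ (?n - 1)" by (simp add: card_Diff_singleton)
  moreover have "det ?M' = of_int (sign \<kappa>) * det ?M" by (rule det_permute_columns[OF \<kappa>p])
  moreover have "det ?M = cpi ?C" unfolding det_mul dU cpi_def by simp
  ultimately have eq: "of_int (sign \<kappa>) * cpi ?C = ?f * (- 1) ^ (?n - 1)" by simp
  \<comment> \<open>The sign of the shift is left uncomputed; comparing leading coefficients decides
    it.\<close>
  have "cpi ?C = ?f \<or> cpi ?C = - ?f"
    using eq by (cases \<kappa> rule: sign_cases; cases "even (?n - 1)") (auto simp: minus_equation_iff)
  moreover have "cpi ?C \<noteq> - ?f"
  proof
    assume "cpi ?C = - ?f"
    hence "lead_coeff (cpi ?C) = - lead_coeff ?f" by simp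
    thus False using cpi_monic(2)[of ?C] fpoly_monic(2)[of ?n c] by simp
  qed
  ultimately show ?thesis by simp
qed

lemma det_comp_mat: "det (comp_mat c) = (- 1) ^ CARD('n) * c 0"
proof -
  have "c 0 = (- 1) ^ CARD('n) * det (comp_mat c)"
    using cpi_coeff_0[of "comp_mat c"] unfolding cpi_comp_mat coeff_fpoly by simp
  thus ?thesis by (simp add: power_mult_distrib[symmetric] mult.assoc[symmetric])
qed

end

section \<open>Counting invertible matrices modulo a prime\<close>

definition dg :: "'n \<Rightarrow> int \<Rightarrow> int^'n^'n" where
  "dg i0 u = (\<chi> i j. if i = j then (if i = i0 then u else 1) else 0)"

lemma det_dg: "det (dg i0 u) = u" for i0 :: "'n::finite"
proof -
  have "det (dg i0 u) = (\<Prod>i\<in>UNIV. dg i0 u$i$i)" by (rule det_diagonal) (simp add: dg_def)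
  also have "\<dots> = (\<Prod>i\<in>UNIV. if i = i0 then u else 1)" by (simp add: dg_def)
  finally show ?thesis by simp
qed

lemma dg_mult: "dg i0 u ** dg i0 v = dg i0 (u * v)" for i0 :: "'n::finite"
proof -
  have "(dg i0 u ** dg i0 v)$i$j = (\<Sum>k\<in>UNIV. if i = k then (if i = i0 then u else 1) * dg i0 v$i$j else 0)" for i j
    unfolding matrix_matrix_mult_def vec_lambda_beta by (intro sum.cong) (auto simp: dg_def)
  thus ?thesis by (simp add: vec_eq_iff) (simp add: dg_def)
qed

lemma dg_cong: "int p dvd u - v \<Longrightarrow> mcong p (dg i0 u) (dg i0 v)" by (auto simp: mcong_def dg_def)

lemma dg_1: "dg i0 1 = mat 1" by (simp add: dg_def mat_def vec_eq_iff)

lemma unit_mod: assumes "prime p" "\<not> int p dvd d" obtains u where "int p dvd u * d - 1"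
proof -
  have "coprime (int p) d" using assms by (simp add: prime_imp_coprime)
  then obtain s t where "s * int p + t * d = 1" by (metis bezout_int coprime_imp_gcd_eq_1)
  hence "t * d - 1 = - s * int p" by (simp add: algebra_simps)
  thus ?thesis using that[of t] by simp
qed

text \<open>A diagonal factor corrects the determinant to 1 modulo \<open>p\<close>. The corrected
  matrix lifts to \<open>elemgrp\<close>, where true inverses exist.\<close>

lemma inverse_mod_prime:
  assumes p: "prime p" and h: "\<not> int p dvd det (h :: int^'n^'n)"
  shows "\<exists>h'. mcong p (h ** h') (mat 1) \<and> mcong p (h' ** h) (mat 1)"
proof -
  obtain u where u: "int p dvd u * det h - 1" using unit_mod[OF p h] .
  define i0 :: 'n where "i0 = undefined"
  let ?D = "dg i0 u" and ?D' = "dg i0 (det h)"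
  have "det (h ** ?D) - 1 = u * det h - 1" by (simp add: det_mul det_dg mult.commute)
  then obtain B where B: "B \<in> elemgrp" "mcong p B (h ** ?D)" using elemgrp_mod_prime[OF p, of "h ** ?D"] u by auto
  obtain B' where B': "B ** B' = mat 1" "B' ** B = mat 1" using elemgrp_inverse[OF B(1)] by blast
  have DD: "mcong p (?D ** ?D') (mat 1)" unfolding dg_mult using dg_cong[of p "u * det h" 1 i0] u by (simp add: dg_1)
  have 1: "mcong p (h ** (?D ** B')) (mat 1)"
    using mcong_mult[OF mcong_sym[OF B(2)] mcong_refl[of p B']] B' by (simp add: matrix_mul_assoc)
  have "mcong p (B' ** (h ** ?D)) (mat 1)" using mcong_mult[OF mcong_refl[of p B'] mcong_sym[OF B(2)]] B' by simp
  hence "mcong p (B' ** (h ** ?D) ** ?D') (mat 1 ** ?D')" by (rule mcong_mult[OF _ mcong_refl])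
  hence a: "mcong p (B' ** h ** (?D ** ?D')) ?D'" by (simp add: matrix_mul_assoc)
  have "mcong p (B' ** h ** mat 1) (B' ** h ** (?D ** ?D'))" by (rule mcong_mult[OF mcong_refl mcong_sym[OF DD]])
  hence "mcong p (B' ** h) ?D'" using a mcong_trans by auto
  hence "mcong p (?D ** (B' ** h)) (?D ** ?D')" by (rule mcong_mult[OF mcong_refl])
  hence "mcong p (?D ** B' ** h) (mat 1)" using DD mcong_trans by (auto simp: matrix_mul_assoc)
  thus ?thesis using 1 by blast
qed

text \<open>Multiplying one row by the units 1, ..., p - 1 embeds that many disjoint copies of
  \<open>SLp p\<close> into all matrices. The factor 2 comes from p \<le> 2 (p - 1).\<close>

lemma card_SLp_le: assumes p: "prime p" shows "card (SLp p :: (int^'n^'n) set) * p \<le> 2 * p ^ (CARD('n) * CARD('n))"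
proof -
  define i0 :: 'n where "i0 = undefined"
  have p2: "p \<ge> 2" using p by (simp add: prime_ge_2_nat)
  let ?f = "\<lambda>(A, u). red p (dg i0 u ** A) :: int^'n^'n"
  have "inj_on ?f (SLp p \<times> {1..<int p})"
  proof (rule inj_onI, clarify)
    fix A A' :: "int^'n^'n" and u u' assume A: "A \<in> SLp p" "A' \<in> SLp p" and u: "u \<in> {1..<int p}" "u' \<in> {1..<int p}"
      and "red p (dg i0 u ** A) = red p (dg i0 u' ** A')"
    hence c: "mcong p (dg i0 u ** A) (dg i0 u' ** A')" by (simp add: red_eq_iff)
    have "int p dvd u * det A - u' * det A'" using mcong_det[OF c] by (simp add: det_mul det_dg)
    moreover have dA: "int p dvd det A - 1" "int p dvd det A' - 1" using A by (auto simp: SLp_def)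
    moreover have "u - u' = (u * det A - u' * det A') - u * (det A - 1) + u' * (det A' - 1)" by (simp add: algebra_simps)
    ultimately have "int p dvd u - u'" by (metis dvd_add dvd_diff dvd_mult)
    hence uu: "u = u'" using u by (metis atLeastLessThan_iff mod_eq_dvd_iff mod_pos_pos_trivial order_trans zero_le_one)
    have "\<not> int p dvd u" using u zdvd_imp_le[of "int p" u] by auto
    then obtain v where v: "int p dvd v * u - 1" using unit_mod[OF p] by blast
    have vu: "mcong p (dg i0 v ** dg i0 u) (mat 1)" unfolding dg_mult using dg_cong[OF v, of i0] by (simp add: dg_1)
    have "mcong p (dg i0 v ** (dg i0 u ** A)) (dg i0 v ** (dg i0 u ** A'))" by (rule mcong_mult[OF mcong_refl c[folded uu]])
    hence 1: "mcong p (dg i0 v ** dg i0 u ** A) (dg i0 v ** dg i0 u ** A')" by (simp add: matrix_mul_assoc)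
    have 2: "mcong p (dg i0 v ** dg i0 u ** M) M" for M using mcong_mult[OF vu mcong_refl[of p M]] by simp
    have "mcong p A A'" by (rule mcong_trans[OF mcong_trans[OF mcong_sym[OF 2] 1] 2])
    hence "red p A = red p A'" by (simp add: red_eq_iff)
    hence "A = A'" using A red_id by (metis (no_types, lifting) SLp_def mem_Collect_eq)
    thus "A = A' \<and> u = u'" using uu by simp
  qed
  moreover have "?f ` (SLp p \<times> {1..<int p}) \<subseteq> Mp p" using red_Mp[of p] p2 by auto
  ultimately have "card (SLp p \<times> {1..<int p} :: ((int^'n^'n) \<times> int) set) \<le> card (Mp p :: (int^'n^'n) set)"
    using finite_Mp by (rule card_inj_on_le)
  hence "card (SLp p :: (int^'n^'n) set) * (p - 1) \<le> p ^ (CARD('n) * CARD('n))" using p2 by (simp add: card_cartesian_product card_Mp nat_diff_distrib)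
  moreover have "card (SLp p :: (int^'n^'n) set) * p \<le> card (SLp p :: (int^'n^'n) set) * (2 * (p - 1))" using p2 by (intro mult_le_mono2) simp
  ultimately show ?thesis by (simp only: mult.left_commute[of _ 2])
qed

definition GLp :: "nat \<Rightarrow> (int^'n^'n) set" where "GLp p = {h\<in>Mp p. \<not> int p dvd det h}"

text \<open>Count the pairs of a matrix \<open>h\<close> and a residue \<open>t\<close> with h + t
  singular. Each \<open>h\<close> has at most n such \<open>t\<close>, since -t is a root of its
  characteristic polynomial, and each singular matrix yields \<open>p\<close> pairs. So at most the
  fraction n/p of all matrices is singular.\<close>

lemma card_GLp: assumes pr: "prime p" "p \<ge> 2 * CARD('n)" shows "p ^ (CARD('n) * CARD('n)) \<le> 2 * card (GLp p :: (int^'n^'n) set)"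
proof -
  obtain R P where "place R P p" using place_exists[OF pr(1)] .
  then interpret place R P p .
  let ?I = "\<lambda>t::int. (\<chi> i j. if i = j then t else 0) :: int^'n^'n"
  let ?X = "Mp p - GLp p :: (int^'n^'n) set"
  let ?S = "SIGMA h:(Mp p :: (int^'n^'n) set). {t\<in>{0..<int p}. int p dvd det (h + ?I t)}"
  have p0: "p > 0" using pr prime_gt_0_nat by blast
  have fiber: "card {t\<in>{0..<int p}. int p dvd det (h + ?I t)} \<le> CARD('n)" for h :: "int^'n^'n"
  proof (rule ccontr)
    let ?T = "{t\<in>{0..<int p}. int p dvd det (h + ?I t)}"
    assume n: "\<not> ?thesis"
    have "coeff (cpoly (cpi h)) CARD('n) \<in> P"
    proof (rule root_bound[of _ "(\<lambda>t. of_int (- t)) ` ?T"])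
      show "coeff (cpoly (cpi h)) i \<in> R" for i by (simp add: coeff_map_poly R_of_int)
      have "inj_on (\<lambda>t. of_int (- t) :: complex) ?T" by (auto simp: inj_on_def)
      hence "card ((\<lambda>t. of_int (- t) :: complex) ` ?T) = card ?T" by (rule card_image)
      moreover have "degree (cpoly (cpi h)) = CARD('n)" using cpi_monic(1)[of h] by (simp add: degree_map_poly)
      ultimately show "degree (cpoly (cpi h)) < card ((\<lambda>t. of_int (- t) :: complex) ` ?T)" using n by simp
      show "s = t" if st: "s \<in> (\<lambda>t. of_int (- t)) ` ?T" "t \<in> (\<lambda>t. of_int (- t)) ` ?T" "s - t \<in> P" for s t
      proof -
        obtain a b where ab: "a \<in> ?T" "b \<in> ?T" "s = of_int (- a)" "t = of_int (- b)" using st by blast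
        have "int p dvd - a - - b" using st(3) of_int_cg[of "- a" "- b"] ab by simp
        hence "int p dvd b - a" by simp
        hence "b = a" using ab(1,2) by (metis (no_types, lifting) atLeastLessThan_iff mem_Collect_eq mod_eq_dvd_iff mod_pos_pos_trivial)
        thus ?thesis using ab by simp
      qed
      show "poly (cpoly (cpi h)) s \<in> P" if st: "s \<in> (\<lambda>t. of_int (- t)) ` ?T" for s
      proof -
        obtain t where t: "t \<in> ?T" "s = of_int (- t)" using st by blast
        have "poly (cpi h) (- t) = det (- (h + ?I t))" unfolding poly_cpi by (intro arg_cong[of _ _ det]) (simp add: vec_eq_iff)
        hence "int p dvd poly (cpi h) (- t)" using t unfolding det_neg by (metis (no_types, lifting) dvd_mult mem_Collect_eq)
        moreover have "poly (cpoly (cpi h)) s = of_int (poly (cpi h) (- t))"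
          unfolding t(2) by (simp add: poly_altdef coeff_map_poly degree_map_poly)
        ultimately show ?thesis using of_int_P by simp
      qed
      show "finite ((\<lambda>t. of_int (- t) :: complex) ` ?T)" by (intro finite_imageI finite_subset[of ?T "{0..<int p}"]) auto
    qed (auto simp: R_of_int R_minus)
    moreover have "coeff (cpi h) CARD('n) = 1" using cpi_monic[of h] by simp
    ultimately show False using P1 by (simp add: coeff_map_poly)
  qed
  have finT: "finite {t\<in>{0..<int p}. int p dvd det (h + ?I t)}" for h by (rule finite_subset[of _ "{0..<int p}"]) auto
  have finS: "finite ?S" by (rule finite_SigmaI[OF finite_Mp finT])
  have "card ?S = (\<Sum>h\<in>Mp p. card {t\<in>{0..<int p}. int p dvd det (h + ?I t)})" by (rule card_SigmaI) (use finite_Mp finT in auto)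
  also have "\<dots> \<le> (\<Sum>h\<in>(Mp p :: (int^'n^'n) set). CARD('n))" using fiber by (rule sum_mono)
  finally have S1: "card ?S \<le> p ^ (CARD('n) * CARD('n)) * CARD('n)" by (simp add: card_Mp)
  let ?g = "\<lambda>(h, t). (red p (h - ?I t), t)"
  have "inj_on ?g (?X \<times> {0..<int p})"
  proof (rule inj_onI, clarify)
    fix h h' :: "int^'n^'n" and t assume h: "h \<in> Mp p" "h' \<in> Mp p" "red p (h - ?I t) = red p (h' - ?I t)"
    hence "mcong p h h'" by (simp add: red_eq_iff mcong_def)
    hence "red p h = red p h'" by (simp add: red_eq_iff)
    thus "h = h' \<and> t = t" using h red_id by metis
  qed
  moreover have "?g ` (?X \<times> {0..<int p}) \<subseteq> ?S"
  proof (rule image_subsetI)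
    fix x assume "x \<in> ?X \<times> {0..<int p}"
    then obtain h :: "int^'n^'n" and t where x: "x = (h, t)" and h: "h \<in> Mp p" "h \<notin> GLp p" and t: "t \<in> {0..<int p}" by blast
    have "mcong p (red p (h - ?I t) + ?I t) h" using red_mcong[of p "h - ?I t"] by (simp add: mcong_def algebra_simps)
    hence "int p dvd det (red p (h - ?I t) + ?I t) - det h" by (rule mcong_det)
    moreover have "int p dvd det h" using h by (simp add: GLp_def)
    ultimately have "int p dvd det (red p (h - ?I t) + ?I t)" by (metis diff_add_cancel dvd_add)
    thus "?g x \<in> ?S" unfolding x using t red_Mp[OF p0] by simp
  qed
  ultimately have "card (?X \<times> {0..<int p}) \<le> card ?S" using finS by (rule card_inj_on_le)
  hence S2: "card ?X * p \<le> p ^ (CARD('n) * CARD('n)) * CARD('n)" using S1 by (simp add: card_cartesian_product)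
  hence "card ?X * p * 2 \<le> p ^ (CARD('n) * CARD('n)) * CARD('n) * 2" by simp
  also have "\<dots> \<le> p ^ (CARD('n) * CARD('n)) * p" using mult_le_mono2[OF pr(2), of "p ^ (CARD('n) * CARD('n))"] by (simp add: mult_ac)
  finally have "(card ?X * 2) * p \<le> p ^ (CARD('n) * CARD('n)) * p" by (simp only: mult_ac)
  hence X: "card ?X * 2 \<le> p ^ (CARD('n) * CARD('n))" using p0 mult_le_cancel2 by blast
  have "card (Mp p :: (int^'n^'n) set) = card (GLp p :: (int^'n^'n) set) + card ?X"
    using card_Un_disjoint[of "GLp p :: (int^'n^'n) set" ?X] finite_Mp[of p] finite_subset[of "GLp p" "Mp p"]
    by (auto simp: GLp_def Un_Diff_cancel Un_absorb1 intro: finite_subset)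
  thus ?thesis using X by (simp add: card_Mp)
qed

definition good_mats :: "nat \<Rightarrow> (nat \<Rightarrow> int) set \<Rightarrow> (int^'n^'n) set" where
  "good_mats p F = {A\<in>SLp p. \<exists>c\<in>F. \<forall>i. int p dvd coeff (cpi A) i - coeff (fpoly CARD('n) c) i}"

text \<open>A conjugate \<open>A = h C h\<^sup>-\<^sup>1\<close> of a companion matrix \<open>C\<close> and the first column of \<open>h\<close> together determine \<open>h\<close>, because \<open>h\<close> sends
  \<open>e\<^sub>k\<^sub>+\<^sub>1 = C e\<^sub>k\<close> to \<open>A (h e\<^sub>k)\<close>.\<close>

lemma card_good_mats:
  fixes F :: "(nat \<Rightarrow> int) set"
  assumes p: "prime p" "p \<ge> 2 * CARD('n)" and F: "F \<subseteq> {..<CARD('n)} \<rightarrow>\<^sub>E {0..<int p}"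
    and const: "\<And>c. c \<in> F \<Longrightarrow> int p dvd c 0 - (-1) ^ CARD('n)"
  shows "card (SLp p :: (int^'n^'n) set) * card F \<le> 4 * p ^ (CARD('n) - 1) * card (good_mats p F :: (int^'n^'n) set)"
proof -
  let ?n = "CARD('n)"
  have p0: "p > 0" using p prime_gt_0_nat by blast
  obtain r :: "'n \<Rightarrow> nat" where r: "bij_betw r UNIV {..<?n}" using ex_bij_betw_finite_nat[of "UNIV :: 'n set"] by (auto simp: atLeast0LessThan)
  obtain i0 where i0: "r i0 = 0" using r_surj[OF r, of 0] by auto
  define iv where "iv h = (SOME h'. mcong p (h ** h') (mat 1) \<and> mcong p (h' ** h) (mat 1))" for h :: "int^'n^'n"
  have iv: "mcong p (h ** iv h) (mat 1)" "mcong p (iv h ** h) (mat 1)" if "h \<in> GLp p" for h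
    using someI_ex[OF inverse_mod_prime[OF p(1), of h]] that unfolding iv_def by (auto simp: GLp_def)
  let ?C = "comp_mat r"
  let ?V = "{v :: int^'n. \<forall>i. v$i \<in> {0..<int p}}"
  let ?f = "\<lambda>(h, c). (red p (h ** ?C c ** iv h), \<chi> i. h$i$i0)"
  have finF: "finite F" using F finite_PiE[of "{..<?n}" "\<lambda>_. {0..<int p}"] finite_subset by auto
  have Ah: "mcong p (h ** ?C c ** iv h ** h) (h ** ?C c)" if "h \<in> GLp p" for h c
    using mcong_mult[OF mcong_refl[of p "h ** ?C c"] iv(2)[OF that]] by (simp add: matrix_mul_assoc)
  have "inj_on ?f (GLp p \<times> F)"
  proof (rule inj_onI, clarify)
    fix h g :: "int^'n^'n" and c d assume h: "h \<in> GLp p" "g \<in> GLp p" and c: "c \<in> F" "d \<in> F"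
      and e: "red p (h ** ?C c ** iv h) = red p (g ** ?C d ** iv g)" "(\<chi> i. h$i$i0) = (\<chi> i. g$i$i0)"
    let ?A = "h ** ?C c ** iv h"
    have Ag: "mcong p (?A ** g) (g ** ?C d)"
    proof -
      have "mcong p ?A (g ** ?C d ** iv g)" using e by (simp add: red_eq_iff)
      hence "mcong p (?A ** g) (g ** ?C d ** iv g ** g)" by (rule mcong_mult[OF _ mcong_refl])
      thus ?thesis using Ah[OF h(2)] mcong_trans by blast
    qed
    have hC: "(M ** ?C b)$i$j' = M$i$j" if jj: "r j = Suc (r j')" for M :: "int^'n^'n" and b i j j'
    proof -
      have "Suc (r j') < ?n" using r_lt[OF r, of j] jj by simp
      hence "(M ** ?C b)$i$j' = (\<Sum>l\<in>UNIV. if l = j then M$i$l else 0)"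
        unfolding matrix_matrix_mult_def comp_mat_def[OF r] vec_lambda_beta
        by (intro sum.cong) (auto simp: jj[symmetric] r_inj[OF r])
      thus ?thesis by simp
    qed
    have col: "\<forall>j. r j = k \<longrightarrow> (\<forall>i. int p dvd h$i$j - g$i$j)" for k
    proof (induction k)
      case 0
      show ?case using e(2) i0 r_inj[OF r] by (auto simp: vec_eq_iff) (metis cancel_comm_monoid_add_class.diff_cancel dvd_0_right)
    next
      case (Suc k)
      show ?case
      proof (intro allI impI)
        fix j i assume j: "r j = Suc k"
        obtain j' where j': "r j' = k" using r_surj[OF r, of k] r_lt[OF r, of j] j by auto
        have "int p dvd (\<Sum>l\<in>UNIV. ?A$i$l * h$l$j' - ?A$i$l * g$l$j')"
          using Suc j' by (intro dvd_sum) (simp flip: right_diff_distrib)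
        hence 1: "int p dvd (?A ** h)$i$j' - (?A ** g)$i$j'" by (simp add: matrix_matrix_mult_def[of ?A] sum_subtractf)
        have 2: "int p dvd (?A ** h)$i$j' - h$i$j" using Ah[OF h(1), of c] hC[of j j' h c i] j j' unfolding mcong_def by metis
        have 3: "int p dvd (?A ** g)$i$j' - g$i$j" using Ag hC[of j j' g d i] j j' unfolding mcong_def by metis
        have "h$i$j - g$i$j = ((?A ** h)$i$j' - (?A ** g)$i$j') - ((?A ** h)$i$j' - h$i$j) + ((?A ** g)$i$j' - g$i$j)" by simp
        thus "int p dvd h$i$j - g$i$j" using 1 2 3 by (metis dvd_add dvd_diff)
      qed
    qed
    hence "mcong p h g" unfolding mcong_def by blast
    hence hg: "h = g" using h red_id red_eq_iff by (metis (no_types, lifting) GLp_def mem_Collect_eq)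
    have "mcong p (h ** ?C c) (h ** ?C d)" using mcong_trans[OF mcong_sym[OF Ah[OF h(1), of c]]] Ag hg by blast
    hence "mcong p (iv h ** (h ** ?C c)) (iv h ** (h ** ?C d))" by (rule mcong_mult[OF mcong_refl])
    hence 1: "mcong p (iv h ** h ** ?C c) (iv h ** h ** ?C d)" by (simp add: matrix_mul_assoc)
    have 2: "mcong p (iv h ** h ** M) M" for M using mcong_mult[OF iv(2)[OF h(1)] mcong_refl[of p M]] by simp
    have CC: "mcong p (?C c) (?C d)" by (rule mcong_trans[OF mcong_trans[OF mcong_sym[OF 2] 1] 2])
    have "c k = d k" if kn: "k < ?n" for k
    proof -
      obtain i where i: "r i = k" using r_surj[OF r kn] by blast
      obtain j where j: "r j = ?n - 1" using r_surj[OF r, of "?n - 1"] by auto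
      have "int p dvd ?C c$i$j - ?C d$i$j" using CC by (simp add: mcong_def)
      hence "int p dvd d k - c k" using j i by (simp add: comp_mat_def[OF r])
      moreover have "c k \<in> {0..<int p}" "d k \<in> {0..<int p}" using c F kn by (blast intro: PiE_mem)+
      ultimately show ?thesis by (metis atLeastLessThan_iff mod_eq_dvd_iff mod_pos_pos_trivial)
    qed
    hence "c = d" using c F by (intro PiE_ext[of c "{..<?n}" "\<lambda>_. {0..<int p}"]) auto
    thus "h = g \<and> c = d" using hg by simp
  qed
  moreover have "?f ` (GLp p \<times> F) \<subseteq> good_mats p F \<times> ?V"
  proof (rule image_subsetI)
    fix x assume "x \<in> (GLp p :: (int^'n^'n) set) \<times> F"
    then obtain h :: "int^'n^'n" and c where x: "x = (h, c)" and h: "h \<in> GLp p" and c: "c \<in> F" by blast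
    let ?A = "h ** ?C c ** iv h"
    have hi: "int p dvd det h * det (iv h) - 1" using mcong_det[OF iv(1)[OF h]] by (simp add: det_mul)
    have dC: "int p dvd det (?C c) - 1"
    proof -
      have "det (?C c) - 1 = (-1) ^ ?n * (c 0 - (-1) ^ ?n)"
        by (simp add: det_comp_mat[OF r] right_diff_distrib power_mult_distrib[symmetric])
      thus ?thesis using const[OF c] by simp
    qed
    have "det ?A - 1 = (det h * det (iv h) - 1) * det (?C c) + (det (?C c) - 1)" by (simp add: det_mul algebra_simps)
    hence "int p dvd det ?A - 1" using dvd_add[OF dvd_mult2[OF hi] dC] by metis
    hence SL: "red p ?A \<in> SLp p" by (rule red_SLp[OF p0])
    have "int p dvd coeff (cpi (red p ?A)) i - coeff (fpoly ?n c) i" for i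
    proof -
      have "int p dvd coeff (cpi (red p ?A)) i - coeff (cpi ?A) i" by (rule cpi_mcong[OF red_mcong])
      moreover have "int p dvd coeff (cpi ?A) i - coeff (fpoly ?n c) i"
        using cpi_conj[OF iv(1)[OF h], of "?C c" i] by (simp add: cpi_comp_mat[OF r])
      ultimately show ?thesis using dvd_add[of "int p" "coeff (cpi (red p ?A)) i - coeff (cpi ?A) i"] by fastforce
    qed
    hence "red p ?A \<in> good_mats p F" using SL c by (auto simp: good_mats_def)
    moreover have "(\<chi> i. h$i$i0) \<in> ?V" using h by (auto simp: GLp_def Mp_def)
    ultimately show "?f x \<in> good_mats p F \<times> ?V" unfolding x by simp
  qed
  moreover have "finite (good_mats p F \<times> ?V)"
    using finite_SLp[of p] card_vec(2)[of "\<lambda>_. {0..<int p}"] by (auto simp: good_mats_def intro: finite_subset)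
  ultimately have "card (GLp p \<times> F :: ((int^'n^'n) \<times> _) set) \<le> card (good_mats p F \<times> ?V :: ((int^'n^'n) \<times> _) set)" by (rule card_inj_on_le)
  moreover have "card ?V = p ^ ?n" using card_vec(1)[of "\<lambda>_ :: 'n. {0..<int p}"] by simp
  ultimately have gl: "card (GLp p :: (int^'n^'n) set) * card F \<le> card (good_mats p F :: (int^'n^'n) set) * p ^ ?n"
    by (simp add: card_cartesian_product)
  let ?s = "card (SLp p :: (int^'n^'n) set)" and ?g = "card (good_mats p F :: (int^'n^'n) set)" and ?N = "p ^ (?n * ?n)"
  \<comment> \<open>\<open>card (SLp p) * p\<close> is at most 2 p^(n^2), hence at most 4
    \<open>card (GLp p)\<close>; combined with \<open>gl\<close>, one factor \<open>p\<close>
    cancels.\<close>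
  have "?s * card F * p \<le> 2 * ?N * card F" using mult_le_mono1[OF card_SLp_le[OF p(1)], of "card F"] by (simp add: mult_ac)
  also have "\<dots> \<le> 2 * (2 * card (GLp p :: (int^'n^'n) set)) * card F" using card_GLp[OF p] by (intro mult_le_mono1 mult_le_mono2) auto
  also have "\<dots> \<le> 4 * (?g * p ^ ?n)" using gl by simp
  also have "p ^ ?n = p ^ (?n - 1) * p" by (simp add: power_eq_if)
  finally have "?s * card F * p \<le> (4 * p ^ (?n - 1) * ?g) * p" by (simp add: mult_ac)
  thus ?thesis using p0 by simp
qed

section \<open>Galois action on the roots of a characteristic polynomial\<close>

definition rts :: "int poly \<Rightarrow> complex set" where "rts f = {z. poly (cpoly f) z = 0}"

lemma lead_coeff_cpoly: "lead_coeff f = 1 \<Longrightarrow> lead_coeff (cpoly f) = 1" "degree (cpoly f) = degree f"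
  by (simp_all add: degree_map_poly coeff_map_poly)

lemma
  assumes f: "lead_coeff f = 1"
  shows finite_rts: "finite (rts f)" and card_rts: "card (rts f) \<le> degree f"
    and rts_algebraic_int: "z \<in> rts f \<Longrightarrow> algebraic_int z" and gstable_rts: "gstable (rts f)"
proof -
  have nz: "cpoly f \<noteq> 0" using lead_coeff_cpoly(1)[OF f] by auto
  show fin: "finite (rts f)" unfolding rts_def by (rule poly_roots_finite[OF nz])
  show "card (rts f) \<le> degree f" unfolding rts_def using card_poly_roots_bound[OF nz] by (simp add: degree_map_poly)
  show ai: "algebraic_int z" if "z \<in> rts f" for z
    by (rule algebraic_int.intros[of "cpoly f"]) (use that lead_coeff_cpoly(1)[OF f] in \<open>auto simp: rts_def coeff_map_poly\<close>)
  show "gstable (rts f)" unfolding gstable_def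
  proof (intro conjI ballI fin subsetI)
    show q: "z \<in> qbar" if "z \<in> rts f" for z
      using ai[OF that] by (simp add: qbar_def algebraic_int_imp_algebraic)
    fix \<sigma> z assume s: "\<sigma> \<in> autq" and z: "z \<in> rts f"
    have "\<sigma> (poly (cpoly f) z) = poly (cpoly f) (\<sigma> z)"
      by (rule autq_poly[OF s]) (use q[OF z] in \<open>auto simp: coeff_map_poly autq_of_int[OF s]\<close>)
    thus "\<sigma> z \<in> rts f" using z autq_0[OF s] by (simp add: rts_def)
  qed
qed

lemma gstableD: "gstable Z \<Longrightarrow> \<sigma> \<in> autq \<Longrightarrow> z \<in> Z \<Longrightarrow> \<sigma> z \<in> Z" by (auto simp: gstable_def)

context place
begin

lemma poly_cg:
  assumes "\<And>i. coeff f i \<equiv>\<^sub>P coeff g i" "x \<in> R" shows "poly f x \<equiv>\<^sub>P poly g x"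
proof -
  have "poly (f - g) x \<in> P" unfolding poly_altdef
    by (intro P_sum P_mult' R_power) (use assms in auto)
  thus ?thesis by simp
qed

text \<open>The value at \<open>x\<close> is a product of powers of the differences x - z over the
  roots, and \<open>P\<close> is prime.\<close>

lemma root_near:
  assumes f: "lead_coeff f = 1" and x: "x \<in> R" "poly (cpoly f) x \<in> P"
  shows "\<exists>z\<in>rts f. x \<equiv>\<^sub>P z"
proof -
  have xz: "x - z \<in> R" if "z \<in> rts f" for z using x R_diff alg_int_R rts_algebraic_int[OF f that] by blast
  have "(\<Prod>z\<in>rts f. [:- z, 1:] ^ Polynomial.order z (cpoly f)) = cpoly f"
    using complex_poly_decompose[of "cpoly f"] lead_coeff_cpoly(1)[OF f] by (simp add: rts_def)
  hence "poly (cpoly f) x = poly (\<Prod>z\<in>rts f. [:- z, 1:] ^ Polynomial.order z (cpoly f)) x" by (rule arg_cong[OF sym])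
  hence "(\<Prod>z\<in>rts f. (x - z) ^ Polynomial.order z (cpoly f)) \<in> P" using x by (simp add: poly_prod poly_power)
  hence "\<exists>z\<in>rts f. (x - z) ^ Polynomial.order z (cpoly f) \<in> P"
    using P_prodE[OF finite_rts[OF f], of "\<lambda>z. (x - z) ^ Polynomial.order z (cpoly f)"] R_power xz by simp
  then obtain z where "z \<in> rts f" "(x - z) ^ Polynomial.order z (cpoly f) \<in> P" by blast
  thus ?thesis using P_power xz by blast
qed

text \<open>\<open>ptype\<close> depends on \<open>f\<close> modulo \<open>p\<close> only and speaks
  of residues; this is the same pattern carried by the actual roots.\<close>

definition rmatch :: "nat \<Rightarrow> nat \<Rightarrow> int poly \<Rightarrow> (nat \<Rightarrow> complex) \<Rightarrow> bool" where
  "rmatch n m f \<gamma> \<longleftrightarrow> bij_betw \<gamma> {..<n} (rts f) \<and> (\<forall>k<n. \<forall>l<n. \<gamma> k \<equiv>\<^sub>P \<gamma> l \<longrightarrow> k = l) \<and>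
     (\<forall>k<m. \<gamma> k ^ p \<equiv>\<^sub>P \<gamma> (if Suc k < m then Suc k else 0)) \<and>
     (\<forall>k. m \<le> k \<longrightarrow> k < n \<longrightarrow> (\<exists>a::int. \<gamma> k \<equiv>\<^sub>P of_int a \<and> \<not> int p dvd a - 1 \<and> \<not> int p dvd a + 1))"

text \<open>Each residue is congruent to some root, and incongruent residues give different roots.
  As \<open>f\<close> has at most \<open>n\<close> roots, all are met, each exactly once.\<close>

lemma ptype_rmatch:
  assumes f: "lead_coeff f = 1" "degree f = n" and t: "ptype n m f" and m: "0 < m" "m < n"
  shows "\<exists>\<gamma>. rmatch n m f \<gamma>"
proof -
  obtain \<beta> where b: "(\<forall>k<n. \<beta> k \<in> R) \<and> (\<forall>k<n. \<forall>l<n. \<beta> k \<equiv>\<^sub>P \<beta> l \<longrightarrow> k = l) \<and>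
     (\<forall>k<m. \<beta> k ^ p \<equiv>\<^sub>P \<beta> (if Suc k < m then Suc k else 0)) \<and>
     (\<forall>k. m \<le> k \<longrightarrow> k < n \<longrightarrow> (\<exists>a::int. \<beta> k = of_int a \<and> \<not> int p dvd a - 1 \<and> \<not> int p dvd a + 1)) \<and>
     (\<forall>i. coeff (cpoly f) i \<equiv>\<^sub>P coeff (\<Prod>k<n. [:- \<beta> k, 1:]) i)" using t unfolding ptype_def by (rule exE)
  note b2 = conjunct2[OF b] and b3 = conjunct2[OF conjunct2[OF b]] and b4 = conjunct2[OF conjunct2[OF conjunct2[OF b]]]
  note \<beta> = conjunct1[OF b] conjunct1[OF b2] conjunct1[OF b3] conjunct1[OF b4] conjunct2[OF b4]
  have "\<exists>z\<in>rts f. \<beta> k \<equiv>\<^sub>P z" if k: "k < n" for k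
  proof (rule root_near[OF f(1)])
    show bR: "\<beta> k \<in> R" using \<beta>(1) k by blast
    have "poly (cpoly f) (\<beta> k) \<equiv>\<^sub>P poly (\<Prod>j<n. [:- \<beta> j, 1:]) (\<beta> k)" using \<beta>(5) by (intro poly_cg[OF _ bR]) blast
    moreover have "poly (\<Prod>j<n. [:- \<beta> j, 1:]) (\<beta> k) = 0" using k by (auto simp: poly_prod)
    ultimately show "poly (cpoly f) (\<beta> k) \<in> P" by simp
  qed
  then obtain \<gamma> where \<gamma>: "\<And>k. k < n \<Longrightarrow> \<gamma> k \<in> rts f" "\<And>k. k < n \<Longrightarrow> \<beta> k \<equiv>\<^sub>P \<gamma> k" by metis
  have gR: "\<gamma> k \<in> R" if "k < n" for k using \<gamma>(1)[OF that] alg_int_R rts_algebraic_int[OF f(1)] by blast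
  have inc: "k = l" if kl: "k < n" "l < n" "\<gamma> k \<equiv>\<^sub>P \<gamma> l" for k l
  proof -
    have "\<beta> k \<equiv>\<^sub>P \<beta> l" by (rule cg_trans[OF cg_trans[OF \<gamma>(2)[OF kl(1)] kl(3)] cg_sym[OF \<gamma>(2)[OF kl(2)]]])
    thus ?thesis using \<beta>(2) kl by blast
  qed
  have inj: "inj_on \<gamma> {..<n}"
  proof (rule inj_onI)
    fix k l assume "k \<in> {..<n}" "l \<in> {..<n}" "\<gamma> k = \<gamma> l"
    thus "k = l" using inc[of k l] P0 by simp
  qed
  have "\<gamma> ` {..<n} = rts f"
  proof (rule card_subset_eq[OF finite_rts[OF f(1)]])
    show sub: "\<gamma> ` {..<n} \<subseteq> rts f" using \<gamma>(1) by auto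
    show "card (\<gamma> ` {..<n}) = card (rts f)"
      using card_mono[OF finite_rts[OF f(1)] sub] card_rts[OF f(1)] card_image[OF inj] f(2) by simp
  qed
  hence "bij_betw \<gamma> {..<n} (rts f)" using inj by (simp add: bij_betw_def)
  moreover have "\<gamma> k ^ p \<equiv>\<^sub>P \<gamma> (if Suc k < m then Suc k else 0)" if k: "k < m" for k
  proof -
    let ?l = "if Suc k < m then Suc k else 0"
    have kn: "k < n" "?l < n" using k m by auto
    have "\<gamma> k ^ p \<equiv>\<^sub>P \<beta> k ^ p" by (rule cg_power[OF cg_sym[OF \<gamma>(2)[OF kn(1)]]]) (use gR \<beta>(1) kn in blast)+
    moreover have "\<beta> k ^ p \<equiv>\<^sub>P \<beta> ?l" using \<beta>(3) k by blast
    ultimately have "\<gamma> k ^ p \<equiv>\<^sub>P \<beta> ?l" by (rule cg_trans)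
    thus ?thesis by (rule cg_trans[OF _ \<gamma>(2)[OF kn(2)]])
  qed
  moreover have "\<exists>a::int. \<gamma> k \<equiv>\<^sub>P of_int a \<and> \<not> int p dvd a - 1 \<and> \<not> int p dvd a + 1" if k: "m \<le> k" "k < n" for k
    using \<beta>(4) cg_sym[OF \<gamma>(2)[OF k(2)]] k by metis
  ultimately show ?thesis using inc unfolding rmatch_def by blast
qed

text \<open>The roots are pairwise incongruent, so the root to which \<sigma> sends a given one can
  be read off from congruences.\<close>

lemma frob_rmatch:
  assumes g: "rmatch n m f \<gamma>" and f: "lead_coeff f = 1" and m: "0 < m" "m < n"
    and s: "\<sigma> \<in> autq" "\<And>z. z \<in> rts f \<Longrightarrow> \<sigma> z \<equiv>\<^sub>P z ^ p"
  shows "k < m \<Longrightarrow> \<sigma> (\<gamma> k) = \<gamma> (if Suc k < m then Suc k else 0)" "m \<le> k \<Longrightarrow> k < n \<Longrightarrow> \<sigma> (\<gamma> k) = \<gamma> k"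
proof -
  have bij: "bij_betw \<gamma> {..<n} (rts f)" and inc: "\<And>k l. k < n \<Longrightarrow> l < n \<Longrightarrow> \<gamma> k \<equiv>\<^sub>P \<gamma> l \<Longrightarrow> k = l"
    using g unfolding rmatch_def by blast+
  have step: "\<sigma> (\<gamma> k) = \<gamma> l" if kl: "k < n" "l < n" "\<gamma> k ^ p \<equiv>\<^sub>P \<gamma> l" for k l
  proof -
    have gk: "\<gamma> k \<in> rts f" using bij kl(1) by (auto dest: bij_betwE)
    hence "\<sigma> (\<gamma> k) \<in> rts f" by (rule gstableD[OF gstable_rts[OF f] s(1)])
    then obtain j where j: "j < n" "\<sigma> (\<gamma> k) = \<gamma> j" using bij_betw_imp_surj_on[OF bij] by (metis imageE lessThan_iff)
    have "\<gamma> j \<equiv>\<^sub>P \<gamma> l" using cg_trans[OF s(2)[OF gk] kl(3)] j by simp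
    hence "j = l" using inc j kl by blast
    thus ?thesis using j by simp
  qed
  show "k < m \<Longrightarrow> \<sigma> (\<gamma> k) = \<gamma> (if Suc k < m then Suc k else 0)"
    using g m unfolding rmatch_def by (intro step) auto
  assume k: "m \<le> k" "k < n"
  then obtain a :: int where a: "\<gamma> k \<equiv>\<^sub>P of_int a" using g unfolding rmatch_def by blast
  have "\<gamma> k \<in> rts f" using bij k(2) by (auto dest: bij_betwE)
  hence gR: "\<gamma> k \<in> R" using alg_int_R rts_algebraic_int[OF f] by blast
  have "\<gamma> k ^ p \<equiv>\<^sub>P \<gamma> k" by (rule cg_trans[OF cg_trans[OF cg_power[OF a gR R_of_int] fermat] cg_sym[OF a]])
  thus "\<sigma> (\<gamma> k) = \<gamma> k" using step k by blast
qed

text \<open>A rational root would be an integer dividing the constant coefficient, hence 1 or -1.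
  This is why \<open>ptype\<close> keeps the residues of the fixed roots away from these two
  values.\<close>

lemma rmatch_irrational:
  assumes g: "rmatch n m f \<gamma>" and f: "lead_coeff f = 1" "\<bar>coeff f 0\<bar> = 1" and k: "m \<le> k" "k < n"
  shows "\<gamma> k \<notin> \<rat>"
proof
  assume rat: "\<gamma> k \<in> \<rat>"
  have gk: "\<gamma> k \<in> rts f" using g k unfolding rmatch_def by (auto dest: bij_betwE)
  obtain b where b: "\<gamma> k = of_int b"
    using rational_algebraic_int_is_int[OF rts_algebraic_int[OF f(1) gk] rat] by (auto elim: Ints_cases)
  have "poly (cpoly f) (of_int b) = of_int (poly f b)" by (simp add: poly_altdef coeff_map_poly degree_map_poly)
  hence "poly f b = 0" using gk b by (simp add: rts_def)
  moreover obtain c q where fq: "f = pCons c q" by (cases f)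
  ultimately have "c = - (b * poly q b)" by simp
  hence "b dvd coeff f 0" unfolding fq by simp
  hence b1: "\<bar>b\<bar> = 1" using f(2) by (metis dvd_abs_iff zdvd1_eq)
  obtain a where a: "\<gamma> k \<equiv>\<^sub>P of_int a" "\<not> int p dvd a - 1" "\<not> int p dvd a + 1" using g k unfolding rmatch_def by blast
  have "int p dvd b - a" using a(1) of_int_cg[of b a] b by simp
  hence "int p dvd a - b" by (simp add: dvd_diff_commute)
  thus False using a b1 by (cases "b \<ge> 0") auto
qed

lemma frobenius_on:
  assumes Z: "gstable Z" "\<And>z. z \<in> Z \<Longrightarrow> algebraic_int z" and big: "p > card Z ^ card Z * card Z"
  obtains \<sigma> where "\<sigma> \<in> autq" "\<And>z. z \<in> Z \<Longrightarrow> \<sigma> z \<equiv>\<^sub>P z ^ p"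
proof -
  have fin: "finite Z" using Z(1) by (simp add: gstable_def)
  obtain a where a: "bij_betw a {..<card Z} Z" using ex_bij_betw_nat_finite[OF fin] by (auto simp: atLeast0LessThan)
  have aZ: "a i \<in> Z" if "i < card Z" for i using a that by (auto dest: bij_betwE)
  have "\<exists>\<sigma>\<in>autq. \<forall>i<card Z. \<sigma> (a i) \<equiv>\<^sub>P a i ^ p"
    by (rule frobenius_exists[where Z = Z]) (use Z(2) aZ gstableD[OF Z(1)] fin big in auto)
  then obtain \<sigma> where s: "\<sigma> \<in> autq" "\<forall>i<card Z. \<sigma> (a i) \<equiv>\<^sub>P a i ^ p" by blast
  have "\<sigma> z \<equiv>\<^sub>P z ^ p" if z: "z \<in> Z" for z
  proof -
    obtain i where "i < card Z" "z = a i" using z bij_betw_imp_surj_on[OF a] by (metis imageE lessThan_iff)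
    thus ?thesis using s(2) by blast
  qed
  thus ?thesis using that[OF s(1)] by blast
qed

lemma ptype_frobenius:
  assumes f: "lead_coeff f = 1" "degree f = n" "\<bar>coeff f 0\<bar> = 1" and t: "ptype n m f"
    and m: "0 < m" "m < n" and big: "p > n ^ n * n"
  obtains \<gamma> \<sigma> where "\<sigma> \<in> autq" "bij_betw \<gamma> {..<n} (rts f)"
    "\<And>k. k < m \<Longrightarrow> \<sigma> (\<gamma> k) = \<gamma> (if Suc k < m then Suc k else 0)"
    "\<And>k. m \<le> k \<Longrightarrow> k < n \<Longrightarrow> \<sigma> (\<gamma> k) = \<gamma> k" "\<And>k. m \<le> k \<Longrightarrow> k < n \<Longrightarrow> \<gamma> k \<notin> \<rat>"
proof -
  obtain \<gamma> where g: "rmatch n m f \<gamma>" using ptype_rmatch[OF f(1,2) t m] by blast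
  have bij: "bij_betw \<gamma> {..<n} (rts f)" using g unfolding rmatch_def by blast
  have "card (rts f) = n" using bij_betw_same_card[OF bij] by simp
  then obtain \<sigma> where s: "\<sigma> \<in> autq" "\<And>z. z \<in> rts f \<Longrightarrow> \<sigma> z \<equiv>\<^sub>P z ^ p"
    using frobenius_on[OF gstable_rts[OF f(1)] rts_algebraic_int[OF f(1)]] big by metis
  show ?thesis
  proof (rule that[OF s(1) bij])
    show "\<sigma> (\<gamma> k) = \<gamma> (if Suc k < m then Suc k else 0)" if "k < m" for k
      by (rule frob_rmatch(1)[OF g f(1) m s(1) _ that]) (rule s(2))
    show "\<sigma> (\<gamma> k) = \<gamma> k" if k: "m \<le> k" "k < n" for k
      by (rule frob_rmatch(2)[OF g f(1) m s(1) _ k]) (rule s(2))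
    show "\<gamma> k \<notin> \<rat>" if k: "m \<le> k" "k < n" for k by (rule rmatch_irrational[OF g f(1,3) k])
  qed
qed

text \<open>The square of a Frobenius element tells the two kernels apart: its action is nontrivial on one
  set of roots and trivial on the other.\<close>

lemma ptype_ker_ne:
  assumes f: "lead_coeff f = 1" "degree f = n" and h: "lead_coeff h = 1" "degree h = n" and n: "n \<ge> 4"
    and t: "ptype n (if \<forall>z\<in>rts h. z ^ (p ^ 2) \<equiv>\<^sub>P z then n - 1 else 2) f"
    and inc: "\<And>x y. x \<in> rts h \<Longrightarrow> y \<in> rts h \<Longrightarrow> x \<equiv>\<^sub>P y \<Longrightarrow> x = y"
    and big: "p > (2 * n) ^ (2 * n) * (2 * n)"
  shows "ker_of (rts f) \<noteq> ker_of (rts h)"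
proof
  assume eq: "ker_of (rts f) = ker_of (rts h)"
  define m where "m = (if \<forall>z\<in>rts h. z ^ (p ^ 2) \<equiv>\<^sub>P z then n - 1 else 2)"
  \<comment> \<open>A single automorphism has to act as Frobenius on both root sets, hence the union
    and the doubled bound on \<open>p\<close>.\<close>
  let ?Z = "rts f \<union> rts h"
  have m: "0 < m" "m < n" using n by (auto simp: m_def)
  obtain \<gamma> where g: "rmatch n m f \<gamma>" using ptype_rmatch[OF f _ m] t unfolding m_def by blast
  have bij: "bij_betw \<gamma> {..<n} (rts f)" using g unfolding rmatch_def by blast
  have gs: "gstable ?Z" using gstable_rts[OF f(1)] gstable_rts[OF h(1)] by (auto simp: gstable_def)
  have ai: "algebraic_int z" if "z \<in> ?Z" for z using that rts_algebraic_int[OF f(1)] rts_algebraic_int[OF h(1)] by blast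
  have "card ?Z \<le> 2 * n" using card_Un_le[of "rts f" "rts h"] card_rts[OF f(1)] card_rts[OF h(1)] f h by simp
  hence "card ?Z ^ card ?Z * card ?Z \<le> (2 * n) ^ (2 * n) * (2 * n)"
    using n by (intro mult_le_mono order.trans[OF power_mono power_increasing]) auto
  hence lt: "card ?Z ^ card ?Z * card ?Z < p" using big by linarith
  obtain \<sigma> where s: "\<sigma> \<in> autq" "\<And>z. z \<in> ?Z \<Longrightarrow> \<sigma> z \<equiv>\<^sub>P z ^ p" using frobenius_on[OF gs _ lt] ai by metis
  have fr1: "\<sigma> (\<gamma> k) = \<gamma> (if Suc k < m then Suc k else 0)" if "k < m" for k
    by (rule frob_rmatch(1)[OF g f(1) m s(1) _ that]) (use s(2) in blast)
  have fr2: "\<sigma> (\<gamma> k) = \<gamma> k" if "m \<le> k" "k < n" for k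
    by (rule frob_rmatch(2)[OF g f(1) m s(1) _ that]) (use s(2) in blast)
  have ss: "\<sigma> \<circ> \<sigma> \<in> autq" by (rule autq_comp[OF s(1) s(1)])
  have sq: "(\<sigma> \<circ> \<sigma>) z \<equiv>\<^sub>P z ^ (p ^ 2)" if z: "z \<in> rts h" for z
  proof -
    have z': "\<sigma> z \<in> rts h" by (rule gstableD[OF gstable_rts[OF h(1)] s(1) z])
    have R: "z \<in> R" "\<sigma> z \<in> R" using z z' alg_int_R rts_algebraic_int[OF h(1)] by blast+
    have "\<sigma> z ^ p \<equiv>\<^sub>P (z ^ p) ^ p" by (rule cg_power[OF s(2) R(2) R_power[OF R(1)]]) (use z in blast)
    hence "\<sigma> (\<sigma> z) \<equiv>\<^sub>P (z ^ p) ^ p" using cg_trans[OF s(2)] z' by blast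
    thus ?thesis by (simp add: power2_eq_square power_mult)
  qed
  show False
  proof (cases "\<forall>z\<in>rts h. z ^ (p ^ 2) \<equiv>\<^sub>P z")
    case True
    hence mn: "m = n - 1" by (auto simp: m_def)
    have "(\<sigma> \<circ> \<sigma>) z = z" if z: "z \<in> rts h" for z
    proof (rule inc)
      show "(\<sigma> \<circ> \<sigma>) z \<in> rts h" by (rule gstableD[OF gstable_rts[OF h(1)] ss z])
      have "z ^ (p ^ 2) \<equiv>\<^sub>P z" using True z by blast
      with sq[OF z] show "(\<sigma> \<circ> \<sigma>) z \<equiv>\<^sub>P z" by (rule cg_trans)
    qed (rule z)
    hence "\<sigma> \<circ> \<sigma> \<in> ker_of (rts h)" using ss unfolding ker_of_def by blast
    hence "\<sigma> \<circ> \<sigma> \<in> ker_of (rts f)" using eq by simp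
    moreover have g0: "\<gamma> 0 \<in> rts f" using bij n by (auto dest: bij_betwE)
    ultimately have "\<sigma> (\<sigma> (\<gamma> 0)) = \<gamma> 0" by (auto simp: ker_of_def)
    \<comment> \<open>The cycle has length at least 3, so its square moves the first root to the
      third.\<close>
    moreover have "2 < m" using n mn by linarith
    moreover from this have "\<sigma> (\<gamma> 0) = \<gamma> 1" "\<sigma> (\<gamma> 1) = \<gamma> 2" using fr1[of 0] fr1[of 1] by (simp_all add: numeral_2_eq_2)
    ultimately have "\<gamma> 2 = \<gamma> 0" by simp
    thus False using bij_betw_imp_inj_on[OF bij] n by (auto dest: inj_onD)
  next
    case False
    hence m2: "m = 2" by (simp only: m_def if_False)
    have "(\<sigma> \<circ> \<sigma>) z = z" if z: "z \<in> rts f" for z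
    proof -
      obtain k where k: "k < n" "z = \<gamma> k" using z bij_betw_imp_surj_on[OF bij] by (metis imageE lessThan_iff)
      have s01: "\<sigma> (\<gamma> 0) = \<gamma> 1" "\<sigma> (\<gamma> 1) = \<gamma> 0" using fr1[of 0] fr1[of 1] m2 by simp_all
      consider "k = 0" | "k = 1" | "2 \<le> k" by linarith
      thus ?thesis
      proof cases
        case 1 thus ?thesis using s01 k(2) by simp
      next
        case 2 thus ?thesis using s01 k(2) by simp
      next
        case 3 thus ?thesis using fr2[of k] k m2 by simp
      qed
    qed
    hence "\<sigma> \<circ> \<sigma> \<in> ker_of (rts f)" using ss unfolding ker_of_def by blast
    hence "\<sigma> \<circ> \<sigma> \<in> ker_of (rts h)" using eq by simp
    hence "(\<sigma> \<circ> \<sigma>) z = z" if "z \<in> rts h" for z using that by (auto simp: ker_of_def)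
    hence "z ^ (p ^ 2) \<equiv>\<^sub>P z" if "z \<in> rts h" for z using cg_sym[OF sq[OF that]] that by metis
    thus False using False by blast
  qed
qed

lemma ptype_cong:
  assumes "\<And>i. int p dvd coeff f i - coeff g i" "ptype n m f" shows "ptype n m g"
proof -
  have c: "coeff (cpoly g) i \<equiv>\<^sub>P coeff (cpoly f) i" for i
    using cg_sym[of "of_int (coeff f i)" "of_int (coeff g i)"] assms(1)[of i] of_int_cg by (simp add: coeff_map_poly)
  obtain \<beta> where b: "(\<forall>k<n. \<beta> k \<in> R) \<and> (\<forall>k<n. \<forall>l<n. \<beta> k \<equiv>\<^sub>P \<beta> l \<longrightarrow> k = l) \<and>
     (\<forall>k<m. \<beta> k ^ p \<equiv>\<^sub>P \<beta> (if Suc k < m then Suc k else 0)) \<and>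
     (\<forall>k. m \<le> k \<longrightarrow> k < n \<longrightarrow> (\<exists>a::int. \<beta> k = of_int a \<and> \<not> int p dvd a - 1 \<and> \<not> int p dvd a + 1)) \<and>
     (\<forall>i. coeff (cpoly f) i \<equiv>\<^sub>P coeff (\<Prod>k<n. [:- \<beta> k, 1:]) i)" using assms(2) unfolding ptype_def by (rule exE)
  note b2 = conjunct2[OF b] and b3 = conjunct2[OF conjunct2[OF b]] and b4 = conjunct2[OF conjunct2[OF conjunct2[OF b]]]
  note \<beta> = conjunct1[OF b] conjunct1[OF b2] conjunct1[OF b3] conjunct1[OF b4] conjunct2[OF b4]
  have "coeff (cpoly g) i \<equiv>\<^sub>P coeff (\<Prod>k<n. [:- \<beta> k, 1:]) i" for i using cg_trans[OF c] \<beta>(5) by blast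
  thus ?thesis using \<beta>(1-4) unfolding ptype_def by (intro exI[of _ \<beta>] conjI) blast+
qed

end

text \<open>A nonzero difference of two elements of \<open>Z\<close> satisfies an integer equation
  with nonzero constant coefficient. If the difference lies in \<open>P\<close>, then
  \<open>p\<close> divides that coefficient, which bounds \<open>p\<close> for every place above
  it.\<close>

lemma distinct_mod_large_primes:
  assumes fin: "finite Z" and Z: "\<And>z. z \<in> Z \<Longrightarrow> algebraic_int z"
  shows "\<exists>B. \<forall>p>B. \<forall>R P. place R P p \<longrightarrow> (\<forall>x\<in>Z. \<forall>y\<in>Z. x - y \<in> P \<longrightarrow> x = y)"
proof -
  have "\<exists>c::int. c \<noteq> 0 \<and> (\<forall>p R P. place R P p \<longrightarrow> x - y \<in> P \<longrightarrow> int p dvd c)" if xy: "x \<in> Z" "y \<in> Z" "x \<noteq> y" for x y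
  proof -
    define d where "d = x - y"
    have d0: "d \<noteq> 0" using xy by (simp add: d_def)
    have "d \<in> qbar" unfolding d_def using Z xy by (intro qbar_closed) (auto simp: qbar_def algebraic_int_imp_algebraic)
    hence "algebraic d" by (simp add: qbar_def)
    then obtain q where q: "q \<noteq> 0" "poly (cpoly q) d = 0" by (rule algebraicE')
    \<comment> \<open>Factors X can be removed from the polynomial because \<open>d\<close> is not
      0.\<close>
    have "\<exists>q. poly (cpoly q) d = 0 \<and> coeff q 0 \<noteq> 0" using q(2,1)
    proof (induction q rule: pCons_induct)
      case (pCons c q)
      show ?case
      proof (cases "c = 0")
        case True
        hence "q \<noteq> 0" using pCons by auto
        moreover have "poly (cpoly q) d = 0" using pCons.prems True d0 by (simp add: map_poly_pCons)
        ultimately show ?thesis using pCons.IH by blast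
      next
        case False thus ?thesis using pCons.prems by (intro exI[of _ "pCons c q"]) simp
      qed
    qed simp
    then obtain q where q: "poly (cpoly q) d = 0" "coeff q 0 \<noteq> 0" by blast
    have "int p dvd coeff q 0" if pl: "place R P p" and dP: "x - y \<in> P" for p R P
    proof -
      interpret place R P p by (rule pl)
      have "poly (cpoly q) d - poly (cpoly q) 0 \<in> P"
      proof -
        have dR: "d \<in> R" unfolding d_def using alg_int_R Z xy R_diff by blast
        have "d ^ i - 0 ^ i \<in> P" for i
          using cg_power[of d 0 i] dP dR R0 by (simp add: d_def)
        hence "(\<Sum>i\<le>degree (cpoly q). coeff (cpoly q) i * (d ^ i - 0 ^ i)) \<in> P"
          by (intro P_sum P_mult) (simp_all add: coeff_map_poly R_of_int)
        thus ?thesis unfolding poly_altdef by (simp only: sum_subtractf right_diff_distrib)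
      qed
      hence "of_int (coeff q 0) \<in> P" using q(1) P_minus[of "- of_int (coeff q 0)"] by (simp add: poly_0_coeff_0 coeff_map_poly)
      thus ?thesis by (simp add: of_int_P)
    qed
    thus ?thesis using q(2) by blast
  qed
  then obtain c :: "complex \<Rightarrow> complex \<Rightarrow> int" where c: "\<And>x y. x \<in> Z \<Longrightarrow> y \<in> Z \<Longrightarrow> x \<noteq> y \<Longrightarrow> c x y \<noteq> 0"
    "\<And>x y p R P. x \<in> Z \<Longrightarrow> y \<in> Z \<Longrightarrow> x \<noteq> y \<Longrightarrow> place R P p \<Longrightarrow> x - y \<in> P \<Longrightarrow> int p dvd c x y" by metis
  define B where "B = (\<Sum>x\<in>Z. \<Sum>y\<in>Z. nat \<bar>c x y\<bar>)"
  have le: "nat \<bar>c x y\<bar> \<le> B" if "x \<in> Z" "y \<in> Z" for x y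
    unfolding B_def using member_le_sum[of x Z "\<lambda>x. \<Sum>y\<in>Z. nat \<bar>c x y\<bar>"] member_le_sum[of y Z "\<lambda>y. nat \<bar>c x y\<bar>"] that fin by force
  have "x = y" if a: "p > B" "place R P p" "x \<in> Z" "y \<in> Z" "x - y \<in> P" for p R P x y
  proof (rule ccontr)
    assume "x \<noteq> y"
    hence "int p dvd c x y" "c x y \<noteq> 0" using c a by blast+
    hence "int p \<le> \<bar>c x y\<bar>" using zdvd_imp_le[of "int p" "\<bar>c x y\<bar>"] by simp
    thus False using le[OF a(3,4)] a(1) by linarith
  qed
  thus ?thesis by blast
qed

text \<open>Powers of \<sigma> move the points other than \<open>z0\<close> transitively and fix
  \<open>z0\<close>. Being irrational, \<open>z0\<close> is moved by some automorphism, so the group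
  is transitive with a point stabiliser transitive on the rest. \<tau> provides the transposition to
  be conjugated.\<close>

lemma full_action:
  assumes Z: "gstable Z" and n: "n \<ge> 3"
    and bg: "bij_betw \<gamma> {..<n} Z" and s: "\<sigma> \<in> autq" and cyc: "\<And>k. k < n - 1 \<Longrightarrow> \<sigma> (\<gamma> k) = \<gamma> (if Suc k < n - 1 then Suc k else 0)"
    and fx: "\<sigma> (\<gamma> (n - 1)) = \<gamma> (n - 1)" and irr: "\<gamma> (n - 1) \<notin> \<rat>"
    and bd: "bij_betw \<delta> {..<n} Z" and t: "\<tau> \<in> autq" "\<tau> (\<delta> 0) = \<delta> 1" "\<tau> (\<delta> 1) = \<delta> 0"
    and tf: "\<And>k. 2 \<le> k \<Longrightarrow> k < n \<Longrightarrow> \<tau> (\<delta> k) = \<delta> k"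
    and \<pi>: "\<pi> permutes Z"
  shows "\<exists>\<rho>\<in>autq. \<forall>z\<in>Z. \<rho> z = \<pi> z"
proof -
  define N where "N = n - 1"
  define z0 where "z0 = \<gamma> N"
  have N: "N > 0" "N < n" using n by (auto simp: N_def)
  have gZ: "\<gamma> k \<in> Z" if "k < n" for k using bg that by (auto dest: bij_betwE)
  have z0: "z0 \<in> Z" using gZ N by (simp add: z0_def)
  have idx: "\<exists>k<N. u = \<gamma> k" if u: "u \<in> Z" "u \<noteq> z0" for u
  proof -
    obtain k where k: "k < n" "u = \<gamma> k" using u(1) bij_betw_imp_surj_on[OF bg] by (metis imageE lessThan_iff)
    have "k \<noteq> N" using k u by (auto simp: z0_def)
    hence "k < N" using k by (simp add: N_def)
    thus ?thesis using k by blast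
  qed
  have pw: "(\<sigma> ^^ j) (\<gamma> k) = \<gamma> ((k + j) mod N)" if k: "k < N" for j k
  proof (induction j)
    case 0 thus ?case using k by simp
  next
    case (Suc j)
    have lt: "(k + j) mod N < N" using N by simp
    have "(\<sigma> ^^ Suc j) (\<gamma> k) = \<sigma> (\<gamma> ((k + j) mod N))" by (simp add: Suc)
    also have "\<dots> = \<gamma> (if Suc ((k + j) mod N) < N then Suc ((k + j) mod N) else 0)" using cyc[of "(k + j) mod N"] lt by (simp only: N_def)
    also have "(if Suc ((k + j) mod N) < N then Suc ((k + j) mod N) else 0) = (k + Suc j) mod N"
      using lt by (simp add: mod_Suc)
    finally show ?case .
  qed
  have pz: "(\<sigma> ^^ j) z0 = z0" for j by (induction j) (use fx in \<open>auto simp: z0_def N_def\<close>)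
  have tr1: "\<exists>\<rho>\<in>autq. \<rho> z0 = z0 \<and> \<rho> u = v" if uv: "u \<in> Z" "u \<noteq> z0" "v \<in> Z" "v \<noteq> z0" for u v
  proof -
    obtain k l where kl: "k < N" "u = \<gamma> k" "l < N" "v = \<gamma> l" using idx uv by metis
    have "k + (N - k + l) = l + N" using kl by simp
    hence "(\<sigma> ^^ (N - k + l)) u = v" using pw[OF kl(1), of "N - k + l"] kl by simp
    thus ?thesis using autq_funpow[OF s, of "N - k + l"] pz by blast
  qed
  obtain \<rho> where r: "\<rho> \<in> autq" "\<rho> z0 \<noteq> z0"
    using fixed_by_autq_imp_rat[of z0] irr z0 Z by (auto simp: z0_def N_def gstable_def)
  have tr0: "\<exists>\<rho>\<in>autq. \<rho> z0 = x" if x: "x \<in> Z" for x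
  proof (cases "x = z0")
    case True thus ?thesis using autq_id by (intro bexI[of _ id]) auto
  next
    case False
    obtain \<rho>' where r': "\<rho>' \<in> autq" "\<rho>' (\<rho> z0) = x" using tr1[OF gstableD[OF Z r(1) z0] r(2) x False] by blast
    thus ?thesis using autq_comp[OF r'(1) r(1)] by (intro bexI[of _ "\<rho>' \<circ> \<rho>"]) auto
  qed
  \<comment> \<open>Restriction to \<open>Z\<close>, extended by the identity, so that the group
    consists of permutations in the sense of \<open>permutes\<close>.\<close>
  define ext where "ext \<sigma> = (\<lambda>z. if z \<in> Z then \<sigma> z else z)" for \<sigma> :: "complex \<Rightarrow> complex"
  define G where "G = ext ` autq"
  have inv: "inv' (ext \<sigma>) = ext (inv' \<sigma>)" and perm: "ext \<sigma> permutes Z" if s: "\<sigma> \<in> autq" for \<sigma>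
  proof -
    have 1: "ext \<sigma> (ext (inv' \<sigma>) z) = z" for z using gstableD[OF Z autq_inv[OF s]] autq_inv_apply[OF s] by (simp add: ext_def)
    have 2: "ext (inv' \<sigma>) (ext \<sigma> z) = z" for z using gstableD[OF Z s] autq_inv_apply[OF s] by (simp add: ext_def)
    show "inv' (ext \<sigma>) = ext (inv' \<sigma>)" using 1 2 by (intro inv_unique_comp) (auto simp: fun_eq_iff)
    have "bij (ext \<sigma>)" using 1 2 by (intro o_bij[of "ext (inv' \<sigma>)"]) (auto simp: fun_eq_iff)
    thus "ext \<sigma> permutes Z" unfolding permutes_def bij_iff by (auto simp: ext_def)
  qed
  have d01: "\<delta> 0 \<in> Z" "\<delta> 1 \<in> Z" "\<delta> 0 \<noteq> \<delta> 1"
    using bij_betwE[OF bd] inj_onD[OF bij_betw_imp_inj_on[OF bd], of 0 1] n by auto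
  have "\<pi> \<in> G"
  proof (rule symmetric_if_2transitive[where a = "\<delta> 0" and b = "\<delta> 1"])
    show "finite Z" using Z by (simp add: gstable_def)
    show "g \<circ> h \<in> G" if "g \<in> G" "h \<in> G" for g h
    proof -
      obtain a b where ab: "a \<in> autq" "b \<in> autq" "g = ext a" "h = ext b" using \<open>g \<in> G\<close> \<open>h \<in> G\<close> by (auto simp: G_def)
      have "ext a \<circ> ext b = ext (a \<circ> b)" using gstableD[OF Z ab(2)] by (auto simp: ext_def fun_eq_iff)
      thus ?thesis using ab autq_comp by (auto simp: G_def)
    qed
    show "g permutes Z" if "g \<in> G" for g using that perm by (auto simp: G_def)
    show "inv' g \<in> G" if "g \<in> G" for g using that inv autq_inv by (auto simp: G_def)
    have "ext id = id" by (auto simp: ext_def)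
    thus "id \<in> G" using autq_id by (auto simp: G_def intro: image_eqI[of _ _ id])
    have "ext \<tau> = tr (\<delta> 0) (\<delta> 1)"
    proof
      fix z show "ext \<tau> z = tr (\<delta> 0) (\<delta> 1) z"
      proof (cases "z \<in> Z")
        case True
        then obtain k where k: "k < n" "z = \<delta> k" using bij_betw_imp_surj_on[OF bd] by (metis imageE lessThan_iff)
        consider "k = 0" | "k = 1" | "2 \<le> k" by linarith
        thus ?thesis
        proof cases
          case 1 thus ?thesis using k(2) True t(2) by (simp add: ext_def)
        next
          case 2 thus ?thesis using k(2) True t(3) by (simp add: ext_def)
        next
          case 3
          hence "\<delta> k \<noteq> \<delta> 0" "\<delta> k \<noteq> \<delta> 1" using k n bij_betw_imp_inj_on[OF bd] by (auto dest: inj_onD)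
          thus ?thesis using tf[OF 3] k True by (simp add: ext_def)
        qed
      next
        case False
        hence "z \<noteq> \<delta> 0" "z \<noteq> \<delta> 1" using d01 by auto
        thus ?thesis using False by (simp add: ext_def)
      qed
    qed
    thus "tr (\<delta> 0) (\<delta> 1) \<in> G" unfolding G_def using t(1) by (metis imageI)
    show "\<exists>g\<in>G. g (\<delta> 0) = x \<and> g (\<delta> 1) = y" if xy: "x \<in> Z" "y \<in> Z" "x \<noteq> y" for x y
    proof -
      \<comment> \<open>Bring the first point to \<open>z0\<close>, move the second one inside the
        stabiliser of \<open>z0\<close>, then bring \<open>z0\<close> to \<open>x\<close>.\<close>
      obtain a b where a: "a \<in> autq" "a z0 = \<delta> 0" and b: "b \<in> autq" "b z0 = x" using tr0 xy d01 by metis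
      have ia: "inv' a (\<delta> 0) = z0" using a autq_inv_apply(2)[OF a(1), of z0] by simp
      have ia1: "inv' a (\<delta> 1) \<noteq> z0" using d01(3) a autq_inv_apply(1)[OF a(1), of "\<delta> 1"] by auto
      have ib1: "inv' b y \<noteq> z0" using xy(3) b autq_inv_apply(1)[OF b(1), of y] by auto
      obtain w where w: "w \<in> autq" "w z0 = z0" "w (inv' a (\<delta> 1)) = inv' b y"
        using tr1[OF gstableD[OF Z autq_inv[OF a(1)] d01(2)] ia1 gstableD[OF Z autq_inv[OF b(1)] xy(2)] ib1] by blast
      let ?v = "b \<circ> (w \<circ> inv' a)"
      have v: "?v \<in> autq" using autq_comp[OF b(1) autq_comp[OF w(1) autq_inv[OF a(1)]]] .
      have "?v (\<delta> 0) = x" "?v (\<delta> 1) = y" using ia w b autq_inv_apply(1)[OF b(1)] by simp_all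
      thus ?thesis using v d01 by (intro bexI[of _ "ext ?v"]) (auto simp: ext_def G_def)
    qed
    show "\<pi> permutes Z" by (rule \<pi>)
  qed
  then obtain \<rho> where "\<rho> \<in> autq" "\<pi> = ext \<rho>" by (auto simp: G_def)
  thus ?thesis by (auto simp: ext_def)
qed

lemma full_enum_exists:
  assumes Z: "gstable Z" "card Z = n" and full: "\<And>\<pi>. \<pi> permutes Z \<Longrightarrow> \<exists>\<rho>\<in>autq. \<forall>z\<in>Z. \<rho> z = \<pi> z"
  shows "\<exists>e. full_enum n e \<and> e ` {1..n} = Z"
proof -
  have fin: "finite Z" using Z by (simp add: gstable_def)
  obtain e where e: "bij_betw e {1..n} Z" using bij_betw_from_nat_into_finite ex_bij_betw_nat_finite_1[OF fin] Z by auto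
  have inj: "inj_on e {1..n}" and im: "e ` {1..n} = Z" using e by (auto simp: bij_betw_def)
  have "\<exists>\<sigma>. acts n e \<sigma> g" if g: "g permutes {1..n}" for g
  proof -
    define \<pi> where "\<pi> z = (if z \<in> Z then e (g (inv_into {1..n} e z)) else z)" for z
    have pe: "\<pi> (e k) = e (g k)" if k: "k \<in> {1..n}" for k
      using inv_into_f_f[OF inj k] im k by (auto simp: \<pi>_def)
    have "bij_betw \<pi> Z Z"
    proof -
      have "bij_betw (e \<circ> g \<circ> inv_into {1..n} e) Z Z"
        by (intro bij_betw_trans[OF bij_betw_inv_into[OF e]] bij_betw_trans[OF permutes_imp_bij[OF g]] e)
      thus ?thesis by (rule bij_betw_cong[THEN iffD1, rotated]) (simp add: \<pi>_def)
    qed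
    hence "\<pi> permutes Z" by (rule bij_imp_permutes) (simp add: \<pi>_def)
    then obtain \<rho> where r: "\<rho> \<in> autq" "\<forall>z\<in>Z. \<rho> z = \<pi> z" using full by blast
    hence "acts n e \<rho> g" unfolding acts_def using pe im g by auto
    thus ?thesis by blast
  qed
  thus ?thesis using inj im Z unfolding full_enum_def by blast
qed

section \<open>Random walks and characteristic polynomials of prescribed type\<close>

text \<open>One place is chosen for each prime once and for all, so that \<open>mtype\<close>
  becomes a predicate on matrices modulo \<open>p\<close> whose density can be counted.\<close>

definition plc :: "nat \<Rightarrow> complex set \<times> complex set" where
  "plc p = (SOME x. place (fst x) (snd x) p)"

lemma plc: assumes "prime p" shows "place (fst (plc p)) (snd (plc p)) p"
proof -
  obtain R P where "place R P p" by (rule place_exists[OF assms])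
  hence "place (fst (R, P)) (snd (R, P)) p" by simp
  thus ?thesis unfolding plc_def by (rule someI)
qed

definition mtype :: "nat \<Rightarrow> nat \<Rightarrow> int^'n^'n \<Rightarrow> bool" where
  "mtype m p A \<longleftrightarrow> place.ptype (fst (plc p)) (snd (plc p)) p CARD('n) m (cpi A)"

lemma mtype_mcong: assumes "prime p" "mcong p A B" "mtype m p A" shows "mtype m p B"
  unfolding mtype_def
  by (rule place.ptype_cong[OF plc[OF assms(1)] cpi_mcong[OF assms(2)] assms(3)[unfolded mtype_def]])

text \<open>The constant is 4 from \<open>card_good_mats\<close> times the constant of
  \<open>many_ptypes\<close>. Its independence of \<open>p\<close> is essential: missing the type at
  many primes then has a probability bounded by a power of a fixed number below 1.\<close>

lemma card_mtype:
  assumes pr: "prime p" "p \<ge> 8 * CARD('n)" and m: "2 \<le> m" "m < CARD('n)"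
  shows "card (SLp p :: (int^'n^'n) set) \<le> 8 * (4 * CARD('n)) ^ CARD('n) * CARD('n) ^ CARD('n) * card {A\<in>SLp p :: (int^'n^'n) set. mtype m p A}"
proof -
  let ?n = "CARD('n)"
  interpret place "fst (plc p)" "snd (plc p)" p by (rule plc[OF pr(1)])
  let ?M = "{A\<in>SLp p :: (int^'n^'n) set. mtype m p A}"
  let ?D = "2 * (4 * ?n) ^ ?n * ?n ^ ?n"
  obtain F where F: "F \<subseteq> ({..<?n} \<rightarrow>\<^sub>E {0..<int p})" "\<forall>c\<in>F. ptype ?n m (fpoly ?n c) \<and> int p dvd c 0 - (-1) ^ ?n"
    "p ^ (?n - 1) \<le> card F * ?D" using many_ptypes[OF m pr(2)] by blast
  have "good_mats p F \<subseteq> ?M"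
  proof
    fix A :: "int^'n^'n" assume "A \<in> good_mats p F"
    then obtain c where c: "A \<in> SLp p" "c \<in> F" "\<forall>i. int p dvd coeff (cpi A) i - coeff (fpoly ?n c) i"
      by (auto simp: good_mats_def)
    have "ptype ?n m (cpi A)"
    proof (rule ptype_cong)
      show "int p dvd coeff (fpoly ?n c) i - coeff (cpi A) i" for i using c(3) by (simp add: dvd_diff_commute)
      show "ptype ?n m (fpoly ?n c)" using F(2) c(2) by blast
    qed
    thus "A \<in> ?M" using c(1) by (simp add: mtype_def)
  qed
  hence g: "card (good_mats p F :: (int^'n^'n) set) \<le> card ?M" by (intro card_mono) (simp_all add: finite_SLp)
  let ?s = "card (SLp p :: (int^'n^'n) set)"
  have "?s * card F \<le> 4 * p ^ (?n - 1) * card (good_mats p F :: (int^'n^'n) set)"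
    by (rule card_good_mats[OF pr(1) _ F(1)]) (use pr F(2) in auto)
  also have "\<dots> \<le> 4 * p ^ (?n - 1) * card ?M" using g by (intro mult_le_mono2)
  finally have a: "?s * card F \<le> 4 * p ^ (?n - 1) * card ?M" .
  have "?s * p ^ (?n - 1) \<le> ?s * (card F * ?D)" by (intro mult_le_mono2 F(3))
  also have "\<dots> = ?s * card F * ?D" by (simp only: mult.assoc)
  also have "\<dots> \<le> 4 * p ^ (?n - 1) * card ?M * ?D" by (intro mult_le_mono1 a)
  also have "\<dots> = (4 * ?D * card ?M) * p ^ (?n - 1)" by (simp only: mult_ac)
  finally have "?s \<le> 4 * ?D * card ?M" using prime_gt_0_nat[OF pr(1)] by (simp only: mult_le_cancel2) simp
  thus ?thesis by (simp add: mult.assoc)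
qed

section \<open>Probabilities along the walk\<close>

definition walk_vals :: "(int^'n^'n) set \<Rightarrow> nat \<Rightarrow> (int^'n^'n) set" where
  "walk_vals \<Sigma> k = foldl (**) (mat 1) ` {xs. set xs \<subseteq> \<Sigma> \<and> length xs = k}"

lemma finite_walk_vals: "finite \<Sigma> \<Longrightarrow> finite (walk_vals \<Sigma> k)"
  unfolding walk_vals_def by (intro finite_imageI finite_lists_length_eq)

lemma walk_vals_SLZ: fixes \<Sigma> :: "(int^'n^'n) set" assumes "\<Sigma> \<subseteq> SLZ" shows "walk_vals \<Sigma> k \<subseteq> SLZ"
proof -
  have "det (foldl (**) A xs) = det A" if "set xs \<subseteq> \<Sigma>" for xs and A :: "int^'n^'n"
    using that assms by (induction xs arbitrary: A) (auto simp: det_mul SLZ_def)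
  thus ?thesis by (auto simp: walk_vals_def SLZ_def)
qed

lemma walk_prob_mono:
  assumes "finite \<Sigma>" "\<And>X. X \<in> walk_vals \<Sigma> k \<Longrightarrow> P X \<Longrightarrow> Q X" shows "walk_prob \<Sigma> k P \<le> walk_prob \<Sigma> k Q"
proof -
  have "card {xs. set xs \<subseteq> \<Sigma> \<and> length xs = k \<and> P (foldl (**) (mat 1) xs)} \<le> card {xs. set xs \<subseteq> \<Sigma> \<and> length xs = k \<and> Q (foldl (**) (mat 1) xs)}"
    by (intro card_mono finite_subset[OF _ finite_lists_length_eq[OF assms(1), of k]]) (use assms(2) in \<open>auto simp: walk_vals_def\<close>)
  thus ?thesis unfolding walk_prob_def by (simp add: divide_right_mono)
qed

lemma walk_prob_disj: "walk_prob \<Sigma> k (\<lambda>X. P X \<or> Q X) \<le> walk_prob \<Sigma> k P + walk_prob \<Sigma> k Q"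
proof -
  let ?W = "\<lambda>P. {xs. set xs \<subseteq> \<Sigma> \<and> length xs = k \<and> P (foldl (**) (mat 1) xs)}"
  have "?W (\<lambda>X. P X \<or> Q X) = ?W P \<union> ?W Q" by auto
  hence "card (?W (\<lambda>X. P X \<or> Q X)) \<le> card (?W P) + card (?W Q)" by (simp add: card_Un_le)
  hence "real (card (?W (\<lambda>X. P X \<or> Q X))) \<le> real (card (?W P)) + real (card (?W Q))" by linarith
  thus ?thesis unfolding walk_prob_def by (simp add: divide_right_mono flip: add_divide_distrib)
qed

lemma walk_prob_Bex:
  assumes "finite I" "\<And>i. i \<in> I \<Longrightarrow> walk_prob \<Sigma> k (Q i) \<le> \<epsilon>"
  shows "walk_prob \<Sigma> k (\<lambda>X. \<exists>i\<in>I. Q i X) \<le> real (card I) * \<epsilon>"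
  using assms
proof (induction I rule: finite_induct)
  case empty thus ?case by (simp add: walk_prob_def)
next
  case (insert i I)
  have "walk_prob \<Sigma> k (\<lambda>X. \<exists>i\<in>insert i I. Q i X) \<le> walk_prob \<Sigma> k (Q i) + walk_prob \<Sigma> k (\<lambda>X. \<exists>i\<in>I. Q i X)"
    using walk_prob_disj[of \<Sigma> k "Q i" "\<lambda>X. \<exists>i\<in>I. Q i X"] by simp
  also have "\<dots> \<le> \<epsilon> + real (card I) * \<epsilon>" using insert by (intro add_mono) auto
  finally show ?case using insert(1,2) by (simp add: algebra_simps)
qed

lemma walk_prob_compl:
  assumes "finite \<Sigma>" "\<Sigma> \<noteq> {}" shows "walk_prob \<Sigma> k P = 1 - walk_prob \<Sigma> k (\<lambda>X. \<not> P X)"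
proof -
  let ?W = "\<lambda>P. {xs. set xs \<subseteq> \<Sigma> \<and> length xs = k \<and> P (foldl (**) (mat 1) xs)}"
  have fin: "finite (?W P)" for P by (rule finite_subset[OF _ finite_lists_length_eq[OF assms(1), of k]]) auto
  have "{xs. set xs \<subseteq> \<Sigma> \<and> length xs = k} = ?W P \<union> ?W (\<lambda>X. \<not> P X)" by auto
  hence "card \<Sigma> ^ k = card (?W P \<union> ?W (\<lambda>X. \<not> P X))" using card_lists_length_eq[OF assms(1), of k] by simp
  also have "\<dots> = card (?W P) + card (?W (\<lambda>X. \<not> P X))" by (rule card_Un_disjoint[OF fin fin]) auto
  finally have "real (card \<Sigma>) ^ k = real (card (?W P)) + real (card (?W (\<lambda>X. \<not> P X)))" by (simp flip: of_nat_add of_nat_power)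
  moreover have "real (card \<Sigma>) ^ k > 0" using assms by (simp add: card_gt_0_iff)
  ultimately show ?thesis unfolding walk_prob_def by (simp add: field_simps)
qed

lemma
  fixes X :: "int^'n^'n" assumes "X \<in> SLZ"
  shows cpi_SLZ: "\<bar>coeff (cpi X) 0\<bar> = 1"
  using assms by (simp add: cpi_coeff_0 SLZ_def power_abs)

lemma full_enum_of_types:
  fixes X :: "int^'n^'n"
  assumes n: "CARD('n) \<ge> 3" and X: "X \<in> SLZ"
    and p: "prime p" "p > CARD('n) ^ CARD('n) * CARD('n)" "mtype (CARD('n) - 1) p X"
    and q: "prime q" "q > CARD('n) ^ CARD('n) * CARD('n)" "mtype 2 q X"
  shows "\<exists>e. full_enum CARD('n) e \<and> e ` {1..CARD('n)} = rts (cpi X)"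
proof -
  let ?n = "CARD('n)" and ?f = "cpi X"
  note f = cpi_monic(2)[of X] cpi_monic(1)[of X] cpi_SLZ[OF X]
  obtain \<gamma> \<sigma> where g: "\<sigma> \<in> autq" "bij_betw \<gamma> {..<?n} (rts ?f)"
    "\<And>k. k < ?n - 1 \<Longrightarrow> \<sigma> (\<gamma> k) = \<gamma> (if Suc k < ?n - 1 then Suc k else 0)"
    "\<And>k. ?n - 1 \<le> k \<Longrightarrow> k < ?n \<Longrightarrow> \<sigma> (\<gamma> k) = \<gamma> k" "\<And>k. ?n - 1 \<le> k \<Longrightarrow> k < ?n \<Longrightarrow> \<gamma> k \<notin> \<rat>"
    by (rule place.ptype_frobenius[OF plc[OF p(1)] f p(3)[unfolded mtype_def] _ _ p(2)]) (use n in auto)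
  obtain \<delta> \<tau> where d: "\<tau> \<in> autq" "bij_betw \<delta> {..<?n} (rts ?f)"
    "\<And>k. k < 2 \<Longrightarrow> \<tau> (\<delta> k) = \<delta> (if Suc k < 2 then Suc k else 0)"
    "\<And>k. 2 \<le> k \<Longrightarrow> k < ?n \<Longrightarrow> \<tau> (\<delta> k) = \<delta> k" "\<And>k. 2 \<le> k \<Longrightarrow> k < ?n \<Longrightarrow> \<delta> k \<notin> \<rat>"
    by (rule place.ptype_frobenius[OF plc[OF q(1)] f q(3)[unfolded mtype_def] _ _ q(2)]) (use n in auto)
  have t: "\<tau> (\<delta> 0) = \<delta> 1" "\<tau> (\<delta> 1) = \<delta> 0" using d(3)[of 0] d(3)[of 1] by simp_all
  have l: "\<sigma> (\<gamma> (?n - 1)) = \<gamma> (?n - 1)" "\<gamma> (?n - 1) \<notin> \<rat>" using g(4,5)[of "?n - 1"] n by simp_all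
  show ?thesis
  proof (rule full_enum_exists)
    show "gstable (rts ?f)" by (rule gstable_rts[OF f(1)])
    show "card (rts ?f) = ?n" using bij_betw_same_card[OF g(2)] by simp
    show "\<exists>\<rho>\<in>autq. \<forall>z\<in>rts ?f. \<rho> z = \<pi> z" if "\<pi> permutes rts ?f" for \<pi>
      by (rule full_action[OF gstable_rts[OF f(1)] n g(2,1,3) l d(2,1) t d(4) that])
  qed
qed

text \<open>The type \<open>t p\<close> is read off from the roots of \<open>A\<close> at the chosen
  place, before any \<open>X\<close> is known. The bound \<open>B\<close> also forces the roots of
  \<open>A\<close> to be incongruent modulo the place.\<close>

lemma types_separating_kernel:
  fixes A :: "int^'n^'n"
  assumes n: "CARD('n) \<ge> 4"
  shows "\<exists>t B. (\<forall>p. t p = 2 \<or> t p = CARD('n) - 1) \<and>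
    (\<forall>X p. p > B \<longrightarrow> prime p \<longrightarrow> mtype (t p) p (X :: int^'n^'n) \<longrightarrow> ker_of (rts (cpi X)) \<noteq> ker_of (rts (cpi A)))"
proof -
  let ?n = "CARD('n)" and ?h = "cpi A"
  obtain B where B: "\<forall>p>B. \<forall>R P. place R P p \<longrightarrow> (\<forall>x\<in>rts ?h. \<forall>y\<in>rts ?h. x - y \<in> P \<longrightarrow> x = y)"
    using distinct_mod_large_primes[of "rts ?h"] finite_rts[OF cpi_monic(2)[of A]] rts_algebraic_int[OF cpi_monic(2)[of A]] by blast
  define t where "t p = (if \<forall>z\<in>rts ?h. z ^ (p ^ 2) - z \<in> snd (plc p) then ?n - 1 else 2)" for p
  define B' where "B' = max B ((2 * ?n) ^ (2 * ?n) * (2 * ?n))"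
  have "ker_of (rts (cpi X)) \<noteq> ker_of (rts ?h)" if a: "p > B'" "prime p" "mtype (t p) p X" for X :: "int^'n^'n" and p
  proof (rule place.ptype_ker_ne[OF plc[OF a(2)] cpi_monic(2) cpi_monic(1) cpi_monic(2) cpi_monic(1) n])
    show "place.ptype (fst (plc p)) (snd (plc p)) p ?n (if \<forall>z\<in>rts ?h. z ^ p\<^sup>2 - z \<in> snd (plc p) then ?n - 1 else 2) (cpi X)"
      using a(3) unfolding mtype_def t_def .
    show "x = y" if "x \<in> rts ?h" "y \<in> rts ?h" "x - y \<in> snd (plc p)" for x y
      using B plc[OF a(2)] a(1) that unfolding B'_def by (meson max_less_iff_conj)
    show "(2 * ?n) ^ (2 * ?n) * (2 * ?n) < p" using a(1) by (simp add: B'_def)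
  qed
  moreover have "\<forall>p. t p = 2 \<or> t p = ?n - 1" by (simp add: t_def)
  ultimately show ?thesis by blast
qed

definition good :: "(int^'n^'n) set \<Rightarrow> int^'n^'n \<Rightarrow> bool" where
  "good \<Theta> X \<longleftrightarrow> (\<exists>e. full_enum CARD('n) e \<and> e ` {1..CARD('n)} = rts (cpi X)) \<and>
     (\<forall>A\<in>\<Theta>. ker_of (rts (cpi X)) \<noteq> ker_of (rts (cpi A)))"

context
  fixes \<Sigma> :: "(int^'n^'n) set"
  assumes n5: "CARD('n) \<ge> 5" and fin: "finite \<Sigma>" and sub: "\<Sigma> \<subseteq> SLZ" and gen: "gen_by \<Sigma> = SLZ"
begin

text \<open>Take so many large primes that missing the type at all of them has limiting probability
  below \<epsilon>/2; the other half of \<epsilon> pays for the deviation from the uniform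
  distribution.\<close>

lemma walk_hits_type:
  assumes t: "\<And>p. t p = 2 \<or> t p = CARD('n) - 1" and e: "\<epsilon> > 0"
  shows "\<exists>K. \<forall>k\<ge>K. walk_prob \<Sigma> k (\<lambda>X. \<not> (\<exists>p>B. prime p \<and> mtype (t p) p X)) \<le> \<epsilon>"
proof -
  let ?n = "CARD('n)"
  have n3: "?n \<ge> 3" using n5 by simp
  define D where "D = 8 * (4 * ?n) ^ ?n * ?n ^ ?n"
  define c where "c = 1 / real D"
  have D1: "D \<ge> 1" unfolding D_def by simp
  have c: "0 < c" "c \<le> 1" using D1 by (simp_all add: c_def)
  obtain j where j: "(1 - c) ^ j < \<epsilon> / 2" using real_arch_pow_inv[of "\<epsilon> / 2" "1 - c"] e c by auto
  have "infinite ({p. prime p} - {..max B (8 * ?n)})" using primes_infinite by (simp add: Diff_infinite_finite)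
  then obtain J where J: "finite J" "card J = j" "J \<subseteq> {p. prime p} - {..max B (8 * ?n)}"
    using infinite_arbitrarily_large by blast
  have Jp: "prime p" "p > B" "p \<ge> 8 * ?n" if "p \<in> J" for p using J(3) that by auto
  let ?G = "\<lambda>p. {A\<in>SLp p :: (int^'n^'n) set. mtype (t p) p A}"
  have dens: "c * real (card (SLp p :: (int^'n^'n) set)) \<le> real (card (?G p))" if p: "p \<in> J" for p
  proof -
    have "2 \<le> t p" "t p < ?n" using t[of p] n5 by auto
    hence "card (SLp p :: (int^'n^'n) set) \<le> D * card (?G p)" unfolding D_def by (rule card_mtype[OF Jp(1,3)[OF p]])
    hence "real (card (SLp p :: (int^'n^'n) set)) \<le> real D * real (card (?G p))" by (metis of_nat_le_iff of_nat_mult)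
    thus ?thesis using D1 by (simp add: c_def field_simps)
  qed
  have "\<exists>K. \<forall>k\<ge>K. walk_prob \<Sigma> k (\<lambda>X. \<forall>p\<in>J. red p X \<notin> ?G p) \<le> (1 - c) ^ card J + \<epsilon> / 2"
    by (rule walk_avoids_product[OF n3 fin sub gen J(1)]) (use Jp dens e in auto)
  then obtain K where K: "\<And>k. k \<ge> K \<Longrightarrow> walk_prob \<Sigma> k (\<lambda>X. \<forall>p\<in>J. red p X \<notin> ?G p) \<le> (1 - c) ^ card J + \<epsilon> / 2" by blast
  have "walk_prob \<Sigma> k (\<lambda>X. \<not> (\<exists>p>B. prime p \<and> mtype (t p) p X)) \<le> \<epsilon>" if k: "k \<ge> K" for k
  proof -
    have "walk_prob \<Sigma> k (\<lambda>X. \<not> (\<exists>p>B. prime p \<and> mtype (t p) p X)) \<le> walk_prob \<Sigma> k (\<lambda>X. \<forall>p\<in>J. red p X \<notin> ?G p)"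
    proof (rule walk_prob_mono[OF fin], intro ballI notI)
      fix X :: "int^'n^'n" and p assume n: "\<not> (\<exists>p>B. prime p \<and> mtype (t p) p X)" and p: "p \<in> J" "red p X \<in> ?G p"
      have "mtype (t p) p X" using mtype_mcong[OF Jp(1)[OF p(1)] red_mcong] p(2) by blast
      thus False using n Jp[OF p(1)] by blast
    qed
    thus ?thesis using K[OF k] j unfolding J(2) by linarith
  qed
  thus ?thesis by blast
qed

text \<open>A union bound: two events yield the symmetric group, and one event for each member of
  \<Theta> separates the kernels. This is the origin of \<eta>.\<close>

lemma walk_good:
  assumes \<Theta>: "finite \<Theta>" and e: "\<epsilon> > 0"
  shows "\<exists>k. walk_prob \<Sigma> k (\<lambda>X. \<not> good \<Theta> X) \<le> \<epsilon>"
proof -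
  let ?n = "CARD('n)"
  define h where "h t B = (\<lambda>X :: int^'n^'n. \<exists>p>B. prime p \<and> mtype (t p) p X)" for t :: "nat \<Rightarrow> nat" and B :: nat
  define \<eta> where "\<eta> = \<epsilon> / (real (card \<Theta>) + 2)"
  have h0: "\<eta> > 0" using e by (simp add: \<eta>_def)
  have hits: "\<exists>K. \<forall>k\<ge>K. walk_prob \<Sigma> k (\<lambda>X. \<not> h t B X) \<le> \<eta>" if "\<And>p. t p = 2 \<or> t p = ?n - 1" for t B
    unfolding h_def by (rule walk_hits_type[OF that h0])
  let ?N = "?n ^ ?n * ?n"
  obtain K1 where K1: "\<And>k. k \<ge> K1 \<Longrightarrow> walk_prob \<Sigma> k (\<lambda>X. \<not> h (\<lambda>_. ?n - 1) ?N X) \<le> \<eta>" using hits[of "\<lambda>_. ?n - 1" ?N] by auto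
  obtain K2 where K2: "\<And>k. k \<ge> K2 \<Longrightarrow> walk_prob \<Sigma> k (\<lambda>X. \<not> h (\<lambda>_. 2) ?N X) \<le> \<eta>" using hits[of "\<lambda>_. 2" ?N] by auto
  have "\<exists>t B. (\<forall>p. t p = 2 \<or> t p = ?n - 1) \<and> (\<forall>X. h t B X \<longrightarrow> ker_of (rts (cpi X)) \<noteq> ker_of (rts (cpi A)))" for A :: "int^'n^'n"
  proof -
    have "?n \<ge> 4" using n5 by simp
    from types_separating_kernel[OF this, of A] obtain t B where "\<forall>p. t p = 2 \<or> t p = ?n - 1"
      "\<forall>X p. p > B \<longrightarrow> prime p \<longrightarrow> mtype (t p) p (X :: int^'n^'n) \<longrightarrow> ker_of (rts (cpi X)) \<noteq> ker_of (rts (cpi A))" by (elim exE conjE)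
    thus ?thesis unfolding h_def by (intro exI[of _ t] exI[of _ B]) blast
  qed
  then obtain t B where tB: "\<And>A p. t A p = 2 \<or> t A p = ?n - 1"
    "\<And>A X. h (t A) (B A) X \<Longrightarrow> ker_of (rts (cpi X)) \<noteq> ker_of (rts (cpi (A :: int^'n^'n)))" by metis
  have "\<forall>A. \<exists>K. \<forall>k\<ge>K. walk_prob \<Sigma> k (\<lambda>X. \<not> h (t A) (B A) X) \<le> \<eta>" using hits tB(1) by blast
  then obtain K where K: "\<And>A k. k \<ge> K A \<Longrightarrow> walk_prob \<Sigma> k (\<lambda>X. \<not> h (t A) (B A) X) \<le> \<eta>" by metis
  \<comment> \<open>The sum of the thresholds exceeds each of them, so a single length serves all
    events.\<close>
  define k where "k = K1 + K2 + sum K \<Theta>"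
  have kK: "K A \<le> k" if "A \<in> \<Theta>" for A using member_le_sum[of A \<Theta> K] that \<Theta> by (simp add: k_def)
  have "walk_prob \<Sigma> k (\<lambda>X. \<not> good \<Theta> X) \<le> walk_prob \<Sigma> k (\<lambda>X. \<not> h (\<lambda>_. ?n - 1) ?N X \<or> \<not> h (\<lambda>_. 2) ?N X \<or> (\<exists>A\<in>\<Theta>. \<not> h (t A) (B A) X))"
  proof (rule walk_prob_mono[OF fin], rule ccontr)
    fix X assume X: "X \<in> walk_vals \<Sigma> k" and ng: "\<not> good \<Theta> X"
      and "\<not> (\<not> h (\<lambda>_. ?n - 1) ?N X \<or> \<not> h (\<lambda>_. 2) ?N X \<or> (\<exists>A\<in>\<Theta>. \<not> h (t A) (B A) X))"
    hence hh: "h (\<lambda>_. ?n - 1) ?N X" "h (\<lambda>_. 2) ?N X" "\<forall>A\<in>\<Theta>. h (t A) (B A) X" by blast+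
    obtain p q where "prime p" "p > ?N" "mtype (?n - 1) p X" "prime q" "q > ?N" "mtype 2 q X" using hh(1,2) unfolding h_def by blast
    hence "\<exists>e. full_enum ?n e \<and> e ` {1..?n} = rts (cpi X)"
      using full_enum_of_types[of X p q] walk_vals_SLZ[OF sub] X n5 by auto
    thus False using ng hh(3) tB(2) unfolding good_def by blast
  qed
  also have "\<dots> \<le> walk_prob \<Sigma> k (\<lambda>X. \<not> h (\<lambda>_. ?n - 1) ?N X) + walk_prob \<Sigma> k (\<lambda>X. \<not> h (\<lambda>_. 2) ?N X \<or> (\<exists>A\<in>\<Theta>. \<not> h (t A) (B A) X))"
    by (rule walk_prob_disj)
  also have "\<dots> \<le> walk_prob \<Sigma> k (\<lambda>X. \<not> h (\<lambda>_. ?n - 1) ?N X) + (walk_prob \<Sigma> k (\<lambda>X. \<not> h (\<lambda>_. 2) ?N X) + walk_prob \<Sigma> k (\<lambda>X. \<exists>A\<in>\<Theta>. \<not> h (t A) (B A) X))"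
    by (intro add_left_mono walk_prob_disj)
  also have "\<dots> \<le> \<eta> + (\<eta> + real (card \<Theta>) * \<eta>)"
    by (intro add_mono walk_prob_Bex \<Theta> K1 K2 K kK) (simp_all add: k_def)
  also have "\<dots> = (real (card \<Theta>) + 2) * \<eta>" by (simp add: algebra_simps)
  also have "\<dots> = \<epsilon>" unfolding \<eta>_def by simp
  finally show ?thesis by blast
qed

text \<open>The set \<Theta> of a stage contains all matrices that the walk can reach at the earlier
  lengths, not just the likely ones. Good outcomes of different stages therefore always have
  different splitting fields.\<close>

lemma good_stages:
  "\<exists>\<kappa>. \<forall>s. \<exists>\<Theta>. (\<forall>r<s. walk_vals \<Sigma> (\<kappa> r) \<subseteq> \<Theta>) \<and> walk_prob \<Sigma> (\<kappa> s) (\<lambda>X. \<not> good \<Theta> X) \<le> 1 / 2 ^ s"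
proof -
  let ?P = "\<lambda>s (x :: (int^'n^'n) set \<times> nat). finite (fst x) \<and> walk_prob \<Sigma> (snd x) (\<lambda>X. \<not> good (fst x) X) \<le> 1 / 2 ^ s"
  let ?Q = "\<lambda>s x y. fst y = fst x \<union> walk_vals \<Sigma> (snd x)"
  have step: "\<exists>y. ?P s y \<and> fst y = \<Theta>" if "finite \<Theta>" for s and \<Theta> :: "(int^'n^'n) set"
    using walk_good[OF that, of "1 / 2 ^ s"] that by auto
  have "\<exists>f. \<forall>s. ?P s (f s) \<and> ?Q s (f s) (f (Suc s))"
  proof (rule dependent_nat_choice)
    show "\<exists>x. ?P 0 x" using step[of "{}" 0] by auto
    fix x s assume "?P s x"
    hence "finite (fst x \<union> walk_vals \<Sigma> (snd x))" using finite_walk_vals[OF fin] by simp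
    from step[OF this, of "Suc s"] show "\<exists>y. ?P (Suc s) y \<and> ?Q s x y" .
  qed
  then obtain f where f: "\<And>s. ?P s (f s)" "\<And>s. ?Q s (f s) (f (Suc s))" by blast
  have "walk_vals \<Sigma> (snd (f r)) \<subseteq> fst (f s)" if "r < s" for r s
    using that
  proof (induction s)
    case (Suc s)
    show ?case
    proof (cases "r = s")
      case False
      hence "walk_vals \<Sigma> (snd (f r)) \<subseteq> fst (f s)" using Suc by simp
      thus ?thesis using f(2)[of s] by blast
    qed (use f(2)[of s] in blast)
  qed simp
  thus ?thesis using f(1) by (intro exI[of _ "\<lambda>s. snd (f s)"] allI) (rule_tac x = "fst (f s)" in exI, blast)
qed

end

theorem theorem6:
  fixes \<Sigma> :: "(int ^'n^'n) set"
  assumes n5: "CARD('n) \<ge> 5"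
    and fin: "finite \<Sigma>"
    and sub: "\<Sigma> \<subseteq> SLZ"
    and gen: "gen_by \<Sigma> = SLZ"
  shows "\<forall>G1 G2. subgroup G1 (alt_group CARD('n)) \<longrightarrow> subgroup G2 (alt_group CARD('n)) \<longrightarrow>
    (\<exists>F. algebraic_ext_Q F \<and> (\<exists>ns ks :: nat \<Rightarrow> nat. \<forall>i\<ge>1.
       walk_prob \<Sigma> (ns i) (\<lambda>X. gal (split_field F X) F \<cong> (alt_group CARD('n))\<lparr>carrier := G1\<rparr>)
         \<ge> 1 - 1 / 2 ^ i
     \<and> walk_prob \<Sigma> (ks i) (\<lambda>X. gal (split_field F X) F \<cong> (alt_group CARD('n))\<lparr>carrier := G2\<rparr>)
         \<ge> 1 - 1 / 2 ^ i))"
proof (intro allI impI)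
  fix G1 G2 assume G12: "subgroup G1 (alt_group CARD('n))" "subgroup G2 (alt_group CARD('n))"
  let ?n = "CARD('n)"
  have n3: "?n \<ge> 3" using n5 by simp
  have ne: "\<Sigma> \<noteq> {}" by (rule Sigma_ne[OF n3 fin sub gen, where J = "{}"]) auto
  obtain \<kappa> where "\<forall>s. \<exists>\<Theta>. (\<forall>r<s. walk_vals \<Sigma> (\<kappa> r) \<subseteq> \<Theta>) \<and> walk_prob \<Sigma> (\<kappa> s) (\<lambda>X. \<not> good \<Theta> X) \<le> 1 / 2 ^ s"
    using good_stages[OF n5 fin sub gen] by blast
  then obtain \<Theta> where \<Theta>: "\<And>r s. r < s \<Longrightarrow> walk_vals \<Sigma> (\<kappa> r) \<subseteq> \<Theta> s"
    and prob: "\<And>s. walk_prob \<Sigma> (\<kappa> s) (\<lambda>X. \<not> good (\<Theta> s) X) \<le> 1 / 2 ^ s" by metis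
  define \<Gamma> where "\<Gamma> s = {X\<in>walk_vals \<Sigma> (\<kappa> s). good (\<Theta> s) X}" for s
  define kr where "kr X = ker_of (rts (cpi X))" for X :: "int^'n^'n"
  have disj: "kr Y \<noteq> kr X" if "X \<in> \<Gamma> r" "Y \<in> \<Gamma> s" "r < s" for X Y r s
    using that \<Theta>[OF that(3)] unfolding \<Gamma>_def good_def kr_def by blast
  have uniq: "r = s" if "X \<in> \<Gamma> r" "Y \<in> \<Gamma> s" "kr X = kr Y" for X Y r s
    using disj[of X r Y s] disj[of Y s X r] that by (metis nat_neq_iff)
  \<comment> \<open>The kernels themselves are the indices: matrices of one stage with the same
    splitting field share an index, and by \<open>uniq\<close> an index belongs to a single stage,
    so the parity in \<open>G\<close> is unambiguous.\<close>
  define I where "I = (\<Union>s. kr ` \<Gamma> s)"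
  have "\<forall>i\<in>I. \<exists>s e. (\<exists>X\<in>\<Gamma> s. kr X = i) \<and> full_enum ?n e \<and> ker_of (e ` {1..?n}) = i"
    unfolding I_def \<Gamma>_def good_def kr_def by fastforce
  then obtain st e where st: "\<And>i. i \<in> I \<Longrightarrow> \<exists>X\<in>\<Gamma> (st i). kr X = i" and en: "\<And>i. i \<in> I \<Longrightarrow> full_enum ?n (e i)"
    and ke: "\<And>i. i \<in> I \<Longrightarrow> ker_of (e i ` {1..?n}) = i" by metis
  define G where "G i = (if even (st i) then G1 else G2)" for i
  interpret galois_family ?n I e G
    by (rule galois_family.intro) (use n5 en ke G12 in \<open>auto simp: G_def\<close>)
  have iso: "gal (split_field FF X) FF \<cong> (alt_group ?n)\<lparr>carrier := (if even s then G1 else G2)\<rparr>" if X: "X \<in> \<Gamma> s" for X s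
  proof -
    have i: "kr X \<in> I" using X by (auto simp: I_def)
    have "st (kr X) = s" using st[OF i] uniq X by metis
    moreover have "gal (field_adjoin FF (rts (cpi X))) FF \<cong> (alt_group ?n)\<lparr>carrier := G (kr X)\<rparr>"
      by (rule gal_iso[OF i gstable_rts[OF cpi_monic(2)]]) (simp only: ke[OF i], simp only: kr_def)
    moreover have "split_field FF X = field_adjoin FF (rts (cpi X))" by (simp add: split_field_def rts_def char_poly_int_eq)
    ultimately show ?thesis by (simp add: G_def)
  qed
  have pr: "walk_prob \<Sigma> (\<kappa> s) (\<lambda>X. gal (split_field FF X) FF \<cong> (alt_group ?n)\<lparr>carrier := (if even s then G1 else G2)\<rparr>) \<ge> 1 - 1 / 2 ^ s" for s
  proof -
    let ?E = "\<lambda>X. gal (split_field FF X) FF \<cong> (alt_group ?n)\<lparr>carrier := (if even s then G1 else G2)\<rparr>"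
    have "walk_prob \<Sigma> (\<kappa> s) (\<lambda>X. \<not> ?E X) \<le> walk_prob \<Sigma> (\<kappa> s) (\<lambda>X. \<not> good (\<Theta> s) X)"
      by (rule walk_prob_mono[OF fin]) (use iso in \<open>auto simp: \<Gamma>_def\<close>)
    thus ?thesis using prob[of s] walk_prob_compl[OF fin ne, of "\<kappa> s" ?E] by linarith
  qed
  \<comment> \<open>The stages used for \<open>i\<close> are 2 i and 2 i + 1; their errors are at
    most 1/2^i because both numbers are at least \<open>i\<close>.\<close>
  have le: "1 - 1 / 2 ^ i \<le> 1 - 1 / (2::real) ^ s" if "i \<le> s" for i s :: nat
    using power_increasing[OF that, of "2::real"] by (simp add: frac_le)
  show "\<exists>F. algebraic_ext_Q F \<and> (\<exists>ns ks :: nat \<Rightarrow> nat. \<forall>i\<ge>1.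
       walk_prob \<Sigma> (ns i) (\<lambda>X. gal (split_field F X) F \<cong> (alt_group ?n)\<lparr>carrier := G1\<rparr>) \<ge> 1 - 1 / 2 ^ i
     \<and> walk_prob \<Sigma> (ks i) (\<lambda>X. gal (split_field F X) F \<cong> (alt_group ?n)\<lparr>carrier := G2\<rparr>) \<ge> 1 - 1 / 2 ^ i)"
  proof (rule exI[of _ FF], rule conjI[OF algebraic_FF], rule exI[of _ "\<lambda>i. \<kappa> (2 * i)"], rule exI[of _ "\<lambda>i. \<kappa> (2 * i + 1)"], intro allI impI conjI)
    fix i :: nat
    show "1 - 1 / 2 ^ i \<le> walk_prob \<Sigma> (\<kappa> (2 * i)) (\<lambda>X. gal (split_field FF X) FF \<cong> (alt_group ?n)\<lparr>carrier := G1\<rparr>)"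
      using pr[of "2 * i"] le[of i "2 * i"] by simp
    show "1 - 1 / 2 ^ i \<le> walk_prob \<Sigma> (\<kappa> (2 * i + 1)) (\<lambda>X. gal (split_field FF X) FF \<cong> (alt_group ?n)\<lparr>carrier := G2\<rparr>)"
      using pr[of "2 * i + 1"] le[of i "2 * i + 1"] by simp
  qed
qed

end
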